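(* Let $(\Lambda,M,[\cdot,\cdot],\lambda)$ be a polarized tropical abelian variety of dimension $n$ with canonical form $\omega$ on the associated tropical abelian variety $N_{\mathbb R}/\Lambda$. Let $\mu$ be a positive Radon measure on $N_{\mathbb R}/\Lambda$ satisfying $$\mu(N_{\mathbb R}/\Lambda)=n!\,\sqrt{\deg(\Lambda,M,[\cdot,\cdot],\lambda)}.$$ Then the tropical Monge–Ampère equation $$(\omega+d'd''\varphi)^{\wedge n}=\mu$$ is solved by a continuous $\omega$-psh function $\varphi:N_{\mathbb R}/\Lambda\to\mathbb R$, unique up to constants.
   Context: A polarized tropical abelian variety of dimension $n$ with polarization of degree $d^2$ is a quadruple $(\Lambda,M,[\cdot,\cdot],\lambda)$ such that: $\Lambda,M$ are free abelian groups of rank $n$; $[\cdot,\cdot]:\Lambda\times M\to\mathbb R$ is a bilinear pairing whose induced bilinear form $\Lambda_{\mathbb R}\times M_{\mathbb R}\to\mathbb R$ is non-degenerate; $\lambda:\Lambda\to M$ is a homomorphism with $\#\mathrm{coker}(\lambda)=d$ (finite); the pairing $[\cdot,\lambda(\cdot)]:\Lambda\times\Lambda\to\mathbb R$ is symmetric and positive definite. $\deg(\Lambda,M,[\cdot,\cdot],\lambda)=d^2$. Put $N=\mathrm{Hom}(M,\mathbb Z)$; $\Lambda$ is identified with a lattice in $N_{\mathbb R}=N\otimes\mathbb R$ so that $[\cdot,\cdot]=\langle\cdot,\cdot\rangle$, and $\pi:N_{\mathbb R}\to N_{\mathbb R}/\Lambda$ is the quotient map onto the associated tropical abelian variety. Let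 $b$ be the positive definite symmetric bilinear form on $N_{\mathbb R}$ extending $[\cdot,\lambda(\cdot)]$. Lagerberg forms and currents. On open $V\subset N_{\mathbb R}$, $A^{p,q}(V)=C^\infty(V)\otimes\Lambda^pM_{\mathbb R}\otimes\Lambda^qM_{\mathbb R}$ with elements $\sum f_{IJ}d'u_I\wedge d''u_J$, differentials $d',d''$, and algebra involution $J$ exchanging $d'u$ and $d''u$; $\int f\,d'u_1\wedge d''u_1\wedge\cdots\wedge d'u_n\wedge d''u_n=\int f\,d\lambda_N$ for a basis $u_i$ of $M$, $\lambda_N$ the Haar measure for which $N$ has covolume $1$. All this descends to $N_{\mathbb R}/\Lambda$ via local inverses of $\pi$. Currents $D^{p,q}$ are dual to compactly supported $(n-p,n-q)$-forms; a $(p,p)$-form is positive if it is a finite sum $\sum_j(-1)^{p(p-1)/2}f_j\alpha_j\wedge J(\alpha_j)$ with $f_j\ge0$ and $\alpha_j$ of type $(p,0)$; a current $T\in D^{p,p}$ is positive if $T(J\eta)=(-1)^{n-p}T(\eta)$ and $T(\eta)\ge0$ for positive compactly supported $\eta$. Positive $(n,n)$-currents are identified with positive Radon measures. The canonical form $\omega$ is the Lagerberg $(1,1)$-form on $N_{\mathbb R}/\Lambda$ with $\pi^*\omega=\sum_{k,l}b(u_k',u_l')\,d'u_k\wedge d''u_l=d'd''\bigl(\tfrac12b(u,u)\bigr)$, where $u_1,\ldots,u_n$ is a basis of $M_{\mathbb R}$ with dual basis $u_1',\ldots,u_n'$ of $N_{\mathbb R}$. A function $\varphi:N_{\mathbb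 R}/\Lambda\to\mathbb R$ is $\omega$-psh if it is strongly upper semicontinuous ($\varphi(a)=\limsup_{x\to a,x\notin E}\varphi(x)$ for all $a$ and all Lebesgue null sets $E$), locally integrable, and $d'd''[\varphi]+\omega$ is a positive current; equivalently, $\varphi\circ\pi+\tfrac12b(u,u)$ is convex on $N_{\mathbb R}$. The measure $(\omega+d'd''\varphi)^{\wedge n}$ is the measure on $N_{\mathbb R}/\Lambda$ which locally, via $\pi$, is the real Monge–Ampère measure $(d'd''f)^{\wedge n}$ of the convex function $f=\varphi\circ\pi+\tfrac12b(u,u)$ (for $f\in C^2$ it equals $n!\det(\partial^2f/\partial u_i\partial u_j)\,\lambda_N$ in coordinates given by a basis of $M$, extended to all convex functions by continuity under locally uniform convergence). *)

theory Defs
  imports "HOL-Analysis.Analysis" "HOL-Algebra.Coset" "HOL-Algebra.FiniteProduct"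
begin

definition free_basis :: "('a, 'x) monoid_scheme \<Rightarrow> ('n::finite \<Rightarrow> 'a) \<Rightarrow> bool" where
  "free_basis G e \<longleftrightarrow> range e \<subseteq> carrier G \<and>
     (\<forall>x\<in>carrier G. \<exists>!k::'n \<Rightarrow> int. x = finprod G (\<lambda>i. e i [^]\<^bsub>G\<^esub> k i) UNIV)"

definition polarization_degree ::
    "('l, 'x) monoid_scheme \<Rightarrow> ('m, 'y) monoid_scheme \<Rightarrow> ('l \<Rightarrow> 'm) \<Rightarrow> nat" where
  "polarization_degree \<Lambda> M lam = (order (M Mod (lam ` carrier \<Lambda>)))\<^sup>2"

text \<open>
  The groups are free abelian of rank \<open>CARD('n)\<close>, with bases \<open>f\<close> of \<open>\<Lambda>\<close> and \<open>e\<close> of \<open>M\<close>.  In the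
  induced bases of \<open>\<Lambda>\<^sub>R\<close> and \<open>M\<^sub>R\<close> the real bilinear form induced by the pairing \<open>P\<close> is
  \<open>(s, t) \<mapsto> \<Sum>j. \<Sum>i. s j * t i * P (f j) (e i)\<close>; the two conditions \<open>nondegenerate_left\<close> and
  \<open>nondegenerate_right\<close> say that it has no left or right radical.
\<close>

locale polarized_tropical_abelian_variety =
  fixes \<Lambda> :: "('l, 'x) monoid_scheme" and M :: "('m, 'y) monoid_scheme"
    and P :: "'l \<Rightarrow> 'm \<Rightarrow> real" and lam :: "'l \<Rightarrow> 'm"
    and f :: "'n::finite \<Rightarrow> 'l" and e :: "'n \<Rightarrow> 'm"
  assumes comm_group_\<Lambda>: "comm_group \<Lambda>" and basis_\<Lambda>: "free_basis \<Lambda> f"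
    and comm_group_M: "comm_group M" and basis_M: "free_basis M e"
    and pairing_add_left: "\<And>l l' m. \<lbrakk>l \<in> carrier \<Lambda>; l' \<in> carrier \<Lambda>; m \<in> carrier M\<rbrakk>
      \<Longrightarrow> P (l \<otimes>\<^bsub>\<Lambda>\<^esub> l') m = P l m + P l' m"
    and pairing_add_right: "\<And>l m m'. \<lbrakk>l \<in> carrier \<Lambda>; m \<in> carrier M; m' \<in> carrier M\<rbrakk>
      \<Longrightarrow> P l (m \<otimes>\<^bsub>M\<^esub> m') = P l m + P l m'"
    and nondegenerate_left: "\<And>s :: 'n \<Rightarrow> real.
      (\<And>i. (\<Sum>j\<in>UNIV. s j * P (f j) (e i)) = 0) \<Longrightarrow> (\<forall>j. s j = 0)"
    and nondegenerate_right: "\<And>t :: 'n \<Rightarrow> real.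
      (\<And>j. (\<Sum>i\<in>UNIV. t i * P (f j) (e i)) = 0) \<Longrightarrow> (\<forall>i. t i = 0)"
    and lam_hom: "lam \<in> hom \<Lambda> M"
    and finite_coker: "finite (carrier (M Mod (lam ` carrier \<Lambda>)))"
    and polarization_symmetric: "\<And>l l'. \<lbrakk>l \<in> carrier \<Lambda>; l' \<in> carrier \<Lambda>\<rbrakk>
      \<Longrightarrow> P l (lam l') = P l' (lam l)"
    and polarization_pos: "\<And>l. \<lbrakk>l \<in> carrier \<Lambda>; l \<noteq> \<one>\<^bsub>\<Lambda>\<^esub>\<rbrakk> \<Longrightarrow> P l (lam l) > 0"

text \<open>
  \<open>N\<^sub>R = Hom(M, \<real>)\<close> is identified with \<open>real^'n\<close> by sending a homomorphism \<open>h\<close> to \<open>(\<chi> i. h (e i))\<close>;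
  then \<open>N = Hom(M, \<int>)\<close> becomes the integer lattice, \<open>\<lambda>\<^sub>N\<close> becomes \<open>lborel\<close>, and the basis \<open>u\<^sub>i = e i\<close>
  of \<open>M\<^sub>R\<close> becomes the coordinate functions \<open>\<lambda>x. x $ i\<close>, with dual basis \<open>axis i 1\<close>.  An element \<open>l\<close> of
  \<open>\<Lambda>\<close> is the homomorphism \<open>P l\<close>.
\<close>

type_synonym 'n NR = "(real, 'n) vec"

definition lattice_vector :: "('l \<Rightarrow> 'm \<Rightarrow> real) \<Rightarrow> ('n::finite \<Rightarrow> 'm) \<Rightarrow> 'l \<Rightarrow> 'n NR" where
  "lattice_vector P e l = (\<chi> i. P l (e i))"

definition period_lattice ::
    "('l, 'x) monoid_scheme \<Rightarrow> ('l \<Rightarrow> 'm \<Rightarrow> real) \<Rightarrow> ('n::finite \<Rightarrow> 'm) \<Rightarrow> 'n NR set" where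
  "period_lattice \<Lambda> P e = lattice_vector P e ` carrier \<Lambda>"

definition polarization_form ::
    "('l, 'x) monoid_scheme \<Rightarrow> ('l \<Rightarrow> 'm \<Rightarrow> real) \<Rightarrow> ('l \<Rightarrow> 'm) \<Rightarrow> ('n::finite \<Rightarrow> 'm)
      \<Rightarrow> 'n NR \<Rightarrow> 'n NR \<Rightarrow> real" where
  "polarization_form \<Lambda> P lam e = (THE b. bilinear b \<and>
     (\<forall>l\<in>carrier \<Lambda>. \<forall>l'\<in>carrier \<Lambda>.
        b (lattice_vector P e l) (lattice_vector P e l') = P l (lam l')))"

text \<open>From here on \<open>L\<close> is the lattice \<open>\<Lambda>\<close> inside \<open>N\<^sub>R\<close>, and points of the torus are cosets of \<open>L\<close>.\<close>

definition torus_proj :: "'n::finite NR set \<Rightarrow> 'n NR \<Rightarrow> 'n NR set" where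
  "torus_proj L x = (\<lambda>l. x + l) ` L"

definition torus_topology :: "'n::finite NR set \<Rightarrow> 'n NR set topology" where
  "torus_topology L =
     topology (\<lambda>U. U \<subseteq> range (torus_proj L) \<and> open (torus_proj L -` U))"

lemma openin_torus_topology:
  "openin (torus_topology L) U \<longleftrightarrow> U \<subseteq> range (torus_proj L) \<and> open (torus_proj L -` U)"
proof -
  have "istopology (\<lambda>U. U \<subseteq> range (torus_proj L) \<and> open (torus_proj L -` U))"
    unfolding istopology_def by (auto simp: vimage_Union)
  then show ?thesis
    by (simp add: torus_topology_def topology_inverse')
qed

lemma topspace_torus_topology: "topspace (torus_topology L) = range (torus_proj L)"
proof -
  have "openin (torus_topology L) (range (torus_proj L))"
    by (simp add: openin_torus_topology vimage_def)
  then show ?thesis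
    by (meson openin_subset openin_topspace openin_torus_topology subset_antisym)
qed

definition borel_sets :: "'a topology \<Rightarrow> 'a set set" where
  "borel_sets X = sigma_sets (topspace X) {U. openin X U}"

definition radon_measure :: "'a topology \<Rightarrow> 'a measure \<Rightarrow> bool" where
  "radon_measure X \<mu> \<longleftrightarrow> space \<mu> = topspace X \<and> sets \<mu> = borel_sets X \<and>
     (\<forall>K. compactin X K \<longrightarrow> emeasure \<mu> K < \<infinity>) \<and>
     (\<forall>A\<in>sets \<mu>. emeasure \<mu> A = (SUP K\<in>{K. compactin X K \<and> K \<subseteq> A}. emeasure \<mu> K))"

text \<open>
  The measure \<open>\<nu>\<close> on the torus is, locally via \<open>torus_proj L\<close>, the measure \<open>m\<close> on \<open>N\<^sub>R\<close>.
\<close>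

definition descends_to :: "'n::finite NR set \<Rightarrow> 'n NR measure \<Rightarrow> 'n NR set measure \<Rightarrow> bool" where
  "descends_to L m \<nu> \<longleftrightarrow>
     space \<nu> = range (torus_proj L) \<and> sets \<nu> = borel_sets (torus_topology L) \<and>
     (\<forall>V B. open V \<and> inj_on (torus_proj L) V \<and> B \<in> sets borel \<and> B \<subseteq> V
        \<longrightarrow> emeasure \<nu> (torus_proj L ` B) = emeasure m B)"

definition periodic :: "'n::finite NR set \<Rightarrow> ('n NR \<Rightarrow> real) \<Rightarrow> bool" where
  "periodic L g \<longleftrightarrow> (\<forall>x. \<forall>l\<in>L. g (x + l) = g x)"

definition lattice_basis :: "'n NR set \<Rightarrow> ('n::finite \<Rightarrow> 'n NR) \<Rightarrow> bool" where
  "lattice_basis L v \<longleftrightarrow> inj v \<and> independent (range v) \<and>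
     L = {\<Sum>i\<in>UNIV. of_int (k i) *\<^sub>R v i |k :: 'n \<Rightarrow> int. True}"

definition fundamental_domain :: "'n::finite NR set \<Rightarrow> 'n NR set" where
  "fundamental_domain L = (let v = (SOME v :: 'n \<Rightarrow> 'n NR. lattice_basis L v) in
     {\<Sum>i\<in>UNIV. t i *\<^sub>R v i |t. \<forall>i. 0 \<le> t i \<and> t i < 1})"

text \<open>For periodic functions the following does not depend on the choice of the lattice basis.\<close>

definition torus_integral :: "'n::finite NR set \<Rightarrow> ('n NR \<Rightarrow> real) \<Rightarrow> real" where
  "torus_integral L g = (LINT x:fundamental_domain L|lebesgue. g x)"

definition partial_deriv :: "'n::finite \<Rightarrow> ('n NR \<Rightarrow> real) \<Rightarrow> 'n NR \<Rightarrow> real" where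
  "partial_deriv i g x = frechet_derivative g (at x) (axis i 1)"

fun C_diff :: "nat \<Rightarrow> ('n::finite NR \<Rightarrow> real) \<Rightarrow> bool" where
  "C_diff 0 g \<longleftrightarrow> continuous_on UNIV g"
| "C_diff (Suc k) g \<longleftrightarrow> (\<forall>x. g differentiable at x) \<and> (\<forall>i. C_diff k (partial_deriv i g))"

definition smooth :: "('n::finite NR \<Rightarrow> real) \<Rightarrow> bool" where
  "smooth g \<longleftrightarrow> (\<forall>k. C_diff k g)"

text \<open>
  A form \<open>\<alpha>\<close> is given by its coefficients: \<open>\<alpha> = (\<Sum>I J. \<alpha> I J d'u\<^sub>I \<and> d''u\<^sub>J)\<close>, where
  \<open>d'u\<^sub>I = d'u\<^sub>i\<^sub>1 \<and> \<dots> \<and> d'u\<^sub>i\<^sub>p\<close> for \<open>I = {i\<^sub>1 < \<dots> < i\<^sub>p}\<close>, with respect to a linear order on the index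
  type of the basis.
\<close>

type_synonym 'n form = "'n set \<Rightarrow> 'n set \<Rightarrow> 'n NR \<Rightarrow> real"

definition of_type :: "nat \<Rightarrow> nat \<Rightarrow> 'n::finite form \<Rightarrow> bool" where
  "of_type p q \<alpha> \<longleftrightarrow> (\<forall>I J. \<alpha> I J \<noteq> (\<lambda>x. 0) \<longrightarrow> card I = p \<and> card J = q)"

text \<open>Forms on the torus, pulled back to \<open>N\<^sub>R\<close>.\<close>

definition torus_form :: "'n NR set \<Rightarrow> nat \<Rightarrow> nat \<Rightarrow> 'n::finite form \<Rightarrow> bool" where
  "torus_form L p q \<alpha> \<longleftrightarrow> of_type p q \<alpha> \<and> (\<forall>I J. smooth (\<alpha> I J) \<and> periodic L (\<alpha> I J))"

definition inversions :: "'n::linorder set \<Rightarrow> 'n set \<Rightarrow> nat" where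
  "inversions I I' = card {(i, i'). i \<in> I \<and> i' \<in> I' \<and> i' < i}"

text \<open>
  For disjoint \<open>I, I'\<close> and disjoint \<open>J, J'\<close>, the form
  \<open>d'u\<^sub>I \<and> d''u\<^sub>J \<and> d'u\<^sub>I\<^sub>' \<and> d''u\<^sub>J\<^sub>'\<close> equals \<open>d'u\<^sub>K \<and> d''u\<^sub>H\<close>, \<open>K = I \<union> I'\<close>, \<open>H = J \<union> J'\<close>, up to the sign
  below.
\<close>

definition wedge :: "'n::{finite,linorder} form \<Rightarrow> 'n form \<Rightarrow> 'n form" where
  "wedge \<alpha> \<beta> = (\<lambda>K H x. \<Sum>I\<in>Pow K. \<Sum>J\<in>Pow H.
     (-1) ^ (card J * card (K - I) + inversions I (K - I) + inversions J (H - J))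
       * \<alpha> I J x * \<beta> (K - I) (H - J) x)"

definition d'u :: "'n::finite \<Rightarrow> 'n form" where
  "d'u i = (\<lambda>I J x. if I = {i} \<and> J = {} then 1 else 0)"

definition d''u :: "'n::finite \<Rightarrow> 'n form" where
  "d''u i = (\<lambda>I J x. if I = {} \<and> J = {i} then 1 else 0)"

definition d' :: "'n::{finite,linorder} form \<Rightarrow> 'n form" where
  "d' \<alpha> = (\<lambda>I J x. \<Sum>i\<in>UNIV. wedge (d'u i) (\<lambda>I' J'. partial_deriv i (\<alpha> I' J')) I J x)"

definition d'' :: "'n::{finite,linorder} form \<Rightarrow> 'n form" where
  "d'' \<alpha> = (\<lambda>I J x. \<Sum>i\<in>UNIV. wedge (d''u i) (\<lambda>I' J'. partial_deriv i (\<alpha> I' J')) I J x)"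

text \<open>The sign comes from \<open>J(d'u\<^sub>I \<and> d''u\<^sub>J) = d''u\<^sub>I \<and> d'u\<^sub>J = (-1)\<^bsup>card I * card J\<^esup> d'u\<^sub>J \<and> d''u\<^sub>I\<close>.\<close>

definition form_J :: "'n::finite form \<Rightarrow> 'n form" where
  "form_J \<alpha> = (\<lambda>I J x. (-1) ^ (card I * card J) * \<alpha> J I x)"

text \<open>
  The sign comes from reordering \<open>d'u\<^sub>1 \<and> d''u\<^sub>1 \<and> \<dots> \<and> d'u\<^sub>n \<and> d''u\<^sub>n\<close> to
  \<open>d'u\<^sub>1 \<and> \<dots> \<and> d'u\<^sub>n \<and> d''u\<^sub>1 \<and> \<dots> \<and> d''u\<^sub>n\<close>.
\<close>

definition form_integral :: "'n NR set \<Rightarrow> 'n::finite form \<Rightarrow> real" where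
  "form_integral L \<alpha> =
     (-1) ^ (CARD('n) * (CARD('n) - 1) div 2) * torus_integral L (\<alpha> UNIV UNIV)"

definition positive_form :: "'n NR set \<Rightarrow> nat \<Rightarrow> 'n::{finite,linorder} form \<Rightarrow> bool" where
  "positive_form L p \<eta> \<longleftrightarrow> (\<exists>(r::nat) g \<alpha>.
     (\<forall>j<r. smooth (g j) \<and> periodic L (g j) \<and> (\<forall>x. g j x \<ge> 0) \<and> torus_form L p 0 (\<alpha> j)) \<and>
     \<eta> = (\<lambda>I J x. \<Sum>j<r. (-1) ^ (p * (p - 1) div 2) * g j x * wedge (\<alpha> j) (form_J (\<alpha> j)) I J x))"

text \<open>
  The torus is compact, so all smooth forms on it are test forms.  A current of type \<open>(p, q)\<close> is
  represented by its values on forms \<open>\<eta>\<close> with \<open>torus_form L (n - p) (n - q) \<eta>\<close>.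
\<close>

type_synonym 'n current = "'n form \<Rightarrow> real"

definition current_of_form :: "'n NR set \<Rightarrow> 'n::{finite,linorder} form \<Rightarrow> 'n current" where
  "current_of_form L \<alpha> = (\<lambda>\<eta>. form_integral L (wedge \<alpha> \<eta>))"

definition current_of_function ::
    "'n NR set \<Rightarrow> ('n NR set \<Rightarrow> real) \<Rightarrow> 'n::{finite,linorder} current" where
  "current_of_function L \<phi> = (\<lambda>\<eta>. form_integral L (\<lambda>I J x. \<phi> (torus_proj L x) * \<eta> I J x))"

text \<open>
  Differentials of a current of total degree \<open>k = p + q\<close>, with the sign that makes them compatible
  with those of forms.
\<close>

definition current_d' :: "nat \<Rightarrow> 'n::{finite,linorder} current \<Rightarrow> 'n current" where
  "current_d' k T = (\<lambda>\<eta>. (-1) ^ (k + 1) * T (d' \<eta>))"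

definition current_d'' :: "nat \<Rightarrow> 'n::{finite,linorder} current \<Rightarrow> 'n current" where
  "current_d'' k T = (\<lambda>\<eta>. (-1) ^ (k + 1) * T (d'' \<eta>))"

definition positive_current :: "'n NR set \<Rightarrow> nat \<Rightarrow> 'n::{finite,linorder} current \<Rightarrow> bool" where
  "positive_current L p T \<longleftrightarrow> (\<forall>\<eta>. torus_form L (CARD('n) - p) (CARD('n) - p) \<eta> \<longrightarrow>
     T (form_J \<eta>) = (-1) ^ (CARD('n) - p) * T \<eta> \<and>
     (positive_form L (CARD('n) - p) \<eta> \<longrightarrow> T \<eta> \<ge> 0))"

definition canonical_form :: "('n NR \<Rightarrow> 'n NR \<Rightarrow> real) \<Rightarrow> 'n::{finite,linorder} form" where
  "canonical_form b = (\<lambda>I J x. \<Sum>k\<in>UNIV. \<Sum>l\<in>UNIV.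
     b (axis k 1) (axis l 1) * wedge (d'u k) (d''u l) I J x)"

definition torus_null_set :: "'n::finite NR set \<Rightarrow> 'n NR set set \<Rightarrow> bool" where
  "torus_null_set L E \<longleftrightarrow> E \<subseteq> range (torus_proj L) \<and> torus_proj L -` E \<in> null_sets lebesgue"

definition strongly_usc :: "'n::finite NR set \<Rightarrow> ('n NR set \<Rightarrow> real) \<Rightarrow> bool" where
  "strongly_usc L \<phi> \<longleftrightarrow> (\<forall>a\<in>range (torus_proj L). \<forall>E. torus_null_set L E \<longrightarrow>
     ereal (\<phi> a) = Limsup (atin_within (torus_topology L) a (- E)) (\<lambda>x. ereal (\<phi> x)))"

definition omega_psh ::
    "'n::{finite,linorder} NR set \<Rightarrow> ('n NR \<Rightarrow> 'n NR \<Rightarrow> real) \<Rightarrow> ('n NR set \<Rightarrow> real) \<Rightarrow> bool"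
  where
  "omega_psh L b \<phi> \<longleftrightarrow> strongly_usc L \<phi> \<and>
     (\<forall>K. compact K \<longrightarrow> (\<lambda>x. \<phi> (torus_proj L x)) absolutely_integrable_on K) \<and>
     positive_current L 1 (\<lambda>\<eta>.
       current_d' 1 (current_d'' 0 (current_of_function L \<phi>)) \<eta>
       + current_of_form L (canonical_form b) \<eta>)"

definition hessian_density :: "('n::finite NR \<Rightarrow> real) \<Rightarrow> 'n NR \<Rightarrow> real" where
  "hessian_density g x = fact CARD('n) * det (\<chi> i j. partial_deriv i (partial_deriv j g) x)"

text \<open>
  The Monge-Ampere measure of a convex function \<open>g\<close> on \<open>N\<^sub>R\<close>, obtained by continuity (for locally
  uniform convergence of functions and vague convergence of measures) from the class of convex
  functions of class \<open>C\<^sup>2\<close>.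
\<close>

definition real_monge_ampere :: "('n::finite NR \<Rightarrow> real) \<Rightarrow> 'n NR measure \<Rightarrow> bool" where
  "real_monge_ampere g m \<longleftrightarrow> sets m = sets borel \<and>
     (\<forall>K. compact K \<longrightarrow> emeasure m K < \<infinity>) \<and>
     (\<forall>G. (\<forall>k::nat. C_diff 2 (G k) \<and> convex_on UNIV (G k)) \<and>
          (\<forall>K. compact K \<longrightarrow> uniform_limit K G g sequentially) \<longrightarrow>
        (\<forall>h. continuous_on UNIV h \<and> compact (closure {x. h x \<noteq> 0}) \<longrightarrow>
          (\<lambda>k. LINT x|lborel. h x * hessian_density (G k) x) \<longlonglongrightarrow> (LINT x|m. h x)))"

text \<open>\<open>tropical_monge_ampere L b \<phi> \<nu>\<close> is the equation \<open>(\<omega> + d'd''\<phi>)\<^bsup>\<and>n\<^esup> = \<nu>\<close>.\<close>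

definition tropical_monge_ampere ::
    "'n::finite NR set \<Rightarrow> ('n NR \<Rightarrow> 'n NR \<Rightarrow> real) \<Rightarrow> ('n NR set \<Rightarrow> real)
      \<Rightarrow> 'n NR set measure \<Rightarrow> bool" where
  "tropical_monge_ampere L b \<phi> \<nu> \<longleftrightarrow>
     (\<exists>m. real_monge_ampere (\<lambda>x. \<phi> (torus_proj L x) + 1/2 * b x x) m \<and> descends_to L m \<nu>)"

end

theory Submission
  imports Defs "HOL-Complex_Analysis.Great_Picard"
begin

text \<open>
  Put \<open>q x = b x x / 2\<close>.  On \<open>N\<^sub>R\<close> the equation asks for a periodic \<open>\<phi>\<close> with \<open>\<phi> + q\<close> convex and with a
  prescribed periodic Monge-Ampere measure.  This is an optimal transport problem on the torus for
  the cost \<open>q (x - z)\<close>, and it is solved by Kantorovich duality.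

  The \<^emph>\<open>c-transform\<close> \<open>ct \<phi> z = (SUP x. - \<phi> x - q (x - z))\<close> is the Legendre transform of \<open>\<phi> + q\<close>
  with \<open>q\<close> split off, so it is again periodic.  For almost all \<open>z\<close> the supremum is attained at a
  single point \<open>T \<phi> z\<close> (\<open>nonunique_null\<close>); for convex \<open>\<phi> + q\<close> the map \<open>T \<phi>\<close> inverts the gradient
  map \<open>x \<mapsto> B\<^sup>-\<^sup>1 (grad (\<phi> + q) x)\<close>, where \<open>B\<close> is the linear map belonging to \<open>b\<close>.  The change of variables
  formula therefore identifies the Monge-Ampere measure of \<open>\<phi> + q\<close> with the image of Lebesgue measure
  under \<open>T \<phi>\<close>, multiplied by \<open>n! det B\<close>; since the measure is defined by approximation with convex
  functions of class \<open>C\<^sup>2\<close>, the identity is proved for these and passes to the limit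
  (\<open>real_monge_ampere_push\<close>).  So the equation says that \<open>T \<phi>\<close> pushes \<open>n! det B\<close> times Lebesgue
  measure on the torus forward to \<open>\<mu>\<close> (\<open>tropical_monge_ampere_iff\<close>).

  Both measures have the same total mass.  Indeed \<open>B\<close> maps the lattice \<open>\<Lambda>\<close> onto the image of \<open>lam\<close>
  in \<open>M\<close>, which has index \<open>d\<close>; unit cubes at coset representatives tile a fundamental domain of that
  image, so \<open>det B\<close> times the covolume of \<open>\<Lambda>\<close> is \<open>d\<close> (\<open>covolume\<close>), the square root of the degree.

  Existence.  The functional \<open>J \<phi> = \<integral> \<phi> d\<mu> + n! det B \<integral> ct \<phi>\<close> does not change when a constant is
  added to \<open>\<phi>\<close>, by the equality of masses, and does not increase when \<open>\<phi>\<close> is replaced by its double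
  c-transform.  Double c-transforms have a common Lipschitz constant, so a minimiser exists by the
  Arzela-Ascoli theorem (\<open>minimiser_ex\<close>).  As the derivative of \<open>ct\<close> in the direction \<open>h\<close> is
  \<open>- h \<circ> T \<phi>\<close>, the vanishing of the first variation is exactly the push-forward equation
  (\<open>minimiser_pushes_forward\<close>).

  Uniqueness.  Let \<open>\<phi>\<close> and \<open>\<psi>\<close> be two solutions.  The excess \<open>\<phi> x + ct \<phi> z + q (x - z)\<close> is nonnegative
  and vanishes exactly at the maximisers.  Integrating the excess of \<open>\<phi>\<close> along the graph of \<open>T \<psi>\<close> and
  conversely gives two nonnegative numbers with sum zero, so \<open>T \<phi>\<close> and \<open>T \<psi>\<close> agree almost everywhere.
  By closedness \<open>ct \<phi> + q\<close> and \<open>ct \<psi> + q\<close> have a common subgradient at every point; hence they differ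
  by a constant, and so do \<open>\<phi>\<close> and \<open>\<psi>\<close> (\<open>potentials_differ_by_constant\<close>).

  Finally, for continuous \<open>\<phi>\<close> the condition of being \<open>\<omega>\<close>-psh means that \<open>\<phi> + q\<close> is convex
  (\<open>positive_current_iff_convex\<close>).  Convolution with powers of a trigonometric polynomial
  gives smooth periodic approximations of \<open>\<phi>\<close>, and for smooth functions integration by parts turns
  the current into integration against the Hessian of \<open>\<phi> + q\<close>.
\<close>

section \<open>Change of variables\<close>

text \<open>
  Transformation formulas that are proved by induction on the coordinates need a well-order on the
  index type.  Every finite type carries one, and relabelling the coordinates along it preserves
  Lebesgue measure and determinants.
\<close>

typedef 'a wo = "UNIV :: 'a set" morphisms of_wo to_wo ..

instance wo :: (finite) finite
proof
  have "(UNIV :: 'a wo set) = to_wo ` UNIV"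
    by (metis UNIV_eq_I of_wo_inverse rangeI)
  then show "finite (UNIV :: 'a wo set)" by (metis finite finite_imageI)
qed

instantiation wo :: (finite) wellorder
begin

definition less_eq_wo :: "'a wo \<Rightarrow> 'a wo \<Rightarrow> bool" where
  "less_eq_wo x y \<longleftrightarrow> to_nat (of_wo x) \<le> to_nat (of_wo y)"

definition less_wo :: "'a wo \<Rightarrow> 'a wo \<Rightarrow> bool" where
  "less_wo x y \<longleftrightarrow> to_nat (of_wo x) < to_nat (of_wo y)"

instance
proof
  fix P :: "'a wo \<Rightarrow> bool" and a
  assume step: "\<And>x. (\<And>y. y < x \<Longrightarrow> P y) \<Longrightarrow> P x"
  show "P a"
    by (induct a rule: measure_induct_rule[where f="\<lambda>x. to_nat (of_wo x)"])
       (rule step, simp add: less_wo_def)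
qed (auto simp: less_eq_wo_def less_wo_def of_wo_inject)

end

definition relabel :: "real ^ 'n::finite \<Rightarrow> real ^ 'n wo" where
  "relabel x = (\<chi> i. x $ of_wo i)"

definition unlabel :: "real ^ 'n wo \<Rightarrow> real ^ 'n::finite" where
  "unlabel y = (\<chi> i. y $ to_wo i)"

lemma relabel_unlabel [simp]: "relabel (unlabel y) = y" "unlabel (relabel x) = x"
  by (simp_all add: relabel_def unlabel_def vec_eq_iff of_wo_inverse to_wo_inverse)

lemma bounded_linear_relabel: "bounded_linear relabel"
  by (rule linear_conv_bounded_linear[THEN iffD1], rule linearI)
     (simp_all add: relabel_def vec_eq_iff)

lemma bounded_linear_unlabel: "bounded_linear unlabel"
  by (rule linear_conv_bounded_linear[THEN iffD1], rule linearI)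
     (simp_all add: unlabel_def vec_eq_iff)

lemma bij_of_wo: "bij of_wo"
  by (metis UNIV_I bijI' of_wo_inject to_wo_inverse)

lemma prod_Basis_cart: "(\<Prod>b\<in>Basis. (x::real^'n) \<bullet> b) = (\<Prod>i\<in>UNIV. x $ i)"
proof -
  have B: "(Basis :: (real^'n) set) = range (\<lambda>i. axis i 1)"
    by (auto simp: Basis_vec_def)
  have "inj (\<lambda>i. axis i 1 :: real^'n)"
    by (auto simp: inj_on_def axis_eq_axis)
  then show ?thesis
    unfolding B by (subst prod.reindex) (auto simp: inner_axis)
qed

lemma distr_relabel: "distr lborel borel relabel = (lborel :: (real ^ 'n::finite wo) measure)"
proof (rule lborel_eqI[symmetric])
  fix l u :: "real ^ 'n wo"
  assume le: "\<And>b. b \<in> Basis \<Longrightarrow> l \<bullet> b \<le> u \<bullet> b"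
  have le': "l $ i \<le> u $ i" for i
    using le[of "axis i 1"] by (simp add: inner_axis)
  have meas: "relabel \<in> borel_measurable borel"
    using bounded_linear_relabel linear_continuous_on borel_measurable_continuous_onI by blast
  have "emeasure (distr lborel borel relabel) (box l u)
      = emeasure lborel (relabel -` box l u)"
    using meas by (subst emeasure_distr) auto
  also have "relabel -` box l u = box (unlabel l) (unlabel u)"
  proof -
    have "(\<forall>i. l $ i < x $ of_wo i \<and> x $ of_wo i < u $ i) \<longleftrightarrow>
          (\<forall>i. l $ to_wo i < x $ i \<and> x $ i < u $ to_wo i)" for x :: "real^'n"
      by (metis of_wo_inverse to_wo_inverse UNIV_I)
    then show ?thesis by (auto simp: mem_box_cart relabel_def unlabel_def)
  qed
  also have "emeasure lborel \<dots> = (\<Prod>b\<in>Basis. (unlabel u - unlabel l) \<bullet> b)"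
    using le' by (intro emeasure_lborel_box) (auto simp: Basis_vec_def inner_axis unlabel_def)
  also have "(\<Prod>b\<in>Basis. (unlabel u - unlabel l) \<bullet> b) = (\<Prod>i\<in>UNIV. (u - l) $ to_wo i)"
    by (simp add: prod_Basis_cart) (simp add: unlabel_def)
  also have "\<dots> = (\<Prod>i\<in>UNIV. (u - l) $ i)"
    using prod.reindex_bij_betw[OF bij_of_wo, of "\<lambda>i. (u - l) $ to_wo i"]
    by (simp add: of_wo_inverse)
  finally show "emeasure (distr lborel borel relabel) (box l u) = ennreal (\<Prod>b\<in>Basis. (u - l) \<bullet> b)"
    by (simp add: prod_Basis_cart)
qed simp

lemma measurable_relabel [measurable]:
  "relabel \<in> borel_measurable borel" "unlabel \<in> borel_measurable borel"
  using bounded_linear_relabel bounded_linear_unlabel linear_continuous_on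
    borel_measurable_continuous_onI by blast+

lemma distr_unlabel: "distr lborel borel unlabel = (lborel :: (real ^ 'n::finite) measure)"
proof -
  have "distr lborel borel unlabel = distr (distr lborel borel relabel) borel unlabel"
    by (simp add: distr_relabel)
  also have "\<dots> = (lborel :: (real ^ 'n) measure)"
    by (subst distr_distr) (auto simp: o_def distr_id2)
  finally show ?thesis .
qed

lemma det_relabel:
  fixes A :: "real ^ 'n ^ 'n::finite"
  shows "det (\<chi> i j. A $ of_wo i $ of_wo j) = det A"
proof -
  have sgn: "sign (to_wo \<circ> p \<circ> of_wo) = sign p" if p: "p permutes (UNIV::'n set)" for p
  proof -
    have eq: "map_permutation UNIV to_wo p = to_wo \<circ> p \<circ> of_wo"
      by (rule ext) (metis UNIV_I comp_apply injI map_permutation_apply of_wo_inverse to_wo_inject)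
    have "evenperm (map_permutation UNIV to_wo p) \<longleftrightarrow> evenperm p"
      by (rule evenperm_map_permutation) (use p in \<open>auto simp: inj_on_def to_wo_inject\<close>)
    then show ?thesis by (simp add: eq sign_def)
  qed
  have perm: "to_wo \<circ> p \<circ> of_wo permutes UNIV" if "p permutes (UNIV::'n set)" for p
    using that unfolding permutes_def
    by (metis (no_types, lifting) UNIV_I comp_apply of_wo_inverse to_wo_inverse)
  have perm': "of_wo \<circ> p \<circ> to_wo permutes UNIV" if "p permutes (UNIV::'n wo set)" for p
    using that unfolding permutes_def
    by (metis (no_types, lifting) UNIV_I comp_apply of_wo_inverse to_wo_inverse)
  have "det A = (\<Sum>p | p permutes UNIV. of_int (sign p) * (\<Prod>i\<in>UNIV. A $ i $ p i))"
    by (simp add: det_def)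
  also have "\<dots> = (\<Sum>p | p permutes UNIV. of_int (sign p) *
      (\<Prod>i\<in>UNIV. A $ of_wo i $ of_wo (p i)))"
  proof (rule sum.reindex_bij_witness[where i="\<lambda>q. of_wo \<circ> q \<circ> to_wo" and j="\<lambda>p. to_wo \<circ> p \<circ> of_wo"])
    fix p assume p: "p \<in> {p. p permutes (UNIV::'n set)}"
    have "(\<Prod>i\<in>UNIV. A $ of_wo i $ p (of_wo i)) = (\<Prod>i\<in>UNIV. A $ i $ p i)"
      by (rule prod.reindex_bij_betw[OF bij_of_wo])
    then show "of_int (sign (to_wo \<circ> p \<circ> of_wo)) * (\<Prod>i\<in>UNIV. A $ of_wo i $ of_wo ((to_wo \<circ> p \<circ> of_wo) i))
        = of_int (sign p) * (\<Prod>i\<in>UNIV. A $ i $ p i)"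
      using p by (simp add: sgn to_wo_inverse)
  qed (use perm perm' in \<open>auto simp: fun_eq_iff of_wo_inverse to_wo_inverse\<close>)
  also have "\<dots> = det (\<chi> i j. A $ of_wo i $ of_wo j)"
    by (simp add: det_def)
  finally show ?thesis ..
qed

lemma has_derivative_relabelled:
  assumes "(g has_derivative g') (at (unlabel y))"
  shows "(relabel \<circ> g \<circ> unlabel has_derivative relabel \<circ> g' \<circ> unlabel) (at y)"
  using assms by (intro diff_chain_at bounded_linear_imp_has_derivative
    bounded_linear_relabel bounded_linear_unlabel) (auto simp: o_def)

lemma det_matrix_relabelled: "det (matrix (relabel \<circ> g' \<circ> unlabel)) = det (matrix g')"
proof -
  have "unlabel (axis j 1) = axis (of_wo j) (1::real)" for j :: "'a wo"
    by (auto simp: unlabel_def axis_def vec_eq_iff of_wo_inverse to_wo_inverse)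
  then have "matrix (relabel \<circ> g' \<circ> unlabel) = (\<chi> i j. matrix g' $ of_wo i $ of_wo j)"
    by (simp add: matrix_def relabel_def)
  then show ?thesis by (simp add: det_relabel)
qed

text \<open>
  The formula for Lebesgue measurable sets of finite measure gives this identity between measures of
  Borel sets: if one side is finite then so is the other, and otherwise both are infinite.
\<close>

lemma emeasure_injective_image:
  fixes g :: "real ^ 'n::finite \<Rightarrow> real ^ 'n"
  assumes A: "A \<in> sets borel" and gA: "g ` A \<in> sets borel"
    and der: "\<And>x. x \<in> A \<Longrightarrow> (g has_derivative g' x) (at x)"
    and inj: "inj_on g A"
    and meas: "(\<lambda>x. \<bar>det (matrix (g' x))\<bar>) \<in> borel_measurable borel"
  shows "emeasure lborel (g ` A) = (\<integral>\<^sup>+x\<in>A. ennreal \<bar>det (matrix (g' x))\<bar> \<partial>lborel)"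
proof -
  define G where "G = relabel \<circ> g \<circ> unlabel"
  define G' where "G' y = relabel \<circ> g' (unlabel y) \<circ> unlabel" for y
  define B where "B = unlabel -` A"
  define \<delta> where "\<delta> x = \<bar>det (matrix (g' x))\<bar>" for x
  have B: "B \<in> sets borel" unfolding B_def using measurable_sets[OF measurable_relabel(2) A] by simp
  have GB: "G ` B = unlabel -` (g ` A)"
  proof
    show "unlabel -` (g ` A) \<subseteq> G ` B"
    proof
      fix y assume "y \<in> unlabel -` (g ` A)"
      then obtain x where x: "x \<in> A" "unlabel y = g x" by auto
      then have "y = G (relabel x)" "relabel x \<in> B"
        by (auto simp: G_def B_def simp flip: x(2))
      then show "y \<in> G ` B" by blast
    qed
  qed (auto simp: G_def B_def)
  have GBb: "G ` B \<in> sets borel" unfolding GB using measurable_sets[OF measurable_relabel(2) gA] by simp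
  have derG: "(G has_derivative G' y) (at y within B)" if "y \<in> B" for y
    unfolding G_def G'_def
    by (rule has_derivative_at_withinI, rule has_derivative_relabelled) (use that der in \<open>auto simp: B_def\<close>)
  have injG: "inj_on G B"
    using inj unfolding inj_on_def G_def B_def by (metis comp_apply relabel_unlabel vimageE)
  have detG: "det (matrix (G' y)) = det (matrix (g' (unlabel y)))" for y
    unfolding G'_def by (rule det_matrix_relabelled)
  have key: "G ` B \<in> lmeasurable \<and> measure lebesgue (G ` B) = m \<longleftrightarrow>
      ((\<lambda>y. \<delta> (unlabel y)) has_integral m) B" for m
    using has_measure_differentiable_image[of B G G' m] B derG injG
    by (simp add: detG \<delta>_def)
  have \<delta>m [measurable]: "\<delta> \<in> borel_measurable borel" using meas by (simp add: \<delta>_def[abs_def])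
  have \<delta>0: "\<delta> x \<ge> 0" for x by (simp add: \<delta>_def)
  have B' [measurable]: "B \<in> sets borel" by (rule B)
  have main: "emeasure lborel (G ` B) = (\<integral>\<^sup>+y\<in>B. ennreal (\<delta> (unlabel y)) \<partial>lborel)"
  proof (cases "(\<integral>\<^sup>+y\<in>B. ennreal (\<delta> (unlabel y)) \<partial>lborel) < \<infinity>")
    case True
    define m where "m = enn2real (\<integral>\<^sup>+y\<in>B. ennreal (\<delta> (unlabel y)) \<partial>lborel)"
    have m: "(\<integral>\<^sup>+y\<in>B. ennreal (\<delta> (unlabel y)) \<partial>lborel) = ennreal m"
      using True by (simp add: m_def)
    have "((\<lambda>y. indicator B y * \<delta> (unlabel y)) has_integral m) UNIV"
      by (rule nn_integral_has_integral)
         (use \<delta>0 m in \<open>auto simp: m_def indicator_mult_ennreal mult.commute ennreal_indicator[symmetric] ennreal_mult'\<close>)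
    then have "((\<lambda>y. if y \<in> B then \<delta> (unlabel y) else 0) has_integral m) UNIV"
      by (rule has_integral_eq[rotated]) (auto simp: indicator_def)
    then have "((\<lambda>y. \<delta> (unlabel y)) has_integral m) B"
      by (simp add: has_integral_restrict_UNIV)
    then have "G ` B \<in> lmeasurable" "measure lebesgue (G ` B) = m" using key by auto
    then have "emeasure lebesgue (G ` B) = ennreal m"
      by (simp add: emeasure_eq_measure2)
    then show ?thesis using m GBb by simp
  next
    case False
    show ?thesis
    proof (rule ccontr)
      assume ne: "emeasure lborel (G ` B) \<noteq> (\<integral>\<^sup>+y\<in>B. ennreal (\<delta> (unlabel y)) \<partial>lborel)"
      then have "emeasure lborel (G ` B) < \<infinity>" using False by (metis infinity_ennreal_def top.not_eq_extremum)
      then have "G ` B \<in> lmeasurable" using GBb by (simp add: fmeasurable_def)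
      then have "((\<lambda>y. \<delta> (unlabel y)) has_integral (measure lebesgue (G ` B))) B"
        using key by blast
      then have "((\<lambda>y. if y \<in> B then \<delta> (unlabel y) else 0) has_integral (measure lebesgue (G ` B))) UNIV"
        by (simp add: has_integral_restrict_UNIV)
      then have "(\<integral>\<^sup>+y. ennreal (if y \<in> B then \<delta> (unlabel y) else 0) \<partial>lborel) = ennreal (measure lebesgue (G ` B))"
        by (intro nn_integral_has_integral_lborel) (auto simp: \<delta>0)
      also have "(\<integral>\<^sup>+y. ennreal (if y \<in> B then \<delta> (unlabel y) else 0) \<partial>lborel)
        = (\<integral>\<^sup>+y\<in>B. ennreal (\<delta> (unlabel y)) \<partial>lborel)"
        by (rule nn_integral_cong) (auto simp: indicator_def)
      finally show False using False by simp
    qed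
  qed
  have "emeasure lborel (g ` A) = emeasure (distr lborel borel unlabel) (g ` A)"
    by (simp add: distr_unlabel)
  also have "\<dots> = emeasure lborel (G ` B)"
    using gA by (subst emeasure_distr) (auto simp: GB)
  also have "\<dots> = (\<integral>\<^sup>+y. ennreal (\<delta> (unlabel y)) * indicator A (unlabel y) \<partial>lborel)"
    unfolding main by (rule nn_integral_cong) (auto simp: B_def indicator_def)
  also have "\<dots> = (\<integral>\<^sup>+x. ennreal (\<delta> x) * indicator A x \<partial>distr lborel borel unlabel)"
    using A by (subst nn_integral_distr) auto
  finally show ?thesis by (simp add: distr_unlabel \<delta>_def)
qed

lemma emeasure_linear_image_cart:
  fixes g :: "real ^ 'n::finite \<Rightarrow> real ^ 'n"
  assumes A: "A \<in> sets borel" and lin: "linear g" and inj: "inj g"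
  shows "emeasure lborel (g ` A) = ennreal \<bar>det (matrix g)\<bar> * emeasure lborel A"
proof -
  obtain h where h: "linear h" "h \<circ> g = id"
    using linear_injective_left_inverse[OF lin inj] by blast
  have gh: "g \<circ> h = id" using h lin linear_inverse_left by blast
  have "g ` A = h -` A"
    using h(2) gh by (auto simp: fun_eq_iff image_iff) (metis)
  moreover have "h \<in> borel_measurable borel"
    using h(1) by (simp add: borel_measurable_continuous_onI linear_continuous_on linear_conv_bounded_linear)
  ultimately have gA: "g ` A \<in> sets borel" using measurable_sets[of h borel borel A] A by simp
  have "emeasure lborel (g ` A) = (\<integral>\<^sup>+x\<in>A. ennreal \<bar>det (matrix g)\<bar> \<partial>lborel)"
    by (rule emeasure_injective_image[where g'="\<lambda>_. g"])
       (use A gA lin inj in \<open>auto simp: linear_imp_has_derivative inj_on_def\<close>)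
  then show ?thesis using A by (simp add: nn_integral_cmult)
qed

text \<open>
  Sard's theorem for maps between spaces of the same dimension, which needs differentiability only.
\<close>

lemma negligible_singular_values:
  fixes g :: "real ^ 'n::finite \<Rightarrow> real ^ 'n"
  assumes der: "\<And>x. x \<in> S \<Longrightarrow> (g has_derivative g' x) (at x)"
    and sing: "\<And>x. x \<in> S \<Longrightarrow> det (matrix (g' x)) = 0"
  shows "\<exists>N \<in> null_sets lborel. g ` S \<subseteq> N"
proof -
  define G where "G = relabel \<circ> g \<circ> unlabel"
  define G' where "G' y = relabel \<circ> g' (unlabel y) \<circ> unlabel" for y
  define B where "B = unlabel -` S"
  have derG: "(G has_derivative G' y) (at y within B)" if "y \<in> B" for y
    unfolding G_def G'_def
    by (rule has_derivative_at_withinI, rule has_derivative_relabelled) (use that der in \<open>auto simp: B_def\<close>)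
  have detG: "det (matrix (G' y)) = det (matrix (g' (unlabel y)))" for y
    unfolding G'_def by (rule det_matrix_relabelled)
  have "negligible (G ` B)"
  proof (rule baby_Sard[where f'=G'])
    fix y assume y: "y \<in> B"
    then have "det (matrix (G' y)) = 0" using sing by (auto simp: detG B_def)
    then show "rank (matrix (G' y)) < CARD('n wo)" by (simp add: det_eq_0_rank)
  qed (use derG in auto)
  then have "G ` B \<in> null_sets lebesgue" by (simp add: negligible_iff_null_sets)
  then obtain N where N: "N \<in> null_sets lborel" "G ` B \<subseteq> N"
    by (metis null_sets_completion_iff2 subset_refl)
  have "g ` S \<subseteq> relabel -` N"
  proof
    fix z assume "z \<in> g ` S"
    then obtain x where x: "x \<in> S" "z = g x" by auto
    then have "relabel z = G (relabel x)" "relabel x \<in> B" by (auto simp: G_def B_def)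
    then show "z \<in> relabel -` N" using N(2) by auto
  qed
  moreover have "relabel -` N \<in> null_sets lborel"
  proof -
    have Nb: "N \<in> sets borel" using N(1) by auto
    then have "emeasure (distr lborel borel relabel) N = emeasure lborel (relabel -` N)"
      by (subst emeasure_distr) auto
    moreover have "relabel -` N \<in> sets borel" using measurable_sets[OF measurable_relabel(1) Nb] by simp
    ultimately show ?thesis using N(1) by (simp add: distr_relabel null_sets_def)
  qed
  ultimately show ?thesis by blast
qed

section \<open>Lattices and fundamental domains\<close>

definition is_fundamental_domain :: "'n::finite NR set \<Rightarrow> 'n NR set \<Rightarrow> bool" where
  "is_fundamental_domain L D \<longleftrightarrow> D \<in> sets borel \<and> (\<forall>x. \<exists>!l. l \<in> L \<and> x - l \<in> D)"

lemma nn_integral_translate: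
  fixes h :: "'a::euclidean_space \<Rightarrow> ennreal"
  assumes [measurable]: "h \<in> borel_measurable borel"
  shows "(\<integral>\<^sup>+x. h (x + c) \<partial>lborel) = (\<integral>\<^sup>+x. h x \<partial>lborel)"
proof -
  have "(\<integral>\<^sup>+x. h x \<partial>lborel) = (\<integral>\<^sup>+x. h x \<partial>distr lborel borel ((+) c))"
    by (simp add: lborel_distr_plus)
  also have "\<dots> = (\<integral>\<^sup>+x. h (x + c) \<partial>lborel)"
    by (subst nn_integral_distr) (auto simp: add.commute)
  finally show ?thesis ..
qed

lemma fundamental_domain_count:
  assumes "is_fundamental_domain L D"
  shows "(\<integral>\<^sup>+l. indicator D (x - l) \<partial>count_space L) = 1"
proof -
  obtain l0 where l0: "l0 \<in> L" "x - l0 \<in> D" and uniq: "\<And>l. l \<in> L \<Longrightarrow> x - l \<in> D \<Longrightarrow> l = l0"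
    using assms unfolding is_fundamental_domain_def by metis
  have "(\<integral>\<^sup>+l. indicator D (x - l) \<partial>count_space L) = (\<integral>\<^sup>+l. indicator {l0} l \<partial>count_space L)"
  proof (rule nn_integral_cong)
    fix l assume "l \<in> space (count_space L)"
    then have "x - l \<in> D \<longleftrightarrow> l = l0" using l0 uniq[of l] by fastforce
    then show "indicator D (x - l) = (indicator {l0} l :: ennreal)" by (simp add: indicator_def)
  qed
  then show ?thesis using l0 by simp
qed

text \<open>
  The translates of a fundamental domain cover the space exactly once, so an integral over the space
  unfolds into a sum of integrals over the domain.
\<close>

lemma nn_integral_unfold:
  fixes h :: "'n::finite NR \<Rightarrow> ennreal"
  assumes cnt: "countable L" and fd: "is_fundamental_domain L D"
    and [measurable]: "h \<in> borel_measurable borel"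
  shows "(\<integral>\<^sup>+x. h x \<partial>lborel) = (\<integral>\<^sup>+l. (\<integral>\<^sup>+x\<in>D. h (x + l) \<partial>lborel) \<partial>count_space L)"
proof -
  have [measurable]: "D \<in> sets borel" using fd by (simp add: is_fundamental_domain_def)
  have "(\<integral>\<^sup>+x. h x \<partial>lborel) = (\<integral>\<^sup>+x. (\<integral>\<^sup>+l. h x * indicator D (x - l) \<partial>count_space L) \<partial>lborel)"
    by (simp add: nn_integral_cmult fundamental_domain_count[OF fd])
  also have "\<dots> = (\<integral>\<^sup>+l. (\<integral>\<^sup>+x. h x * indicator D (x - l) \<partial>lborel) \<partial>count_space L)"
    by (rule nn_integral_count_space_nn_integral[OF cnt]) measurable
  also have "\<dots> = (\<integral>\<^sup>+l. (\<integral>\<^sup>+x\<in>D. h (x + l) \<partial>lborel) \<partial>count_space L)"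
  proof (rule nn_integral_cong)
    fix l
    show "(\<integral>\<^sup>+x. h x * indicator D (x - l) \<partial>lborel) = (\<integral>\<^sup>+x\<in>D. h (x + l) \<partial>lborel)"
      using nn_integral_translate[of "\<lambda>x. h x * indicator D (x - l)" l] by simp
  qed
  finally show ?thesis .
qed

text \<open>
  Cut \<open>D\<close> into the pieces that lie in the translates of \<open>E\<close> and move each piece into \<open>E\<close>; by
  periodicity the integrals over the pieces do not change.
\<close>

lemma nn_integral_fundamental_domains_eq:
  fixes g :: "'n::finite NR \<Rightarrow> ennreal"
  assumes cnt: "countable L" and neg: "\<And>l. l \<in> L \<Longrightarrow> - l \<in> L"
    and D: "is_fundamental_domain L D" and E: "is_fundamental_domain L E"
    and [measurable]: "g \<in> borel_measurable borel" and per: "\<And>x l. l \<in> L \<Longrightarrow> g (x + l) = g x"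
  shows "(\<integral>\<^sup>+x\<in>D. g x \<partial>lborel) = (\<integral>\<^sup>+x\<in>E. g x \<partial>lborel)"
proof -
  have [measurable]: "D \<in> sets borel" "E \<in> sets borel"
    using D E by (simp_all add: is_fundamental_domain_def)
  have "(\<integral>\<^sup>+x\<in>D. g x \<partial>lborel)
      = (\<integral>\<^sup>+l. (\<integral>\<^sup>+x\<in>E. g (x + l) * indicator D (x + l) \<partial>lborel) \<partial>count_space L)"
    by (rule nn_integral_unfold[OF cnt E]) measurable
  also have "\<dots> = (\<integral>\<^sup>+l. (\<integral>\<^sup>+x. g x * indicator E x * indicator D (x + l) \<partial>lborel) \<partial>count_space L)"
    by (intro nn_integral_cong) (auto simp: per mult_ac)
  also have "\<dots> = (\<integral>\<^sup>+x. (\<integral>\<^sup>+l. g x * indicator E x * indicator D (x + l) \<partial>count_space L) \<partial>lborel)"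
    by (rule nn_integral_count_space_nn_integral[OF cnt, symmetric]) measurable
  also have "\<dots> = (\<integral>\<^sup>+x\<in>E. g x \<partial>lborel)"
  proof (rule nn_integral_cong)
    fix x
    have "(\<integral>\<^sup>+l. indicator D (x + l) \<partial>count_space L) = (\<integral>\<^sup>+l. indicator D (x - l) \<partial>count_space L)"
    proof -
      have "bij_betw uminus L L"
        by (rule bij_betw_byWitness[where f'=uminus]) (use neg in auto)
      from nn_integral_bij_count_space[OF this, of "\<lambda>l. indicator D (x - l)"]
      show ?thesis by simp
    qed
    then show "(\<integral>\<^sup>+l. g x * indicator E x * indicator D (x + l) \<partial>count_space L) = g x * indicator E x"
      by (simp add: nn_integral_cmult fundamental_domain_count[OF D])
  qed
  finally show ?thesis .
qed

lemma integral_fundamental_domains_eq: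
  fixes g :: "'n::finite NR \<Rightarrow> real"
  assumes cnt: "countable L" and neg: "\<And>l. l \<in> L \<Longrightarrow> - l \<in> L"
    and D: "is_fundamental_domain L D" and E: "is_fundamental_domain L E"
    and fin: "emeasure lborel D < \<infinity>"
    and g [measurable]: "g \<in> borel_measurable borel" and per: "periodic L g"
    and bnd: "\<And>x. \<bar>g x\<bar> \<le> C"
  shows "(LINT x:D|lborel. g x) = (LINT x:E|lborel. g x)"
proof -
  have [measurable]: "D \<in> sets borel" "E \<in> sets borel"
    using D E by (simp_all add: is_fundamental_domain_def)
  have "emeasure lborel D = emeasure lborel E"
    using nn_integral_fundamental_domains_eq[OF cnt neg D E, of "\<lambda>_. 1"] by simp
  then have finE: "emeasure lborel E < \<infinity>" using fin by simp
  have int: "integrable lborel (\<lambda>x. indicator X x *\<^sub>R g x)"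
    if "X \<in> sets borel" "emeasure lborel X < \<infinity>" for X
  proof (rule Bochner_Integration.integrable_bound)
    show "integrable lborel (\<lambda>x. indicator X x *\<^sub>R C)" using that by simp
    show "AE x in lborel. norm (indicator X x *\<^sub>R g x) \<le> norm (indicator X x *\<^sub>R C)"
      using bnd order_trans[OF abs_ge_zero bnd] by (auto simp: indicator_def)
  qed (use that in measurable)
  have *: "(\<integral>\<^sup>+x. ennreal (s * (indicator D x *\<^sub>R g x)) \<partial>lborel)
      = (\<integral>\<^sup>+x. ennreal (s * (indicator E x *\<^sub>R g x)) \<partial>lborel)" for s
  proof -
    have "(\<integral>\<^sup>+x. ennreal (s * (indicator X x *\<^sub>R g x)) \<partial>lborel) = (\<integral>\<^sup>+x\<in>X. ennreal (s * g x) \<partial>lborel)" for X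
      by (rule nn_integral_cong) (auto simp: indicator_def)
    moreover have "(\<integral>\<^sup>+x\<in>D. ennreal (s * g x) \<partial>lborel) = (\<integral>\<^sup>+x\<in>E. ennreal (s * g x) \<partial>lborel)"
      by (rule nn_integral_fundamental_domains_eq[OF cnt neg D E])
         (use per in \<open>auto simp: periodic_def\<close>)
    ultimately show ?thesis by simp
  qed
  show ?thesis
    unfolding set_lebesgue_integral_def
    using *[of 1] *[of "-1"] int[of D] int[of E] fin finE
    by (subst (1 2) real_lebesgue_integral_def) auto
qed

locale torus_lattice =
  fixes L :: "'n::finite NR set"
  assumes ex_lattice_basis: "\<exists>v :: 'n \<Rightarrow> 'n NR. lattice_basis L v"
begin

definition v :: "'n \<Rightarrow> 'n NR" where "v = (SOME v. lattice_basis L v)"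

definition comb :: "real ^ 'n \<Rightarrow> 'n NR" where "comb t = (\<Sum>i\<in>UNIV. t $ i *\<^sub>R v i)"

definition coord :: "'n NR \<Rightarrow> real ^ 'n" where "coord = inv_into UNIV comb"

abbreviation FD :: "'n NR set" where "FD \<equiv> fundamental_domain L"

lemma v: "lattice_basis L v"
  unfolding v_def using ex_lattice_basis by (rule someI_ex)

lemmas v_inj = v[unfolded lattice_basis_def, THEN conjunct1]
  and v_independent = v[unfolded lattice_basis_def, THEN conjunct2, THEN conjunct1]
  and L_eq = v[unfolded lattice_basis_def, THEN conjunct2, THEN conjunct2]

lemma linear_comb: "linear comb"
  by (rule linearI) (simp_all add: comb_def scaleR_left_distrib sum.distrib scaleR_right.sum)

lemma inj_comb: "inj comb"
proof (rule linear_injective_0[OF linear_comb, THEN iffD2], intro allI impI)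
  fix t assume 0: "comb t = 0"
  note inj = v_inj and ind = v_independent
  have "(\<Sum>w\<in>range v. (t $ (inv_into UNIV v w)) *\<^sub>R w) = 0"
    using 0 by (simp add: sum.reindex inj comb_def)
  then have "t $ (inv_into UNIV v (v i)) = 0" for i
    using independentD[OF ind, of "range v" "\<lambda>w. t $ (inv_into UNIV v w)" "v i"] by simp
  then show "t = 0" by (simp add: inj vec_eq_iff)
qed

lemma coord_comb [simp]: "coord (comb t) = t"
  by (simp add: coord_def inj_comb)

lemma surj_comb: "surj comb"
  using linear_comb inj_comb linear_injective_imp_surjective by blast

lemma comb_coord [simp]: "comb (coord x) = x"
  by (simp add: coord_def surj_comb surj_f_inv_f)

lemma linear_coord: "linear coord"
proof (rule linearI)
  fix x y
  have "comb (coord x + coord y) = x + y" by (simp add: linear_add[OF linear_comb])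
  then show "coord (x + y) = coord x + coord y" using coord_comb[of "coord x + coord y"] by simp
next
  fix c x
  have "comb (c *\<^sub>R coord x) = c *\<^sub>R x" by (simp add: linear_cmul[OF linear_comb])
  then show "coord (c *\<^sub>R x) = c *\<^sub>R coord x" using coord_comb[of "c *\<^sub>R coord x"] by simp
qed

lemmas coord_add = linear_add[OF linear_coord] and coord_diff = linear_diff[OF linear_coord]
  and coord_0 = linear_0[OF linear_coord] and coord_neg = linear_neg[OF linear_coord]
  and coord_scaleR = linear_cmul[OF linear_coord]

lemma bounded_linear_coord: "bounded_linear coord"
  using linear_coord by (simp add: linear_conv_bounded_linear)

lemma bounded_linear_comb: "bounded_linear comb"
  using linear_comb by (simp add: linear_conv_bounded_linear)

lemma measurable_coord [measurable]: "coord \<in> borel_measurable borel"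
  by (simp add: borel_measurable_continuous_onI linear_continuous_on bounded_linear_coord)

lemma coord_eqI: "(\<And>i. coord x $ i = coord y $ i) \<Longrightarrow> x = y"
  by (metis comb_coord vec_eq_iff)

lemma L_iff: "l \<in> L \<longleftrightarrow> (\<forall>i. coord l $ i \<in> \<int>)"
proof
  assume "l \<in> L"
  then obtain k :: "'n \<Rightarrow> int" where "l = (\<Sum>i\<in>UNIV. of_int (k i) *\<^sub>R v i)"
    by (subst (asm) L_eq) blast
  then have "l = comb (\<chi> i. of_int (k i))" by (simp add: comb_def)
  then show "\<forall>i. coord l $ i \<in> \<int>" by simp
next
  assume *: "\<forall>i. coord l $ i \<in> \<int>"
  then have "coord l = (\<chi> i. of_int \<lfloor>coord l $ i\<rfloor>)"
    by (simp add: vec_eq_iff)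
  then have "comb (coord l) = (\<Sum>i\<in>UNIV. of_int \<lfloor>coord l $ i\<rfloor> *\<^sub>R v i)"
    unfolding comb_def by (metis (no_types, lifting) sum.cong vec_lambda_beta)
  then show "l \<in> L" by (subst L_eq) (auto intro!: exI[of _ "\<lambda>i. \<lfloor>coord l $ i\<rfloor>"])
qed

lemma FD_eq: "FD = {x. \<forall>i. 0 \<le> coord x $ i \<and> coord x $ i < 1}"
proof -
  have "FD = {\<Sum>i\<in>UNIV. t i *\<^sub>R v i |t. \<forall>i. 0 \<le> t i \<and> t i < 1}"
    unfolding fundamental_domain_def v_def Let_def ..
  also have "\<dots> = {x. \<forall>i. 0 \<le> coord x $ i \<and> coord x $ i < 1}"
  proof (rule Set.set_eqI, rule iffI)
    fix x assume "x \<in> {\<Sum>i\<in>UNIV. t i *\<^sub>R v i |t. \<forall>i. 0 \<le> t i \<and> t i < 1}"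
    then obtain t where t: "x = (\<Sum>i\<in>UNIV. t i *\<^sub>R v i)" "\<forall>i. 0 \<le> t i \<and> t i < 1" by auto
    then have "x = comb (\<chi> i. t i)" by (simp add: comb_def)
    then show "x \<in> {x. \<forall>i. 0 \<le> coord x $ i \<and> coord x $ i < 1}" using t by simp
  next
    fix x assume "x \<in> {x. \<forall>i. 0 \<le> coord x $ i \<and> coord x $ i < 1}"
    then show "x \<in> {\<Sum>i\<in>UNIV. t i *\<^sub>R v i |t. \<forall>i. 0 \<le> t i \<and> t i < 1}"
      by (auto intro!: exI[of _ "\<lambda>i. coord x $ i"] simp flip: comb_def)
  qed
  finally show ?thesis .
qed

lemma L_zero [simp]: "0 \<in> L" by (simp add: L_iff coord_0)
lemma L_add: "l \<in> L \<Longrightarrow> l' \<in> L \<Longrightarrow> l + l' \<in> L" by (simp add: L_iff coord_add)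
lemma L_neg: "l \<in> L \<Longrightarrow> - l \<in> L" by (simp add: L_iff coord_neg)
lemma L_diff: "l \<in> L \<Longrightarrow> l' \<in> L \<Longrightarrow> l - l' \<in> L" by (simp add: L_iff coord_diff)

lemma countable_L: "countable L"
proof -
  have "L \<subseteq> comb ` (\<lambda>k. \<chi> i. of_int (k i)) ` (UNIV :: ('n \<Rightarrow> int) set)"
  proof
    fix l assume "l \<in> L"
    then have "l = comb (\<chi> i. of_int \<lfloor>coord l $ i\<rfloor>)"
      by (intro coord_eqI) (simp add: L_iff)
    then show "l \<in> comb ` (\<lambda>k. \<chi> i. of_int (k i)) ` UNIV"
      by (intro image_eqI[of _ _ "\<chi> i. of_int \<lfloor>coord l $ i\<rfloor>"]
            image_eqI[of _ _ "\<lambda>i. \<lfloor>coord l $ i\<rfloor>"]) auto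
  qed
  moreover have "countable (UNIV :: ('n \<Rightarrow> int) set)" by simp
  ultimately show ?thesis by (meson countable_image countable_subset)
qed

lemma FD_borel [measurable]: "FD \<in> sets borel"
proof -
  have "{x. 0 \<le> coord x $ i \<and> coord x $ i < 1} \<in> sets borel" for i
  proof -
    have "(\<lambda>x. coord x $ i) \<in> borel_measurable borel"
      by (rule measurable_compose[OF measurable_coord borel_measurable_nth])
    from measurable_sets[OF this, of "{0..<1}"] show ?thesis
      by (simp add: vimage_def)
  qed
  then have "(\<Inter>i. {x. 0 \<le> coord x $ i \<and> coord x $ i < 1}) \<in> sets borel"
    by (intro sets.finite_INT) auto
  moreover have "FD = (\<Inter>i. {x. 0 \<le> coord x $ i \<and> coord x $ i < 1})"
    by (auto simp: FD_eq)
  ultimately show ?thesis by simp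
qed

lemma FD_unique: "\<exists>!l. l \<in> L \<and> x - l \<in> FD"
proof (rule ex1I[of _ "comb (\<chi> i. of_int \<lfloor>coord x $ i\<rfloor>)"])
  have "0 \<le> coord x $ i - of_int \<lfloor>coord x $ i\<rfloor> \<and> coord x $ i - of_int \<lfloor>coord x $ i\<rfloor> < 1" for i
    by linarith
  then show "comb (\<chi> i. of_int \<lfloor>coord x $ i\<rfloor>) \<in> L \<and> x - comb (\<chi> i. of_int \<lfloor>coord x $ i\<rfloor>) \<in> FD"
    by (simp add: L_iff FD_eq coord_diff)
next
  fix l assume l: "l \<in> L \<and> x - l \<in> FD"
  show "l = comb (\<chi> i. of_int \<lfloor>coord x $ i\<rfloor>)"
  proof (rule coord_eqI)
    fix i
    have "coord l $ i \<in> \<int>" using l by (simp add: L_iff)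
    then obtain k where k: "coord l $ i = of_int k" by (rule Ints_cases)
    have "0 \<le> coord (x - l) $ i \<and> coord (x - l) $ i < 1"
      using l unfolding FD_eq by blast
    then have "0 \<le> coord x $ i - of_int k" "coord x $ i - of_int k < 1"
      using k by (simp_all add: coord_diff)
    then have "\<lfloor>coord x $ i\<rfloor> = k" by linarith
    then show "coord l $ i = coord (comb (\<chi> i. of_int \<lfloor>coord x $ i\<rfloor>)) $ i" using k by simp
  qed
qed

lemma is_fundamental_domain_FD: "is_fundamental_domain L FD"
  using FD_unique by (simp add: is_fundamental_domain_def)

text \<open>
  The representative in the fundamental domain of a point modulo the lattice.
\<close>

definition red :: "'n NR \<Rightarrow> 'n NR" where "red x = comb (\<chi> i. frac (coord x $ i))"

lemma red_FD [simp]: "red x \<in> FD"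
  by (simp add: red_def FD_eq frac_lt_1)

lemma red_L: "red x - x \<in> L"
  by (simp add: red_def L_iff coord_diff frac_def)

lemma periodic_add: "periodic L g \<Longrightarrow> l \<in> L \<Longrightarrow> g (x + l) = g x"
  by (simp add: periodic_def)

lemma periodic_red: "periodic L g \<Longrightarrow> g (red x) = g x"
  using periodic_add[OF _ red_L, of g x x] by simp

definition \<rho> :: real where "\<rho> = (SOME r. FD \<subseteq> cball 0 r)"

lemma FD_cball: "FD \<subseteq> cball 0 \<rho>"
proof -
  have "bounded (coord ` FD)"
  proof (rule boundedI)
    fix t assume "t \<in> coord ` FD"
    then obtain x where x: "x \<in> FD" "t = coord x" by blast
    have "\<bar>t $ i\<bar> \<le> 1" for i
    proof -
      have "0 \<le> coord x $ i \<and> coord x $ i < 1" using x(1) unfolding FD_eq by blast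
      then show ?thesis using x(2) by simp
    qed
    then have "(\<Sum>i\<in>UNIV. \<bar>t $ i\<bar>) \<le> (\<Sum>i\<in>(UNIV::'n set). 1)" by (intro sum_mono)
    then show "norm t \<le> real CARD('n)" using norm_le_l1_cart[of t] by simp
  qed
  then have "bounded (comb ` coord ` FD)"
    using bounded_linear_image bounded_linear_comb by blast
  then have "bounded FD" by (simp add: image_image)
  then obtain r where "\<forall>x\<in>FD. norm x \<le> r" unfolding bounded_iff ..
  then have "FD \<subseteq> cball 0 r" by (simp add: subset_iff)
  then show ?thesis unfolding \<rho>_def by (rule someI)
qed

lemma norm_red: "norm (red x) \<le> \<rho>"
  using subsetD[OF FD_cball red_FD] by simp

lemma \<rho>_nonneg: "0 \<le> \<rho>"
  by (rule order_trans[OF norm_ge_zero norm_red[of 0]])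

lemma FD_finite: "emeasure lborel FD < \<infinity>"
proof -
  have "emeasure lborel FD \<le> emeasure lborel (cball (0::'n NR) \<rho>)"
    using FD_cball by (intro emeasure_mono) auto
  also have "\<dots> < \<infinity>" by (rule emeasure_bounded_finite) simp
  finally show ?thesis .
qed

text \<open>
  In lattice coordinates a nonzero lattice point is a nonzero integer vector.
\<close>

lemma L_separated: "\<exists>r>0. \<forall>l\<in>L. l \<noteq> 0 \<longrightarrow> r \<le> norm l"
proof -
  obtain C where C: "C > 0" "\<And>x. norm (coord x) \<le> norm x * C"
    using bounded_linear.pos_bounded[OF bounded_linear_coord] by blast
  have "1 / C \<le> norm l" if l: "l \<in> L" "l \<noteq> 0" for l
  proof -
    have "coord l \<noteq> 0"
    proof
      assume "coord l = 0"
      then have "comb (coord l) = 0" by (simp add: linear_0[OF linear_comb])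
      then show False using l by simp
    qed
    then obtain i where i: "coord l $ i \<noteq> 0" by (auto simp: vec_eq_iff)
    have "1 \<le> \<bar>coord l $ i\<bar>" using i l by (intro Ints_nonzero_abs_ge1) (auto simp: L_iff)
    also have "\<dots> \<le> norm (coord l)" by (rule component_le_norm_cart)
    also have "\<dots> \<le> norm l * C" by (rule C)
    finally show ?thesis using C by (simp add: field_simps)
  qed
  then show ?thesis using C by (intro exI[of _ "1/C"]) auto
qed

subsection \<open>Continuous periodic functions\<close>

text \<open>
  The name stands for \<open>periodic and continuous\<close>: the lifts of continuous functions on the torus.
\<close>

definition pc :: "('n NR \<Rightarrow> real) \<Rightarrow> bool" where
  "pc g \<longleftrightarrow> continuous_on UNIV g \<and> periodic L g"

lemma pc_bounded: assumes "pc g" shows "\<exists>C. \<forall>x. \<bar>g x\<bar> \<le> C"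
proof -
  have "compact (g ` cball 0 \<rho>)"
    using assms by (intro compact_continuous_image) (auto simp: pc_def intro: continuous_on_subset)
  then obtain C where C: "\<forall>y\<in>g ` cball 0 \<rho>. norm y \<le> C"
    using compact_imp_bounded[of "g ` cball 0 \<rho>"] unfolding bounded_iff by meson
  have "\<bar>g x\<bar> \<le> C" for x
  proof -
    have "g (red x) \<in> g ` cball 0 \<rho>" using norm_red[of x] by simp
    then have "norm (g (red x)) \<le> C" using C by blast
    then show ?thesis using assms periodic_red[of g x] by (simp add: pc_def)
  qed
  then show ?thesis by blast
qed

lemma pc_measurable: "pc g \<Longrightarrow> g \<in> borel_measurable borel"
  by (simp add: pc_def borel_measurable_continuous_onI)

lemma pc_add: "pc g \<Longrightarrow> pc h \<Longrightarrow> pc (\<lambda>x. g x + h x)"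
  by (auto simp: pc_def periodic_def intro!: continuous_intros)
lemma pc_diff: "pc g \<Longrightarrow> pc h \<Longrightarrow> pc (\<lambda>x. g x - h x)"
  by (auto simp: pc_def periodic_def intro!: continuous_intros)
lemma pc_mult: "pc g \<Longrightarrow> pc h \<Longrightarrow> pc (\<lambda>x. g x * h x)"
  by (auto simp: pc_def periodic_def intro!: continuous_intros)
lemma pc_const: "pc (\<lambda>x. c)"
  by (auto simp: pc_def periodic_def)
lemma pc_cmult: "pc g \<Longrightarrow> pc (\<lambda>x. c * g x)"
  by (auto simp: pc_def periodic_def intro!: continuous_intros)
lemma pc_uminus: "pc g \<Longrightarrow> pc (\<lambda>x. - g x)"
  by (auto simp: pc_def periodic_def intro!: continuous_intros)
lemma pc_sum: "(\<And>i. i \<in> I \<Longrightarrow> pc (g i)) \<Longrightarrow> pc (\<lambda>x. \<Sum>i\<in>I. g i x)"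
  by (auto simp: pc_def periodic_def intro!: continuous_intros sum.cong)
lemma pc_shift: assumes "pc g" shows "pc (\<lambda>x. g (x + s))"
proof -
  have "continuous_on UNIV (\<lambda>x. g (x + s))"
    using assms by (auto simp: pc_def intro!: continuous_intros continuous_on_compose2[of UNIV g])
  moreover have "g (x + l + s) = g (x + s)" if "l \<in> L" for x l
    using assms that periodic_add[of g l "x + s"] by (simp add: pc_def add_ac)
  ultimately show ?thesis by (simp add: pc_def periodic_def)
qed

lemma FD_integrable:
  fixes g :: "'n NR \<Rightarrow> real"
  assumes [measurable]: "g \<in> borel_measurable borel" and bnd: "\<And>x. x \<in> FD \<Longrightarrow> \<bar>g x\<bar> \<le> C"
  shows "set_integrable lborel FD g"
  unfolding set_integrable_def
proof (rule Bochner_Integration.integrable_bound)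
  show "integrable lborel (\<lambda>x. indicator FD x *\<^sub>R C)" using FD_finite by simp
  show "AE x in lborel. norm (indicator FD x *\<^sub>R g x) \<le> norm (indicator FD x *\<^sub>R C)"
    using bnd order_trans[OF abs_ge_zero bnd] by (auto simp: indicator_def)
qed measurable

lemma pc_integrable: "pc g \<Longrightarrow> set_integrable lborel FD g"
  using pc_bounded[of g] pc_measurable[of g] FD_integrable[of g] by blast

definition I :: "('n NR \<Rightarrow> real) \<Rightarrow> real" where "I g = (LINT x:FD|lborel. g x)"

lemma torus_integral_eq: "g \<in> borel_measurable borel \<Longrightarrow> torus_integral L g = I g"
  unfolding torus_integral_def I_def set_lebesgue_integral_def
  by (rule integral_completion) measurable

lemma I_add: "pc g \<Longrightarrow> pc h \<Longrightarrow> I (\<lambda>x. g x + h x) = I g + I h"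
  unfolding I_def by (intro set_integral_add pc_integrable)
lemma I_diff: "pc g \<Longrightarrow> pc h \<Longrightarrow> I (\<lambda>x. g x - h x) = I g - I h"
  unfolding I_def by (intro set_integral_diff pc_integrable)
lemma I_cmult: "I (\<lambda>x. c * g x) = c * I g"
  unfolding I_def by simp
lemma I_const: "I (\<lambda>x. c) = c * measure lborel FD"
  using FD_finite by (simp add: I_def set_lebesgue_integral_def)
lemma I_sum: assumes "finite J" "\<And>j. j \<in> J \<Longrightarrow> pc (g j)"
  shows "I (\<lambda>x. \<Sum>j\<in>J. g j x) = (\<Sum>j\<in>J. I (g j))"
  using assms by (induction J rule: finite_induct) (auto simp: I_add pc_sum I_const[of 0, simplified])
lemma I_mono: "pc g \<Longrightarrow> pc h \<Longrightarrow> (\<And>x. g x \<le> h x) \<Longrightarrow> I g \<le> I h"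
  unfolding I_def by (intro set_integral_mono pc_integrable)
lemma I_nonneg: "(\<And>x. 0 \<le> g x) \<Longrightarrow> 0 \<le> I g"
  unfolding I_def set_lebesgue_integral_def by (intro Bochner_Integration.integral_nonneg) auto
lemma I_abs_le: assumes "pc g" "\<And>x. \<bar>g x\<bar> \<le> C" shows "\<bar>I g\<bar> \<le> C * measure lborel FD"
proof -
  have "I g \<le> I (\<lambda>x. C)" "I (\<lambda>x. - C) \<le> I g"
    using assms by (auto intro!: I_mono pc_const simp: abs_le_iff) (metis minus_le_iff)
  then show ?thesis by (simp add: I_const abs_le_iff)
qed

text \<open>
  A translate of a fundamental domain is again a fundamental domain.
\<close>

lemma I_shift: assumes g: "pc g" shows "I (\<lambda>x. g (x + s)) = I g"
proof -
  have D: "is_fundamental_domain L ((\<lambda>x. x - s) -` FD)"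
  proof -
    have "(\<lambda>x. x - s) -` FD \<in> sets borel"
      using measurable_sets[of "\<lambda>x. x - s" borel borel FD] by simp
    moreover have "\<exists>!l. l \<in> L \<and> (x - l) - s \<in> FD" for x
      using FD_unique[of "x - s"] by (simp add: algebra_simps)
    ultimately show ?thesis by (simp add: is_fundamental_domain_def)
  qed
  obtain C where C: "\<And>x. \<bar>g x\<bar> \<le> C" using pc_bounded[OF g] by blast
  note [measurable] = pc_measurable[OF g]
  have "I g = (LINT x:(\<lambda>x. x - s) -` FD|lborel. g x)"
    unfolding I_def
    by (rule integral_fundamental_domains_eq[OF countable_L L_neg is_fundamental_domain_FD D FD_finite _ _ C])
       (use g pc_measurable in \<open>auto simp: pc_def\<close>)
  also have "\<dots> = (\<integral>x. indicator FD (x - s) *\<^sub>R g x \<partial>distr lborel borel ((+) s))"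
    by (simp add: set_lebesgue_integral_def lborel_distr_plus indicator_def)
  also have "\<dots> = I (\<lambda>x. g (x + s))"
    by (subst integral_distr) (auto simp: I_def set_lebesgue_integral_def add.commute)
  finally show ?thesis ..
qed

lemma I_tendsto:
  assumes g: "\<And>k. pc (g k)" and h: "h \<in> borel_measurable borel"
    and bnd: "\<And>k x. \<bar>g k x\<bar> \<le> C" and lim: "AE x in lborel. (\<lambda>k. g k x) \<longlonglongrightarrow> h x"
  shows "(\<lambda>k. I (g k)) \<longlonglongrightarrow> I h"
  unfolding I_def set_lebesgue_integral_def
proof (rule integral_dominated_convergence[where w="\<lambda>x. indicator FD x *\<^sub>R C"])
  show "integrable lborel (\<lambda>x. indicator FD x *\<^sub>R C)" using FD_finite by simp
  show "AE x in lborel. (\<lambda>k. indicator FD x *\<^sub>R g k x) \<longlonglongrightarrow> indicator FD x *\<^sub>R h x"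
    using lim by eventually_elim (intro tendsto_intros)
qed (use g h bnd pc_measurable in \<open>auto simp: indicator_def\<close>)

end

section \<open>The c-transform\<close>

text \<open>
  By Fubini's theorem the product of the measure of \<open>N\<close> and the length of the real line is an
  integral of lengths of countable sets.
\<close>

lemma null_set_if_countable_on_lines:
  fixes N :: "'a::euclidean_space set"
  assumes N [measurable]: "N \<in> sets borel" and cnt: "\<And>x. countable {t. x + t *\<^sub>R e \<in> N}"
  shows "N \<in> null_sets lborel"
proof -
  have meas [measurable]: "(\<lambda>(x, t). indicator N (x + t *\<^sub>R e) :: ennreal) \<in> borel_measurable (lborel \<Otimes>\<^sub>M lborel)"
  proof -
    have "(\<lambda>p. fst p + snd p *\<^sub>R e) \<in> borel_measurable (borel \<Otimes>\<^sub>M (borel :: real measure))"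
      by measurable
    then have "(\<lambda>p. indicator N (fst p + snd p *\<^sub>R e) :: ennreal) \<in> borel_measurable (borel \<Otimes>\<^sub>M borel)"
      by measurable
    then show ?thesis by (simp add: case_prod_beta)
  qed
  have "(\<integral>\<^sup>+t. (\<integral>\<^sup>+x. indicator N (x + t *\<^sub>R e) \<partial>lborel) \<partial>(lborel :: real measure))
      = (\<integral>\<^sup>+x. (\<integral>\<^sup>+t. indicator N (x + t *\<^sub>R e) \<partial>(lborel :: real measure)) \<partial>lborel)"
    by (rule lborel_pair.Fubini') (rule meas)
  also have "\<dots> = (\<integral>\<^sup>+x. 0 \<partial>(lborel :: 'a measure))"
  proof (rule nn_integral_cong)
    fix x
    have "{t. x + t *\<^sub>R e \<in> N} \<in> null_sets (lborel :: real measure)"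
      using cnt by (rule countable_imp_null_set_lborel)
    then have "(\<integral>\<^sup>+t. indicator {t. x + t *\<^sub>R e \<in> N} t \<partial>(lborel :: real measure)) = 0"
      by (subst nn_integral_indicator) auto
    then show "(\<integral>\<^sup>+t. indicator N (x + t *\<^sub>R e) \<partial>(lborel :: real measure)) = 0"
      by (simp add: indicator_def)
  qed
  also have "\<dots> = 0" by simp
  finally have "(\<integral>\<^sup>+t. (\<integral>\<^sup>+x. indicator N (x + t *\<^sub>R e) \<partial>lborel) \<partial>(lborel :: real measure)) = 0" .
  moreover have "(\<integral>\<^sup>+x. indicator N (x + t *\<^sub>R e) \<partial>lborel) = emeasure lborel N" for t :: real
    using nn_integral_translate[of "indicator N" "t *\<^sub>R e"] by simp
  \<comment> \<open>The infinite factor is the length of the real line.\<close>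
  ultimately have "emeasure lborel N * \<infinity> = 0" by simp
  then have "emeasure lborel N = 0" by (simp add: ennreal_mult_eq_top_iff split: if_splits)
  then show ?thesis by (simp add: null_sets_def)
qed

locale polarized_torus = torus_lattice L for L :: "'n::finite NR set" +
  fixes b :: "'n NR \<Rightarrow> 'n NR \<Rightarrow> real"
  assumes bilinear_b: "bilinear b" and b_sym: "b x y = b y x" and b_pos: "x \<noteq> 0 \<Longrightarrow> 0 < b x x"
begin

lemma bounded_bilinear_b: "bounded_bilinear b"
  using bilinear_b by (simp add: bilinear_conv_bounded_bilinear)

lemmas b_simps = bilinear_ladd[OF bilinear_b] bilinear_radd[OF bilinear_b]
  bilinear_lmul[OF bilinear_b] bilinear_rmul[OF bilinear_b]
  bilinear_lneg[OF bilinear_b] bilinear_rneg[OF bilinear_b]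
  bilinear_lzero[OF bilinear_b] bilinear_rzero[OF bilinear_b]
  bilinear_lsub[OF bilinear_b] bilinear_rsub[OF bilinear_b]

lemmas continuous_on_b [continuous_intros] = bounded_bilinear.continuous_on[OF bounded_bilinear_b]
lemmas tendsto_b [tendsto_intros] = bounded_bilinear.tendsto[OF bounded_bilinear_b]

definition q :: "'n NR \<Rightarrow> real" where "q x = b x x / 2"

lemma q_add: "q (x + y) = q x + b x y + q y"
  using b_sym[of y x] by (simp add: q_def b_simps field_simps)
lemma q_diff: "q (x - y) = q x - b x y + q y"
  using b_sym[of y x] by (simp add: q_def b_simps field_simps)
lemma q_minus: "q (- x) = q x" by (simp add: q_def b_simps)
lemma q_minus_commute: "q (x - y) = q (y - x)" using q_minus[of "x - y"] by simp
lemma q_nonneg: "0 \<le> q x" by (cases "x = 0") (auto simp: q_def b_simps b_pos less_imp_le)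
lemma q_zero [simp]: "q 0 = 0" by (simp add: q_def b_simps)
lemma q_scaleR: "q (t *\<^sub>R x) = t\<^sup>2 * q x" by (simp add: q_def b_simps power2_eq_square)
lemma b_eq_0_iff: "b x x = 0 \<longleftrightarrow> x = 0" using b_pos[of x] by (cases "x = 0") (auto simp: b_simps)

lemma continuous_on_q [continuous_intros]: "continuous_on S g \<Longrightarrow> continuous_on S (\<lambda>x. q (g x))"
  unfolding q_def by (intro continuous_intros) auto
lemma tendsto_q [tendsto_intros]: "(g \<longlongrightarrow> a) F \<Longrightarrow> ((\<lambda>x. q (g x)) \<longlongrightarrow> q a) F"
  unfolding q_def by (intro tendsto_intros) auto

lemma b_nondegenerate: assumes "\<And>i. b x (axis i 1) = 0" shows "x = 0"
proof -
  have "x = (\<Sum>i\<in>UNIV. x $ i *\<^sub>R axis i 1)"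
    by (simp add: vec_eq_iff axis_def if_distrib cong: if_cong)
  then have "b x x = b x (\<Sum>i\<in>UNIV. x $ i *\<^sub>R axis i 1)" by simp
  also have "\<dots> = (\<Sum>i\<in>UNIV. x $ i * b x (axis i 1))"
    using bilinear_b by (simp add: bilinear_def linear_sum linear_cmul)
  finally show ?thesis using assms by (simp add: b_eq_0_iff)
qed

definition bound_b :: real where "bound_b = (SOME K. 0 < K \<and> (\<forall>x y. \<bar>b x y\<bar> \<le> norm x * norm y * K))"

lemma bound_b: "0 < bound_b" "\<bar>b x y\<bar> \<le> norm x * norm y * bound_b"
proof -
  have "\<exists>K. 0 < K \<and> (\<forall>x y. \<bar>b x y\<bar> \<le> norm x * norm y * K)"
    using bounded_bilinear.pos_bounded[OF bounded_bilinear_b] by simp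
  then have "0 < bound_b \<and> (\<forall>x y. \<bar>b x y\<bar> \<le> norm x * norm y * bound_b)" unfolding bound_b_def by (rule someI_ex)
  then show "0 < bound_b" "\<bar>b x y\<bar> \<le> norm x * norm y * bound_b" by auto
qed

lemma q_le: "q x \<le> (norm x)\<^sup>2 * bound_b / 2"
  using bound_b(2)[of x x] by (simp add: q_def power2_eq_square)

lemma q_lower: "\<exists>c>0. \<forall>x. c * (norm x)\<^sup>2 \<le> q x"
proof -
  have "\<exists>x\<in>sphere 0 1. \<forall>y\<in>sphere 0 1. q x \<le> q y"
  proof (rule continuous_attains_inf)
    have "axis undefined 1 \<in> sphere (0::'n NR) 1" by simp
    then show "sphere (0::'n NR) 1 \<noteq> {}" by blast
  qed (auto intro!: continuous_intros)
  then obtain x where x: "norm x = 1" "\<And>y. norm y = 1 \<Longrightarrow> q x \<le> q y" by auto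
  have "x \<noteq> 0" using x(1) by auto
  then have pos: "0 < q x" using b_pos[of x] by (simp add: q_def)
  have "q x * (norm y)\<^sup>2 \<le> q y" for y
  proof (cases "y = 0")
    case False
    have "q y = (norm y)\<^sup>2 * q ((1 / norm y) *\<^sub>R y)"
      unfolding q_scaleR using False by (simp add: power_divide)
    moreover have "q x \<le> q ((1 / norm y) *\<^sub>R y)" by (rule x(2)) (use False in simp)
    ultimately show ?thesis
      using mult_left_mono[of "q x" "q ((1 / norm y) *\<^sub>R y)" "(norm y)\<^sup>2"] by (simp add: mult.commute)
  qed simp
  then show ?thesis using pos by blast
qed

text \<open>
  A radius that contains all maximisers: further away from \<open>z\<close> the cost exceeds its largest value
  \<open>\<rho>\<^sup>2 * bound_b / 2\<close> on the fundamental domain.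
\<close>

definition R :: real where
  "R = (SOME r. \<rho> \<le> r \<and> (\<forall>u. r < norm u \<longrightarrow> \<rho>\<^sup>2 * bound_b / 2 < q u))"

lemma R: "\<rho> \<le> R" "R < norm u \<Longrightarrow> \<rho>\<^sup>2 * bound_b / 2 < q u"
proof -
  obtain c where c: "c > 0" "\<And>x. c * (norm x)\<^sup>2 \<le> q x" using q_lower by blast
  define r where "r = max \<rho> (max 1 (\<rho>\<^sup>2 * bound_b / 2 / c))"
  have "\<rho>\<^sup>2 * bound_b / 2 < q u" if u: "r < norm u" for u
  proof -
    have "\<rho>\<^sup>2 * bound_b / 2 / c < norm u" "1 < norm u" using u by (auto simp: r_def)
    moreover have "norm u \<le> (norm u)\<^sup>2"
      using mult_left_mono[of 1 "norm u" "norm u"] \<open>1 < norm u\<close> by (simp add: power2_eq_square)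
    ultimately have "\<rho>\<^sup>2 * bound_b / 2 / c < (norm u)\<^sup>2" by linarith
    then have "\<rho>\<^sup>2 * bound_b / 2 < c * (norm u)\<^sup>2" using c(1) by (simp add: field_simps)
    then show ?thesis using c(2)[of u] by linarith
  qed
  then have "\<rho> \<le> r \<and> (\<forall>u. r < norm u \<longrightarrow> \<rho>\<^sup>2 * bound_b / 2 < q u)" by (simp add: r_def)
  then have "\<rho> \<le> R \<and> (\<forall>u. R < norm u \<longrightarrow> \<rho>\<^sup>2 * bound_b / 2 < q u)" unfolding R_def by (rule someI)
  then show "\<rho> \<le> R" "R < norm u \<Longrightarrow> \<rho>\<^sup>2 * bound_b / 2 < q u" by auto
qed

lemma R_nonneg: "0 \<le> R" using R(1) \<rho>_nonneg by linarith

lemma q_red: "q (red u) \<le> \<rho>\<^sup>2 * bound_b / 2"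
proof -
  have "(norm (red u))\<^sup>2 \<le> \<rho>\<^sup>2" using norm_red[of u] by (intro power_mono) auto
  then have "(norm (red u))\<^sup>2 * bound_b / 2 \<le> \<rho>\<^sup>2 * bound_b / 2"
    using bound_b(1) by (simp add: mult_right_mono)
  then show ?thesis using q_le[of "red u"] by linarith
qed

definition ct :: "('n NR \<Rightarrow> real) \<Rightarrow> 'n NR \<Rightarrow> real" where
  "ct \<phi> z = (SUP x. - \<phi> x - q (x - z))"

text \<open>
  That is, \<open>x\<close> attains the supremum in the c-transform at \<open>z\<close>; equivalently, \<open>\<phi> + q\<close> has at \<open>x\<close> the
  subgradient that corresponds to \<open>z\<close> under \<open>b\<close>.
\<close>

definition optimal :: "('n NR \<Rightarrow> real) \<Rightarrow> 'n NR \<Rightarrow> 'n NR \<Rightarrow> bool" where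
  "optimal \<phi> z x \<longleftrightarrow> (\<forall>x'. - \<phi> x' - q (x' - z) \<le> - \<phi> x - q (x - z))"

text \<open>
  A point far from \<open>z\<close> can be moved by a lattice vector into the fundamental domain at \<open>z\<close>, which keeps
  the value of \<open>\<phi>\<close> and lowers the cost.
\<close>

lemma better_point:
  assumes "periodic L \<phi>" "R < norm (x - z)"
  shows "- \<phi> x - q (x - z) < - \<phi> (z + red (x - z)) - q (red (x - z))"
proof -
  have "z + red (x - z) = x + (red (x - z) - (x - z))" by simp
  then have "\<phi> (z + red (x - z)) = \<phi> x" using periodic_add[OF assms(1) red_L] by metis
  then show ?thesis using q_red[of "x - z"] R(2)[OF assms(2)] by linarith
qed

lemma optimal_norm: assumes "pc \<phi>" "optimal \<phi> z x" shows "norm (x - z) \<le> R"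
proof (rule ccontr)
  assume "\<not> norm (x - z) \<le> R"
  then have "- \<phi> x - q (x - z) < - \<phi> (z + red (x - z)) - q (red (x - z))"
    using assms(1) by (intro better_point) (auto simp: pc_def)
  moreover have "- \<phi> (z + red (x - z)) - q (z + red (x - z) - z) \<le> - \<phi> x - q (x - z)"
    using assms(2) by (simp only: optimal_def)
  ultimately show False by simp
qed

lemma optimal_ex: assumes "pc \<phi>" shows "\<exists>x. optimal \<phi> z x"
proof -
  have cont: "continuous_on (cball z R) (\<lambda>x. - \<phi> x - q (x - z))"
    using assms by (auto simp: pc_def intro!: continuous_intros intro: continuous_on_subset)
  have "\<exists>x\<in>cball z R. \<forall>y\<in>cball z R. - \<phi> y - q (y - z) \<le> - \<phi> x - q (x - z)"
    using R_nonneg by (intro continuous_attains_sup cont) auto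
  then obtain x where x: "\<And>y. y \<in> cball z R \<Longrightarrow> - \<phi> y - q (y - z) \<le> - \<phi> x - q (x - z)" by blast
  have "- \<phi> y - q (y - z) \<le> - \<phi> x - q (x - z)" for y
  proof (cases "y \<in> cball z R")
    case True then show ?thesis by (rule x)
  next
    case False
    then have "R < norm (y - z)" by (simp add: dist_norm norm_minus_commute)
    then have "- \<phi> y - q (y - z) < - \<phi> (z + red (y - z)) - q (red (y - z))"
      using assms by (intro better_point) (auto simp: pc_def)
    also have "\<dots> = - \<phi> (z + red (y - z)) - q ((z + red (y - z)) - z)" by simp
    also have "\<dots> \<le> - \<phi> x - q (x - z)"
      using norm_red[of "y - z"] R(1) by (intro x) (simp add: dist_norm)
    finally show ?thesis by simp
  qed
  then show ?thesis by (auto simp: optimal_def)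
qed

lemma ct_eq: "optimal \<phi> z x \<Longrightarrow> ct \<phi> z = - \<phi> x - q (x - z)"
  unfolding ct_def optimal_def by (rule cSup_eq_maximum) auto

lemma ct_ge: assumes "pc \<phi>" shows "- \<phi> x - q (x - z) \<le> ct \<phi> z"
proof -
  obtain y where y: "optimal \<phi> z y" using optimal_ex[OF assms] by blast
  then show ?thesis by (simp add: ct_eq optimal_def)
qed

lemma ct_le: assumes "pc \<phi>" "\<And>x. - \<phi> x - q (x - z) \<le> c" shows "ct \<phi> z \<le> c"
proof -
  obtain y where y: "optimal \<phi> z y" using optimal_ex[OF assms(1)] by blast
  then show ?thesis using assms(2) by (simp add: ct_eq)
qed

lemma optimal_iff: assumes "pc \<phi>" shows "optimal \<phi> z x \<longleftrightarrow> ct \<phi> z = - \<phi> x - q (x - z)"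
  using ct_eq[of \<phi> z x] ct_ge[OF assms, of _ z] by (auto simp: optimal_def)

lemma optimal_shift: assumes "periodic L \<phi>" "l \<in> L" "optimal \<phi> z x" shows "optimal \<phi> (z + l) (x + l)"
  unfolding optimal_def
proof
  fix x'
  have "- \<phi> (x' - l) - q ((x' - l) - z) \<le> - \<phi> x - q (x - z)"
    using assms(3) by (simp only: optimal_def)
  moreover have "\<phi> (x' - l) = \<phi> x'"
    using periodic_add[OF assms(1) assms(2), of "x' - l"] by simp
  moreover have "\<phi> (x + l) = \<phi> x" by (rule periodic_add[OF assms(1,2)])
  ultimately show "- \<phi> x' - q (x' - (z + l)) \<le> - \<phi> (x + l) - q (x + l - (z + l))"
    by (simp add: algebra_simps)
qed

lemma ct_periodic: assumes "pc \<phi>" shows "periodic L (ct \<phi>)"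
  unfolding periodic_def
proof (intro allI ballI)
  fix z l assume l: "l \<in> L"
  obtain x where x: "optimal \<phi> z x" using optimal_ex[OF assms] by blast
  have p: "periodic L \<phi>" using assms by (simp add: pc_def)
  show "ct \<phi> (z + l) = ct \<phi> z"
    using ct_eq[OF optimal_shift[OF p l x]] ct_eq[OF x] periodic_add[OF p l] by simp
qed

text \<open>
  A Lipschitz constant of \<open>q\<close> on the ball of radius \<open>R + 1\<close>.
\<close>

definition lip_const :: real where "lip_const = (2 * R + 1) * bound_b"

lemma lip_const_nonneg: "0 \<le> lip_const" using bound_b(1) R_nonneg by (simp add: lip_const_def)

lemma q_lipschitz:
  assumes "norm u \<le> R" "norm w \<le> 1" shows "\<bar>q (u + w) - q u\<bar> \<le> lip_const * norm w"
proof -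
  have "q (u + w) - q u = b u w + q w" by (simp add: q_add)
  moreover have "\<bar>b u w\<bar> \<le> R * bound_b * norm w"
  proof -
    have "norm u * (bound_b * norm w) \<le> R * (bound_b * norm w)" using bound_b(1) by (intro mult_right_mono assms(1)) simp
    moreover have "norm u * norm w * bound_b = norm u * (bound_b * norm w)" "R * (bound_b * norm w) = R * bound_b * norm w" by simp_all
    ultimately show ?thesis using bound_b(2)[of u w] by linarith
  qed
  moreover have "\<bar>q w\<bar> \<le> bound_b * norm w"
  proof -
    have "norm w * norm w * bound_b \<le> 1 * norm w * bound_b"
      using assms(2) bound_b(1) by (intro mult_right_mono) auto
    moreover have "0 \<le> norm w * norm w * bound_b" using bound_b(1) by simp
    ultimately show ?thesis using bound_b(2)[of w w] by (simp add: q_def mult.commute)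
  qed
  moreover have "0 \<le> R * bound_b * norm w" using R_nonneg bound_b(1) by simp
  ultimately show ?thesis by (simp add: lip_const_def algebra_simps)
qed

text \<open>
  All maximisers lie at distance at most \<open>R\<close>, which depends on \<open>b\<close> and \<open>L\<close> only; so the
  c-transforms of all periodic functions share one modulus of continuity.
\<close>

lemma ct_lipschitz:
  assumes "pc \<phi>" "norm (z - z') \<le> 1" shows "\<bar>ct \<phi> z - ct \<phi> z'\<bar> \<le> lip_const * norm (z - z')"
proof -
  have *: "ct \<phi> z - ct \<phi> z' \<le> lip_const * norm (z - z')" if n: "norm (z - z') \<le> 1" for z z'
  proof -
    obtain x where x: "optimal \<phi> z x" using optimal_ex[OF assms(1)] by blast
    have "\<bar>q ((x - z) + (z - z')) - q (x - z)\<bar> \<le> lip_const * norm (z - z')"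
      by (rule q_lipschitz[OF optimal_norm[OF assms(1) x] n])
    then have "q (x - z') - q (x - z) \<le> lip_const * norm (z - z')" by simp
    then show ?thesis using ct_eq[OF x] ct_ge[OF assms(1), of x z'] by linarith
  qed
  show ?thesis using *[of z z'] *[of z' z] assms(2) by (auto simp: norm_minus_commute)
qed

lemma pc_if_lipschitz:
  assumes p: "periodic L g" and K: "\<And>z z'. norm (z - z') \<le> 1 \<Longrightarrow> \<bar>g z - g z'\<bar> \<le> lip_const * norm (z - z')"
  shows "pc g"
proof -
  have "continuous (at z) g" for z
  proof (rule continuous_at_eps_delta[THEN iffD2], intro allI impI)
    fix e :: real assume e: "0 < e"
    define d where "d = min 1 (e / (lip_const + 1))"
    have d: "0 < d" using e lip_const_nonneg by (simp add: d_def)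
    have "dist (g z') (g z) < e" if z': "dist z' z < d" for z'
    proof -
      have "norm (z' - z) \<le> 1" "norm (z' - z) < e / (lip_const + 1)" using z' by (auto simp: d_def dist_norm)
      then have "\<bar>g z' - g z\<bar> \<le> lip_const * norm (z' - z)" "(lip_const + 1) * norm (z' - z) < e"
        using K lip_const_nonneg by (auto simp: field_simps)
      moreover have "lip_const * norm (z' - z) \<le> (lip_const + 1) * norm (z' - z)" by (intro mult_right_mono) auto
      ultimately show ?thesis by (simp add: dist_real_def)
    qed
    then show "\<exists>d>0. \<forall>x'. dist x' z < d \<longrightarrow> dist (g x') (g z) < e" using d by blast
  qed
  then show ?thesis using p by (simp add: pc_def continuous_on_eq_continuous_within)
qed

lemma pc_ct: "pc \<phi> \<Longrightarrow> pc (ct \<phi>)"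
  by (rule pc_if_lipschitz[OF ct_periodic ct_lipschitz])

lemma ct_dist:
  assumes "pc \<phi>" "pc \<psi>" "\<And>x. \<bar>\<phi> x - \<psi> x\<bar> \<le> C" shows "\<bar>ct \<phi> z - ct \<psi> z\<bar> \<le> C"
proof -
  have "ct \<phi> z \<le> ct \<psi> z + C"
  proof (rule ct_le[OF assms(1)])
    fix x show "- \<phi> x - q (x - z) \<le> ct \<psi> z + C"
      using assms(3)[of x] ct_ge[OF assms(2), of x z] by linarith
  qed
  moreover have "ct \<psi> z \<le> ct \<phi> z + C"
  proof (rule ct_le[OF assms(2)])
    fix x show "- \<psi> x - q (x - z) \<le> ct \<phi> z + C"
      using assms(3)[of x] ct_ge[OF assms(1), of x z] by linarith
  qed
  ultimately show ?thesis by linarith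
qed

lemma ct_ct_le: assumes "pc \<phi>" shows "ct (ct \<phi>) x \<le> \<phi> x"
proof (rule ct_le[OF pc_ct[OF assms]])
  fix z show "- ct \<phi> z - q (z - x) \<le> \<phi> x"
    using ct_ge[OF assms, of x z] q_minus_commute[of x z] by linarith
qed

lemma ct_add_const: assumes "pc \<phi>" shows "ct (\<lambda>x. \<phi> x + c) z = ct \<phi> z - c"
proof -
  obtain x where x: "optimal \<phi> z x" using optimal_ex[OF assms] by blast
  then have "optimal (\<lambda>x. \<phi> x + c) z x" by (simp add: optimal_def)
  from ct_eq[OF this] ct_eq[OF x] show ?thesis by simp
qed

text \<open>
  Up to sign \<open>q (w - z)\<close> and \<open>q z\<close> differ by an affine function of \<open>z\<close>, so \<open>ct \<phi> + q\<close> is a supremum of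
  affine functions.
\<close>

lemma ct_convex: assumes "pc \<phi>" shows "convex_on UNIV (\<lambda>z. ct \<phi> z + q z)"
proof (rule convex_onI)
  fix t :: real and x y :: "'n NR" assume t: "0 < t" "t < 1"
  define z where "z = (1 - t) *\<^sub>R x + t *\<^sub>R y"
  obtain w where w: "optimal \<phi> z w" using optimal_ex[OF assms] by blast
  have e: "- \<phi> w - q (w - u) + q u = - \<phi> w - q w + b w u" for u by (simp add: q_diff)
  have "ct \<phi> z + q z = - \<phi> w - q w + b w z" using ct_eq[OF w] e[of z] by simp
  also have "\<dots> = (1 - t) * (- \<phi> w - q w + b w x) + t * (- \<phi> w - q w + b w y)"
    by (simp add: z_def b_simps algebra_simps)
  also have "\<dots> \<le> (1 - t) * (ct \<phi> x + q x) + t * (ct \<phi> y + q y)"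
  proof -
    have "- \<phi> w - q w + b w u \<le> ct \<phi> u + q u" for u
      using ct_ge[OF assms, of w u] e[of u] by linarith
    from add_mono[OF mult_left_mono[OF this] mult_left_mono[OF this]] show ?thesis using t by simp
  qed
  finally show "ct \<phi> ((1 - t) *\<^sub>R x + t *\<^sub>R y) + q ((1 - t) *\<^sub>R x + t *\<^sub>R y)
      \<le> (1 - t) * (ct \<phi> x + q x) + t * (ct \<phi> y + q y)" by (simp add: z_def)
qed simp

text \<open>
  Subgradients of a convex function are monotone; add the two optimality inequalities.
\<close>

lemma optimal_monotone: assumes "optimal \<phi> z x" "optimal \<phi> z' x'" shows "0 \<le> b (x - x') (z - z')"
proof -
  have "- \<phi> x' - q (x' - z) \<le> - \<phi> x - q (x - z)" "- \<phi> x - q (x - z') \<le> - \<phi> x' - q (x' - z')"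
    using assms by (auto simp: optimal_def)
  then show ?thesis by (simp add: q_diff b_simps)
qed

lemma optimal_limit:
  assumes "pc \<phi>" and optimal: "\<And>k. optimal (\<Phi> k) (zs k) (xs k)" and z: "zs \<longlonglongrightarrow> z" and x: "xs \<longlonglongrightarrow> x"
    and lim: "uniform_limit UNIV \<Phi> \<phi> sequentially"
  shows "optimal \<phi> z x"
  unfolding optimal_def
proof
  fix x'
  have l1: "(\<lambda>k. - \<Phi> k x' - q (x' - zs k)) \<longlonglongrightarrow> - \<phi> x' - q (x' - z)"
    by (intro tendsto_intros z tendsto_uniform_limitI[OF lim]) simp
  have "isCont \<phi> x" using assms(1) by (simp add: pc_def continuous_on_eq_continuous_at)
  then have c: "(\<lambda>k. \<phi> (xs k)) \<longlonglongrightarrow> \<phi> x" using x by (rule isCont_tendsto_compose)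
  have "(\<lambda>k. \<Phi> k (xs k) - \<phi> (xs k)) \<longlonglongrightarrow> 0"
  proof (rule tendstoI)
    fix e :: real assume "0 < e"
    then have "\<forall>\<^sub>F k in sequentially. \<forall>x\<in>UNIV. dist (\<Phi> k x) (\<phi> x) < e"
      using lim by (simp add: uniform_limit_iff)
    then show "\<forall>\<^sub>F k in sequentially. dist (\<Phi> k (xs k) - \<phi> (xs k)) 0 < e"
      by eventually_elim (simp add: dist_real_def)
  qed
  from tendsto_add[OF this c] have "(\<lambda>k. \<Phi> k (xs k)) \<longlonglongrightarrow> \<phi> x" by simp
  then have l2: "(\<lambda>k. - \<Phi> k (xs k) - q (xs k - zs k)) \<longlonglongrightarrow> - \<phi> x - q (x - z)"
    by (intro tendsto_intros z x)
  show "- \<phi> x' - q (x' - z) \<le> - \<phi> x - q (x - z)"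
    by (rule LIMSEQ_le[OF l1 l2]) (use optimal in \<open>auto simp: optimal_def\<close>)
qed

subsection \<open>The optimal map\<close>

definition nonunique :: "('n NR \<Rightarrow> real) \<Rightarrow> 'n NR set" where
  "nonunique \<phi> = {z. \<exists>x x'. optimal \<phi> z x \<and> optimal \<phi> z x' \<and> x \<noteq> x'}"

text \<open>
  Where the maximiser is not unique the value is arbitrary; these points form a null set.
\<close>

definition T :: "('n NR \<Rightarrow> real) \<Rightarrow> 'n NR \<Rightarrow> 'n NR" where
  "T \<phi> z = (if z \<in> nonunique \<phi> then 0 else THE x. optimal \<phi> z x)"

lemma optimal_T: assumes "pc \<phi>" "z \<notin> nonunique \<phi>" shows "optimal \<phi> z x \<longleftrightarrow> x = T \<phi> z"
proof -
  have "\<exists>!x. optimal \<phi> z x" using optimal_ex[OF assms(1)] assms(2) by (auto simp: nonunique_def)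
  then have "optimal \<phi> z (THE x. optimal \<phi> z x)" by (rule theI')
  then show ?thesis using assms(2) by (auto simp: T_def nonunique_def)
qed

lemma optimal_sequence_subseq:
  assumes "pc \<phi>" and optimal: "\<And>k. optimal (\<Phi> k) (zs k) (xs k)" and z: "zs \<longlonglongrightarrow> z" and "\<And>k. pc (\<Phi> k)"
    and lim: "uniform_limit UNIV \<Phi> \<phi> sequentially"
  shows "\<exists>x r. strict_mono r \<and> (xs \<circ> r) \<longlonglongrightarrow> x \<and> optimal \<phi> z x"
proof -
  obtain B where B: "\<And>k. norm (zs k) \<le> B"
    using convergent_imp_bounded[OF z] unfolding bounded_iff by auto
  have "norm (xs k) \<le> B + R" for k
    using norm_triangle_sub[of "xs k" "zs k"] optimal_norm[OF assms(4) optimal, of k] B[of k] by linarith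
  then have "bounded (range xs)" by (auto simp: bounded_iff)
  then obtain x r where xr: "strict_mono r" "(xs \<circ> r) \<longlonglongrightarrow> x"
    using bounded_imp_convergent_subsequence by blast
  have ul: "uniform_limit UNIV (\<lambda>k. \<Phi> (r k)) \<phi> sequentially"
    using filterlim_compose[OF lim filterlim_subseq[OF xr(1)]] by (simp add: o_def)
  have "optimal \<phi> z x"
    by (rule optimal_limit[OF assms(1) _ LIMSEQ_subseq_LIMSEQ[OF z xr(1)] xr(2) ul]) (simp add: optimal)
  then show ?thesis using xr by blast
qed

text \<open>Where the maximiser is unique, maximisers are stable under uniform perturbation.\<close>

lemma optimal_tendsto_T:
  assumes "pc \<phi>" and z: "z \<notin> nonunique \<phi>" and optimal: "\<And>k. optimal (\<Phi> k) z (xs k)" and pc: "\<And>k. pc (\<Phi> k)"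
    and lim: "uniform_limit UNIV \<Phi> \<phi> sequentially"
  shows "xs \<longlonglongrightarrow> T \<phi> z"
proof (rule ccontr)
  assume "\<not> xs \<longlonglongrightarrow> T \<phi> z"
  then obtain e where e: "e > 0" "\<exists>\<^sub>F k in sequentially. e \<le> dist (xs k) (T \<phi> z)"
    unfolding tendsto_iff by (auto simp: not_eventually not_less)
  then have "infinite {k. e \<le> dist (xs k) (T \<phi> z)}"
    by (simp add: frequently_cofinite flip: cofinite_eq_sequentially)
  then obtain r :: "nat \<Rightarrow> nat" where r: "strict_mono r" "\<And>k. e \<le> dist (xs (r k)) (T \<phi> z)"
    using infinite_enumerate[of "{k. e \<le> dist (xs k) (T \<phi> z)}"] by blast
  have "uniform_limit UNIV (\<lambda>k. \<Phi> (r k)) \<phi> sequentially"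
    using filterlim_compose[OF lim filterlim_subseq[OF r(1)]] by (simp add: o_def)
  then obtain x s where s: "strict_mono s" "((\<lambda>k. xs (r k)) \<circ> s) \<longlonglongrightarrow> x" "optimal \<phi> z x"
    using optimal_sequence_subseq[of \<phi> "\<lambda>k. \<Phi> (r k)" "\<lambda>_. z" "\<lambda>k. xs (r k)" z] assms(1) optimal pc by auto
  have "e \<le> dist x (T \<phi> z)"
    by (rule LIMSEQ_le_const[OF tendsto_dist[OF s(2) tendsto_const]]) (use r in auto)
  then show False using s(3) e(1) optimal_T[OF assms(1) z] by simp
qed

lemma uniform_limit_const_seq: "uniform_limit S (\<lambda>k::nat. \<phi>) (\<phi> :: 'a \<Rightarrow> real) sequentially"
  by (simp add: uniform_limit_iff)

lemma closed_optimal_pair: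
  assumes "pc \<phi>" "closed C"
  shows "closed {z. \<exists>x x'. optimal \<phi> z x \<and> optimal \<phi> z x' \<and> (x, x') \<in> C}"
  unfolding closed_sequential_limits
proof (intro allI impI, elim conjE)
  fix zs z assume zs: "\<forall>k. zs k \<in> {z. \<exists>x x'. optimal \<phi> z x \<and> optimal \<phi> z x' \<and> (x, x') \<in> C}"
    and z: "zs \<longlonglongrightarrow> z"
  then obtain xs xs' where xs: "\<And>k. optimal \<phi> (zs k) (xs k)" "\<And>k. optimal \<phi> (zs k) (xs' k)"
    "\<And>k. (xs k, xs' k) \<in> C" by simp metis
  obtain x r where r: "strict_mono r" "(xs \<circ> r) \<longlonglongrightarrow> x" "optimal \<phi> z x"
    using optimal_sequence_subseq[where \<Phi>="\<lambda>_. \<phi>", OF assms(1) xs(1) z assms(1) uniform_limit_const_seq] by blast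
  obtain x' s where s: "strict_mono s" "((xs' \<circ> r) \<circ> s) \<longlonglongrightarrow> x'" "optimal \<phi> z x'"
    using optimal_sequence_subseq[where \<Phi>="\<lambda>_. \<phi>" and zs="zs \<circ> r" and xs="xs' \<circ> r", OF assms(1) _
        LIMSEQ_subseq_LIMSEQ[OF z r(1)] assms(1) uniform_limit_const_seq] xs(2) by auto
  have "(\<lambda>k. (xs (r (s k)), xs' (r (s k)))) \<longlonglongrightarrow> (x, x')"
    using LIMSEQ_subseq_LIMSEQ[OF r(2) s(1)] s(2) by (intro tendsto_Pair) (auto simp: o_def)
  then have "(x, x') \<in> C" by (rule closed_sequentially[OF assms(2), rotated]) (rule xs(3))
  then show "z \<in> {z. \<exists>x x'. optimal \<phi> z x \<and> optimal \<phi> z x' \<and> (x, x') \<in> C}" using r s by blast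
qed

text \<open>
  The coordinate \<open>i\<close> of the subgradient jumps by at least \<open>1 / (k + 1)\<close> at these points.
\<close>

definition jump :: "('n NR \<Rightarrow> real) \<Rightarrow> 'n \<Rightarrow> nat \<Rightarrow> 'n NR set" where
  "jump \<phi> i k = {z. \<exists>x x'. optimal \<phi> z x \<and> optimal \<phi> z x' \<and> inverse (real (Suc k)) \<le> b (x - x') (axis i 1)}"

lemma nonunique_eq: "nonunique \<phi> = (\<Union>i. \<Union>k. jump \<phi> i k)"
proof
  show "nonunique \<phi> \<subseteq> (\<Union>i. \<Union>k. jump \<phi> i k)"
  proof
    fix z assume "z \<in> nonunique \<phi>"
    then obtain x x' where x: "optimal \<phi> z x" "optimal \<phi> z x'" "x \<noteq> x'" by (auto simp: nonunique_def)
    then obtain i where i: "b (x - x') (axis i 1) \<noteq> 0"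
      using b_nondegenerate[of "x - x'"] by auto
    have "\<exists>y y'. optimal \<phi> z y \<and> optimal \<phi> z y' \<and> 0 < b (y - y') (axis i 1)"
    proof (cases "0 < b (x - x') (axis i 1)")
      case False
      then have "0 < b (x' - x) (axis i 1)" using i by (simp add: b_simps)
      then show ?thesis using x by blast
    qed (use x in blast)
    then obtain y y' where y: "optimal \<phi> z y" "optimal \<phi> z y'" "0 < b (y - y') (axis i 1)" by blast
    then obtain k where "inverse (real (Suc k)) < b (y - y') (axis i 1)"
      using reals_Archimedean by blast
    then have "z \<in> jump \<phi> i k" using y by (auto simp: jump_def intro!: less_imp_le)
    then show "z \<in> (\<Union>i. \<Union>k. jump \<phi> i k)" by blast
  qed
  show "(\<Union>i. \<Union>k. jump \<phi> i k) \<subseteq> nonunique \<phi>"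
  proof
    fix z assume "z \<in> (\<Union>i. \<Union>k. jump \<phi> i k)"
    then obtain i k x x' where x: "optimal \<phi> z x" "optimal \<phi> z x'" "inverse (real (Suc k)) \<le> b (x - x') (axis i 1)"
      by (auto simp: jump_def)
    then have "x \<noteq> x'" by (auto simp: b_simps)
    then show "z \<in> nonunique \<phi>" using x by (auto simp: nonunique_def)
  qed
qed

lemma closed_jump: assumes "pc \<phi>" shows "closed (jump \<phi> i k)"
proof -
  have "closed {p. inverse (real (Suc k)) \<le> b (fst p - snd p) (axis i 1)}"
    by (intro closed_Collect_le continuous_intros)
  from closed_optimal_pair[OF assms this] show ?thesis by (simp add: jump_def)
qed

text \<open>
  Along a coordinate line the corresponding component of the maximiser is monotone, so it jumps at
  countably many points only.
\<close>

lemma jump_null: assumes "pc \<phi>" shows "jump \<phi> i k \<in> null_sets lborel"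
proof (rule null_set_if_countable_on_lines)
  show "jump \<phi> i k \<in> sets borel" using closed_jump[OF assms] by (rule borel_closed)
  fix z
  \<comment> \<open>A selection of maximisers; \<open>p\<close> is its monotone component along the line.\<close>
  define sel where "sel w = (SOME x. optimal \<phi> w x)" for w
  have sel: "optimal \<phi> w (sel w)" for w unfolding sel_def by (rule someI_ex[OF optimal_ex[OF assms]])
  define p where "p t = b (sel (z + t *\<^sub>R axis i 1)) (axis i 1)" for t
  have mono': "b x (axis i 1) \<le> b y (axis i 1)"
    if "optimal \<phi> (z + s *\<^sub>R axis i 1) x" "optimal \<phi> (z + t *\<^sub>R axis i 1) y" "s < t" for s t x y
  proof -
    have "0 \<le> b (y - x) ((t - s) *\<^sub>R axis i 1)"
      using optimal_monotone[OF that(2,1)] by (simp add: scaleR_left_diff_distrib)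
    then have "0 \<le> (t - s) * b (y - x) (axis i 1)" by (simp add: b_simps)
    then show ?thesis using that(3) by (simp add: zero_le_mult_iff b_simps)
  qed
  have "mono p"
  proof (rule monoI)
    fix s t :: real assume "s \<le> t"
    then show "p s \<le> p t" unfolding p_def by (cases "s = t") (auto intro!: mono' sel)
  qed
  then have cnt: "countable {t. \<not> isCont p t}" by (rule mono_ctble_discont)
  have "{t. z + t *\<^sub>R axis i 1 \<in> jump \<phi> i k} \<subseteq> {t. \<not> isCont p t}"
  proof
    fix t assume "t \<in> {t. z + t *\<^sub>R axis i 1 \<in> jump \<phi> i k}"
    then obtain x x' where x: "optimal \<phi> (z + t *\<^sub>R axis i 1) x" "optimal \<phi> (z + t *\<^sub>R axis i 1) x'"
      "inverse (real (Suc k)) \<le> b (x - x') (axis i 1)" by (auto simp: jump_def)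
    have "0 < inverse (real (Suc k))" by simp
    then have lt: "b x' (axis i 1) < b x (axis i 1)" using x(3) unfolding b_simps by linarith
    show "t \<in> {t. \<not> isCont p t}"
    proof (rule CollectI, rule notI)
      assume c: "isCont p t"
      \<comment> \<open>At a continuity point of \<open>p\<close> every maximiser would have the component \<open>p t\<close>.\<close>
      have "p t \<le> b x' (axis i 1)"
      proof (rule tendsto_upperbound)
        show "(p \<longlongrightarrow> p t) (at_left t)" using c by (simp add: isCont_def filterlim_at_split)
        show "\<forall>\<^sub>F s in at_left t. p s \<le> b x' (axis i 1)"
          unfolding p_def by (auto simp: eventually_at_filter intro!: always_eventually mono'[OF sel x(2)])
      qed simp
      moreover have "b x (axis i 1) \<le> p t"
      proof (rule tendsto_lowerbound)
        show "(p \<longlongrightarrow> p t) (at_right t)" using c by (simp add: isCont_def filterlim_at_split)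
        show "\<forall>\<^sub>F s in at_right t. b x (axis i 1) \<le> p s"
          unfolding p_def by (auto simp: eventually_at_filter intro!: always_eventually mono'[OF x(1) sel])
      qed simp
      ultimately show False using lt by simp
    qed
  qed
  then show "countable {t. z + t *\<^sub>R axis i 1 \<in> jump \<phi> i k}" using cnt countable_subset by blast
qed

lemma nonunique_null: assumes "pc \<phi>" shows "nonunique \<phi> \<in> null_sets lborel"
  unfolding nonunique_eq using jump_null[OF assms] by (intro null_sets_UN') auto

lemma AE_not_nonunique: "pc \<phi> \<Longrightarrow> AE z in lborel. z \<notin> nonunique \<phi>"
  using nonunique_null AE_not_in by blast

text \<open>
  Away from the null set of ambiguous points, the preimage of a closed set is the closed set of points
  with a maximiser in it.
\<close>

lemma measurable_T: assumes "pc \<phi>" shows "T \<phi> \<in> borel_measurable borel"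
proof (rule borel_measurableI)
  fix S :: "'n NR set" assume S: "open S"
  have mb: "nonunique \<phi> \<in> sets borel" using nonunique_null[OF assms] by auto
  define A where "A = {z. \<exists>x x'. optimal \<phi> z x \<and> optimal \<phi> z x' \<and> (x, x') \<in> (- S) \<times> UNIV}"
  have "closed A" unfolding A_def
    by (intro closed_optimal_pair assms closed_Times) (use S in auto)
  then have Ab: "A \<in> sets borel" by (rule borel_closed)
  have "T \<phi> -` S = (- nonunique \<phi> - A) \<union> (if 0 \<in> S then nonunique \<phi> else {})"
  proof (rule Set.set_eqI)
    fix z
    show "z \<in> T \<phi> -` S \<longleftrightarrow> z \<in> (- nonunique \<phi> - A) \<union> (if 0 \<in> S then nonunique \<phi> else {})"
    proof (cases "z \<in> nonunique \<phi>")
      case True then show ?thesis by (simp add: T_def)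
    next
      case False
      then show ?thesis using optimal_T[OF assms False] by (auto simp: A_def)
    qed
  qed
  then show "T \<phi> -` S \<inter> space borel \<in> sets borel" using mb Ab by (auto intro!: sets.Diff sets.Un)
qed

lemma nonunique_shift: assumes "periodic L \<phi>" "l \<in> L" shows "z + l \<in> nonunique \<phi> \<longleftrightarrow> z \<in> nonunique \<phi>"
proof -
  have *: "z + l \<in> nonunique \<phi>" if lz: "l \<in> L" "z \<in> nonunique \<phi>" for z l
  proof -
    obtain x x' where "optimal \<phi> z x" "optimal \<phi> z x'" "x \<noteq> x'" using lz(2) unfolding nonunique_def by blast
    then have "optimal \<phi> (z + l) (x + l)" "optimal \<phi> (z + l) (x' + l)" "x + l \<noteq> x' + l"
      using assms lz by (auto intro: optimal_shift)
    then show ?thesis unfolding nonunique_def by blast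
  qed
  show ?thesis using *[OF assms(2), of z] *[OF L_neg[OF assms(2)], of "z + l"] by auto
qed

lemma T_shift: assumes "pc \<phi>" "l \<in> L" "z \<notin> nonunique \<phi>" shows "T \<phi> (z + l) = T \<phi> z + l"
proof -
  have p: "periodic L \<phi>" using assms by (simp add: pc_def)
  have "optimal \<phi> (z + l) (T \<phi> z + l)"
    using optimal_T[OF assms(1,3)] by (intro optimal_shift p assms) auto
  then show ?thesis using optimal_T[OF assms(1), of "z + l"] nonunique_shift[OF p assms(2)] assms(3) by simp
qed

lemma T_norm: assumes "pc \<phi>" "z \<notin> nonunique \<phi>" shows "norm (T \<phi> z - z) \<le> R"
  using optimal_norm[OF assms(1)] optimal_T[OF assms] by blast

end

section \<open>The variational problem\<close>

locale torus_ma = polarized_torus L b for L :: "'n::finite NR set" and b +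
  fixes \<nu> :: "'n NR measure" and \<kappa> :: real
  assumes sets_\<nu> [measurable_cong]: "sets \<nu> = sets borel" and fin_\<nu>: "finite_measure \<nu>"
    and \<kappa>_pos: "0 < \<kappa>" and mass: "measure \<nu> UNIV = \<kappa> * measure lborel FD"
begin

lemma space_\<nu> [simp]: "space \<nu> = UNIV" using sets_eq_imp_space_eq[OF sets_\<nu>] by simp

lemma integrable_\<nu>: assumes "pc g" shows "integrable \<nu> g"
proof -
  interpret finite_measure \<nu> by (rule fin_\<nu>)
  obtain C where C: "\<And>x. \<bar>g x\<bar> \<le> C" using pc_bounded[OF assms] by blast
  note [measurable] = pc_measurable[OF assms]
  show ?thesis by (rule integrable_const_bound[where B=C]) (use C in auto)
qed

lemma integral_\<nu>_const: "(\<integral>x. c \<partial>\<nu>) = c * measure \<nu> UNIV"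
  by (simp add: space_\<nu>)

text \<open>
  The dual functional of the transport problem between \<open>\<nu>\<close> and \<open>\<kappa>\<close> times Lebesgue measure.
\<close>

definition J :: "('n NR \<Rightarrow> real) \<Rightarrow> real" where "J \<phi> = (\<integral>x. \<phi> x \<partial>\<nu>) + \<kappa> * I (ct \<phi>)"

text \<open>
  This is where the two measures have to have the same total mass.
\<close>

lemma J_add_const: assumes "pc \<phi>" shows "J (\<lambda>x. \<phi> x + c) = J \<phi>"
proof -
  have "(\<integral>x. \<phi> x + c \<partial>\<nu>) = (\<integral>x. \<phi> x \<partial>\<nu>) + c * measure \<nu> UNIV"
    using integrable_\<nu>[OF assms] integrable_\<nu>[OF pc_const[of c]]
    by (simp add: integral_\<nu>_const)
  moreover have "I (ct (\<lambda>x. \<phi> x + c)) = I (ct \<phi>) - c * measure lborel FD"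
  proof -
    have "ct (\<lambda>x. \<phi> x + c) = (\<lambda>z. ct \<phi> z - c)" by (rule ext) (rule ct_add_const[OF assms])
    then show ?thesis using I_diff[OF pc_ct[OF assms] pc_const[of c]] by (simp add: I_const)
  qed
  ultimately show ?thesis unfolding J_def mass by (simp only:) (simp add: algebra_simps)
qed

lemma J_ct_ct: assumes "pc \<phi>" shows "J (ct (ct \<phi>)) \<le> J \<phi>"
proof -
  have "(\<integral>x. ct (ct \<phi>) x \<partial>\<nu>) \<le> (\<integral>x. \<phi> x \<partial>\<nu>)"
    by (intro integral_mono integrable_\<nu> pc_ct assms ct_ct_le)
  moreover have "I (ct (ct (ct \<phi>))) \<le> I (ct \<phi>)"
    by (intro I_mono pc_ct assms ct_ct_le)
  ultimately show ?thesis using \<kappa>_pos by (simp add: J_def add_mono mult_left_mono)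
qed

lemma J_dist:
  assumes "pc \<phi>" "pc \<psi>" "\<And>x. \<bar>\<phi> x - \<psi> x\<bar> \<le> C" shows "\<bar>J \<phi> - J \<psi>\<bar> \<le> 2 * C * measure \<nu> UNIV"
proof -
  have "\<bar>\<integral>x. \<phi> x - \<psi> x \<partial>\<nu>\<bar> \<le> (\<integral>x. C \<partial>\<nu>)"
    by (rule order_trans[OF integral_abs_bound
        integral_mono[OF integrable_abs[OF integrable_\<nu>[OF pc_diff[OF assms(1,2)]]] integrable_\<nu>[OF pc_const]]])
       (rule assms(3))
  then have 1: "\<bar>(\<integral>x. \<phi> x \<partial>\<nu>) - (\<integral>x. \<psi> x \<partial>\<nu>)\<bar> \<le> C * measure \<nu> UNIV"
    using integrable_\<nu>[OF assms(1)] integrable_\<nu>[OF assms(2)] by (simp add: mult.commute)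
  have "\<bar>I (\<lambda>z. ct \<phi> z - ct \<psi> z)\<bar> \<le> C * measure lborel FD"
    by (intro I_abs_le pc_diff pc_ct assms ct_dist)
  then have "\<bar>I (ct \<phi>) - I (ct \<psi>)\<bar> \<le> C * measure lborel FD"
    by (simp add: I_diff pc_ct assms)
  then have "\<kappa> * \<bar>I (ct \<phi>) - I (ct \<psi>)\<bar> \<le> \<kappa> * (C * measure lborel FD)"
    using \<kappa>_pos by simp
  then have "\<bar>\<kappa> * (I (ct \<phi>) - I (ct \<psi>))\<bar> \<le> C * measure \<nu> UNIV"
    using \<kappa>_pos by (simp add: abs_mult mass mult_ac)
  then show ?thesis using 1 by (simp add: J_def right_diff_distrib)
qed

text \<open>
  The value at \<open>z'\<close> can be compared with the translate of the maximiser at \<open>z\<close> that lies in the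
  fundamental domain at \<open>z'\<close>.
\<close>

lemma ct_osc: assumes "pc \<phi>" shows "ct \<phi> z - ct \<phi> z' \<le> \<rho>\<^sup>2 * bound_b / 2"
proof -
  obtain x where x: "optimal \<phi> z x" using optimal_ex[OF assms] by blast
  have "z' + red (x - z') = x + (red (x - z') - (x - z'))" by simp
  then have "\<phi> (z' + red (x - z')) = \<phi> x"
    using assms periodic_add[OF _ red_L] unfolding pc_def by metis
  then have "- \<phi> x - q (red (x - z')) \<le> ct \<phi> z'"
    using ct_ge[OF assms, of "z' + red (x - z')" z'] by simp
  then show ?thesis using ct_eq[OF x] q_red[of "x - z'"] q_nonneg[of "x - z"] by linarith
qed

text \<open>
  If \<open>a\<close> is a minimum of \<open>\<phi>\<close>, then \<open>ct \<phi>\<close> is at least \<open>- \<phi> a\<close> up to a constant.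
\<close>

lemma J_bounded_below: assumes "pc \<phi>" shows "- (\<rho>\<^sup>2 * bound_b / 2) * measure \<nu> UNIV \<le> J \<phi>"
proof -
  have "\<exists>x\<in>cball 0 \<rho>. \<forall>y\<in>cball 0 \<rho>. \<phi> x \<le> \<phi> y"
    using assms \<rho>_nonneg
    by (intro continuous_attains_inf) (auto simp: pc_def intro: continuous_on_subset)
  then obtain a where "\<forall>y\<in>cball 0 \<rho>. \<phi> a \<le> \<phi> y" by blast
  then have a: "\<phi> a \<le> \<phi> y" if "norm y \<le> \<rho>" for y using that by simp
  have min: "\<phi> a \<le> \<phi> y" for y
    using a[OF norm_red[of y]] assms periodic_red[of \<phi> y] by (simp add: pc_def)
  have ctl: "- \<phi> a - \<rho>\<^sup>2 * bound_b / 2 \<le> ct \<phi> z" for z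
  proof -
    have "z + red (a - z) = a + (red (a - z) - (a - z))" by simp
    then have "\<phi> (z + red (a - z)) = \<phi> a"
      using assms periodic_add[OF _ red_L] unfolding pc_def by metis
    then have "- \<phi> a - q (red (a - z)) \<le> ct \<phi> z"
      using ct_ge[OF assms, of "z + red (a - z)" z] by simp
    then show ?thesis using q_red[of "a - z"] by linarith
  qed
  have "(\<integral>x. \<phi> a \<partial>\<nu>) \<le> (\<integral>x. \<phi> x \<partial>\<nu>)"
    by (intro integral_mono integrable_\<nu> assms pc_const min)
  moreover have "I (\<lambda>z. - \<phi> a - \<rho>\<^sup>2 * bound_b / 2) \<le> I (ct \<phi>)"
    by (intro I_mono pc_const pc_ct assms ctl)
  then have "\<kappa> * ((- \<phi> a - \<rho>\<^sup>2 * bound_b / 2) * measure lborel FD) \<le> \<kappa> * I (ct \<phi>)"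
    using \<kappa>_pos by (simp add: I_const del: mult_minus_left)
  then have "(- \<phi> a - \<rho>\<^sup>2 * bound_b / 2) * measure \<nu> UNIV \<le> \<kappa> * I (ct \<phi>)"
    by (simp add: mass mult_ac)
  ultimately show ?thesis unfolding J_def integral_\<nu>_const by (simp add: algebra_simps)
qed

text \<open>
  Replacing each member of a minimising sequence by its double c-transform does not increase the
  functional and makes the sequence equicontinuous, so a subsequence converges uniformly.
\<close>

lemma minimiser_ex: "\<exists>\<phi>. pc \<phi> \<and> (\<forall>\<psi>. pc \<psi> \<longrightarrow> J \<phi> \<le> J \<psi>)"
proof -
  define S where "S = Inf (J ` {\<phi>. pc \<phi>})"
  have bdd: "bdd_below (J ` {\<phi>. pc \<phi>})"
    using J_bounded_below by (auto intro!: bdd_belowI2)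
  have ne: "J ` {\<phi>. pc \<phi>} \<noteq> {}" using pc_const by blast
  have S_le: "S \<le> J \<psi>" if "pc \<psi>" for \<psi>
    unfolding S_def using that by (intro cInf_lower bdd) auto
  have "\<exists>\<phi>. pc \<phi> \<and> J \<phi> < S + inverse (real (Suc k))" for k
  proof -
    have "Inf (J ` {\<phi>. pc \<phi>}) < S + inverse (real (Suc k))" by (simp add: S_def)
    from cInf_lessD[OF ne this] show ?thesis by auto
  qed
  then obtain \<Phi> where \<Phi>: "\<And>k. pc (\<Phi> k)" "\<And>k. J (\<Phi> k) < S + inverse (real (Suc k))" by metis
  \<comment> \<open>Normalising the value at the origin makes the sequence uniformly bounded.\<close>
  define \<Psi> where "\<Psi> k x = ct (ct (\<Phi> k)) x + (- ct (ct (\<Phi> k)) 0)" for k x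
  have pcc: "pc (ct (ct (\<Phi> k)))" for k by (intro pc_ct \<Phi>)
  have pc\<Psi>: "pc (\<Psi> k)" for k unfolding \<Psi>_def[abs_def] by (intro pc_add pcc pc_const)
  have J\<Psi>: "J (\<Psi> k) < S + inverse (real (Suc k))" for k
  proof -
    have "J (\<Psi> k) = J (ct (ct (\<Phi> k)))"
      unfolding \<Psi>_def[abs_def] by (rule J_add_const[OF pcc])
    then show ?thesis using J_ct_ct[OF \<Phi>(1)[of k]] \<Phi>(2)[of k] by linarith
  qed
  have bnd: "norm (\<Psi> k x) \<le> \<rho>\<^sup>2 * bound_b / 2" for k x
    using ct_osc[OF pc_ct[OF \<Phi>(1)[of k]], of x 0] ct_osc[OF pc_ct[OF \<Phi>(1)[of k]], of 0 x]
    unfolding \<Psi>_def real_norm_def by linarith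
  have lip: "\<bar>\<Psi> k x - \<Psi> k y\<bar> \<le> lip_const * norm (x - y)" if "norm (x - y) \<le> 1" for k x y
    using ct_lipschitz[OF pc_ct[OF \<Phi>(1)[of k]] that] by (simp add: \<Psi>_def)
  have equi: "\<exists>d. 0 < d \<and> (\<forall>k y. y \<in> cball 0 \<rho> \<and> norm (x - y) < d \<longrightarrow> norm (\<Psi> k x - \<Psi> k y) < e)"
    if "x \<in> cball 0 \<rho>" "0 < e" for x e
  proof (intro exI[of _ "min 1 (e / (lip_const + 1))"] conjI allI impI)
    show "0 < min 1 (e / (lip_const + 1))" using that lip_const_nonneg by simp
    fix k y assume y: "y \<in> cball 0 \<rho> \<and> norm (x - y) < min 1 (e / (lip_const + 1))"
    then have "\<bar>\<Psi> k x - \<Psi> k y\<bar> \<le> lip_const * norm (x - y)" by (intro lip) simp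
    also have "\<dots> \<le> (lip_const + 1) * norm (x - y)" by (intro mult_right_mono) auto
    also have "\<dots> < e" using y lip_const_nonneg by (simp add: field_simps)
    finally show "norm (\<Psi> k x - \<Psi> k y) < e" by simp
  qed
  obtain g and r :: "nat \<Rightarrow> nat" where g: "continuous_on (cball 0 \<rho>) g" and r: "strict_mono r"
    and conv: "\<And>e. 0 < e \<Longrightarrow> \<exists>N. \<forall>n x. n \<ge> N \<and> x \<in> cball 0 \<rho> \<longrightarrow> norm (\<Psi> (r n) x - g x) < e"
    using Arzela_Ascoli[OF compact_cball, of 0 \<rho> \<Psi> "\<rho>\<^sup>2 * bound_b / 2"] bnd equi by metis
  \<comment> \<open>Convergence on a ball that contains the fundamental domain extends by periodicity.\<close>
  define G where "G x = g (red x)" for x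
  have ul: "uniform_limit UNIV (\<lambda>n. \<Psi> (r n)) G sequentially"
    unfolding uniform_limit_iff eventually_sequentially
  proof (intro allI impI)
    fix e :: real assume "0 < e"
    then obtain N where N: "\<And>n x. n \<ge> N \<Longrightarrow> x \<in> cball 0 \<rho> \<Longrightarrow> norm (\<Psi> (r n) x - g x) < e"
      using conv by blast
    have "dist (\<Psi> (r n) x) (G x) < e" if "n \<ge> N" for n x
      using N[OF that, of "red x"] norm_red[of x] periodic_red[of "\<Psi> (r n)" x] pc\<Psi>[of "r n"]
      by (simp add: G_def dist_norm pc_def)
    then show "\<exists>N. \<forall>n\<ge>N. \<forall>x\<in>UNIV. dist (\<Psi> (r n) x) (G x) < e" by blast
  qed
  have contG: "continuous_on UNIV G"
    by (rule uniform_limit_theorem[OF _ ul]) (use pc\<Psi> in \<open>auto simp: pc_def\<close>)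
  have perG: "periodic L G"
    unfolding periodic_def
  proof (intro allI ballI)
    fix x l assume l: "l \<in> L"
    have "(\<lambda>n. \<Psi> (r n) (x + l)) \<longlonglongrightarrow> G (x + l)" "(\<lambda>n. \<Psi> (r n) x) \<longlonglongrightarrow> G x"
      by (intro tendsto_uniform_limitI[OF ul] UNIV_I)+
    moreover have "\<Psi> (r n) (x + l) = \<Psi> (r n) x" for n
      using pc\<Psi> l by (simp add: pc_def periodic_add)
    ultimately show "G (x + l) = G x" using LIMSEQ_unique by simp
  qed
  have pcG: "pc G" using contG perG by (simp add: pc_def)
  have "J G \<le> S"
  proof (rule field_le_epsilon)
    fix e :: real assume e: "0 < e"
    define C where "C = e / 2 / (2 * measure \<nu> UNIV + 1)"
    have C: "0 < C" using e by (simp add: C_def add_nonneg_pos)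
    have "\<forall>\<^sub>F n in sequentially. \<forall>x\<in>UNIV. dist (\<Psi> (r n) x) (G x) < C"
      using ul C by (simp add: uniform_limit_iff)
    moreover have "\<forall>\<^sub>F n in sequentially. inverse (real (Suc n)) < e / 2"
      using order_tendstoD(2)[OF LIMSEQ_inverse_real_of_nat, of "e/2"] e by simp
    ultimately have "\<forall>\<^sub>F n in sequentially. (\<forall>x\<in>UNIV. dist (\<Psi> (r n) x) (G x) < C) \<and> inverse (real (Suc n)) < e / 2"
      by (rule eventually_conj)
    then obtain n where n: "\<And>x. dist (\<Psi> (r n) x) (G x) < C" "inverse (real (Suc n)) < e / 2"
      unfolding eventually_sequentially by auto
    have "\<bar>J G - J (\<Psi> (r n))\<bar> \<le> 2 * C * measure \<nu> UNIV"
      using n(1) by (intro J_dist pcG pc\<Psi>) (auto simp: dist_real_def abs_minus_commute less_imp_le)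
    moreover have "2 * C * measure \<nu> UNIV \<le> e / 2"
    proof -
      have "2 * C * measure \<nu> UNIV \<le> C * (2 * measure \<nu> UNIV + 1)" using C by (simp add: algebra_simps)
      also have "\<dots> = e / 2"
      proof -
        have "2 * measure \<nu> UNIV + 1 \<noteq> 0" using measure_nonneg[of \<nu> UNIV] by linarith
        from nonzero_eq_divide_eq[OF this, of C "e / 2"] show ?thesis using C_def by simp
      qed
      finally show ?thesis .
    qed
    moreover have "J (\<Psi> (r n)) < S + inverse (real (Suc (r n)))" by (rule J\<Psi>)
    moreover have "inverse (real (Suc (r n))) \<le> inverse (real (Suc n))"
      using seq_suble[OF r, of n] by (intro le_imp_inverse_le) auto
    ultimately show "J G \<le> S + e" using n(2) by linarith
  qed
  then show ?thesis using pcG S_le order_trans by blast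
qed

text \<open>
  The derivative of the c-transform in the direction \<open>h\<close> is \<open>- h\<close> at the maximiser.  This turns the
  minimality of \<open>\<phi>\<close> into an equation.
\<close>

lemma ct_derivative:
  assumes "pc \<phi>" "pc h" "z \<notin> nonunique \<phi>"
  shows "(\<lambda>k. (ct (\<lambda>x. \<phi> x + h x / real (Suc k)) z - ct \<phi> z) * real (Suc k)) \<longlonglongrightarrow> - h (T \<phi> z)"
proof -
  define \<Phi> where "\<Phi> k x = \<phi> x + h x / real (Suc k)" for k x
  have pc\<Phi>: "pc (\<Phi> k)" for k
    unfolding \<Phi>_def[abs_def] using pc_add[OF assms(1) pc_cmult[OF assms(2), of "1 / real (Suc k)"]]
    by simp
  obtain C where C: "\<And>x. \<bar>h x\<bar> \<le> C" using pc_bounded[OF assms(2)] by blast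
  have ul: "uniform_limit UNIV \<Phi> \<phi> sequentially"
  proof (rule uniform_limitI)
    fix e :: real assume e: "0 < e"
    have "(\<lambda>k. C * inverse (real (Suc k))) \<longlonglongrightarrow> C * 0"
      by (intro tendsto_intros LIMSEQ_inverse_real_of_nat)
    then have "\<forall>\<^sub>F k in sequentially. C * inverse (real (Suc k)) < e"
      using e by (intro order_tendstoD(2)[where y="C * 0"]) auto
    then show "\<forall>\<^sub>F k in sequentially. \<forall>x\<in>UNIV. dist (\<Phi> k x) (\<phi> x) < e"
    proof eventually_elim
      case (elim k)
      have "\<bar>h x / real (Suc k)\<bar> \<le> C * inverse (real (Suc k))" for x
        using C[of x] by (simp add: divide_simps)
      then show ?case using elim by (auto simp: \<Phi>_def dist_real_def intro: le_less_trans)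
    qed
  qed
  define xs where "xs k = (SOME x. optimal (\<Phi> k) z x)" for k
  have xs: "optimal (\<Phi> k) z (xs k)" for k unfolding xs_def by (rule someI_ex[OF optimal_ex[OF pc\<Phi>]])
  have lim: "xs \<longlonglongrightarrow> T \<phi> z" by (rule optimal_tendsto_T[OF assms(1,3) xs pc\<Phi> ul])
  have hc: "isCont h (T \<phi> z)" using assms(2) by (simp add: pc_def continuous_on_eq_continuous_at)
  have up: "(ct (\<Phi> k) z - ct \<phi> z) * real (Suc k) \<le> - h (xs k)" for k
  proof -
    have "ct (\<Phi> k) z - ct \<phi> z \<le> - (h (xs k) / real (Suc k))"
      using ct_eq[OF xs[of k]] ct_ge[OF assms(1), of "xs k" z] by (simp add: \<Phi>_def)
    then have "(ct (\<Phi> k) z - ct \<phi> z) * real (Suc k) \<le> - (h (xs k) / real (Suc k)) * real (Suc k)"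
      by (rule mult_right_mono) simp
    then show ?thesis by (simp del: of_nat_Suc)
  qed
  have low: "- h (T \<phi> z) \<le> (ct (\<Phi> k) z - ct \<phi> z) * real (Suc k)" for k
  proof -
    have "optimal \<phi> z (T \<phi> z)" using optimal_T[OF assms(1,3)] by simp
    then have "- (h (T \<phi> z) / real (Suc k)) \<le> ct (\<Phi> k) z - ct \<phi> z"
      using ct_eq[of \<phi> z "T \<phi> z"] ct_ge[OF pc\<Phi>[of k], of "T \<phi> z" z] by (simp add: \<Phi>_def)
    then have "- (h (T \<phi> z) / real (Suc k)) * real (Suc k) \<le> (ct (\<Phi> k) z - ct \<phi> z) * real (Suc k)"
      by (rule mult_right_mono) simp
    then show ?thesis by (simp del: of_nat_Suc)
  qed
  have "(\<lambda>k. (ct (\<Phi> k) z - ct \<phi> z) * real (Suc k)) \<longlonglongrightarrow> - h (T \<phi> z)"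
    by (rule tendsto_sandwich[OF _ _ tendsto_const tendsto_minus[OF isCont_tendsto_compose[OF hc lim]]])
       (use up low in auto)
  then show ?thesis by (simp add: \<Phi>_def[abs_def] del: of_nat_Suc)
qed

lemma minimiser_pushes_forward:
  assumes \<phi>: "pc \<phi>" and min: "\<And>\<psi>. pc \<psi> \<Longrightarrow> J \<phi> \<le> J \<psi>" and h: "pc h"
  shows "(\<integral>x. h x \<partial>\<nu>) = \<kappa> * I (\<lambda>z. h (T \<phi> z))"
proof -
  \<comment> \<open>One inequality suffices, because it also holds for \<open>- h\<close>.\<close>
  have *: "\<kappa> * I (\<lambda>z. h (T \<phi> z)) \<le> (\<integral>x. h x \<partial>\<nu>)" if h: "pc h" for h
  proof -
    define \<Phi> where "\<Phi> k x = \<phi> x + h x / real (Suc k)" for k x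
    have pc\<Phi>: "pc (\<Phi> k)" for k
      unfolding \<Phi>_def[abs_def] using pc_add[OF \<phi> pc_cmult[OF h, of "1 / real (Suc k)"]] by simp
    obtain C where C: "\<And>x. \<bar>h x\<bar> \<le> C" using pc_bounded[OF h] by blast
    define D where "D k z = (ct (\<Phi> k) z - ct \<phi> z) * real (Suc k)" for k z
    have D_eq: "D k = (\<lambda>z. real (Suc k) * (ct (\<Phi> k) z - ct \<phi> z))" for k
      by (simp add: D_def[abs_def] mult.commute)
    have pcD: "pc (D k)" for k
      unfolding D_eq by (intro pc_cmult pc_diff pc_ct pc\<Phi> \<phi>)
    have nonneg: "0 \<le> (\<integral>x. h x \<partial>\<nu>) + \<kappa> * I (D k)" for k
    proof -
      have "(\<integral>x. \<Phi> k x \<partial>\<nu>) = (\<integral>x. \<phi> x \<partial>\<nu>) + (\<integral>x. h x \<partial>\<nu>) / real (Suc k)"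
        unfolding \<Phi>_def using integrable_\<nu>[OF \<phi>] integrable_\<nu>[OF h] by simp
      moreover have "I (D k) = real (Suc k) * (I (ct (\<Phi> k)) - I (ct \<phi>))"
        unfolding D_eq I_cmult by (simp add: I_diff pc_ct pc\<Phi> \<phi>)
      moreover have "(J (\<Phi> k) - J \<phi>) * real (Suc k) = ((\<integral>x. \<Phi> k x \<partial>\<nu>) - (\<integral>x. \<phi> x \<partial>\<nu>)) * real (Suc k)
          + \<kappa> * (real (Suc k) * (I (ct (\<Phi> k)) - I (ct \<phi>)))"
        by (simp add: J_def algebra_simps del: of_nat_Suc)
      ultimately have "(J (\<Phi> k) - J \<phi>) * real (Suc k) = (\<integral>x. h x \<partial>\<nu>) + \<kappa> * I (D k)"
        by (simp del: of_nat_Suc)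
      moreover have "0 \<le> (J (\<Phi> k) - J \<phi>) * real (Suc k)"
        using min[OF pc\<Phi>[of k]] by (intro mult_nonneg_nonneg) auto
      ultimately show ?thesis by simp
    qed
    have "\<bar>D k z\<bar> \<le> C" for k z
    proof -
      have "\<bar>\<Phi> k x - \<phi> x\<bar> \<le> C / real (Suc k)" for x
        using C[of x] by (simp add: \<Phi>_def divide_right_mono)
      then have "\<bar>ct (\<Phi> k) z - ct \<phi> z\<bar> \<le> C / real (Suc k)" by (rule ct_dist[OF pc\<Phi> \<phi>])
      then have "\<bar>ct (\<Phi> k) z - ct \<phi> z\<bar> * real (Suc k) \<le> C / real (Suc k) * real (Suc k)"
        by (rule mult_right_mono) simp
      then show ?thesis by (simp add: D_def abs_mult del: of_nat_Suc)
    qed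
    moreover have "AE z in lborel. (\<lambda>k. D k z) \<longlonglongrightarrow> - h (T \<phi> z)"
      using AE_not_nonunique[OF \<phi>]
    proof eventually_elim
      case (elim z) then show ?case
        using ct_derivative[OF \<phi> h elim] by (simp add: D_def \<Phi>_def[abs_def])
    qed
    moreover have "(\<lambda>z. - h (T \<phi> z)) \<in> borel_measurable borel"
      using measurable_compose[OF measurable_T[OF \<phi>] pc_measurable[OF h]] by simp
    ultimately have "(\<lambda>k. I (D k)) \<longlonglongrightarrow> I (\<lambda>z. - h (T \<phi> z))"
      by (intro I_tendsto[where C=C] pcD)
    then have "(\<lambda>k. (\<integral>x. h x \<partial>\<nu>) + \<kappa> * I (D k)) \<longlonglongrightarrow> (\<integral>x. h x \<partial>\<nu>) + \<kappa> * I (\<lambda>z. - h (T \<phi> z))"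
      by (intro tendsto_intros)
    then have "0 \<le> (\<integral>x. h x \<partial>\<nu>) + \<kappa> * I (\<lambda>z. - h (T \<phi> z))"
      by (rule LIMSEQ_le_const) (use nonneg in auto)
    then show ?thesis using I_cmult[of "-1" "\<lambda>z. h (T \<phi> z)"] by simp
  qed
  have "\<kappa> * I (\<lambda>z. - h (T \<phi> z)) \<le> (\<integral>x. - h x \<partial>\<nu>)" by (rule *[OF pc_uminus[OF h]])
  then have "(\<integral>x. h x \<partial>\<nu>) \<le> \<kappa> * I (\<lambda>z. h (T \<phi> z))"
    using I_cmult[of "-1" "\<lambda>z. h (T \<phi> z)"] by simp
  then show ?thesis using *[OF h] by simp
qed

text \<open>
  The double c-transform of a minimiser is a minimiser too, and it is convex up to \<open>q\<close>.
\<close>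

theorem exists_pushforward_solution:
  "\<exists>\<phi>. pc \<phi> \<and> convex_on UNIV (\<lambda>x. \<phi> x + q x) \<and>
     (\<forall>h. pc h \<longrightarrow> (\<integral>x. h x \<partial>\<nu>) = \<kappa> * I (\<lambda>z. h (T \<phi> z)))"
proof -
  obtain \<psi> where \<psi>: "pc \<psi>" "\<And>u. pc u \<Longrightarrow> J \<psi> \<le> J u" using minimiser_ex by blast
  have pc: "pc (ct (ct \<psi>))" by (intro pc_ct \<psi>)
  have "J (ct (ct \<psi>)) \<le> J u" if "pc u" for u
    using J_ct_ct[OF \<psi>(1)] \<psi>(2)[OF that] by linarith
  then show ?thesis
    using pc minimiser_pushes_forward[OF pc] ct_convex[OF pc_ct[OF \<psi>(1)]]
    by (intro exI[of _ "ct (ct \<psi>)"]) blast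
qed

end

section \<open>Convex functions of class C2\<close>

definition grad :: "('n::finite NR \<Rightarrow> real) \<Rightarrow> 'n NR \<Rightarrow> 'n NR" where
  "grad g x = (\<chi> i. partial_deriv i g x)"

definition Hess :: "('n::finite NR \<Rightarrow> real) \<Rightarrow> 'n NR \<Rightarrow> 'n NR \<Rightarrow> 'n NR" where
  "Hess g x v = (\<chi> j. frechet_derivative (partial_deriv j g) (at x) v)"

lemma vec_axis_expansion: "(x :: real ^ 'n::finite) = (\<Sum>i\<in>UNIV. x $ i *\<^sub>R axis i 1)"
  by (simp add: vec_eq_iff axis_def if_distrib cong: if_cong)

lemma linear_axis_expansion:
  fixes x :: "real ^ 'n::finite"
  assumes "linear g" shows "g x = (\<Sum>i\<in>UNIV. x $ i *\<^sub>R g (axis i 1))"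
  using vec_axis_expansion[of x] linear_sum[OF assms] linear_cmul[OF assms]
  by (metis (no_types, lifting) sum.cong)

lemma frechet_derivative_grad:
  assumes "g differentiable (at x)" shows "frechet_derivative g (at x) v = grad g x \<bullet> v"
  using linear_axis_expansion[OF linear_frechet_derivative[OF assms], of v]
  by (simp add: grad_def partial_deriv_def inner_vec_def mult.commute)

lemma has_derivative_grad:
  assumes "g differentiable (at x)" shows "(g has_derivative (\<lambda>v. grad g x \<bullet> v)) (at x)"
proof -
  have "frechet_derivative g (at x) = (\<lambda>v. grad g x \<bullet> v)"
    by (rule ext) (rule frechet_derivative_grad[OF assms])
  then show ?thesis using assms frechet_derivative_works[of g "at x"] by simp
qed

lemma C_diff_2D:
  assumes "C_diff 2 g"
  shows "g differentiable (at x)" "partial_deriv j g differentiable (at x)"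
    "continuous_on UNIV (partial_deriv i (partial_deriv j g))"
  using assms by (simp_all add: numeral_2_eq_2)

lemma has_derivative_Hess:
  assumes "C_diff 2 g" shows "(grad g has_derivative Hess g x) (at x)"
proof -
  have "((\<lambda>x. grad g x \<bullet> i) has_derivative (\<lambda>v. Hess g x v \<bullet> i)) (at x)" if i: "i \<in> Basis" for i :: "'a NR"
  proof -
    obtain j where j: "i = axis j 1" using i by (auto simp: Basis_vec_def)
    have "(partial_deriv j g has_derivative frechet_derivative (partial_deriv j g) (at x)) (at x)"
      using C_diff_2D(2)[OF assms] frechet_derivative_works by blast
    then show ?thesis by (simp add: j inner_axis grad_def Hess_def)
  qed
  then show ?thesis by (subst has_derivative_componentwise_within) blast
qed

lemma linear_Hess: "C_diff 2 g \<Longrightarrow> linear (Hess g x)"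
  using has_derivative_Hess has_derivative_linear by blast

lemma matrix_Hess: "matrix (Hess g x) = transpose (\<chi> i j. partial_deriv i (partial_deriv j g) x)"
  by (simp add: matrix_def Hess_def transpose_def partial_deriv_def vec_eq_iff)

lemma hessian_density_eq: "hessian_density (g :: 'n::finite NR \<Rightarrow> real) x = fact CARD('n) * det (matrix (Hess g x))"
  by (simp only: hessian_density_def matrix_Hess det_transpose)

lemma continuous_on_det_Hess: "C_diff 2 g \<Longrightarrow> continuous_on UNIV (\<lambda>x. det (matrix (Hess g x)))"
  unfolding matrix_Hess det_transpose unfolding det_def vec_lambda_beta
  by (intro continuous_intros C_diff_2D(3))

lemma line_derivative:
  assumes "g differentiable (at (x + t *\<^sub>R d))"
  shows "((\<lambda>t. g (x + t *\<^sub>R d)) has_real_derivative grad g (x + t *\<^sub>R d) \<bullet> d) (at t)"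
proof -
  have "((\<lambda>t. x + t *\<^sub>R d) has_derivative (\<lambda>t. t *\<^sub>R d)) (at t)"
    by (auto intro!: derivative_eq_intros)
  from has_derivative_compose[OF this has_derivative_grad[OF assms]]
  show ?thesis by (simp add: has_field_derivative_def mult_commute_abs)
qed

lemma convex_on_line:
  assumes "convex_on UNIV g" shows "convex_on UNIV (\<lambda>t::real. g (x + t *\<^sub>R d))"
proof (rule convex_onI)
  fix t a c :: real assume t: "0 < t" "t < 1"
  have "x + ((1 - t) *\<^sub>R a + t *\<^sub>R c) *\<^sub>R d = (1 - t) *\<^sub>R (x + a *\<^sub>R d) + t *\<^sub>R (x + c *\<^sub>R d)"
    by (simp add: algebra_simps)
  then show "g (x + ((1 - t) *\<^sub>R a + t *\<^sub>R c) *\<^sub>R d) \<le> (1 - t) * g (x + a *\<^sub>R d) + t * g (x + c *\<^sub>R d)"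
    using convex_onD[OF assms, of t] t by simp
qed simp

lemma gradient_inequality:
  assumes "convex_on UNIV g" "g differentiable (at x)" shows "g x + grad g x \<bullet> d \<le> g (x + d)"
proof -
  have "((\<lambda>t. g (x + t *\<^sub>R d)) has_real_derivative grad g x \<bullet> d) (at 0 within UNIV)"
    using line_derivative[of g x 0 d] assms(2) by simp
  from convex_on_imp_above_tangent[OF convex_on_line[OF assms(1), of x d] _ _ _ this, of 1]
  show ?thesis by simp
qed

text \<open>
  The gradient of a convex function is monotone along lines.
\<close>

lemma Hess_nonneg:
  assumes "convex_on UNIV g" "C_diff 2 g" shows "0 \<le> Hess g x v \<bullet> v"
proof (rule mono_on_imp_deriv_nonneg)
  note diff = C_diff_2D(1)[OF assms(2)]
  show "mono_on UNIV (\<lambda>t. grad g (x + t *\<^sub>R v) \<bullet> v)"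
  proof (rule mono_onI)
    fix s t :: real assume "s \<le> t"
    have "g (x + s *\<^sub>R v) + grad g (x + s *\<^sub>R v) \<bullet> ((t - s) *\<^sub>R v) \<le> g (x + t *\<^sub>R v)"
      using gradient_inequality[OF assms(1) diff, of "x + s *\<^sub>R v" "(t - s) *\<^sub>R v"]
      by (simp add: scaleR_left_diff_distrib)
    moreover have "g (x + t *\<^sub>R v) + grad g (x + t *\<^sub>R v) \<bullet> ((s - t) *\<^sub>R v) \<le> g (x + s *\<^sub>R v)"
      using gradient_inequality[OF assms(1) diff, of "x + t *\<^sub>R v" "(s - t) *\<^sub>R v"]
      by (simp add: scaleR_left_diff_distrib)
    ultimately have "0 \<le> (t - s) * (grad g (x + t *\<^sub>R v) \<bullet> v - grad g (x + s *\<^sub>R v) \<bullet> v)"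
      by (simp add: algebra_simps)
    then show "grad g (x + s *\<^sub>R v) \<bullet> v \<le> grad g (x + t *\<^sub>R v) \<bullet> v"
      using \<open>s \<le> t\<close> by (cases "s = t") (auto simp: zero_le_mult_iff)
  qed
  have "((\<lambda>t. x + t *\<^sub>R v) has_derivative (\<lambda>t. t *\<^sub>R v)) (at 0)"
    by (auto intro!: derivative_eq_intros)
  from has_derivative_compose[OF this, of "grad g" "Hess g x"] has_derivative_Hess[OF assms(2), of x]
  have "((\<lambda>t. grad g (x + t *\<^sub>R v)) has_derivative (\<lambda>t. Hess g x (t *\<^sub>R v))) (at 0)" by simp
  from has_derivative_inner_left[OF this, of v]
  show "((\<lambda>t. grad g (x + t *\<^sub>R v) \<bullet> v) has_real_derivative Hess g x v \<bullet> v) (at 0)"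
    by (simp add: has_field_derivative_def linear_cmul[OF linear_Hess[OF assms(2)]] mult_commute_abs)
qed simp

text \<open>
  On the segment from the identity to \<open>A\<close> all matrices except possibly \<open>A\<close> have a positive definite
  quadratic form, hence nonzero determinant; so the determinant cannot change its sign.
\<close>

lemma det_nonneg:
  fixes A :: "real ^ 'n::finite ^ 'n"
  assumes pos: "\<And>v. 0 \<le> (A *v v) \<bullet> v" shows "0 \<le> det A"
proof (rule ccontr)
  assume neg: "\<not> 0 \<le> det A"
  define M where "M s = (1 - s) *\<^sub>R mat 1 + s *\<^sub>R A" for s :: real
  have "continuous_on {0..1} (\<lambda>s. det (M s))"
    unfolding M_def det_def by (intro continuous_intros)
  moreover have "det (M 1) \<le> 0" "0 \<le> det (M 0)" using neg by (simp_all add: M_def)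
  ultimately obtain s where s: "0 \<le> s" "s \<le> 1" "det (M s) = 0"
    using IVT2'[of "\<lambda>s. det (M s)" 1 0 0] by auto
  have "s \<noteq> 1" using s(3) neg by (auto simp: M_def)
  then have s1: "s < 1" using s by simp
  obtain v where v: "v \<noteq> 0" "M s *v v = 0"
    using s(3) invertible_det_nz[of "M s"] invertible_left_inverse[of "M s"]
      matrix_left_invertible_ker[of "M s"] by blast
  have "0 = (M s *v v) \<bullet> v" using v(2) by simp
  also have "\<dots> = (1 - s) * (v \<bullet> v) + s * ((A *v v) \<bullet> v)"
    by (simp add: M_def matrix_vector_mult_add_rdistrib scaleR_matrix_vector_assoc[symmetric] inner_add_left)
  also have "\<dots> > 0" using s s1 v(1) pos[of v] by (intro add_pos_nonneg mult_pos_pos mult_nonneg_nonneg) auto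
  finally show False by simp
qed

text \<open>
  If \<open>g\<close> has the same gradient \<open>p\<close> at two points, then \<open>w \<mapsto> g w - p \<bullet> w\<close> is minimal at both, hence on
  the segment between them.  So the gradient is constant there, and the Hessian is degenerate in the
  direction of the segment.
\<close>

lemma inj_on_grad:
  assumes cvx: "convex_on UNIV g" and C2: "C_diff 2 g"
  shows "inj_on (grad g) {x. det (matrix (Hess g x)) \<noteq> 0}"
proof (rule inj_onI, rule ccontr)
  fix x y assume x: "x \<in> {x. det (matrix (Hess g x)) \<noteq> 0}" and eq: "grad g x = grad g y" and ne: "x \<noteq> y"
  note diff = C_diff_2D(1)[OF C2]
  define p where "p = grad g x"
  define d where "d = y - x"
  have lower: "g x + p \<bullet> (w - x) \<le> g w" for w
    using gradient_inequality[OF cvx diff, of x "w - x"] by (simp add: p_def)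
  have y: "g y = g x + p \<bullet> d"
  proof -
    have "g x + p \<bullet> d \<le> g y" using lower[of y] by (simp add: d_def)
    moreover have "g y - p \<bullet> d \<le> g x"
      using gradient_inequality[OF cvx diff, of y "- d"] by (simp add: p_def eq d_def inner_diff_right)
    ultimately show ?thesis by linarith
  qed
  have seg: "grad g (x + t *\<^sub>R d) = p" if t: "0 < t" "t < 1" for t
  proof -
    have "g (x + t *\<^sub>R d) \<le> (1 - t) * g x + t * g y"
      using convex_onD[OF cvx, of t x y] t by (simp add: d_def algebra_simps)
    then have low: "g (x + t *\<^sub>R d) \<le> g x + p \<bullet> (t *\<^sub>R d)" by (simp add: y algebra_simps)
    have "(\<lambda>v. grad g (x + t *\<^sub>R d) \<bullet> v - p \<bullet> v) = (\<lambda>v. 0)"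
    proof (rule differential_zero_maxmin[of "x + t *\<^sub>R d" UNIV "\<lambda>w. g w - p \<bullet> w"])
      show "((\<lambda>w. g w - p \<bullet> w) has_derivative (\<lambda>v. grad g (x + t *\<^sub>R d) \<bullet> v - p \<bullet> v)) (at (x + t *\<^sub>R d))"
        by (intro derivative_intros has_derivative_grad diff)
      have "g (x + t *\<^sub>R d) - p \<bullet> (x + t *\<^sub>R d) \<le> g w - p \<bullet> w" for w
        using low lower[of w] by (simp add: inner_diff_right inner_add_right)
      then show "(\<forall>w\<in>UNIV. g w - p \<bullet> w \<le> g (x + t *\<^sub>R d) - p \<bullet> (x + t *\<^sub>R d)) \<or>
          (\<forall>w\<in>UNIV. g (x + t *\<^sub>R d) - p \<bullet> (x + t *\<^sub>R d) \<le> g w - p \<bullet> w)" by blast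
    qed auto
    then have "(grad g (x + t *\<^sub>R d) - p) \<bullet> v = 0" for v by (simp add: inner_diff_left fun_eq_iff)
    then have "grad g (x + t *\<^sub>R d) - p = 0" by (metis inner_eq_zero_iff)
    then show ?thesis by simp
  qed
  have "((\<lambda>t. x + t *\<^sub>R d) has_derivative (\<lambda>t. t *\<^sub>R d)) (at 0)"
    by (auto intro!: derivative_eq_intros)
  from has_derivative_compose[OF this, of "grad g" "Hess g x"] has_derivative_Hess[OF C2, of x]
  have "((\<lambda>t. grad g (x + t *\<^sub>R d)) has_vector_derivative Hess g x d) (at 0)"
    by (simp add: has_vector_derivative_def linear_cmul[OF linear_Hess[OF C2]])
  then have der: "((\<lambda>t. grad g (x + t *\<^sub>R d)) has_vector_derivative Hess g x d) (at 0 within {0..1/2})"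
    by (rule has_vector_derivative_at_within)
  have "((\<lambda>t. grad g (x + t *\<^sub>R d)) has_vector_derivative 0) (at 0 within {0..1/2})"
  proof (rule has_vector_derivative_transform[where f="\<lambda>_. p"])
    fix t :: real assume t: "t \<in> {0..1/2}"
    show "grad g (x + t *\<^sub>R d) = p" using seg[of t] t by (cases "t = 0") (auto simp: p_def)
  qed auto
  then have "Hess g x d = 0"
    using vector_derivative_unique_within_closed_interval[of 0 "1/2" 0] der by (simp add: box_real)
  moreover have "inj (Hess g x)"
    using x det_nz_iff_inj[OF linear_Hess[OF C2]] by blast
  moreover have "d \<noteq> 0" using ne by (simp add: d_def)
  ultimately show False using linear_injective_0[OF linear_Hess[OF C2]] by blast
qed

section \<open>The transformation formula for a map that is injective at its regular points\<close>

text \<open>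
  On the open set of regular points the map is a homeomorphism onto an open set, by invariance of
  domain; this makes the inverse measurable and allows the change of variables.
\<close>

lemma integral_regular_points:
  fixes g :: "real ^ 'n::finite \<Rightarrow> real ^ 'n" and h :: "real ^ 'n \<Rightarrow> real"
  assumes der: "\<And>x. (g has_derivative g' x) (at x)"
    and cont: "continuous_on UNIV (\<lambda>x. det (matrix (g' x)))"
    and S: "S = {x. det (matrix (g' x)) \<noteq> 0}" and inj: "inj_on g S"
    and h [measurable]: "h \<in> borel_measurable borel"
  shows "(\<lambda>z. indicator (g ` S) z * h (the_inv_into S g z)) \<in> borel_measurable borel"
    and "(\<integral>x. h x * \<bar>det (matrix (g' x))\<bar> \<partial>lborel)
      = (\<integral>z. indicator (g ` S) z * h (the_inv_into S g z) \<partial>lborel)"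
proof -
  define D where "D x = \<bar>det (matrix (g' x))\<bar>" for x
  define k where "k = the_inv_into S g"
  have oS: "open S" unfolding S by (intro open_Collect_neq cont continuous_on_const)
  have contg: "continuous_on S g"
    by (intro continuous_at_imp_continuous_on ballI has_derivative_continuous[OF der])
  have ogS: "open (g ` S)" by (rule invariance_of_domain[OF contg oS inj])
  have contk: "continuous_on (g ` S) k"
  proof -
    obtain k' where k': "homeomorphism S (g ` S) g k'"
      using invariance_of_domain_homeomorphism[OF oS contg _ inj] by auto
    then have "k' z = k z" if "z \<in> g ` S" for z
      using that inj by (auto simp: k_def homeomorphism_def the_inv_into_f_f)
    then show ?thesis using k' by (simp add: homeomorphism_def cong: continuous_on_cong)
  qed
  have [measurable]: "S \<in> sets borel" "g ` S \<in> sets borel" using oS ogS by auto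
  have [measurable]: "D \<in> borel_measurable borel"
    unfolding D_def using borel_measurable_continuous_onI[OF cont] by measurable
  define k0 where "k0 z = (if z \<in> g ` S then k z else 0)" for z
  have k0 [measurable]: "k0 \<in> borel_measurable borel"
    unfolding k0_def by (rule borel_measurable_continuous_on_if) (auto intro: contk)
  have eq: "indicator (g ` S) z * h (the_inv_into S g z) = indicator (g ` S) z * h (k0 z)" for z
    by (simp add: k0_def k_def indicator_def)
  show "(\<lambda>z. indicator (g ` S) z * h (the_inv_into S g z)) \<in> borel_measurable borel"
    unfolding eq by measurable
  have "density lborel (\<lambda>x. ennreal (D x)) = distr (density lborel (indicator (g ` S))) borel k0"
  proof (rule measure_eqI)
    fix E assume "E \<in> sets (density lborel (\<lambda>x. ennreal (D x)))"
    then have [measurable]: "E \<in> sets borel" by simp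
    have img: "g ` (E \<inter> S) = k0 -` E \<inter> g ` S"
      using inj by (auto simp: k0_def k_def the_inv_into_f_f)
    have gE: "g ` (E \<inter> S) \<in> sets borel"
      unfolding img using measurable_sets[OF k0 \<open>E \<in> sets borel\<close>] by auto
    have "emeasure (density lborel (\<lambda>x. ennreal (D x))) E = (\<integral>\<^sup>+x. ennreal (D x) * indicator E x \<partial>lborel)"
      by (rule emeasure_density) auto
    also have "\<dots> = (\<integral>\<^sup>+x\<in>E \<inter> S. ennreal \<bar>det (matrix (g' x))\<bar> \<partial>lborel)"
      by (intro nn_integral_cong) (auto simp: D_def S indicator_def)
    also have "\<dots> = emeasure lborel (g ` (E \<inter> S))"
      by (rule emeasure_injective_image[symmetric])
         (use gE der inj in \<open>auto simp: D_def[abs_def, symmetric] intro: inj_on_subset\<close>)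
    also have "\<dots> = (\<integral>\<^sup>+z. indicator (g ` S) z * indicator (k0 -` E) z \<partial>lborel)"
    proof -
      have "emeasure lborel (g ` (E \<inter> S)) = (\<integral>\<^sup>+z. indicator (g ` (E \<inter> S)) z \<partial>lborel)"
        using gE by simp
      then show ?thesis unfolding img by (simp add: indicator_inter_arith mult.commute)
    qed
    also have "\<dots> = emeasure (density lborel (indicator (g ` S))) (k0 -` E)"
      using measurable_sets[OF k0 \<open>E \<in> sets borel\<close>] by (subst emeasure_density) auto
    also have "\<dots> = emeasure (distr (density lborel (indicator (g ` S))) borel k0) E"
      by (subst emeasure_distr) auto
    finally show "emeasure (density lborel (\<lambda>x. ennreal (D x))) E
        = emeasure (distr (density lborel (indicator (g ` S))) borel k0) E" .
  qed simp
  then have "(\<integral>x. h x \<partial>density lborel (\<lambda>x. ennreal (D x)))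
      = (\<integral>x. h x \<partial>distr (density lborel (\<lambda>z. ennreal (indicator (g ` S) z))) borel k0)"
    by (simp add: ennreal_indicator)
  also have "\<dots> = (\<integral>z. h (k0 z) \<partial>density lborel (\<lambda>z. ennreal (indicator (g ` S) z)))"
    by (rule integral_distr) auto
  also have "\<dots> = (\<integral>z. indicator (g ` S) z *\<^sub>R h (k0 z) \<partial>lborel)"
    by (rule integral_density) auto
  also have "(\<integral>x. h x \<partial>density lborel (\<lambda>x. ennreal (D x))) = (\<integral>x. D x *\<^sub>R h x \<partial>lborel)"
  proof (rule integral_density)
    show "AE x in lborel. 0 \<le> D x" by (simp add: D_def)
  qed auto
  finally have "(\<integral>x. D x * h x \<partial>lborel) = (\<integral>z. indicator (g ` S) z * h (k0 z) \<partial>lborel)"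
    by simp
  then show "(\<integral>x. h x * \<bar>det (matrix (g' x))\<bar> \<partial>lborel)
      = (\<integral>z. indicator (g ` S) z * h (the_inv_into S g z) \<partial>lborel)"
    unfolding eq D_def by (simp add: mult.commute)
qed

section \<open>The Monge-Ampere measure as an image measure\<close>

context polarized_torus
begin

definition bvec :: "'n NR \<Rightarrow> 'n NR" where "bvec z = (\<chi> i. b (axis i 1) z)"

definition bvec_inv :: "'n NR \<Rightarrow> 'n NR" where "bvec_inv = inv_into UNIV bvec"

definition det_b :: real where "det_b = det (matrix bvec)"

lemma linear_bvec: "linear bvec"
  by (rule linearI) (simp_all add: bvec_def b_simps vec_eq_iff)

lemma inner_bvec: "x \<bullet> bvec z = b x z"
proof -
  have "linear (\<lambda>x. b x z)" by (rule linearI) (simp_all add: b_simps)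
  from linear_axis_expansion[OF this, of x] show ?thesis by (simp add: inner_vec_def bvec_def)
qed

lemma inj_bvec: "inj bvec"
proof (rule linear_injective_0[OF linear_bvec, THEN iffD2], intro allI impI)
  fix z assume "bvec z = 0"
  then show "z = 0" using inner_bvec[of z z] by (simp add: b_eq_0_iff)
qed

lemma bvec_inv [simp]: "bvec (bvec_inv y) = y" "bvec_inv (bvec z) = z"
  using linear_injective_imp_surjective[OF linear_bvec inj_bvec] inj_bvec
  by (simp_all add: bvec_inv_def surj_f_inv_f)

lemma linear_bvec_inv: "linear bvec_inv"
proof (rule linearI)
  fix x y
  have "bvec (bvec_inv x + bvec_inv y) = x + y" by (simp add: linear_add[OF linear_bvec])
  then show "bvec_inv (x + y) = bvec_inv x + bvec_inv y" using bvec_inv(2)[of "bvec_inv x + bvec_inv y"] by simp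
next
  fix c x
  have "bvec (c *\<^sub>R bvec_inv x) = c *\<^sub>R x" by (simp add: linear_cmul[OF linear_bvec])
  then show "bvec_inv (c *\<^sub>R x) = c *\<^sub>R bvec_inv x" using bvec_inv(2)[of "c *\<^sub>R bvec_inv x"] by simp
qed

lemma det_b_pos: "0 < det_b"
proof -
  have "matrix bvec *v v = bvec v" for v using matrix_works[of bvec v] linear_bvec
    by (simp add: linear_def scalar_mult_eq_scaleR matrix_vector_mul(1))
  then have "0 \<le> (matrix bvec *v v) \<bullet> v" for v
    using inner_bvec[of v v] q_nonneg[of v] by (simp add: q_def inner_commute)
  then have "0 \<le> det_b" unfolding det_b_def by (rule det_nonneg)
  moreover have "det_b \<noteq> 0" unfolding det_b_def using det_nz_iff_inj[OF linear_bvec] inj_bvec by blast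
  ultimately show ?thesis by simp
qed

definition push :: "('n NR \<Rightarrow> real) \<Rightarrow> real \<Rightarrow> 'n NR measure" where
  "push \<phi> \<kappa> = distr (density lborel (\<lambda>_. ennreal \<kappa>)) borel (T \<phi>)"

lemma sets_push [simp]: "sets (push \<phi> \<kappa>) = sets borel" by (simp add: push_def)

lemma emeasure_push:
  assumes "pc \<phi>" "A \<in> sets borel"
  shows "emeasure (push \<phi> \<kappa>) A = ennreal \<kappa> * emeasure lborel (T \<phi> -` A)"
proof -
  note [measurable] = measurable_T[OF assms(1)]
  have "T \<phi> -` A \<in> sets borel" using measurable_sets[OF measurable_T[OF assms(1)] assms(2)] by simp
  then show ?thesis
    unfolding push_def using assms(2) by (subst emeasure_distr) (auto simp: emeasure_density nn_integral_cmult)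
qed

lemma integral_push:
  fixes h :: "'n NR \<Rightarrow> real"
  assumes "pc \<phi>" "h \<in> borel_measurable borel" "0 \<le> \<kappa>"
  shows "(\<integral>x. h x \<partial>push \<phi> \<kappa>) = \<kappa> * (\<integral>z. h (T \<phi> z) \<partial>lborel)"
proof -
  note [measurable] = measurable_T[OF assms(1)] assms(2)
  have "(\<integral>x. h x \<partial>push \<phi> \<kappa>) = (\<integral>z. h (T \<phi> z) \<partial>density lborel (\<lambda>_. ennreal \<kappa>))"
    unfolding push_def by (rule integral_distr) auto
  also have "\<dots> = (\<integral>z. \<kappa> *\<^sub>R h (T \<phi> z) \<partial>lborel)"
    by (rule integral_density) (use assms in auto)
  finally show ?thesis by simp
qed

lemma emeasure_push_bounded:
  assumes "pc \<phi>" "A \<in> sets borel" "bounded A" shows "emeasure (push \<phi> \<kappa>) A < \<infinity>"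
proof -
  obtain C where C: "\<And>x. x \<in> A \<Longrightarrow> norm x \<le> C" using assms(3) by (auto simp: bounded_iff)
  have "emeasure lborel (T \<phi> -` A) \<le> emeasure lborel (cball (0::'n NR) (C + R) \<union> nonunique \<phi>)"
  proof (rule emeasure_mono)
    show "T \<phi> -` A \<subseteq> cball 0 (C + R) \<union> nonunique \<phi>"
    proof
      fix z assume z: "z \<in> T \<phi> -` A"
      show "z \<in> cball 0 (C + R) \<union> nonunique \<phi>"
      proof (cases "z \<in> nonunique \<phi>")
        case False
        have "norm z \<le> norm (T \<phi> z) + norm (T \<phi> z - z)"
          by (metis norm_minus_commute norm_triangle_sub)
        also have "\<dots> \<le> C + R" using C z T_norm[OF assms(1) False] by (intro add_mono) auto
        finally show ?thesis by simp
      qed simp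
    qed
  qed (use nonunique_null[OF assms(1)] in auto)
  also have "\<dots> = emeasure lborel (cball (0::'n NR) (C + R))"
    by (rule emeasure_Un_null_set[OF _ nonunique_null[OF assms(1)]]) simp
  also have "\<dots> < \<infinity>" by (rule emeasure_bounded_finite) simp
  finally show ?thesis by (simp add: emeasure_push[OF assms(1,2)] ennreal_mult_less_top)
qed

text \<open>
  The gradient map in the coordinates of \<open>N\<^sub>R\<close>: for \<open>g = \<phi> + q\<close> it inverts \<open>T \<phi>\<close>.
\<close>

definition \<gamma> :: "('n NR \<Rightarrow> real) \<Rightarrow> 'n NR \<Rightarrow> 'n NR" where "\<gamma> g x = bvec_inv (grad g x)"

lemma \<gamma>_eq_iff: "\<gamma> g x = z \<longleftrightarrow> grad g x = bvec z"
  unfolding \<gamma>_def by (metis bvec_inv)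

lemma has_derivative_\<gamma>: assumes "C_diff 2 g" shows "(\<gamma> g has_derivative (bvec_inv \<circ> Hess g x)) (at x)"
proof -
  have "bounded_linear bvec_inv" using linear_bvec_inv by (simp add: linear_conv_bounded_linear)
  from bounded_linear.has_derivative[OF this has_derivative_Hess[OF assms]]
  show ?thesis by (simp add: \<gamma>_def[abs_def] o_def)
qed

lemma det_\<gamma>: assumes "C_diff 2 g"
  shows "det (matrix (bvec_inv \<circ> Hess g x)) = det (matrix (Hess g x)) / det_b"
proof -
  have "matrix (bvec \<circ> bvec_inv) = matrix bvec ** matrix bvec_inv"
    by (rule matrix_compose[OF linear_bvec_inv linear_bvec])
  moreover have "bvec \<circ> bvec_inv = id" by (auto simp: fun_eq_iff)
  ultimately have "det_b * det (matrix bvec_inv) = 1"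
    unfolding det_b_def by (metis det_I det_mul matrix_id_mat_1)
  moreover have "matrix (bvec_inv \<circ> Hess g x) = matrix bvec_inv ** matrix (Hess g x)"
    by (rule matrix_compose[OF linear_Hess[OF assms] linear_bvec_inv])
  ultimately show ?thesis using det_b_pos by (simp add: det_mul field_simps)
qed

definition regular :: "('n NR \<Rightarrow> real) \<Rightarrow> 'n NR set" where
  "regular g = {x. det (matrix (Hess g x)) \<noteq> 0}"

text \<open>
  The function \<open>h\<close> transported by \<open>\<gamma> g\<close>, and zero outside the image of the regular points.
\<close>

definition inverse_image :: "('n NR \<Rightarrow> real) \<Rightarrow> ('n NR \<Rightarrow> real) \<Rightarrow> 'n NR \<Rightarrow> real" where
  "inverse_image g h z = indicator (\<gamma> g ` regular g) z * h (the_inv_into (regular g) (\<gamma> g) z)"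

lemma inj_on_\<gamma>: "convex_on UNIV g \<Longrightarrow> C_diff 2 g \<Longrightarrow> inj_on (\<gamma> g) (regular g)"
  using inj_on_grad[of g] unfolding regular_def inj_on_def \<gamma>_def by (metis bvec_inv(1))

lemma integral_hessian_density:
  assumes cvx: "convex_on UNIV g" and C2: "C_diff 2 g" and h: "h \<in> borel_measurable borel"
  shows "inverse_image g h \<in> borel_measurable borel"
    and "(\<integral>x. h x * hessian_density g x \<partial>lborel) = fact CARD('n) * det_b * (\<integral>z. inverse_image g h z \<partial>lborel)"
proof -
  have reg: "regular g = {x. det (matrix (bvec_inv \<circ> Hess g x)) \<noteq> 0}"
    using det_b_pos by (simp add: regular_def det_\<gamma>[OF C2])
  have cont: "continuous_on UNIV (\<lambda>x. det (matrix (bvec_inv \<circ> Hess g x)))"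
    unfolding det_\<gamma>[OF C2] using det_b_pos by (intro continuous_intros continuous_on_det_Hess C2) auto
  note * = integral_regular_points[OF has_derivative_\<gamma>[OF C2] cont reg inj_on_\<gamma>[OF cvx C2] h]
  show "inverse_image g h \<in> borel_measurable borel"
    unfolding inverse_image_def[abs_def] by (rule *(1))
  have "0 \<le> det (matrix (Hess g x))" for x
  proof (rule det_nonneg)
    fix v
    have "matrix (Hess g x) *v v = Hess g x v"
      using linear_Hess[OF C2] by (simp add: matrix_vector_mul(1))
    then show "0 \<le> (matrix (Hess g x) *v v) \<bullet> v" using Hess_nonneg[OF cvx C2, of x v] by simp
  qed
  then have "h x * hessian_density g x = fact CARD('n) * det_b * (h x * \<bar>det (matrix (bvec_inv \<circ> Hess g x))\<bar>)" for x
    using det_b_pos by (simp add: hessian_density_eq det_\<gamma>[OF C2])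
  then show "(\<integral>x. h x * hessian_density g x \<partial>lborel) = fact CARD('n) * det_b * (\<integral>z. inverse_image g h z \<partial>lborel)"
    using *(2) unfolding inverse_image_def by (simp only: integral_mult_right_zero)
qed

lemma critical_values_null:
  assumes "C_diff 2 g" shows "\<exists>N\<in>null_sets lborel. \<gamma> g ` (- regular g) \<subseteq> N"
  by (rule negligible_singular_values[where g'="\<lambda>x. bvec_inv \<circ> Hess g x"])
     (use assms in \<open>auto simp: has_derivative_\<gamma> det_\<gamma> regular_def\<close>)

lemma critical_point_minimal:
  assumes cvx: "convex_on UNIV g" and C2: "C_diff 2 g" and x: "\<gamma> g x = z"
  shows "g x - b x z \<le> g y - b y z"
proof -
  have "g x + bvec z \<bullet> (y - x) \<le> g y"
    using gradient_inequality[OF cvx C_diff_2D(1)[OF C2], of x "y - x"] x by (simp add: \<gamma>_eq_iff)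
  then show ?thesis using inner_bvec[of "y - x" z] by (simp add: inner_commute b_simps)
qed

lemma T_strict_minimum:
  assumes "pc \<phi>" "z \<notin> nonunique \<phi>" "x \<noteq> T \<phi> z"
  shows "\<phi> (T \<phi> z) + q (T \<phi> z) - b (T \<phi> z) z < \<phi> x + q x - b x z"
proof -
  have "optimal \<phi> z (T \<phi> z)" "\<not> optimal \<phi> z x" using optimal_T[OF assms(1,2)] assms(3) by auto
  then have "- \<phi> x - q (x - z) < - \<phi> (T \<phi> z) - q (T \<phi> z - z)"
    using ct_ge[OF assms(1), of x z] unfolding optimal_iff[OF assms(1)] by linarith
  then show ?thesis by (simp add: q_diff)
qed

text \<open>
  At a point \<open>z\<close> where the maximiser is unique, convex functions close to \<open>\<phi> + q\<close> have a critical
  point for the slope \<open>z\<close>, and all their critical points for that slope lie close to \<open>T \<phi> z\<close>.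
\<close>

lemma critical_points_near_T:
  assumes \<phi>: "pc \<phi>" and z: "z \<notin> nonunique \<phi>" and e: "0 < e"
    and cvx: "\<And>k. convex_on UNIV (G k)" and C2: "\<And>k. C_diff 2 (G k)"
    and lim: "\<And>K. compact K \<Longrightarrow> uniform_limit K G (\<lambda>x. \<phi> x + q x) sequentially"
  shows "\<forall>\<^sub>F k in sequentially. (\<exists>x. \<gamma> (G k) x = z) \<and> (\<forall>x. \<gamma> (G k) x = z \<longrightarrow> norm (x - T \<phi> z) < e)"
proof -
  \<comment> \<open>The strict minimum of \<open>F\<close> at \<open>x0\<close> leaves a gap \<open>2 * d\<close> on the sphere of radius \<open>e\<close>.  A function
  within \<open>d\<close> of \<open>F\<close> has a minimum inside the sphere, and by convexity none outside.\<close>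
  define x0 where "x0 = T \<phi> z"
  define F where "F x = \<phi> x + q x - b x z" for x
  have contF: "continuous_on A F" for A
    unfolding F_def using \<phi> by (intro continuous_intros) (auto simp: pc_def intro: continuous_on_subset)
  have "dist x0 (x0 + e *\<^sub>R axis undefined 1) = \<bar>e\<bar>" by (simp add: dist_norm)
  also have "\<bar>e\<bar> = e" using e by (rule abs_of_pos)
  finally have sph0: "sphere x0 e \<noteq> {}" by (auto simp: sphere_def)
  have "\<exists>w\<in>sphere x0 e. \<forall>y\<in>sphere x0 e. F w \<le> F y"
    by (intro continuous_attains_inf contF sph0) simp
  then obtain w where w: "w \<in> sphere x0 e" "\<And>y. y \<in> sphere x0 e \<Longrightarrow> F w \<le> F y" by blast
  have "w \<noteq> x0" using w(1) e by auto
  then have "F x0 < F w" using T_strict_minimum[OF \<phi> z] by (simp add: F_def x0_def)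
  define d where "d = (F w - F x0) / 2"
  have d: "0 < d" using \<open>F x0 < F w\<close> by (simp add: d_def)
  have sph: "F x0 + 2 * d \<le> F y" if "y \<in> sphere x0 e" for y

  proof -
    have "F x0 + 2 * d = F w" by (simp add: d_def field_simps)
    then show ?thesis using w(2)[OF that] by simp
  qed
  have "\<forall>\<^sub>F k in sequentially. \<forall>x\<in>cball x0 e. dist (G k x) (\<phi> x + q x) < d"
    using lim[OF compact_cball] d by (simp add: uniform_limit_iff)
  then show ?thesis
  proof eventually_elim
    case (elim k)
    define Fk where "Fk x = G k x - b x z" for x
    have close: "\<bar>Fk x - F x\<bar> < d" if "x \<in> cball x0 e" for x
    proof -
      have "dist (G k x) (\<phi> x + q x) < d" using elim that by blast
      then show ?thesis by (simp add: Fk_def F_def dist_real_def)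
    qed
    have big: "Fk x0 < Fk y" if y: "y \<in> sphere x0 e" for y
    proof -
      have "\<bar>Fk y - F y\<bar> < d" "\<bar>Fk x0 - F x0\<bar> < d" using y e by (auto intro!: close)
      then show ?thesis using sph[OF y] by linarith
    qed
    have diffG: "G k differentiable (at x)" for x by (rule C_diff_2D(1)[OF C2])
    have derFk: "(Fk has_derivative (\<lambda>v. grad (G k) x \<bullet> v - b v z)) (at x)" for x
    proof -
      have "bounded_linear (\<lambda>v. b v z)"
        by (rule bounded_bilinear.bounded_linear_left[OF bounded_bilinear_b])
      then show ?thesis unfolding Fk_def
        by (intro derivative_intros has_derivative_grad diffG bounded_linear_imp_has_derivative)
    qed
    have "\<exists>x1\<in>cball x0 e. \<forall>y\<in>cball x0 e. Fk x1 \<le> Fk y"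
      using e
      by (intro continuous_attains_inf continuous_at_imp_continuous_on ballI has_derivative_continuous[OF derFk]) auto
    then obtain x1 where x1: "x1 \<in> cball x0 e" "\<And>y. y \<in> cball x0 e \<Longrightarrow> Fk x1 \<le> Fk y" by blast
    have "x1 \<notin> sphere x0 e" using big[of x1] x1(2)[of x0] e by force
    then have "x1 \<in> ball x0 e" using x1(1) by (auto simp: less_le)
    then have "(\<lambda>v. grad (G k) x1 \<bullet> v - b v z) = (\<lambda>v. 0)"
      using x1(2) by (intro differential_zero_maxmin[of x1 "ball x0 e" Fk] derFk) auto
    then have "grad (G k) x1 \<bullet> v = bvec z \<bullet> v" for v
      using inner_bvec[of v z] by (simp add: fun_eq_iff inner_commute)
    then have "grad (G k) x1 = bvec z" using vector_eq_rdot by blast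
    then have ex: "\<exists>x. \<gamma> (G k) x = z" by (auto simp: \<gamma>_eq_iff)
    have "norm (x - x0) < e" if x: "\<gamma> (G k) x = z" for x
    proof (rule ccontr)
      assume "\<not> norm (x - x0) < e"
      then have ge: "e \<le> norm (x - x0)" by simp
      define t where "t = e / norm (x - x0)"
      have n: "0 < norm (x - x0)" using ge e by linarith
      have t: "0 < t" "t \<le> 1" using ge e n by (auto simp: t_def divide_simps)
      define y where "y = (1 - t) *\<^sub>R x0 + t *\<^sub>R x"
      have "y - x0 = t *\<^sub>R (x - x0)" by (simp add: y_def algebra_simps)
      then have "norm (y - x0) = e" using n e by (simp add: t_def)
      then have y: "y \<in> sphere x0 e" by (simp add: dist_norm norm_minus_commute)
      have "Fk y \<le> (1 - t) * Fk x0 + t * Fk x"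
        using convex_onD[OF cvx[of k], of t x0 x] t
        by (simp add: Fk_def y_def b_simps algebra_simps)
      also have "\<dots> \<le> (1 - t) * Fk x0 + t * Fk x0"
        using critical_point_minimal[OF cvx C2 x, of x0] t
        by (intro add_left_mono mult_left_mono) (auto simp: Fk_def)
      finally show False using big[OF y] by (simp add: algebra_simps)
    qed
    then show ?case using ex by (simp add: x0_def)
  qed
qed

text \<open>
  For functions of class \<open>C\<^sup>2\<close> the density integrates to the transported function by the change of
  variables formula, and the critical values form a null set.  As \<open>G k\<close> tends to \<open>\<phi> + q\<close>, the inverse
  gradient maps converge almost everywhere to \<open>T \<phi>\<close>, and dominated convergence applies.
\<close>

theorem real_monge_ampere_push:
  assumes \<phi>: "pc \<phi>"
  shows "real_monge_ampere (\<lambda>x. \<phi> x + q x) (push \<phi> (fact CARD('n) * det_b))"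
  unfolding real_monge_ampere_def
proof (intro conjI allI impI)
  fix K :: "'n NR set" assume "compact K"
  then show "emeasure (push \<phi> (fact CARD('n) * det_b)) K < \<infinity>"
    by (intro emeasure_push_bounded \<phi>) (auto simp: compact_imp_bounded compact_imp_closed)
next
  fix G :: "nat \<Rightarrow> 'n NR \<Rightarrow> real" and h :: "'n NR \<Rightarrow> real"
  assume G: "(\<forall>k. C_diff 2 (G k) \<and> convex_on UNIV (G k)) \<and>
      (\<forall>K. compact K \<longrightarrow> uniform_limit K G (\<lambda>x. \<phi> x + q x) sequentially)"
    and h: "continuous_on UNIV h \<and> compact (closure {x. h x \<noteq> 0})"
  have C2: "C_diff 2 (G k)" and cvx: "convex_on UNIV (G k)" for k using G by auto
  have lim: "uniform_limit K G (\<lambda>x. \<phi> x + q x) sequentially" if "compact K" for K using G that by auto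
  have hm [measurable]: "h \<in> borel_measurable borel" using h by (simp add: borel_measurable_continuous_onI)
  obtain r where r: "\<And>x. h x \<noteq> 0 \<Longrightarrow> norm x \<le> r"
  proof -
    have "bounded {x. h x \<noteq> 0}" using h compact_imp_bounded bounded_closure_image bounded_subset closure_subset by metis
    then show ?thesis using that by (auto simp: bounded_iff)
  qed
  obtain H where H: "\<And>x. \<bar>h x\<bar> \<le> H"
  proof -
    have "compact (h ` closure {x. h x \<noteq> 0})"
      using h by (intro compact_continuous_image) (auto intro: continuous_on_subset)
    then have "bounded (h ` closure {x. h x \<noteq> 0})" by (rule compact_imp_bounded)
    then obtain B where "\<forall>y\<in>h ` closure {x. h x \<noteq> 0}. norm y \<le> B" unfolding bounded_iff ..
    then have B: "\<bar>h x\<bar> \<le> B" if "x \<in> closure {x. h x \<noteq> 0}" for x using that by simp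
    have "\<bar>h x\<bar> \<le> max B 0" for x
      using B[of x] closure_subset[of "{x. h x \<noteq> 0}"] by (cases "h x = 0") auto
    then show ?thesis using that by blast
  qed
  have H0: "0 \<le> H" using H[of 0] by linarith
  obtain Mf where Mf: "\<And>x. norm x \<le> r + 1 \<Longrightarrow> \<bar>\<phi> x + q x\<bar> \<le> Mf"
  proof -
    have "compact ((\<lambda>x. \<phi> x + q x) ` cball 0 (r + 1))"
      using \<phi> by (intro compact_continuous_image continuous_intros) (auto simp: pc_def intro: continuous_on_subset)
    then obtain B where B: "\<forall>y\<in>(\<lambda>x. \<phi> x + q x) ` cball 0 (r + 1). norm y \<le> B"
      using compact_imp_bounded[of "(\<lambda>x. \<phi> x + q x) ` cball 0 (r + 1)"] unfolding bounded_iff by fast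
    show ?thesis by (rule that[of B]) (use B in auto)
  qed
  obtain c where c: "0 < c" "\<And>x. c * (norm x)\<^sup>2 \<le> q x" using q_lower by blast
  define C where "C = (Mf + 1) / c"
  have "\<forall>\<^sub>F k in sequentially. \<forall>x\<in>cball 0 (r + 1). dist (G k x) (\<phi> x + q x) < 1"
    using lim[OF compact_cball] by (simp add: uniform_limit_iff)
  then obtain k0 where "\<forall>k\<ge>k0. \<forall>x\<in>cball 0 (r + 1). dist (G k x) (\<phi> x + q x) < 1"
    unfolding eventually_sequentially ..
  then have k0: "\<bar>G k x - (\<phi> x + q x)\<bar> < 1" if "k0 \<le> k" "norm x \<le> r + 1" for k x
    using that by (simp add: dist_real_def)
  \<comment> \<open>Uniform domination: on the support of \<open>h\<close> the slopes are bounded by the oscillation of \<open>G k\<close> nearby.\<close>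
  have slope: "norm z \<le> C" if k: "k0 \<le> k" and x: "norm x \<le> r" "\<gamma> (G k) x = z" for k x z
  proof (cases "z = 0")
    case True
    have "0 \<le> Mf" using Mf[of x] x(1) by linarith
    then show ?thesis using c(1) True by (simp add: C_def)
  next
    case False
    define w where "w = (1 / norm z) *\<^sub>R z"
    have nw: "norm w = 1" using False by (simp add: w_def)
    have "norm (x + w) \<le> r + 1" using norm_triangle_ineq[of x w] x nw by linarith
    then have "\<bar>G k (x + w)\<bar> < Mf + 1" "\<bar>G k x\<bar> < Mf + 1"
      using k0[OF k, of "x + w"] k0[OF k, of x] Mf[of "x + w"] Mf[of x] x(1) by auto
    moreover have "b w z \<le> G k (x + w) - G k x"
      using critical_point_minimal[OF cvx C2 x(2), of "x + w"] by (simp add: b_simps)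
    moreover have "b w z = 2 * q z / norm z" by (simp add: w_def b_simps q_def)
    moreover have "2 * (c * norm z) \<le> 2 * q z / norm z"
      using c(2)[of z] False by (simp add: field_simps power2_eq_square)
    ultimately have "c * norm z \<le> Mf + 1" by linarith
    then show ?thesis using c(1) by (simp add: C_def field_simps)
  qed
  define u where "u k = inverse_image (G k) h" for k
  have u_bound: "norm (u k z) \<le> indicator (cball 0 C) z * H" if "k0 \<le> k" for k z
  proof (cases "u k z = 0")
    case False
    then obtain x where x: "x \<in> regular (G k)" "z = \<gamma> (G k) x"
      by (auto simp: u_def inverse_image_def indicator_def split: if_splits)
    then have uk: "u k z = h x"
      using the_inv_into_f_f[OF inj_on_\<gamma>[OF cvx C2] x(1)] by (simp add: u_def inverse_image_def)
    then have "norm z \<le> C" using False by (intro slope[OF that]) (auto simp: r x)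
    then show ?thesis using H[of x] uk by simp
  qed (use H0 in simp)
  have "\<exists>N\<in>null_sets lborel. \<gamma> (G k) ` (- regular (G k)) \<subseteq> N" for k
    by (rule critical_values_null[OF C2])
  then obtain N where N: "\<And>k. N k \<in> null_sets lborel" "\<And>k. \<gamma> (G k) ` (- regular (G k)) \<subseteq> N k" by metis
  have "(\<Union>k. N k) \<in> null_sets lborel" using N(1) by (intro null_sets_UN') auto
  then have "AE z in lborel. z \<notin> (\<Union>k. N k)" by (rule AE_not_in)
  then have lim_u: "AE z in lborel. (\<lambda>k. u k z) \<longlonglongrightarrow> h (T \<phi> z)"
    using AE_not_nonunique[OF \<phi>]
  proof eventually_elim
    case (elim z)
    show ?case
    proof (rule tendstoI)
      fix e :: real assume e: "0 < e"
      have "isCont h (T \<phi> z)" using h by (simp add: continuous_on_eq_continuous_at)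
      then obtain d where d: "0 < d" "\<And>x. norm (x - T \<phi> z) < d \<Longrightarrow> dist (h x) (h (T \<phi> z)) < e"
        using e unfolding continuous_at_eps_delta by (metis dist_norm)
      have "\<forall>\<^sub>F k in sequentially. (\<exists>x. \<gamma> (G k) x = z) \<and> (\<forall>x. \<gamma> (G k) x = z \<longrightarrow> norm (x - T \<phi> z) < d)"
        by (rule critical_points_near_T[OF \<phi> elim(2) d(1) cvx C2]) (rule lim)
      then show "\<forall>\<^sub>F k in sequentially. dist (u k z) (h (T \<phi> z)) < e"
      proof eventually_elim
        case (elim k)
        then obtain x where x: "\<gamma> (G k) x = z" by blast
        have reg: "x \<in> regular (G k)" using x N(2)[of k] \<open>z \<notin> (\<Union>k. N k)\<close> by blast
        then have "z \<in> \<gamma> (G k) ` regular (G k)" using x by blast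
        then have "u k z = h x"
          using the_inv_into_f_f[OF inj_on_\<gamma>[OF cvx[of k] C2[of k]] reg] x
          by (simp add: u_def inverse_image_def)
        then show ?case using d(2) elim x by simp
      qed
    qed
  qed
  \<comment> \<open>The shift by \<open>k0\<close> is needed because the domination holds from \<open>k0\<close> on only.\<close>
  have "(\<lambda>k. \<integral>z. u (k + k0) z \<partial>lborel) \<longlonglongrightarrow> (\<integral>z. h (T \<phi> z) \<partial>lborel)"
  proof (rule integral_dominated_convergence[where w="\<lambda>z. indicator (cball 0 C) z * H"])
    show "(\<lambda>z. h (T \<phi> z)) \<in> borel_measurable lborel"
      using measurable_compose[OF measurable_T[OF \<phi>] hm] by simp
    show "u (k + k0) \<in> borel_measurable lborel" for k
      using integral_hessian_density(1)[OF cvx C2 hm] by (simp add: u_def)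
    have "emeasure lborel (cball (0::'n NR) C) < \<infinity>" by (rule emeasure_bounded_finite) simp
    then show "integrable lborel (\<lambda>z. indicator (cball (0::'n NR) C) z * H)"
      by (intro integrable_mult_left) simp
    show "AE z in lborel. (\<lambda>k. u (k + k0) z) \<longlonglongrightarrow> h (T \<phi> z)"
      using lim_u by eventually_elim (rule LIMSEQ_ignore_initial_segment)
    show "AE z in lborel. norm (u (k + k0) z) \<le> indicator (cball 0 C) z * H" for k
      using u_bound by simp
  qed
  then have "(\<lambda>k. \<integral>z. u k z \<partial>lborel) \<longlonglongrightarrow> (\<integral>z. h (T \<phi> z) \<partial>lborel)"
    by (rule LIMSEQ_offset)
  then have "(\<lambda>k. fact CARD('n) * det_b * (\<integral>z. u k z \<partial>lborel)) \<longlonglongrightarrow> fact CARD('n) * det_b * (\<integral>z. h (T \<phi> z) \<partial>lborel)"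
    by (rule tendsto_mult_left)
  then show "(\<lambda>k. \<integral>x. h x * hessian_density (G k) x \<partial>lborel) \<longlonglongrightarrow> (\<integral>x. h x \<partial>push \<phi> (fact CARD('n) * det_b))"
    using det_b_pos by (simp add: integral_hessian_density(2)[OF cvx C2 hm] integral_push[OF \<phi> hm] u_def)
qed simp

end

section \<open>Smooth functions\<close>

lemma partial_deriv_eqI:
  assumes "\<And>x. (g has_derivative g' x) (at x)" shows "partial_deriv i g = (\<lambda>x. g' x (axis i 1))"
  by (rule ext) (simp add: partial_deriv_def frechet_derivative_at[OF assms, symmetric])

lemma C_diff_differentiable: "C_diff (Suc k) g \<Longrightarrow> g differentiable (at x)" by simp

lemma C_diff_mono: "C_diff (Suc k) g \<Longrightarrow> C_diff k g"
proof (induction k arbitrary: g)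
  case 0
  then have "g differentiable_on UNIV" by (simp add: differentiable_on_def)
  then show ?case using differentiable_imp_continuous_on by auto
next
  case (Suc k)
  have "C_diff (Suc k) (partial_deriv i g)" for i using Suc.prems by simp
  then have "C_diff k (partial_deriv i g)" for i by (rule Suc.IH)
  moreover have "\<forall>x. g differentiable (at x)" using Suc.prems by simp
  ultimately show ?case by simp
qed

lemma partial_deriv_const: "partial_deriv i (\<lambda>x. c) = (\<lambda>x. 0)"
  by (subst partial_deriv_eqI[where g'="\<lambda>x v. 0"]) auto

lemma partial_deriv_add:
  assumes "\<And>x. g differentiable (at x)" "\<And>x. h differentiable (at x)"
  shows "partial_deriv i (\<lambda>x. g x + h x) = (\<lambda>x. partial_deriv i g x + partial_deriv i h x)"
proof -
  have "((\<lambda>x. g x + h x) has_derivative (\<lambda>v. frechet_derivative g (at x) v + frechet_derivative h (at x) v)) (at x)" for x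
    using assms frechet_derivative_works by (intro derivative_intros) auto
  from partial_deriv_eqI[OF this] show ?thesis by (simp add: partial_deriv_def)
qed

lemma partial_deriv_mult:
  assumes "\<And>x. g differentiable (at x)" "\<And>x. h differentiable (at x)"
  shows "partial_deriv i (\<lambda>x. g x * h x) = (\<lambda>x. g x * partial_deriv i h x + partial_deriv i g x * h x)"
proof -
  have "((\<lambda>x. g x * h x) has_derivative (\<lambda>v. g x * frechet_derivative h (at x) v + frechet_derivative g (at x) v * h x)) (at x)" for x
    using assms frechet_derivative_works by (intro derivative_intros) auto
  from partial_deriv_eqI[OF this] show ?thesis by (simp add: partial_deriv_def)
qed

lemma C_diff_const: "C_diff k (\<lambda>x. c)"
  by (induction k arbitrary: c) (simp_all add: partial_deriv_const)

lemma C_diff_add: "C_diff k g \<Longrightarrow> C_diff k h \<Longrightarrow> C_diff k (\<lambda>x. g x + h x)"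
proof (induction k arbitrary: g h)
  case 0 then show ?case by (auto intro: continuous_intros)
next
  case (Suc k)
  then have d: "\<And>x. g differentiable (at x)" "\<And>x. h differentiable (at x)" by simp_all
  then show ?case using Suc by (simp add: partial_deriv_add[OF d])
qed

lemma C_diff_mult: "C_diff k g \<Longrightarrow> C_diff k h \<Longrightarrow> C_diff k (\<lambda>x. g x * h x)"
proof (induction k arbitrary: g h)
  case 0 then show ?case by (auto intro: continuous_intros)
next
  case (Suc k)
  then have d: "\<And>x. g differentiable (at x)" "\<And>x. h differentiable (at x)" by simp_all
  have "C_diff k g" "C_diff k h" using Suc.prems C_diff_mono by blast+
  moreover have "C_diff k (partial_deriv i g)" "C_diff k (partial_deriv i h)" for i using Suc.prems by simp_all
  ultimately have "C_diff k (\<lambda>x. g x * partial_deriv i h x + partial_deriv i g x * h x)" for i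
    by (intro C_diff_add Suc.IH)
  then show ?case using d by (simp add: partial_deriv_mult[OF d])
qed

lemma partial_deriv_cmult:
  assumes "\<And>x. g differentiable (at x)"
  shows "partial_deriv i (\<lambda>x. c * g x) = (\<lambda>x. c * partial_deriv i g x)"
  using partial_deriv_mult[of "\<lambda>x. c" g i] assms by (simp add: partial_deriv_const)

lemma linear_differentiable: "linear l \<Longrightarrow> l differentiable (at x)" for l :: "'n::finite NR \<Rightarrow> real"
  using linear_imp_differentiable by blast

lemma partial_deriv_linear: "linear l \<Longrightarrow> partial_deriv i l = (\<lambda>x. l (axis i 1))" for l :: "'n::finite NR \<Rightarrow> real"
  by (rule partial_deriv_eqI[where g'="\<lambda>x. l"]) (simp add: linear_imp_has_derivative)

lemma C_diff_linear: "linear l \<Longrightarrow> C_diff k l" for l :: "'n::finite NR \<Rightarrow> real"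
proof (cases k)
  case 0
  assume "linear l" then show ?thesis using 0 by (simp add: linear_continuous_on linear_conv_bounded_linear)
next
  case (Suc m)
  assume "linear l" then show ?thesis using Suc by (simp add: linear_differentiable partial_deriv_linear C_diff_const)
qed

lemma partial_deriv_cos:
  fixes l :: "'n::finite NR \<Rightarrow> real" assumes "linear l"
  shows "partial_deriv i (\<lambda>x. cos (l x)) = (\<lambda>x. - l (axis i 1) * sin (l x))"
    "partial_deriv i (\<lambda>x. sin (l x)) = (\<lambda>x. l (axis i 1) * cos (l x))"
proof -
  have l: "(l has_derivative l) (at x)" for x using assms by (rule linear_imp_has_derivative)
  have "((\<lambda>x. cos (l x)) has_derivative (\<lambda>v. - l v * sin (l x))) (at x)"
    "((\<lambda>x. sin (l x)) has_derivative (\<lambda>v. l v * cos (l x))) (at x)" for x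
    using has_derivative_cos[OF l, of x] has_derivative_sin[OF l, of x] by (simp_all add: mult.commute)
  then show "partial_deriv i (\<lambda>x. cos (l x)) = (\<lambda>x. - l (axis i 1) * sin (l x))"
    "partial_deriv i (\<lambda>x. sin (l x)) = (\<lambda>x. l (axis i 1) * cos (l x))"
    using partial_deriv_eqI by fast+
qed

lemma C_diff_cos:
  fixes l :: "'n::finite NR \<Rightarrow> real" assumes lin: "linear l"
  shows "C_diff k (\<lambda>x. cos (l x)) \<and> C_diff k (\<lambda>x. sin (l x))"
proof (induction k)
  case 0
  have "continuous_on UNIV l" using lin by (simp add: linear_continuous_on linear_conv_bounded_linear)
  then show ?case by (auto intro!: continuous_intros)
next
  case (Suc k)
  have l: "(l has_derivative l) (at x)" for x using lin by (rule linear_imp_has_derivative)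
  have "(\<lambda>x. cos (l x)) differentiable (at x)" "(\<lambda>x. sin (l x)) differentiable (at x)" for x
    using has_derivative_cos[OF l, of x] has_derivative_sin[OF l, of x] differentiableI by blast+
  moreover have "C_diff k (\<lambda>x. - l (axis i 1) * sin (l x))" "C_diff k (\<lambda>x. l (axis i 1) * cos (l x))" for i
    by (rule C_diff_mult[OF C_diff_const], simp add: Suc)+
  ultimately show ?case by (simp add: partial_deriv_cos[OF lin])
qed

text \<open>
  For the approximating functions below the symmetry of second partial derivatives is carried along
  with smoothness; it is preserved by sums and products.
\<close>

definition smooth_sym :: "('n::finite NR \<Rightarrow> real) \<Rightarrow> bool" where
  "smooth_sym g \<longleftrightarrow> smooth g \<and>
     (\<forall>i j. partial_deriv i (partial_deriv j g) = partial_deriv j (partial_deriv i g))"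

lemma smooth_differentiable: "smooth g \<Longrightarrow> g differentiable (at x)"
  unfolding smooth_def using C_diff_differentiable by blast
lemma smooth_continuous: "smooth g \<Longrightarrow> continuous_on UNIV g"
  unfolding smooth_def by (metis C_diff.simps(1))
lemma smooth_partial: "smooth g \<Longrightarrow> smooth (partial_deriv i g)"
  unfolding smooth_def by (metis C_diff.simps(2))
lemma smooth_const: "smooth (\<lambda>x. c)" by (simp add: smooth_def C_diff_const)
lemma smooth_add: "smooth g \<Longrightarrow> smooth h \<Longrightarrow> smooth (\<lambda>x. g x + h x)" by (simp add: smooth_def C_diff_add)
lemma smooth_mult: "smooth g \<Longrightarrow> smooth h \<Longrightarrow> smooth (\<lambda>x. g x * h x)" by (simp add: smooth_def C_diff_mult)
lemma smooth_cmult: "smooth g \<Longrightarrow> smooth (\<lambda>x. c * g x)" by (intro smooth_mult smooth_const)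
lemma smooth_sum: "(\<And>i. i \<in> A \<Longrightarrow> smooth (g i)) \<Longrightarrow> smooth (\<lambda>x. \<Sum>i\<in>A. g i x)"
  by (induction A rule: infinite_finite_induct) (auto simp: smooth_const smooth_add)

lemma partial_deriv_sum:
  assumes "finite A" "\<And>i. i \<in> A \<Longrightarrow> smooth (g i)"
  shows "partial_deriv j (\<lambda>x. \<Sum>i\<in>A. g i x) = (\<lambda>x. \<Sum>i\<in>A. partial_deriv j (g i) x)"
  using assms
proof (induction A rule: finite_induct)
  case (insert a A)
  have "partial_deriv j (\<lambda>x. g a x + (\<Sum>i\<in>A. g i x)) = (\<lambda>x. partial_deriv j (g a) x + partial_deriv j (\<lambda>x. \<Sum>i\<in>A. g i x) x)"
    using insert by (intro partial_deriv_add smooth_differentiable smooth_sum) auto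
  then show ?case using insert by simp
qed (simp add: partial_deriv_const)

lemma smooth_C2: "smooth g \<Longrightarrow> C_diff 2 g" by (simp add: smooth_def)

lemma smooth_sym_const: "smooth_sym (\<lambda>x. c)"
  by (simp add: smooth_sym_def smooth_const partial_deriv_const)

lemma smooth_sym_add: assumes "smooth_sym g" "smooth_sym h" shows "smooth_sym (\<lambda>x. g x + h x)"
proof -
  have s: "smooth g" "smooth h" using assms by (auto simp: smooth_sym_def)
  have "partial_deriv i (partial_deriv j (\<lambda>x. g x + h x))
      = (\<lambda>x. partial_deriv i (partial_deriv j g) x + partial_deriv i (partial_deriv j h) x)" for i j
    using s by (simp add: partial_deriv_add smooth_differentiable smooth_partial)
  then show ?thesis using assms by (simp add: smooth_sym_def smooth_add)
qed

lemma smooth_sym_mult: assumes "smooth_sym g" "smooth_sym h" shows "smooth_sym (\<lambda>x. g x * h x)"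
proof -
  have s: "smooth g" "smooth h" using assms by (auto simp: smooth_sym_def)
  have "partial_deriv i (partial_deriv j (\<lambda>x. g x * h x)) =
      (\<lambda>x. (g x * partial_deriv i (partial_deriv j h) x + partial_deriv i g x * partial_deriv j h x)
         + (partial_deriv j g x * partial_deriv i h x + partial_deriv i (partial_deriv j g) x * h x))" for i j
    using s by (simp add: partial_deriv_mult partial_deriv_add smooth_differentiable smooth_partial smooth_mult)
  then show ?thesis using assms by (auto simp: smooth_sym_def smooth_mult fun_eq_iff mult.commute)
qed

lemma smooth_sym_cmult: "smooth_sym g \<Longrightarrow> smooth_sym (\<lambda>x. c * g x)" by (intro smooth_sym_mult smooth_sym_const)

lemma smooth_sym_cos: fixes l :: "'n::finite NR \<Rightarrow> real" assumes "linear l"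
  shows "smooth_sym (\<lambda>x. cos (l x))" "smooth_sym (\<lambda>x. sin (l x))"
proof -
  have s: "smooth (\<lambda>x. cos (l x))" "smooth (\<lambda>x. sin (l x))"
    using C_diff_cos[OF assms] by (auto simp: smooth_def)
  have "partial_deriv i (partial_deriv j (\<lambda>x. cos (l x))) = (\<lambda>x. - l (axis j 1) * (l (axis i 1) * cos (l x)))" for i j
    unfolding partial_deriv_cos[OF assms]
    by (subst partial_deriv_cmult[OF smooth_differentiable[OF s(2)]]) (simp add: partial_deriv_cos[OF assms])
  moreover have "partial_deriv i (partial_deriv j (\<lambda>x. sin (l x))) = (\<lambda>x. l (axis j 1) * (- l (axis i 1) * sin (l x)))" for i j
    unfolding partial_deriv_cos[OF assms]
    by (subst partial_deriv_cmult[OF smooth_differentiable[OF s(1)]]) (simp add: partial_deriv_cos[OF assms])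
  ultimately show "smooth_sym (\<lambda>x. cos (l x))" "smooth_sym (\<lambda>x. sin (l x))"
    using s by (auto simp: smooth_sym_def mult_ac)
qed

lemma partial_deriv_translate:
  assumes "\<And>x. g differentiable (at x)" shows "partial_deriv i (\<lambda>x. g (x + s)) = (\<lambda>x. partial_deriv i g (x + s))"
proof -
  have "((\<lambda>x. g (x + s)) has_derivative frechet_derivative g (at (x + s))) (at x)" for x
  proof -
    have "((\<lambda>x. x + s) has_derivative (\<lambda>v. v)) (at x)" by (auto intro!: derivative_eq_intros)
    from has_derivative_compose[OF this] show ?thesis
      using assms frechet_derivative_works by blast
  qed
  from partial_deriv_eqI[OF this] show ?thesis by (simp add: partial_deriv_def)
qed

lemma partial_deriv_reflect:
  assumes "\<And>x. g differentiable (at x)" shows "partial_deriv i (\<lambda>x. g (s - x)) = (\<lambda>x. - partial_deriv i g (s - x))"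
proof -
  have lin: "linear (frechet_derivative g (at y))" for y by (rule linear_frechet_derivative[OF assms])
  have "((\<lambda>x. g (s - x)) has_derivative (\<lambda>v. frechet_derivative g (at (s - x)) (- v))) (at x)" for x
  proof -
    have "((\<lambda>x. s - x) has_derivative (\<lambda>v. - v)) (at x)" by (auto intro!: derivative_eq_intros)
    from has_derivative_compose[OF this] show ?thesis
      using assms frechet_derivative_works by blast
  qed
  from partial_deriv_eqI[OF this] show ?thesis by (simp add: partial_deriv_def linear_neg[OF lin])
qed

lemma C_diff_translate: "C_diff k g \<Longrightarrow> C_diff k (\<lambda>x. g (x + s))"
proof (induction k arbitrary: g)
  case 0 then show ?case by (auto intro!: continuous_intros continuous_on_compose2[of UNIV g])
next
  case (Suc k)
  then have d: "\<And>x. g differentiable (at x)" by simp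
  have "(\<lambda>x. g (x + s)) differentiable (at x)" for x
    by (rule differentiable_compose[of g "\<lambda>x. x + s"]) (use d in auto)
  then show ?case using Suc by (simp add: partial_deriv_translate[OF d])
qed

lemma smooth_translate: "smooth g \<Longrightarrow> smooth (\<lambda>x. g (x + s))"
  by (simp add: smooth_def C_diff_translate)

context torus_lattice
begin

lemma pc_partial: assumes "smooth g" "periodic L g" shows "pc (partial_deriv i g)"
proof -
  have "partial_deriv i g (x + l) = partial_deriv i g x" if "l \<in> L" for x l
  proof -
    have "(\<lambda>x. g (x + l)) = g" using assms(2) that by (simp add: periodic_def)
    then show ?thesis using partial_deriv_translate[OF smooth_differentiable[OF assms(1)], of i l]
      by (simp add: fun_eq_iff)
  qed
  then show ?thesis using smooth_continuous[OF smooth_partial[OF assms(1)]] by (simp add: pc_def periodic_def)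
qed

lemma pc_smooth: "smooth g \<Longrightarrow> periodic L g \<Longrightarrow> pc g" by (simp add: pc_def smooth_continuous)

text \<open>The integral of a translate is constant, so the integral of a derivative vanishes.\<close>

lemma I_partial_deriv: assumes s: "smooth g" and p: "periodic L g" shows "I (partial_deriv i g) = 0"
proof -
  define D where "D k x = real (Suc k) * (g (x + inverse (real (Suc k)) *\<^sub>R axis i 1) - g x)" for k x
  have pcg: "pc g" by (rule pc_smooth[OF s p])
  have pcd: "pc (partial_deriv i g)" by (rule pc_partial[OF s p])
  obtain C where C: "\<And>x. \<bar>partial_deriv i g x\<bar> \<le> C" using pc_bounded[OF pcd] by blast
  have pcD: "pc (D k)" for k unfolding D_def[abs_def] by (intro pc_cmult pc_diff pc_shift pcg)
  have der: "((\<lambda>t. g (x + t *\<^sub>R axis i 1)) has_real_derivative partial_deriv i g (x + t *\<^sub>R axis i 1)) (at t)" for x t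
    using line_derivative[OF smooth_differentiable[OF s], of x "axis i 1" t] by (simp add: grad_def inner_axis)
  have "I (D k) = 0" for k
  proof -
    have "I (D k) = real (Suc k) * (I (\<lambda>x. g (x + inverse (real (Suc k)) *\<^sub>R axis i 1)) - I g)"
      unfolding D_def[abs_def] I_cmult by (simp only: I_diff[OF pc_shift[OF pcg] pcg])
    then show ?thesis by (simp only: I_shift[OF pcg]) simp
  qed
  moreover have "(\<lambda>k. I (D k)) \<longlonglongrightarrow> I (partial_deriv i g)"
  proof (rule I_tendsto[OF pcD pc_measurable[OF pcd]])
    show "\<bar>D k x\<bar> \<le> C" for k x
    proof -
      have "\<exists>t. 0 < t \<and> t < inverse (real (Suc k)) \<and>
          g (x + inverse (real (Suc k)) *\<^sub>R axis i 1) - g (x + 0 *\<^sub>R axis i 1)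
            = (inverse (real (Suc k)) - 0) * partial_deriv i g (x + t *\<^sub>R axis i 1)"
        by (rule MVT2) (use der in auto)
      then obtain t where "g (x + inverse (real (Suc k)) *\<^sub>R axis i 1) - g x
            = inverse (real (Suc k)) * partial_deriv i g (x + t *\<^sub>R axis i 1)" by auto
      then have "D k x = partial_deriv i g (x + t *\<^sub>R axis i 1)" by (simp add: D_def del: of_nat_Suc)
      then show ?thesis using C by simp
    qed
    show "AE x in lborel. (\<lambda>k. D k x) \<longlonglongrightarrow> partial_deriv i g x"
    proof (rule AE_I2)
      fix x
      have "((\<lambda>t. (g (x + t *\<^sub>R axis i 1) - g x) / t) \<longlongrightarrow> partial_deriv i g x) (at 0)"
        using der[of x 0] by (simp add: has_field_derivative_iff)
      moreover have "filterlim (\<lambda>k. inverse (real (Suc k))) (at 0) sequentially"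
        using LIMSEQ_inverse_real_of_nat by (simp add: filterlim_at)
      ultimately have "(\<lambda>k. (g (x + inverse (real (Suc k)) *\<^sub>R axis i 1) - g x) / inverse (real (Suc k))) \<longlonglongrightarrow> partial_deriv i g x"
        by (rule filterlim_compose)
      then show "(\<lambda>k. D k x) \<longlonglongrightarrow> partial_deriv i g x" by (simp add: D_def divide_inverse mult.commute)
    qed
  qed
  ultimately show ?thesis using LIMSEQ_unique[OF _ tendsto_const] by fastforce
qed

lemma integration_by_parts:
  assumes g: "smooth g" "periodic L g" and h: "smooth h" "periodic L h"
  shows "I (\<lambda>x. g x * partial_deriv i h x) = - I (\<lambda>x. partial_deriv i g x * h x)"
proof -
  have "I (partial_deriv i (\<lambda>x. g x * h x)) = 0"
    using g h by (intro I_partial_deriv smooth_mult) (auto simp: periodic_def)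
  then have "I (\<lambda>x. g x * partial_deriv i h x + partial_deriv i g x * h x) = 0"
    using g h by (simp add: partial_deriv_mult smooth_differentiable)
  then show ?thesis
    using I_add[OF pc_mult[OF pc_smooth[OF g] pc_partial[OF h]] pc_mult[OF pc_partial[OF g] pc_smooth[OF h]], of i i]
    by simp
qed

lemma integration_by_parts_twice:
  assumes g: "smooth g" "periodic L g" and h: "smooth h" "periodic L h"
  shows "I (\<lambda>x. g x * partial_deriv j (partial_deriv i h) x) = I (\<lambda>x. partial_deriv i (partial_deriv j g) x * h x)"
proof -
  have p: "periodic L (partial_deriv i h)" "periodic L (partial_deriv j g)"
    using pc_partial g h by (auto simp: pc_def)
  have "I (\<lambda>x. g x * partial_deriv j (partial_deriv i h) x) = - I (\<lambda>x. partial_deriv j g x * partial_deriv i h x)"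
    by (intro integration_by_parts g smooth_partial h p)
  also have "\<dots> = I (\<lambda>x. partial_deriv i (partial_deriv j g) x * h x)"
    by (subst integration_by_parts) (auto intro: g smooth_partial h p)
  finally show ?thesis .
qed

section \<open>Approximation by trigonometric kernels\<close>

text \<open>Kernels that are finite sums of products are convolved without differentiating under the integral.\<close>

inductive separable :: "('n NR \<Rightarrow> 'n NR \<Rightarrow> real) \<Rightarrow> bool" where
  base: "smooth_sym A \<Longrightarrow> pc A \<Longrightarrow> smooth_sym C \<Longrightarrow> pc C \<Longrightarrow> separable (\<lambda>w x. A w * C x)"
| add: "separable k \<Longrightarrow> separable k' \<Longrightarrow> separable (\<lambda>w x. k w x + k' w x)"

lemma separable_mult: "separable k \<Longrightarrow> separable k' \<Longrightarrow> separable (\<lambda>w x. k w x * k' w x)"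
proof (induction rule: separable.induct)
  case (base A C)
  note AC = base.hyps
  from base.prems show ?case
  proof (induction rule: separable.induct)
    case (base A' C')
    have "separable (\<lambda>w x. (A w * A' w) * (C x * C' x))"
      by (intro separable.base smooth_sym_mult pc_mult AC base)
    then show ?case by (simp add: mult_ac)
  next
    case (add k k')
    have "separable (\<lambda>w x. A w * C x * k w x + A w * C x * k' w x)" by (intro separable.add add)
    then show ?case by (simp add: distrib_left)
  qed
next
  case (add k1 k2)
  have "separable (\<lambda>w x. k1 w x * k' w x + k2 w x * k' w x)" by (intro separable.add add)
  then show ?case by (simp add: distrib_right)
qed

lemma separable_const: "separable (\<lambda>w x. c)"
  using separable.base[OF smooth_sym_const[of c] pc_const smooth_sym_const[of 1] pc_const] by simp

lemma separable_convolution: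
  assumes "separable k" and \<phi>: "pc \<phi>"
  shows "smooth_sym (\<lambda>x. I (\<lambda>w. \<phi> w * k w x)) \<and> periodic L (\<lambda>x. I (\<lambda>w. \<phi> w * k w x)) \<and>
    (\<forall>w. smooth_sym (k w)) \<and> (\<forall>x. pc (\<lambda>w. k w x)) \<and>
    (\<forall>i j x. pc (\<lambda>w. partial_deriv i (partial_deriv j (k w)) x)) \<and>
    (\<forall>i j x. partial_deriv i (partial_deriv j (\<lambda>x. I (\<lambda>w. \<phi> w * k w x))) x
      = I (\<lambda>w. \<phi> w * partial_deriv i (partial_deriv j (k w)) x))"
  using assms(1)
proof (induction rule: separable.induct)
  case (base A C)
  have sC: "smooth C" using base by (simp add: smooth_sym_def)
  have eq: "(\<lambda>x. I (\<lambda>w. \<phi> w * (A w * C x))) = (\<lambda>x. I (\<lambda>w. \<phi> w * A w) * C x)"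
    using I_cmult[of "C _" "\<lambda>w. \<phi> w * A w"] by (simp add: mult_ac)
  have dd: "partial_deriv i (partial_deriv j (\<lambda>x. c * C x)) = (\<lambda>x. c * partial_deriv i (partial_deriv j C) x)" for i j c
    by (simp add: partial_deriv_cmult smooth_differentiable smooth_partial sC)
  show ?case unfolding eq dd
  proof (intro conjI allI)
    show "smooth_sym (\<lambda>x. I (\<lambda>w. \<phi> w * A w) * C x)" by (intro smooth_sym_cmult base)
    show "periodic L (\<lambda>x. I (\<lambda>w. \<phi> w * A w) * C x)"
      using pc_cmult[OF \<open>pc C\<close>] by (simp add: pc_def)
    show "smooth_sym (\<lambda>x. A w * C x)" for w by (intro smooth_sym_cmult base)
    show "pc (\<lambda>w. A w * C x)" for x by (intro pc_mult pc_const base)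
    show "pc (\<lambda>w. A w * partial_deriv i (partial_deriv j C) x)" for i j x by (intro pc_mult pc_const base)
    show "I (\<lambda>w. \<phi> w * A w) * partial_deriv i (partial_deriv j C) x
        = I (\<lambda>w. \<phi> w * (A w * partial_deriv i (partial_deriv j C) x))" for i j x
      using I_cmult[of "partial_deriv i (partial_deriv j C) x" "\<lambda>w. \<phi> w * A w"] by (simp add: mult_ac)
  qed
next
  case (add k k')
  note k = add.IH(1) and k' = add.IH(2)
  have eq: "(\<lambda>x. I (\<lambda>w. \<phi> w * (k w x + k' w x))) = (\<lambda>x. I (\<lambda>w. \<phi> w * k w x) + I (\<lambda>w. \<phi> w * k' w x))"
    using k k' by (simp add: distrib_left I_add pc_mult \<phi>)
  have s: "smooth (k w)" "smooth (k' w)" for w using k k' by (auto simp: smooth_sym_def)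
  have s2: "smooth (\<lambda>x. I (\<lambda>w. \<phi> w * k w x))" "smooth (\<lambda>x. I (\<lambda>w. \<phi> w * k' w x))" using k k' by (auto simp: smooth_sym_def)
  have dd: "partial_deriv i (partial_deriv j (\<lambda>x. g x + h x))
      = (\<lambda>x. partial_deriv i (partial_deriv j g) x + partial_deriv i (partial_deriv j h) x)"
    if "smooth g" "smooth h" for g h :: "'n NR \<Rightarrow> real" and i j
    using that by (simp add: partial_deriv_add smooth_differentiable smooth_partial)
  show ?case
    unfolding eq dd[OF s2] dd[OF s]
  proof (intro conjI allI)
    show "smooth_sym (\<lambda>x. I (\<lambda>w. \<phi> w * k w x) + I (\<lambda>w. \<phi> w * k' w x))" using k k' by (intro smooth_sym_add) auto
    show "periodic L (\<lambda>x. I (\<lambda>w. \<phi> w * k w x) + I (\<lambda>w. \<phi> w * k' w x))"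
      using k k' by (simp add: periodic_def)
    show "smooth_sym (\<lambda>x. k w x + k' w x)" for w using k k' by (intro smooth_sym_add) auto
    show "pc (\<lambda>w. k w x + k' w x)" for x using k k' by (intro pc_add) auto
    show "pc (\<lambda>w. partial_deriv i (partial_deriv j (k w)) x + partial_deriv i (partial_deriv j (k' w)) x)" for i j x
      using k k' by (intro pc_add) auto
    show "partial_deriv i (partial_deriv j (\<lambda>x. I (\<lambda>w. \<phi> w * k w x))) x
        + partial_deriv i (partial_deriv j (\<lambda>x. I (\<lambda>w. \<phi> w * k' w x))) x
      = I (\<lambda>w. \<phi> w * (partial_deriv i (partial_deriv j (k w)) x + partial_deriv i (partial_deriv j (k' w)) x))" for i j x
    proof -
      have p1: "pc (\<lambda>w. \<phi> w * partial_deriv i (partial_deriv j (k w)) x)"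
        and p2: "pc (\<lambda>w. \<phi> w * partial_deriv i (partial_deriv j (k' w)) x)"
        using k k' by (auto intro!: pc_mult \<phi>)
      show ?thesis using k k' I_add[OF p1 p2] by (simp add: distrib_left)
    qed
  qed
qed

text \<open>
  A trigonometric polynomial with values between 0 and 1 that equals 1 on the lattice only, so that
  its powers concentrate there.
\<close>

definition bump :: "'n NR \<Rightarrow> real" where
  "bump x = (\<Prod>i\<in>UNIV. (1 + cos (2 * pi * coord x $ i)) / 2)"

definition bump_kernel :: "nat \<Rightarrow> 'n NR \<Rightarrow> real" where
  "bump_kernel N x = bump x ^ N / I (\<lambda>x. bump x ^ N)"

definition mollify :: "nat \<Rightarrow> ('n NR \<Rightarrow> real) \<Rightarrow> 'n NR \<Rightarrow> real" where
  "mollify N \<phi> x = I (\<lambda>w. \<phi> w * bump_kernel N (w - x))"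

lemma linear_coord_i: "linear (\<lambda>x. 2 * pi * coord x $ i)"
  by (rule linearI) (simp_all add: coord_add coord_scaleR algebra_simps)

lemma cos_coord_periodic: "periodic L (\<lambda>x. cos (2 * pi * coord x $ i))" "periodic L (\<lambda>x. sin (2 * pi * coord x $ i))"
proof -
  have "cos (2 * pi * coord (x + l) $ i) = cos (2 * pi * coord x $ i) \<and> sin (2 * pi * coord (x + l) $ i) = sin (2 * pi * coord x $ i)"
    if "l \<in> L" for x l
  proof -
    have "coord l $ i \<in> \<int>" using that by (simp add: L_iff)
    then have "cos (2 * pi * coord l $ i) = 1" "sin (2 * pi * coord l $ i) = 0"
      by (simp_all add: cos_integer_2pi sin_integer_2pi)
    then show ?thesis by (simp add: coord_add distrib_left cos_add sin_add)
  qed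
  then show "periodic L (\<lambda>x. cos (2 * pi * coord x $ i))" "periodic L (\<lambda>x. sin (2 * pi * coord x $ i))"
    by (auto simp: periodic_def)
qed

lemma pc_trig: "pc (\<lambda>x. cos (2 * pi * coord x $ i))" "pc (\<lambda>x. sin (2 * pi * coord x $ i))"
  using smooth_sym_cos[OF linear_coord_i, of i] cos_coord_periodic by (auto intro!: pc_smooth simp: smooth_sym_def)

lemma bump_factor:
  fixes t :: real
  shows "0 \<le> (1 + cos t) / 2" "(1 + cos t) / 2 \<le> 1"
proof -
  have "0 \<le> 1 + cos t" "1 + cos t \<le> 2"
    using cos_ge_minus_one[of t] cos_le_one[of t] by linarith+
  then show "0 \<le> (1 + cos t) / 2" "(1 + cos t) / 2 \<le> 1" by simp_all
qed

lemma bump_nonneg: "0 \<le> bump x" unfolding bump_def by (intro prod_nonneg ballI bump_factor(1))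
lemma bump_le_1: "bump x \<le> 1" unfolding bump_def by (intro prod_le_1 conjI bump_factor)

lemma bump_periodic: "periodic L bump"
  using cos_coord_periodic(1) unfolding periodic_def bump_def by simp

lemma continuous_bump: "continuous_on UNIV bump"
proof -
  have "continuous_on UNIV (\<lambda>x. cos (2 * pi * coord x $ i))" for i using pc_trig by (simp add: pc_def)
  then show ?thesis unfolding bump_def
    by (intro continuous_on_prod continuous_on_divide continuous_on_add continuous_on_const) auto
qed

lemma pc_bump_power: "pc (\<lambda>x. bump x ^ N)"
  using bump_periodic continuous_bump by (auto simp: pc_def periodic_def intro!: continuous_intros)

lemma separable_bump: "separable (\<lambda>w x. bump (w - x))"
proof -
  have f: "separable (\<lambda>w x. (1 + cos (2 * pi * coord (w - x) $ i)) / 2)" for i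
  proof -
    have "separable (\<lambda>w x. 1/2 + ((1/2 * cos (2 * pi * coord w $ i)) * cos (2 * pi * coord x $ i)
        + (1/2 * sin (2 * pi * coord w $ i)) * sin (2 * pi * coord x $ i)))"
      by (intro separable.add separable_const separable.base smooth_sym_cmult smooth_sym_cos linear_coord_i pc_cmult pc_trig)
    moreover have "1/2 + ((1/2 * cos (2 * pi * coord w $ i)) * cos (2 * pi * coord x $ i)
        + (1/2 * sin (2 * pi * coord w $ i)) * sin (2 * pi * coord x $ i)) = (1 + cos (2 * pi * coord (w - x) $ i)) / 2" for w x
      by (simp add: coord_diff right_diff_distrib cos_diff add_divide_distrib)
    ultimately show ?thesis by (simp only:)
  qed
  have "separable (\<lambda>w x. \<Prod>i\<in>A. (1 + cos (2 * pi * coord (w - x) $ i)) / 2)" if "finite A" for A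
    using that
  proof (induction A rule: finite_induct)
    case empty show ?case using separable_const[of 1] by simp
  next
    case (insert a F)
    show ?case unfolding prod.insert[OF insert(1,2)] by (intro separable_mult f insert)
  qed
  then show ?thesis by (simp add: bump_def)
qed

lemma separable_bump_kernel: "separable (\<lambda>w x. bump_kernel N (w - x))"
proof -
  have "separable (\<lambda>w x. bump (w - x) ^ m)" for m
    by (induction m) (auto intro!: separable_const separable_mult separable_bump)
  then have "separable (\<lambda>w x. (1 / I (\<lambda>x. bump x ^ N)) * bump (w - x) ^ N)"
    by (intro separable_mult separable_const)
  then show ?thesis by (simp add: bump_kernel_def)
qed

lemma pc_bump_kernel: "pc (bump_kernel N)"
  unfolding bump_kernel_def[abs_def] using pc_cmult[OF pc_bump_power, of "1 / I (\<lambda>x. bump x ^ N)" N] by simp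

lemma smooth_sym_bump_kernel: "smooth_sym (bump_kernel N)"
proof -
  have "smooth_sym (\<lambda>x. (1 + cos (2 * pi * coord x $ i)) / 2)" for i
    using smooth_sym_cmult[OF smooth_sym_add[OF smooth_sym_const[of 1] smooth_sym_cos(1)[OF linear_coord_i[of i]]], of "1/2"] by simp
  note f = this
  have "smooth_sym (\<lambda>x. \<Prod>i\<in>A. (1 + cos (2 * pi * coord x $ i)) / 2)" if "finite A" for A
    using that
  proof (induction A rule: finite_induct)
    case empty show ?case using smooth_sym_const[of 1] by simp
  next
    case (insert a F)
    show ?case unfolding prod.insert[OF insert(1,2)] by (intro smooth_sym_mult f insert)
  qed
  then have "smooth_sym bump" by (simp add: bump_def[abs_def])
  then have "smooth_sym (\<lambda>x. bump x ^ m)" for m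
    by (induction m) (auto intro!: smooth_sym_const smooth_sym_mult)
  then show ?thesis using smooth_sym_cmult[of "\<lambda>x. bump x ^ N" "1 / I (\<lambda>x. bump x ^ N)"]
    by (simp add: bump_kernel_def[abs_def])
qed

text \<open>
  The integral of a power is at least the contribution of the set where \<open>bump\<close> exceeds \<open>\<theta>\<close>.
\<close>

lemma bump_superlevel:
  assumes "\<theta> < 1" shows "\<exists>c>0. \<forall>N. 0 \<le> \<theta> \<longrightarrow> c * \<theta> ^ N \<le> I (\<lambda>x. bump x ^ N)"
proof -
  define U where "U = coord -` box 0 1 \<inter> bump -` {\<theta><..}"
  have op: "open U" unfolding U_def
    by (intro open_Int open_vimage open_box open_greaterThan continuous_bump
          linear_continuous_on bounded_linear_coord)
  \<comment> \<open>Points on the diagonal near the origin show that the set \<open>U\<close> is not empty.\<close>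
  have "(\<lambda>k. bump (comb (\<chi> i. inverse (real (Suc (Suc k)))))) \<longlonglongrightarrow> (\<Prod>i\<in>(UNIV::'n set). (1 + cos (2 * pi * 0)) / 2)"
    unfolding bump_def coord_comb vec_lambda_beta
    using LIMSEQ_ignore_initial_segment[OF LIMSEQ_inverse_real_of_nat, of 1]
    by (intro tendsto_intros) auto
  then have "\<forall>\<^sub>F k in sequentially. \<theta> < bump (comb (\<chi> i. inverse (real (Suc (Suc k)))))"
    using assms by (intro order_tendstoD(1)) auto
  then obtain k where "\<theta> < bump (comb (\<chi> i. inverse (real (Suc (Suc k)))))"
    unfolding eventually_sequentially by blast
  then have "comb (\<chi> i. inverse (real (Suc (Suc k)))) \<in> U"
    by (simp add: U_def mem_box_cart inverse_less_1_iff)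
  then have "U \<noteq> {}" by blast
  then have "emeasure lborel U \<noteq> 0"
    using open_not_negligible[OF op] op by (simp add: negligible_iff_null_sets null_sets_def)
  have UF: "U \<subseteq> FD" by (rule subsetI) (simp add: U_def FD_eq mem_box_cart less_eq_real_def)
  have Ub: "U \<in> sets borel" using op by simp
  have "emeasure lborel U \<le> emeasure lborel FD" using UF by (intro emeasure_mono) auto
  then have Ufin: "emeasure lborel U < \<infinity>" using FD_finite by (rule le_less_trans)
  then have pos: "0 < measure lborel U"
    using \<open>emeasure lborel U \<noteq> 0\<close> by (simp add: measure_def enn2real_positive_iff zero_less_iff_neq_zero)
  have "measure lborel U * \<theta> ^ N \<le> I (\<lambda>x. bump x ^ N)" if "0 \<le> \<theta>" for N
  proof -
    have "measure lborel U * \<theta> ^ N = (\<integral>x. indicator U x * \<theta> ^ N \<partial>lborel)"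
      using Ub by simp
    also have "\<dots> \<le> (\<integral>x. indicator FD x *\<^sub>R bump x ^ N \<partial>lborel)"
    proof (rule integral_mono)
      show "integrable lborel (\<lambda>x. indicator U x * \<theta> ^ N)"
        using Ub Ufin by (intro integrable_mult_left) simp
      show "integrable lborel (\<lambda>x. indicator FD x *\<^sub>R bump x ^ N)"
        using pc_integrable[OF pc_bump_power] by (simp add: set_integrable_def)
      show "indicator U x * \<theta> ^ N \<le> indicator FD x *\<^sub>R bump x ^ N" for x
      proof (cases "x \<in> U")
        case True
        then have "x \<in> FD" "\<theta> \<le> bump x" using UF by (auto simp: U_def)
        then show ?thesis using that True by (simp add: power_mono)
      qed (simp add: bump_nonneg)
    qed
    also have "\<dots> = I (\<lambda>x. bump x ^ N)" by (simp add: I_def set_lebesgue_integral_def)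
    finally show ?thesis .
  qed
  then show ?thesis using pos by blast
qed

lemma I_bump_pos: "0 < I (\<lambda>x. bump x ^ N)"
proof -
  obtain c where "c > 0" "\<And>N. c * (1/2) ^ N \<le> I (\<lambda>x. bump x ^ N)"
    using bump_superlevel[of "1/2"] by auto
  then show ?thesis by (meson less_le_trans mult_pos_pos zero_less_divide_1_iff zero_less_numeral zero_less_power)
qed

lemma bump_kernel_nonneg: "0 \<le> bump_kernel N x"
  using I_bump_pos[of N] bump_nonneg by (simp add: bump_kernel_def)

lemma I_bump_kernel: "I (bump_kernel N) = 1"
  using I_cmult[of "1 / I (\<lambda>x. bump x ^ N)" "\<lambda>x. bump x ^ N"] I_bump_pos[of N]
  by (simp add: bump_kernel_def[abs_def])

lemma mollify_eq: assumes "pc \<phi>" shows "mollify N \<phi> x = I (\<lambda>w. \<phi> (w + x) * bump_kernel N w)"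
proof -
  have "pc (\<lambda>w. \<phi> w * bump_kernel N (w - x))"
    using pc_mult[OF assms pc_shift[OF pc_bump_kernel, of N "- x"]] by simp
  from I_shift[OF this, of x] show ?thesis by (simp add: mollify_def)
qed

lemma mollify_smooth_sym: assumes "pc \<phi>"
  shows "smooth_sym (mollify N \<phi>)" "periodic L (mollify N \<phi>)"
    "partial_deriv i (partial_deriv j (mollify N \<phi>)) x
      = I (\<lambda>w. \<phi> w * partial_deriv i (partial_deriv j (\<lambda>w. bump_kernel N (w - x))) w)"
proof -
  note * = separable_convolution[OF separable_bump_kernel[of N] assms, folded mollify_def]
  have s: "smooth (bump_kernel N)" using smooth_sym_bump_kernel by (simp add: smooth_sym_def)
  have "partial_deriv i (partial_deriv j (\<lambda>x. bump_kernel N (w - x))) x = partial_deriv i (partial_deriv j (bump_kernel N)) (w - x)" for w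
  proof -
    have "partial_deriv i (\<lambda>x. - partial_deriv j (bump_kernel N) (w - x)) = (\<lambda>x. - (- partial_deriv i (partial_deriv j (bump_kernel N)) (w - x)))"
    proof -
      have "partial_deriv i (\<lambda>x. - 1 * partial_deriv j (bump_kernel N) (w - x)) = (\<lambda>x. - 1 * partial_deriv i (\<lambda>x. partial_deriv j (bump_kernel N) (w - x)) x)"
      proof (rule partial_deriv_cmult)
        show "(\<lambda>x. partial_deriv j (bump_kernel N) (w - x)) differentiable at x" for x
          by (rule differentiable_compose[of "partial_deriv j (bump_kernel N)" "\<lambda>x. w - x"])
             (auto intro: smooth_differentiable smooth_partial s)
      qed
      then show ?thesis by (simp add: partial_deriv_reflect smooth_differentiable smooth_partial s)
    qed
    then show ?thesis by (simp add: partial_deriv_reflect smooth_differentiable smooth_partial s)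
  qed
  moreover have "partial_deriv i (partial_deriv j (\<lambda>w. bump_kernel N (w - x))) w = partial_deriv i (partial_deriv j (bump_kernel N)) (w - x)" for w
    using partial_deriv_translate[of "bump_kernel N" j "- x"] partial_deriv_translate[of "partial_deriv j (bump_kernel N)" i "- x"]
    by (simp add: smooth_differentiable smooth_partial s)
  ultimately show "partial_deriv i (partial_deriv j (mollify N \<phi>)) x
      = I (\<lambda>w. \<phi> w * partial_deriv i (partial_deriv j (\<lambda>w. bump_kernel N (w - x))) w)"
    using * by (simp add: mollify_def[abs_def])
  show "smooth_sym (mollify N \<phi>)" "periodic L (mollify N \<phi>)" using * by (simp_all add: mollify_def[abs_def])
qed

lemma pc_uniformly_continuous:
  assumes "pc \<phi>" "0 < e" shows "\<exists>d>0. \<forall>x u. norm u < d \<longrightarrow> \<bar>\<phi> (x + u) - \<phi> x\<bar> < e"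
proof -
  have "uniformly_continuous_on (cball 0 (\<rho> + 1)) \<phi>"
    using assms by (intro compact_uniformly_continuous) (auto simp: pc_def intro: continuous_on_subset)
  then obtain d where d: "d > 0" "\<And>x y. x \<in> cball 0 (\<rho> + 1) \<Longrightarrow> y \<in> cball 0 (\<rho> + 1) \<Longrightarrow> dist y x < d \<Longrightarrow> dist (\<phi> y) (\<phi> x) < e"
    using assms(2) unfolding uniformly_continuous_on_def by metis
  have "\<bar>\<phi> (x + u) - \<phi> x\<bar> < e" if "norm u < min d 1" for x u
  proof -
    have "norm (red x + u) \<le> \<rho> + 1" using norm_triangle_ineq[of "red x" u] norm_red[of x] that by linarith
    then have "dist (\<phi> (red x + u)) (\<phi> (red x)) < e"
    proof (intro d(2))
      show "red x \<in> cball 0 (\<rho> + 1)" using norm_red[of x] by simp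
      show "red x + u \<in> cball 0 (\<rho> + 1)" using \<open>norm (red x + u) \<le> \<rho> + 1\<close> by simp
      show "dist (red x + u) (red x) < d" using that by (simp add: dist_norm)
    qed
    moreover have "\<phi> (red x + u) = \<phi> (x + u)"
      using assms periodic_add[OF _ red_L[of x], of \<phi> "x + u"] by (simp add: pc_def algebra_simps)
    ultimately show ?thesis using assms periodic_red[of \<phi> x] by (simp add: dist_real_def pc_def)
  qed
  then show ?thesis using d(1) by (intro exI[of _ "min d 1"]) auto
qed

lemma bump_eq_1: assumes "bump x = 1" shows "x \<in> L"
  unfolding L_iff
proof
  fix i
  let ?f = "\<lambda>i. (1 + cos (2 * pi * coord x $ i)) / 2"
  have "bump x = ?f i * (\<Prod>j\<in>UNIV - {i}. ?f j)" unfolding bump_def by (rule prod.remove) auto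
  also have "\<dots> \<le> ?f i * 1"
    by (intro mult_left_mono prod_le_1 conjI bump_factor)
  finally have "1 \<le> cos (2 * pi * coord x $ i)" using assms by simp
  then have "cos (2 * pi * coord x $ i) = 1" using cos_le_one[of "2 * pi * coord x $ i"] by linarith
  then obtain m :: int where "2 * pi * coord x $ i = of_int m * 2 * pi"
    by (auto simp: cos_one_2pi_int)
  then have "coord x $ i = of_int m" by simp
  then show "coord x $ i \<in> \<int>" by simp
qed

text \<open>
  By compactness \<open>bump\<close> stays away from 1 at distance at least \<open>d\<close> from the lattice.
\<close>

lemma bump_concentrates:
  assumes "0 < d" shows "\<exists>\<theta>. 0 \<le> \<theta> \<and> \<theta> < 1 \<and> (\<forall>w. \<theta> < bump w \<longrightarrow> (\<exists>l\<in>L. norm (w - l) < d))"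
proof -
  define A where "A = cball 0 \<rho> \<inter> (\<Inter>l\<in>L. {w. d \<le> norm (w - l)})"
  have "compact A" unfolding A_def
    by (intro compact_Int_closed compact_cball closed_INT ballI closed_Collect_le continuous_intros)
  have "\<exists>\<theta>. 0 \<le> \<theta> \<and> \<theta> < 1 \<and> (\<forall>w\<in>A. bump w \<le> \<theta>)"
  proof (cases "A = {}")
    case True then show ?thesis by (intro exI[of _ 0]) auto
  next
    case False
    have "\<exists>x\<in>A. \<forall>y\<in>A. bump y \<le> bump x"
      using continuous_bump by (intro continuous_attains_sup \<open>compact A\<close> False) (auto intro: continuous_on_subset)
    then obtain x where x: "x \<in> A" "\<And>y. y \<in> A \<Longrightarrow> bump y \<le> bump x" by blast
    have "x \<notin> L"
    proof
      assume "x \<in> L" then have "d \<le> norm (x - x)" using x(1) unfolding A_def by blast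
      then show False using assms by simp
    qed
    then have "bump x \<noteq> 1" using bump_eq_1 by blast
    then have "bump x < 1" using bump_le_1[of x] by simp
    then show ?thesis using x bump_nonneg[of x] by blast
  qed
  then obtain \<theta> where \<theta>: "0 \<le> \<theta>" "\<theta> < 1" "\<And>w. w \<in> A \<Longrightarrow> bump w \<le> \<theta>" by blast
  have "\<exists>l\<in>L. norm (w - l) < d" if "\<theta> < bump w" for w
  proof -
    have "bump (red w) = bump w" by (rule periodic_red[OF bump_periodic])
    then have "red w \<notin> A" using \<theta>(3)[of "red w"] that by auto
    then obtain l where l: "l \<in> L" "norm (red w - l) < d" using norm_red[of w] by (auto simp: A_def not_le)
    have "l - (red w - w) \<in> L" by (intro L_diff l red_L)
    moreover have "norm (w - (l - (red w - w))) < d" using l(2) by (simp add: algebra_simps)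
    ultimately show ?thesis by blast
  qed
  then show ?thesis using \<theta> by blast
qed

text \<open>
  Near the lattice the uniform continuity of \<open>\<phi>\<close> helps; away from it the kernel is exponentially
  small, because its denominator decays at most like \<open>\<theta>'\<close> to the power \<open>N\<close> with \<open>\<theta> < \<theta>'\<close>.
\<close>

lemma mollify_uniform_limit:
  assumes \<phi>: "pc \<phi>" shows "uniform_limit UNIV (\<lambda>N. mollify N \<phi>) \<phi> sequentially"
proof (rule uniform_limitI)
  fix e :: real assume e: "0 < e"
  obtain M where M: "\<And>x. \<bar>\<phi> x\<bar> \<le> M" using pc_bounded[OF \<phi>] by blast
  have M0: "0 \<le> M" using M[of 0] by linarith
  obtain d where d: "d > 0" "\<And>x u. norm u < d \<Longrightarrow> \<bar>\<phi> (x + u) - \<phi> x\<bar> < e / 2"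
    using pc_uniformly_continuous[OF \<phi>, of "e / 2"] e by auto
  obtain \<theta> where \<theta>: "0 \<le> \<theta>" "\<theta> < 1" "\<And>w. \<theta> < bump w \<Longrightarrow> \<exists>l\<in>L. norm (w - l) < d"
    using bump_concentrates[OF d(1)] by blast
  define \<theta>' where "\<theta>' = (\<theta> + 1) / 2"
  have \<theta>': "\<theta> < \<theta>'" "\<theta>' < 1" "0 < \<theta>'" using \<theta> by (auto simp: \<theta>'_def)
  obtain c where c: "c > 0" "\<And>N. c * \<theta>' ^ N \<le> I (\<lambda>x. bump x ^ N)"
    using bump_superlevel[OF \<theta>'(2)] \<theta>' by auto
  define E where "E N = 2 * M * measure lborel FD / c * (\<theta> / \<theta>') ^ N" for N
  have "(\<lambda>N. (\<theta> / \<theta>') ^ N) \<longlonglongrightarrow> 0" using \<theta> \<theta>' by (intro LIMSEQ_realpow_zero) auto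
  then have "E \<longlonglongrightarrow> 2 * M * measure lborel FD / c * 0" unfolding E_def by (rule tendsto_mult_left)
  then have "\<forall>\<^sub>F N in sequentially. E N < e / 2" using e by (intro order_tendstoD(2)) auto
  then show "\<forall>\<^sub>F N in sequentially. \<forall>x\<in>UNIV. dist (mollify N \<phi> x) (\<phi> x) < e"
  proof eventually_elim
    case (elim N)
    define IN where "IN = I (\<lambda>x. bump x ^ N)"
    have IN: "0 < IN" unfolding IN_def by (rule I_bump_pos)
    have "dist (mollify N \<phi> x) (\<phi> x) < e" for x
    proof -
      have p1: "pc (\<lambda>w. \<phi> (w + x) * bump_kernel N w)" by (intro pc_mult pc_shift \<phi> pc_bump_kernel)
      have p2: "pc (\<lambda>w. \<phi> x * bump_kernel N w)" by (intro pc_cmult pc_bump_kernel)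
      have "mollify N \<phi> x - \<phi> x = I (\<lambda>w. \<phi> (w + x) * bump_kernel N w) - I (\<lambda>w. \<phi> x * bump_kernel N w)"
        by (simp add: mollify_eq[OF \<phi>] I_cmult I_bump_kernel)
      also have "\<dots> = I (\<lambda>w. (\<phi> (w + x) - \<phi> x) * bump_kernel N w)"
        by (simp add: left_diff_distrib I_diff[OF p1 p2])
      finally have eq: "mollify N \<phi> x - \<phi> x = I (\<lambda>w. (\<phi> (w + x) - \<phi> x) * bump_kernel N w)" .
      define B where "B = 2 * M * \<theta> ^ N / IN"
      have pt: "\<bar>(\<phi> (w + x) - \<phi> x) * bump_kernel N w\<bar> \<le> e / 2 * bump_kernel N w + B" for w
      proof (cases "\<theta> < bump w")
        case True
        then obtain l where l: "l \<in> L" "norm (w - l) < d" using \<theta>(3) by blast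
        have "\<phi> (w + x) = \<phi> (x + (w - l))"
          using \<phi> periodic_add[OF _ l(1), of \<phi> "x + (w - l)"] by (simp add: pc_def algebra_simps)
        then have "\<bar>\<phi> (w + x) - \<phi> x\<bar> \<le> e / 2" using d(2)[OF l(2), of x] by simp
        then have "\<bar>\<phi> (w + x) - \<phi> x\<bar> * bump_kernel N w \<le> e / 2 * bump_kernel N w"
          by (intro mult_right_mono bump_kernel_nonneg)
        moreover have "0 \<le> B" using M0 \<theta>(1) IN by (simp add: B_def)
        ultimately show ?thesis by (simp add: abs_mult bump_kernel_nonneg)
      next
        case False
        then have "bump w ^ N \<le> \<theta> ^ N" using bump_nonneg by (intro power_mono) auto
        then have "bump_kernel N w \<le> \<theta> ^ N / IN" using IN by (simp add: bump_kernel_def IN_def divide_right_mono)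
        moreover have "\<bar>\<phi> (w + x) - \<phi> x\<bar> \<le> 2 * M" using M[of "w + x"] M[of x] by linarith
        ultimately have "\<bar>\<phi> (w + x) - \<phi> x\<bar> * bump_kernel N w \<le> 2 * M * (\<theta> ^ N / IN)"
          by (intro mult_mono bump_kernel_nonneg) (use M0 in auto)
        moreover have "0 \<le> e / 2 * bump_kernel N w" using e bump_kernel_nonneg by simp
        ultimately show ?thesis by (simp add: abs_mult bump_kernel_nonneg B_def)
      qed
      have p3: "pc (\<lambda>w. e / 2 * bump_kernel N w + B)" by (intro pc_add pc_cmult pc_bump_kernel pc_const)
      have p4: "pc (\<lambda>w. (\<phi> (w + x) - \<phi> x) * bump_kernel N w)" by (rule pc_mult[OF pc_diff[OF pc_shift[OF \<phi>] pc_const] pc_bump_kernel])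
      have "I (\<lambda>w. (\<phi> (w + x) - \<phi> x) * bump_kernel N w) \<le> I (\<lambda>w. e / 2 * bump_kernel N w + B)"
        by (rule I_mono[OF p4 p3]) (rule abs_le_D1[OF pt])
      moreover have "I (\<lambda>w. - 1 * (e / 2 * bump_kernel N w + B)) \<le> I (\<lambda>w. (\<phi> (w + x) - \<phi> x) * bump_kernel N w)"
      proof (rule I_mono[OF pc_cmult[OF p3] p4])
        show "- 1 * (e / 2 * bump_kernel N w + B) \<le> (\<phi> (w + x) - \<phi> x) * bump_kernel N w" for w
          unfolding mult_minus1 by (rule iffD1[OF minus_le_iff abs_le_D2[OF pt]])
      qed
      moreover have "I (\<lambda>w. e / 2 * bump_kernel N w + B) = e / 2 + B * measure lborel FD"
        by (simp only: I_add[OF pc_cmult[OF pc_bump_kernel] pc_const] I_cmult I_bump_kernel I_const mult_1_right)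
      moreover have "B * measure lborel FD \<le> E N"
      proof -
        have "c * \<theta>' ^ N \<le> IN" using c(2) by (simp add: IN_def)
        moreover have "0 < c * \<theta>' ^ N" using c(1) \<theta>'(3) by simp
        ultimately have "2 * M * \<theta> ^ N * measure lborel FD / IN \<le> 2 * M * \<theta> ^ N * measure lborel FD / (c * \<theta>' ^ N)"
          using M0 \<theta>(1) by (intro divide_left_mono) auto
        then show ?thesis by (simp add: B_def E_def power_divide mult_ac)
      qed
      ultimately have "\<bar>mollify N \<phi> x - \<phi> x\<bar> \<le> e / 2 + E N" unfolding eq I_cmult by linarith
      then show ?thesis using elim by (simp add: dist_real_def)
    qed
    then show ?case by blast
  qed
qed

end

section \<open>Smooth approximation of quasi-periodic convex functions\<close>

lemma convex_on_if_Hess_nonneg: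
  fixes g :: "'n::finite NR \<Rightarrow> real"
  assumes C2: "C_diff 2 g" and pos: "\<And>x v. 0 \<le> Hess g x v \<bullet> v" shows "convex_on UNIV g"
proof (rule convex_onI)
  fix s :: real and x y :: "'n NR" assume s: "0 < s" "s < 1"
  define d where "d = y - x"
  have der1: "((\<lambda>t. g (x + t *\<^sub>R d)) has_real_derivative grad g (x + t *\<^sub>R d) \<bullet> d) (at t)" for t
    by (rule line_derivative[OF C_diff_2D(1)[OF C2]])
  have der2: "((\<lambda>t. grad g (x + t *\<^sub>R d) \<bullet> d) has_real_derivative Hess g (x + t *\<^sub>R d) d \<bullet> d) (at t)" for t
  proof -
    have "((\<lambda>t. x + t *\<^sub>R d) has_derivative (\<lambda>t. t *\<^sub>R d)) (at t)"
      by (auto intro!: derivative_eq_intros)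
    from has_derivative_compose[OF this has_derivative_Hess[OF C2]]
    have "((\<lambda>t. grad g (x + t *\<^sub>R d)) has_derivative (\<lambda>u. Hess g (x + t *\<^sub>R d) (u *\<^sub>R d))) (at t)" .
    from has_derivative_inner_left[OF this, of d]
    show ?thesis
      by (simp add: has_field_derivative_def linear_cmul[OF linear_Hess[OF C2]] mult_commute_abs)
  qed
  have "convex_on UNIV (\<lambda>t. g (x + t *\<^sub>R d))"
    by (rule f''_ge0_imp_convex[OF _ der1 der2 pos]) simp
  from convex_onD[OF this, of s 0 1] s
  have "g (x + s *\<^sub>R d) \<le> (1 - s) * g x + s * g (x + d)" by simp
  moreover have "x + s *\<^sub>R d = (1 - s) *\<^sub>R x + s *\<^sub>R y" by (simp add: d_def algebra_simps)
  ultimately show "g ((1 - s) *\<^sub>R x + s *\<^sub>R y) \<le> (1 - s) * g x + s * g y" by (simp add: d_def)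
qed simp

lemma convex_on_pointwise_limit:
  assumes "\<And>k::nat. convex_on UNIV (g k)" and lim: "\<And>x. (\<lambda>k. g k x) \<longlonglongrightarrow> f x"
  shows "convex_on UNIV f"
proof (rule convex_onI)
  fix t :: real and x y assume t: "0 < t" "t < 1"
  show "f ((1 - t) *\<^sub>R x + t *\<^sub>R y) \<le> (1 - t) * f x + t * f y"
  proof (rule LIMSEQ_le[OF lim])
    show "(\<lambda>k. (1 - t) * g k x + t * g k y) \<longlonglongrightarrow> (1 - t) * f x + t * f y"
      by (intro tendsto_intros lim)
    show "\<exists>N. \<forall>k\<ge>N. g k ((1 - t) *\<^sub>R x + t *\<^sub>R y) \<le> (1 - t) * g k x + t * g k y"
      using convex_onD[OF assms(1), of t] t by auto
  qed
qed simp

lemma Hess_inner: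
  fixes g :: "'n::finite NR \<Rightarrow> real"
  assumes "C_diff 2 g"
  shows "Hess g x v \<bullet> v = (\<Sum>i\<in>UNIV. \<Sum>j\<in>UNIV. v $ i * v $ j * partial_deriv i (partial_deriv j g) x)"
proof -
  have "Hess g x v $ j = (\<Sum>i\<in>UNIV. v $ i * partial_deriv i (partial_deriv j g) x)" for j
    using frechet_derivative_grad[OF C_diff_2D(2)[OF assms], of j x v]
    by (simp add: Hess_def grad_def inner_vec_def mult.commute)
  then have "Hess g x v \<bullet> v = (\<Sum>j\<in>UNIV. \<Sum>i\<in>UNIV. v $ i * v $ j * partial_deriv i (partial_deriv j g) x)"
    by (simp add: inner_vec_def sum_distrib_right sum_distrib_left mult_ac)
  then show ?thesis by (subst sum.swap)
qed

context polarized_torus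
begin

lemma has_derivative_q: "(q has_derivative (\<lambda>v. b x v)) (at x)"
proof -
  have "((\<lambda>x. b x x) has_derivative (\<lambda>v. b x v + b v x)) (at x)"
    by (rule bounded_bilinear.FDERIV[OF bounded_bilinear_b]) (auto intro!: derivative_eq_intros)
  then have "((\<lambda>x. b x x / 2) has_derivative (\<lambda>v. (b x v + b v x) / 2)) (at x)"
    by (auto intro!: derivative_eq_intros)
  then show ?thesis using b_sym[of _ x] by (simp add: q_def[abs_def])
qed

lemma partial_deriv_q: "partial_deriv j q = (\<lambda>x. b x (axis j 1))"
  by (rule partial_deriv_eqI) (rule has_derivative_q)

lemma linear_b_left: "linear (\<lambda>x. b x y)"
  by (rule linearI) (simp_all add: b_simps)

lemma smooth_q: "smooth q"
  unfolding smooth_def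
proof
  fix k show "C_diff k q"
  proof (cases k)
    case 0 then show ?thesis using continuous_on_q[OF continuous_on_id] by simp
  next
    case (Suc m)
    have "\<forall>x. q differentiable (at x)" using has_derivative_q differentiableI by blast
    then show ?thesis using Suc by (simp add: partial_deriv_q C_diff_linear[OF linear_b_left])
  qed
qed

text \<open>
  The smooth convex functions that approximate \<open>\<phi> + q\<close>.
\<close>

definition smoothed :: "nat \<Rightarrow> ('n NR \<Rightarrow> real) \<Rightarrow> 'n NR \<Rightarrow> real" where
  "smoothed N \<phi> x = mollify N \<phi> x + q x"

lemma mollify_smooth: "pc \<phi> \<Longrightarrow> smooth (mollify N \<phi>)"
  using mollify_smooth_sym(1) by (simp add: smooth_sym_def)

lemma smoothed_C2: "pc \<phi> \<Longrightarrow> C_diff 2 (smoothed N \<phi>)"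
  unfolding smoothed_def[abs_def] by (intro smooth_C2 smooth_add mollify_smooth smooth_q)

lemma smoothed_second_derivative:
  assumes "pc \<phi>"
  shows "partial_deriv i (partial_deriv j (smoothed N \<phi>)) x
    = partial_deriv i (partial_deriv j (mollify N \<phi>)) x + b (axis i 1) (axis j 1)"
  unfolding smoothed_def[abs_def] using mollify_smooth[OF assms] smooth_q
  by (simp add: partial_deriv_add smooth_differentiable smooth_partial)
     (simp add: partial_deriv_q partial_deriv_linear[OF linear_b_left])

lemma smoothed_limit:
  assumes "pc \<phi>" shows "uniform_limit K (\<lambda>N. smoothed N \<phi>) (\<lambda>x. \<phi> x + q x) sequentially"
proof (rule uniform_limitI)
  fix e :: real assume "0 < e"
  then have "\<forall>\<^sub>F N in sequentially. \<forall>x\<in>UNIV. dist (mollify N \<phi> x) (\<phi> x) < e"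
    using mollify_uniform_limit[OF assms] by (simp add: uniform_limit_iff)
  then show "\<forall>\<^sub>F N in sequentially. \<forall>x\<in>K. dist (smoothed N \<phi> x) (\<phi> x + q x) < e"
    by eventually_elim (simp add: smoothed_def dist_real_def)
qed

text \<open>
  Averaging translates of \<open>\<phi>\<close> preserves convexity of \<open>\<phi> + q\<close>, because translating \<open>q\<close> changes it
  by an affine function only.
\<close>

lemma smoothed_convex:
  assumes \<phi>: "pc \<phi>" and cvx: "convex_on UNIV (\<lambda>x. \<phi> x + q x)" shows "convex_on UNIV (smoothed N \<phi>)"
proof (rule convex_onI)
  fix t :: real and a c :: "'n NR" assume t: "0 < t" "t < 1"
  define x where "x = (1 - t) *\<^sub>R a + t *\<^sub>R c"
  define d where "d = (1 - t) * q a + t * q c - q x"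
  have pt: "\<phi> (w + x) \<le> (1 - t) * \<phi> (w + a) + t * \<phi> (w + c) + d" for w
  proof -
    have e: "w + x = (1 - t) *\<^sub>R (w + a) + t *\<^sub>R (w + c)" by (simp add: x_def algebra_simps)
    have "\<phi> (w + x) + q (w + x) \<le> (1 - t) * (\<phi> (w + a) + q (w + a)) + t * (\<phi> (w + c) + q (w + c))"
      unfolding e using convex_onD[OF cvx, of t "w + a" "w + c"] t by simp
    then have "\<phi> (w + x) + (q w + b w x + q x) \<le> (1 - t) * (\<phi> (w + a) + (q w + b w a + q a)) + t * (\<phi> (w + c) + (q w + b w c + q c))"
      by (simp only: q_add)
    moreover have "b w x = (1 - t) * b w a + t * b w c" by (simp add: x_def b_simps)
    ultimately show ?thesis by (simp add: d_def algebra_simps)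
  qed
  have p: "pc (\<lambda>w. \<phi> (w + y) * bump_kernel N w)" for y by (intro pc_mult pc_shift \<phi> pc_bump_kernel)
  have p1: "pc (\<lambda>w. (1 - t) * (\<phi> (w + a) * bump_kernel N w))" "pc (\<lambda>w. t * (\<phi> (w + c) * bump_kernel N w))" "pc (\<lambda>w. d * bump_kernel N w)"
    by (rule pc_cmult[OF p], rule pc_cmult[OF p], rule pc_cmult[OF pc_bump_kernel])
  have "mollify N \<phi> x = I (\<lambda>w. \<phi> (w + x) * bump_kernel N w)" by (rule mollify_eq[OF \<phi>])
  also have "\<dots> \<le> I (\<lambda>w. (1 - t) * (\<phi> (w + a) * bump_kernel N w) + t * (\<phi> (w + c) * bump_kernel N w) + d * bump_kernel N w)"
  proof (rule I_mono[OF p pc_add[OF pc_add[OF p1(1,2)] p1(3)]])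
    fix w
    have "\<phi> (w + x) * bump_kernel N w \<le> ((1 - t) * \<phi> (w + a) + t * \<phi> (w + c) + d) * bump_kernel N w"
      by (intro mult_right_mono pt bump_kernel_nonneg)
    then show "\<phi> (w + x) * bump_kernel N w \<le> (1 - t) * (\<phi> (w + a) * bump_kernel N w) + t * (\<phi> (w + c) * bump_kernel N w) + d * bump_kernel N w"
      by (simp add: algebra_simps)
  qed
  also have "\<dots> = (1 - t) * mollify N \<phi> a + t * mollify N \<phi> c + d"
    by (simp only: I_add[OF pc_add[OF p1(1,2)] p1(3)] I_add[OF p1(1,2)] I_cmult I_bump_kernel mollify_eq[OF \<phi>] mult_1_right)
  finally have "smoothed N \<phi> x \<le> (1 - t) * smoothed N \<phi> a + t * smoothed N \<phi> c"
    by (simp add: smoothed_def d_def algebra_simps)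
  then show "smoothed N \<phi> ((1 - t) *\<^sub>R a + t *\<^sub>R c) \<le> (1 - t) * smoothed N \<phi> a + t * smoothed N \<phi> c"
    by (simp only: x_def)
qed simp

lemma mollify_bounded: assumes \<phi>: "pc \<phi>" and M: "\<And>x. \<bar>\<phi> x\<bar> \<le> M" shows "\<bar>mollify N \<phi> x\<bar> \<le> M"
proof -
  have p: "pc (\<lambda>w. \<phi> (w + x) * bump_kernel N w)" by (intro pc_mult pc_shift \<phi> pc_bump_kernel)
  have "I (\<lambda>w. \<phi> (w + x) * bump_kernel N w) \<le> I (\<lambda>w. M * bump_kernel N w)"
    by (rule I_mono[OF p pc_cmult[OF pc_bump_kernel]]) (intro mult_right_mono bump_kernel_nonneg abs_le_D1[OF M])
  moreover have "I (\<lambda>w. (- M) * bump_kernel N w) \<le> I (\<lambda>w. \<phi> (w + x) * bump_kernel N w)"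
  proof (rule I_mono[OF pc_cmult[OF pc_bump_kernel] p])
    show "- M * bump_kernel N w \<le> \<phi> (w + x) * bump_kernel N w" for w
      using M[of "w + x"] by (intro mult_right_mono bump_kernel_nonneg) linarith
  qed
  ultimately show ?thesis unfolding I_cmult I_bump_kernel mollify_eq[OF \<phi>] by simp
qed

lemma I_mollify_limit: assumes \<phi>: "pc \<phi>" and \<psi>: "pc \<psi>"
  shows "(\<lambda>N. I (\<lambda>x. mollify N \<phi> x * \<psi> x)) \<longlonglongrightarrow> I (\<lambda>x. \<phi> x * \<psi> x)"
proof -
  obtain M where M: "\<And>x. \<bar>\<phi> x\<bar> \<le> M" using pc_bounded[OF \<phi>] by blast
  obtain C where C: "\<And>x. \<bar>\<psi> x\<bar> \<le> C" using pc_bounded[OF \<psi>] by blast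
  have pcm: "pc (mollify N \<phi>)" for N by (intro pc_smooth mollify_smooth mollify_smooth_sym(2) \<phi>)
  show ?thesis
  proof (rule I_tendsto[where C="M * C"])
    show "pc (\<lambda>x. mollify N \<phi> x * \<psi> x)" for N by (intro pc_mult pcm \<psi>)
    show "(\<lambda>x. \<phi> x * \<psi> x) \<in> borel_measurable borel" by (intro pc_measurable pc_mult \<phi> \<psi>)
    show "\<bar>mollify N \<phi> x * \<psi> x\<bar> \<le> M * C" for N x
      unfolding abs_mult using mollify_bounded[OF \<phi> M] C by (intro mult_mono) (auto intro: order_trans[OF abs_ge_zero M])
    show "AE x in lborel. (\<lambda>N. mollify N \<phi> x * \<psi> x) \<longlonglongrightarrow> \<phi> x * \<psi> x"
      by (intro AE_I2 tendsto_intros tendsto_uniform_limitI[OF mollify_uniform_limit[OF \<phi>]]) simp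
  qed
qed

text \<open>
  For a test function \<open>h\<close> the symmetry of second derivatives is obtained in the weak sense only: it
  holds for the mollified functions, and passes to the limit after integration by parts.
\<close>

lemma I_second_derivative_commute:
  assumes \<phi>: "pc \<phi>" and h: "smooth h" "periodic L h"
  shows "I (\<lambda>x. \<phi> x * partial_deriv j (partial_deriv i h) x) = I (\<lambda>x. \<phi> x * partial_deriv i (partial_deriv j h) x)"
proof -
  have p: "pc (partial_deriv j (partial_deriv i h))" for i j
    using pc_partial[OF h] by (intro pc_partial smooth_partial h) (auto simp: pc_def)
  have "I (\<lambda>x. mollify N \<phi> x * partial_deriv j (partial_deriv i h) x) = I (\<lambda>x. mollify N \<phi> x * partial_deriv i (partial_deriv j h) x)" for N
    using mollify_smooth_sym(1)[OF \<phi>, of N] h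
    by (simp add: integration_by_parts_twice mollify_smooth \<phi> mollify_smooth_sym(2) smooth_sym_def)
  then show ?thesis using LIMSEQ_unique[OF I_mollify_limit[OF \<phi> p[of j i]]] I_mollify_limit[OF \<phi> p[of i j]] by simp
qed

end

section \<open>Forms of bidegree (n-1, n-1)\<close>

lemma inversions_empty [simp]: "inversions {} A = 0" "inversions A {} = 0"
  by (simp_all add: inversions_def)

lemma wedge_single:
  fixes \<beta> :: "'n::{finite,linorder} form"
  shows "wedge (\<lambda>I J x. if I = A \<and> J = B then c else 0) \<beta> K H x =
    (if A \<subseteq> K \<and> B \<subseteq> H then (-1) ^ (card B * card (K - A) + inversions A (K - A) + inversions B (H - B))
      * c * \<beta> (K - A) (H - B) x else 0)"
proof -
  define F where "F I J = (-1) ^ (card J * card (K - I) + inversions I (K - I) + inversions J (H - J)) * c * \<beta> (K - I) (H - J) x" for I J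
  have "wedge (\<lambda>I J x. if I = A \<and> J = B then c else 0) \<beta> K H x
      = (\<Sum>I\<in>Pow K. \<Sum>J\<in>Pow H. if I = A then (if J = B then F I J else 0) else 0)"
    unfolding wedge_def F_def by (intro sum.cong refl) auto
  also have "\<dots> = (\<Sum>I\<in>Pow K. if I = A then (\<Sum>J\<in>Pow H. if J = B then F I J else 0) else 0)"
    by (intro sum.cong refl) auto
  also have "\<dots> = (if A \<subseteq> K \<and> B \<subseteq> H then F A B else 0)" by simp
  finally show ?thesis by (simp add: F_def)
qed

lemma wedge_sum:
  "wedge (\<lambda>I J x. \<Sum>k\<in>S. f k I J x) \<beta> K H x = (\<Sum>k\<in>S. wedge (f k) \<beta> K H x)"
proof -
  have "wedge (\<lambda>I J x. \<Sum>k\<in>S. f k I J x) \<beta> K H x = (\<Sum>I\<in>Pow K. \<Sum>J\<in>Pow H. \<Sum>k\<in>S.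
     (-1) ^ (card J * card (K - I) + inversions I (K - I) + inversions J (H - J)) * f k I J x * \<beta> (K - I) (H - J) x)"
    unfolding wedge_def by (simp add: sum_distrib_left sum_distrib_right)
  also have "\<dots> = (\<Sum>I\<in>Pow K. \<Sum>k\<in>S. \<Sum>J\<in>Pow H.
     (-1) ^ (card J * card (K - I) + inversions I (K - I) + inversions J (H - J)) * f k I J x * \<beta> (K - I) (H - J) x)"
    by (intro sum.cong refl sum.swap)
  also have "\<dots> = (\<Sum>k\<in>S. wedge (f k) \<beta> K H x)"
    unfolding wedge_def by (rule sum.swap)
  finally show ?thesis .
qed

text \<open>
  The sign of the permutation that moves \<open>i\<close> to the front.
\<close>

definition sign_compl :: "'n::{finite,linorder} \<Rightarrow> real" where "sign_compl i = (-1) ^ inversions {i} (- {i})"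

lemma sign_compl_square [simp]: "sign_compl i * sign_compl i = 1" "sign_compl i * (sign_compl i * y) = y"
  by (simp_all add: sign_compl_def flip: power_add mult.assoc mult_2)

lemma d'_top: "d' \<eta> UNIV H x = (\<Sum>i\<in>UNIV. sign_compl i * partial_deriv i (\<eta> (- {i}) H) x)"
proof -
  have "wedge (d'u i) (\<lambda>I' J'. partial_deriv i (\<eta> I' J')) UNIV H x = sign_compl i * partial_deriv i (\<eta> (- {i}) H) x" for i
    unfolding d'u_def by (subst wedge_single) (simp add: sign_compl_def Compl_eq_Diff_UNIV)
  then show ?thesis by (simp add: d'_def)
qed

lemma d''_top: "d'' (\<eta> :: 'n::{finite,linorder} form) UNIV UNIV x = (\<Sum>j\<in>UNIV. (-1) ^ CARD('n) * sign_compl j * partial_deriv j (\<eta> UNIV (- {j})) x)"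
proof -
  have "wedge (d''u j) (\<lambda>I' J'. partial_deriv j (\<eta> I' J')) UNIV UNIV x
      = (-1) ^ CARD('n) * sign_compl j * partial_deriv j (\<eta> UNIV (- {j})) x" for j
    unfolding d''u_def by (subst wedge_single) (simp add: sign_compl_def Compl_eq_Diff_UNIV power_add)
  then show ?thesis by (simp add: d''_def)
qed

lemma wedge_d'u_d''u: "wedge (d'u k) (d''u l) I J x = (if I = {k} \<and> J = {l} then 1 else 0)"
proof -
  have "k \<in> I \<Longrightarrow> I - {k} = {} \<longleftrightarrow> I = {k}" by blast
  then show ?thesis unfolding d'u_def by (subst wedge_single) (auto simp: d''u_def)
qed

lemma card_Compl_singleton: "card (- {i :: 'n::finite}) = CARD('n) - 1"
  by (simp add: Compl_eq_Diff_UNIV)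

lemma CARD_Suc: "\<exists>m. CARD('n::finite) = Suc m"
  using zero_less_card_finite[where 'a='n] by (metis not0_implies_Suc less_irrefl)

lemma wedge_canonical_form:
  "wedge (canonical_form b) \<eta> UNIV UNIV x
    = (\<Sum>i\<in>UNIV. \<Sum>j\<in>UNIV. (-1) ^ (CARD('n) + 1) * sign_compl i * sign_compl j * b (axis i 1) (axis j 1) * \<eta> (- {i}) (- {j}) x)"
  for \<eta> :: "'n::{finite,linorder} form"
proof -
  have "wedge (canonical_form b) \<eta> UNIV UNIV x = (\<Sum>k\<in>UNIV. \<Sum>l\<in>UNIV.
      wedge (\<lambda>I J x. if I = {k} \<and> J = {l} then b (axis k 1) (axis l 1) else 0) \<eta> UNIV UNIV x)"
    unfolding canonical_form_def wedge_d'u_d''u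
    by (simp only: wedge_sum mult.commute[of "b _ _"] if_distrib[of "\<lambda>y. y * _"] mult_1_left mult_zero_left)
  moreover obtain m where "CARD('n) = Suc m" using CARD_Suc by blast
  ultimately show ?thesis
    by (simp add: wedge_single Compl_eq_Diff_UNIV[symmetric] card_Compl_singleton sign_compl_def power_add mult_ac)
qed

text \<open>
  The sign of the reordering of \<open>d'u\<^sub>1 \<and> d''u\<^sub>1 \<and> \<dots> \<and> d'u\<^sub>n \<and> d''u\<^sub>n\<close> in the integral of forms.
\<close>

definition orientation :: "'n::finite itself \<Rightarrow> real" where
  "orientation _ = (-1) ^ (CARD('n) * (CARD('n) - 1) div 2)"

text \<open>
  Up to sign the coefficients of \<open>\<eta>\<close>, as a matrix indexed by the omitted basis elements.  The sign is
  chosen such that positive forms have positive semidefinite coefficient matrices, and it absorbs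
  the signs of \<open>d'\<close>, \<open>d''\<close> and of the wedge product in the pairing with \<open>d'd''[\<phi>] + \<omega>\<close>.
\<close>

definition coeff :: "'n::{finite,linorder} form \<Rightarrow> 'n \<Rightarrow> 'n \<Rightarrow> 'n NR \<Rightarrow> real" where
  "coeff \<eta> i j x = orientation TYPE('n) * (-1) ^ (CARD('n) + 1) * sign_compl i * sign_compl j * \<eta> (- {i}) (- {j}) x"

lemma wedge_alpha_J:
  fixes \<alpha> :: "'n::{finite,linorder} form"
  assumes "of_type p 0 \<alpha>"
  shows "wedge \<alpha> (form_J \<alpha>) K H x = \<alpha> K {} x * \<alpha> H {} x"
proof -
  have z: "\<alpha> I J x = 0" if "J \<noteq> {}" for I J x
  proof (rule ccontr)
    assume "\<alpha> I J x \<noteq> 0"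
    then have "\<alpha> I J \<noteq> (\<lambda>x. 0)" by auto
    then have "card J = 0" using assms by (simp add: of_type_def)
    then show False using that by simp
  qed
  define F where "F I J = (-1) ^ (card J * card (K - I) + inversions I (K - I) + inversions J (H - J)) * \<alpha> I J x * form_J \<alpha> (K - I) (H - J) x" for I J
  have "wedge \<alpha> (form_J \<alpha>) K H x = (\<Sum>I\<in>Pow K. \<Sum>J\<in>Pow H. if J = {} then (if I = K then F I J else 0) else 0)"
    unfolding wedge_def
  proof (intro sum.cong refl)
    fix I J assume I: "I \<in> Pow K"
    show "(-1) ^ (card J * card (K - I) + inversions I (K - I) + inversions J (H - J)) * \<alpha> I J x * form_J \<alpha> (K - I) (H - J) x
        = (if J = {} then (if I = K then F I J else 0) else 0)"
    proof (cases "J = {} \<and> I = K")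
      case False
      then have "J \<noteq> {} \<or> K - I \<noteq> {}" using I by blast
      then show ?thesis using False by (auto simp: z form_J_def)
    qed (simp add: F_def)
  qed
  also have "\<dots> = (\<Sum>I\<in>Pow K. if I = K then F I {} else 0)" by simp
  also have "\<dots> = F K {}" by simp
  also have "F K {} = \<alpha> K {} x * \<alpha> H {} x" by (simp add: F_def form_J_def)
  finally show ?thesis .
qed

text \<open>
  The sign in the definition of positive forms matches the normalisation of the coefficients.
\<close>

lemma orientation_sign:
  "orientation TYPE('n::finite) * (-1) ^ (CARD('n) + 1) * (-1) ^ ((CARD('n) - 1) * (CARD('n) - 1 - 1) div 2) = 1"
proof -
  obtain m where m: "CARD('n) = Suc m" using CARD_Suc by blast
  have "Suc m * m div 2 + m * (m - 1) div 2 = m * m"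
  proof -
    have "even (Suc m * m)" "even (m * (m - 1))" by auto
    then have "2 * (Suc m * m div 2 + m * (m - 1) div 2) = Suc m * m + m * (m - 1)" by simp
    also have "\<dots> = 2 * (m * m)" by (cases m) (auto simp: algebra_simps)
    finally show ?thesis by simp
  qed
  then have "(-1::real) ^ (Suc m * m div 2) * (-1) ^ (m * (m - 1) div 2) = (-1) ^ (m * m)"
    by (metis power_add)
  moreover have "(-1::real) ^ (m * m) * (-1) ^ m = 1"
    by (cases "even m") auto
  ultimately show ?thesis by (simp add: orientation_def m mult_ac)
qed

section \<open>Positivity of the current and convexity\<close>

locale torus_currents = polarized_torus L b for L :: "'n::{finite,linorder} NR set" and b
begin

text \<open>
  The current \<open>d'd''[\<phi>] + \<omega>\<close>.
\<close>

definition curvature :: "('n NR set \<Rightarrow> real) \<Rightarrow> 'n form \<Rightarrow> real" where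
  "curvature \<phi> \<eta> = current_d' 1 (current_d'' 0 (current_of_function L \<phi>)) \<eta>
     + current_of_form L (canonical_form b) \<eta>"

lemma smooth_coeff: assumes "torus_form L p r \<eta>" shows "smooth (coeff \<eta> i j)" "periodic L (coeff \<eta> i j)"
proof -
  have s: "smooth (\<eta> (- {i}) (- {j}))" and p: "periodic L (\<eta> (- {i}) (- {j}))"
    using assms by (auto simp: torus_form_def)
  show "smooth (coeff \<eta> i j)" unfolding coeff_def[abs_def] by (rule smooth_cmult[OF s])
  show "periodic L (coeff \<eta> i j)" using p by (simp add: coeff_def periodic_def)
qed

lemma curvature_eq:
  assumes \<phi>: "pc (\<lambda>x. \<phi> (torus_proj L x))" and \<eta>: "torus_form L p r \<eta>"
  shows "curvature \<phi> \<eta> = (\<Sum>i\<in>UNIV. \<Sum>j\<in>UNIV.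
     I (\<lambda>x. \<phi> (torus_proj L x) * partial_deriv j (partial_deriv i (coeff \<eta> i j)) x)
     + b (axis i 1) (axis j 1) * I (coeff \<eta> i j))"
proof -
  define c where "c = orientation TYPE('n) * (-1) ^ (CARD('n) + 1)"
  have s: "smooth (\<eta> I J)" "periodic L (\<eta> I J)" for I J using \<eta> by (auto simp: torus_form_def)
  have sp: "smooth (partial_deriv i (\<eta> I J))" "periodic L (partial_deriv i (\<eta> I J))" for i I J
    using smooth_partial[OF s(1)] pc_partial[OF s] by (auto simp: pc_def)
  have dd: "partial_deriv j (partial_deriv i (coeff \<eta> i j)) x
      = c * sign_compl i * sign_compl j * partial_deriv j (partial_deriv i (\<eta> (- {i}) (- {j}))) x" for i j x
  proof -
    have "coeff \<eta> i j = (\<lambda>x. (c * sign_compl i * sign_compl j) * \<eta> (- {i}) (- {j}) x)"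
      by (rule ext) (simp add: coeff_def c_def)
    then show ?thesis by (simp only: partial_deriv_cmult[OF smooth_differentiable[OF s(1)]]
        partial_deriv_cmult[OF smooth_differentiable[OF sp(1)]])
  qed
  have top: "d'' (d' \<eta>) UNIV UNIV x = (\<Sum>j\<in>UNIV. \<Sum>i\<in>UNIV.
      (-1) ^ CARD('n) * (sign_compl i * sign_compl j) * partial_deriv j (partial_deriv i (\<eta> (- {i}) (- {j}))) x)" for x
  proof -
    have "d' \<eta> UNIV (- {j}) = (\<lambda>x. \<Sum>i\<in>UNIV. sign_compl i * partial_deriv i (\<eta> (- {i}) (- {j})) x)" for j
      by (rule ext) (rule d'_top)
    then have "partial_deriv j (d' \<eta> UNIV (- {j})) x = (\<Sum>i\<in>UNIV. sign_compl i * partial_deriv j (partial_deriv i (\<eta> (- {i}) (- {j}))) x)" for j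
      by (simp add: partial_deriv_sum smooth_cmult sp partial_deriv_cmult smooth_differentiable)
    then show ?thesis by (simp add: d''_top sum_distrib_left mult_ac)
  qed
  have pdd: "pc (\<lambda>x. \<phi> (torus_proj L x) * partial_deriv j (partial_deriv i (coeff \<eta> i j)) x)" for i j
    using smooth_coeff[OF \<eta>, of i j] pc_partial[OF smooth_coeff[OF \<eta>, of i j]]
    by (intro pc_mult \<phi> pc_partial smooth_partial) (auto simp: pc_def)
  have pco: "pc (coeff \<eta> i j)" for i j by (rule pc_smooth[OF smooth_coeff[OF \<eta>]])
  have "orientation TYPE('n) * (- (\<phi> (torus_proj L x) * d'' (d' \<eta>) UNIV UNIV x))
      = (\<Sum>i\<in>UNIV. \<Sum>j\<in>UNIV. \<phi> (torus_proj L x) * partial_deriv j (partial_deriv i (coeff \<eta> i j)) x)" for x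
    unfolding top dd c_def
    by (subst sum.swap) (simp add: sum_distrib_left sum_negf[symmetric] mult_ac)
  then have eq1: "(\<lambda>x. orientation TYPE('n) * (- (\<phi> (torus_proj L x) * d'' (d' \<eta>) UNIV UNIV x)))
      = (\<lambda>x. \<Sum>i\<in>UNIV. \<Sum>j\<in>UNIV. \<phi> (torus_proj L x) * partial_deriv j (partial_deriv i (coeff \<eta> i j)) x)" by (rule ext)
  have dm: "(\<lambda>x. \<phi> (torus_proj L x) * d'' (d' \<eta>) UNIV UNIV x) \<in> borel_measurable borel"
    unfolding top
    by (intro borel_measurable_times[OF pc_measurable[OF \<phi>]] borel_measurable_sum
        borel_measurable_times[OF borel_measurable_const] borel_measurable_continuous_onI
        smooth_continuous[OF smooth_partial[OF sp(1)]])
  have "current_d' 1 (current_d'' 0 (current_of_function L \<phi>)) \<eta>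
      = - (orientation TYPE('n) * torus_integral L (\<lambda>x. \<phi> (torus_proj L x) * d'' (d' \<eta>) UNIV UNIV x))"
    by (simp add: current_d'_def current_d''_def current_of_function_def form_integral_def orientation_def)
  also have "\<dots> = I (\<lambda>x. orientation TYPE('n) * (- (\<phi> (torus_proj L x) * d'' (d' \<eta>) UNIV UNIV x)))"
    using I_cmult[of "- orientation TYPE('n)" "\<lambda>x. \<phi> (torus_proj L x) * d'' (d' \<eta>) UNIV UNIV x"]
    by (simp add: torus_integral_eq[OF dm])
  also have "\<dots> = (\<Sum>i\<in>UNIV. \<Sum>j\<in>UNIV. I (\<lambda>x. \<phi> (torus_proj L x) * partial_deriv j (partial_deriv i (coeff \<eta> i j)) x))"
    unfolding eq1 by (simp add: I_sum pc_sum pdd)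
  finally have 1: "current_d' 1 (current_d'' 0 (current_of_function L \<phi>)) \<eta>
      = (\<Sum>i\<in>UNIV. \<Sum>j\<in>UNIV. I (\<lambda>x. \<phi> (torus_proj L x) * partial_deriv j (partial_deriv i (coeff \<eta> i j)) x))" .
  have eq2: "(\<lambda>x. orientation TYPE('n) * wedge (canonical_form b) \<eta> UNIV UNIV x)
      = (\<lambda>x. \<Sum>i\<in>UNIV. \<Sum>j\<in>UNIV. b (axis i 1) (axis j 1) * coeff \<eta> i j x)"
    by (rule ext) (simp add: wedge_canonical_form coeff_def sum_distrib_left mult_ac)
  have wm: "(\<lambda>x. wedge (canonical_form b) \<eta> UNIV UNIV x) \<in> borel_measurable borel"
    unfolding wedge_canonical_form
    by (intro borel_measurable_times borel_measurable_sum borel_measurable_const borel_measurable_continuous_onI smooth_continuous s)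
  have "current_of_form L (canonical_form b) \<eta> = I (\<lambda>x. orientation TYPE('n) * wedge (canonical_form b) \<eta> UNIV UNIV x)"
    by (simp add: current_of_form_def form_integral_def orientation_def I_cmult torus_integral_eq[OF wm])
  also have "\<dots> = (\<Sum>i\<in>UNIV. \<Sum>j\<in>UNIV. b (axis i 1) (axis j 1) * I (coeff \<eta> i j))"
    unfolding eq2 by (simp add: I_sum pc_sum pc_cmult pco I_cmult)
  finally show ?thesis using 1 by (simp add: curvature_def sum.distrib)
qed

text \<open>
  The involution transposes the coefficient matrix up to sign, and the second derivatives commute
  under the integral.
\<close>

lemma curvature_form_J:
  assumes \<phi>: "pc (\<lambda>x. \<phi> (torus_proj L x))" and \<eta>: "torus_form L (CARD('n) - 1) (CARD('n) - 1) \<eta>"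
  shows "curvature \<phi> (form_J \<eta>) = (-1) ^ (CARD('n) - 1) * curvature \<phi> \<eta>"
proof -
  let ?\<epsilon> = "(-1::real) ^ (CARD('n) - 1)"
  have J: "torus_form L (CARD('n) - 1) (CARD('n) - 1) (form_J \<eta>)"
    unfolding torus_form_def of_type_def
  proof (intro conjI allI impI)
    fix I J :: "'n set" assume "form_J \<eta> I J \<noteq> (\<lambda>x. 0)"
    then have "\<eta> J I \<noteq> (\<lambda>x. 0)" by (auto simp: form_J_def)
    then show "card I = CARD('n) - 1" "card J = CARD('n) - 1" using \<eta> by (auto simp: torus_form_def of_type_def)
  next
    fix I J :: "'n set"
    have "smooth (\<eta> J I)" "periodic L (\<eta> J I)" using \<eta> by (auto simp: torus_form_def)
    then show "smooth (form_J \<eta> I J)" "periodic L (form_J \<eta> I J)"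
      unfolding form_J_def by (auto intro: smooth_cmult simp: periodic_def)
  qed
  have co: "coeff (form_J \<eta>) i j = (\<lambda>x. ?\<epsilon> * coeff \<eta> j i x)" for i j
  proof -
    have "(-1::real) ^ ((CARD('n) - Suc 0) * (CARD('n) - Suc 0)) = (-1) ^ (CARD('n) - Suc 0)"
      by (cases "even (CARD('n) - Suc 0)") auto
    then show ?thesis by (intro ext) (simp add: coeff_def form_J_def card_Compl_singleton mult_ac)
  qed
  have s: "smooth (coeff \<eta> i j)" "periodic L (coeff \<eta> i j)" for i j using smooth_coeff[OF \<eta>] by auto
  have "partial_deriv j (partial_deriv i (\<lambda>x. ?\<epsilon> * coeff \<eta> j i x)) = (\<lambda>x. ?\<epsilon> * partial_deriv j (partial_deriv i (coeff \<eta> j i)) x)" for i j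
    by (simp only: partial_deriv_cmult[OF smooth_differentiable[OF s(1)]]
        partial_deriv_cmult[OF smooth_differentiable[OF smooth_partial[OF s(1)]]])
  then have "I (\<lambda>x. \<phi> (torus_proj L x) * partial_deriv j (partial_deriv i (coeff (form_J \<eta>) i j)) x)
      = ?\<epsilon> * I (\<lambda>x. \<phi> (torus_proj L x) * partial_deriv j (partial_deriv i (coeff \<eta> j i)) x)" for i j
    unfolding co using I_cmult[of ?\<epsilon> "\<lambda>x. \<phi> (torus_proj L x) * partial_deriv j (partial_deriv i (coeff \<eta> j i)) x"]
    by (simp add: mult.left_commute)
  moreover have "I (coeff (form_J \<eta>) i j) = ?\<epsilon> * I (coeff \<eta> j i)" for i j
    unfolding co by (rule I_cmult)
  ultimately have "curvature \<phi> (form_J \<eta>) = (\<Sum>i\<in>UNIV. \<Sum>j\<in>UNIV. ?\<epsilon> *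
     (I (\<lambda>x. \<phi> (torus_proj L x) * partial_deriv j (partial_deriv i (coeff \<eta> j i)) x)
     + b (axis i 1) (axis j 1) * I (coeff \<eta> j i)))"
    unfolding curvature_eq[OF \<phi> J] by (simp add: distrib_left mult.left_commute)
  also have "\<dots> = ?\<epsilon> * (\<Sum>i\<in>UNIV. \<Sum>j\<in>UNIV.
     I (\<lambda>x. \<phi> (torus_proj L x) * partial_deriv i (partial_deriv j (coeff \<eta> j i)) x)
     + b (axis j 1) (axis i 1) * I (coeff \<eta> j i))"
    unfolding sum_distrib_left
    by (intro sum.cong refl) (simp add: I_second_derivative_commute[OF \<phi> s] b_sym)
  also have "\<dots> = ?\<epsilon> * curvature \<phi> \<eta>"
    unfolding curvature_eq[OF \<phi> \<eta>] by (subst sum.swap) simp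
  finally show ?thesis .
qed

text \<open>
  The wedge product of \<open>\<alpha>\<close> and \<open>form_J \<alpha>\<close> has a coefficient matrix of rank one.
\<close>

lemma positive_form_coeff:
  assumes "positive_form L (CARD('n) - 1) \<eta>"
  shows "\<exists>(r::nat) g A. (\<forall>k<r. \<forall>x. 0 \<le> g k x) \<and>
    (\<forall>i j x. coeff \<eta> i j x = (\<Sum>k<r. g k x * A k i x * A k j x))"
proof -
  obtain r g \<alpha> where all: "\<forall>k<(r::nat). smooth (g k) \<and> periodic L (g k) \<and> (\<forall>x. 0 \<le> g k x) \<and> torus_form L (CARD('n) - 1) 0 (\<alpha> k)"
    and \<eta>: "\<eta> = (\<lambda>I J x. \<Sum>k<r. (-1) ^ ((CARD('n) - 1) * (CARD('n) - 1 - 1) div 2) * g k x * wedge (\<alpha> k) (form_J (\<alpha> k)) I J x)"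
    using assms unfolding positive_form_def by (elim exE conjE)
  have *: "(\<forall>x. 0 \<le> g k x) \<and> torus_form L (CARD('n) - 1) 0 (\<alpha> k)" if "k < r" for k using all that by simp
  have w: "wedge (\<alpha> k) (form_J (\<alpha> k)) K H x = \<alpha> k K {} x * \<alpha> k H {} x" if "k < r" for k K H x
    using *[OF that] by (intro wedge_alpha_J) (auto simp: torus_form_def)
  have "coeff \<eta> i j x = (\<Sum>k<r. g k x * (sign_compl i * \<alpha> k (- {i}) {} x) * (sign_compl j * \<alpha> k (- {j}) {} x))" for i j x
  proof -
    define s where "s = (-1::real) ^ ((CARD('n) - 1) * (CARD('n) - 1 - 1) div 2)"
    have sg1: "orientation TYPE('n) * (-1) ^ (CARD('n) + 1) * s = 1"
      unfolding s_def by (rule orientation_sign)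
    have "coeff \<eta> i j x = (orientation TYPE('n) * (-1) ^ (CARD('n) + 1)) * (\<Sum>k<r. s * (g k x * (sign_compl i * \<alpha> k (- {i}) {} x) * (sign_compl j * \<alpha> k (- {j}) {} x)))"
      unfolding coeff_def \<eta> s_def[symmetric] by (simp add: w sum_distrib_left mult_ac)
    also have "\<dots> = (orientation TYPE('n) * (-1) ^ (CARD('n) + 1) * s) * (\<Sum>k<r. g k x * (sign_compl i * \<alpha> k (- {i}) {} x) * (sign_compl j * \<alpha> k (- {j}) {} x))"
      by (simp only: sum_distrib_left[symmetric] mult.assoc)
    finally show ?thesis unfolding sg1 by simp
  qed
  then show ?thesis using *
    by (intro exI[of _ r] exI[of _ g] exI[of _ "\<lambda>k i x. sign_compl i * \<alpha> k (- {i}) {} x"]) simp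
qed

text \<open>
  After mollifying, integration by parts moves both derivatives to \<open>\<phi>\<close>; the integrand becomes the
  trace of the product of two positive semidefinite matrices, the Hessian of a convex function and the
  coefficient matrix.
\<close>

lemma curvature_nonneg:
  assumes \<phi>: "pc (\<lambda>x. \<phi> (torus_proj L x))" and cvx: "convex_on UNIV (\<lambda>x. \<phi> (torus_proj L x) + q x)"
    and \<eta>: "torus_form L (CARD('n) - 1) (CARD('n) - 1) \<eta>" and pos: "positive_form L (CARD('n) - 1) \<eta>"
  shows "0 \<le> curvature \<phi> \<eta>"
proof -
  define f where "f x = \<phi> (torus_proj L x)" for x
  have f: "pc f" using \<phi> by (simp add: f_def[abs_def])
  obtain r g A where g: "\<forall>k<(r::nat). \<forall>x. 0 \<le> g k x"
    and co': "\<forall>i j x. coeff \<eta> i j x = (\<Sum>k<r. g k x * A k i x * A k j x)"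
    using positive_form_coeff[OF pos] by (elim exE conjE)
  have co: "coeff \<eta> i j x = (\<Sum>k<r. g k x * A k i x * A k j x)" for i j x using co' by blast
  have s: "smooth (coeff \<eta> i j)" "periodic L (coeff \<eta> i j)" for i j using smooth_coeff[OF \<eta>] by auto
  have pco: "pc (coeff \<eta> i j)" for i j by (rule pc_smooth[OF s])
  have pdd: "pc (partial_deriv j (partial_deriv i (coeff \<eta> i j)))" for i j
    using pc_partial[OF s] by (intro pc_partial smooth_partial s) (auto simp: pc_def)
  define TN where "TN N = (\<Sum>i\<in>UNIV. \<Sum>j\<in>UNIV. I (\<lambda>x. mollify N f x * partial_deriv j (partial_deriv i (coeff \<eta> i j)) x)
     + b (axis i 1) (axis j 1) * I (coeff \<eta> i j))" for N
  have "TN \<longlonglongrightarrow> curvature \<phi> \<eta>"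
    unfolding TN_def curvature_eq[OF \<phi> \<eta>] f_def[symmetric]
    by (intro tendsto_sum tendsto_add tendsto_const I_mollify_limit f pdd)
  moreover have "0 \<le> TN N" for N
  proof -
    have ms: "smooth (mollify N f)" "periodic L (mollify N f)" using mollify_smooth mollify_smooth_sym(2) f by auto
    have pm: "pc (partial_deriv i (partial_deriv j (mollify N f)))" for i j
      using pc_partial[OF ms] by (intro pc_partial smooth_partial ms) (auto simp: pc_def)
    define M where "M i j x = partial_deriv i (partial_deriv j (mollify N f)) x + b (axis i 1) (axis j 1)" for i j x
    have pM: "pc (\<lambda>x. M i j x * coeff \<eta> i j x)" for i j
      unfolding M_def by (intro pc_mult pc_add pm pc_const pco)
    have "I (\<lambda>x. mollify N f x * partial_deriv j (partial_deriv i (coeff \<eta> i j)) x)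
     + b (axis i 1) (axis j 1) * I (coeff \<eta> i j) = I (\<lambda>x. M i j x * coeff \<eta> i j x)" for i j
    proof -
      have "I (\<lambda>x. M i j x * coeff \<eta> i j x) = I (\<lambda>x. partial_deriv i (partial_deriv j (mollify N f)) x * coeff \<eta> i j x + b (axis i 1) (axis j 1) * coeff \<eta> i j x)"
        by (simp add: M_def distrib_right)
      also have "\<dots> = I (\<lambda>x. partial_deriv i (partial_deriv j (mollify N f)) x * coeff \<eta> i j x) + b (axis i 1) (axis j 1) * I (coeff \<eta> i j)"
        by (simp only: I_add[OF pc_mult[OF pm pco] pc_cmult[OF pco]] I_cmult)
      finally show ?thesis by (simp add: integration_by_parts_twice[OF ms s])
    qed
    then have "TN N = I (\<lambda>x. \<Sum>i\<in>UNIV. \<Sum>j\<in>UNIV. M i j x * coeff \<eta> i j x)"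
      unfolding TN_def by (simp add: I_sum pc_sum pM)
    also have "0 \<le> \<dots>"
    proof (rule I_nonneg)
      fix x
      have Hn: "0 \<le> (\<Sum>i\<in>UNIV. \<Sum>j\<in>UNIV. v i * v j * M i j x)" for v
        using Hess_nonneg[OF smoothed_convex[OF f] smoothed_C2[OF f], of N x "\<chi> i. v i"] cvx
        unfolding Hess_inner[OF smoothed_C2[OF f]] smoothed_second_derivative[OF f]
        by (simp add: M_def f_def)
      have "(\<Sum>i\<in>UNIV. \<Sum>j\<in>UNIV. M i j x * coeff \<eta> i j x)
          = (\<Sum>i\<in>UNIV. \<Sum>j\<in>UNIV. \<Sum>k<r. g k x * (A k i x * A k j x * M i j x))"
        unfolding co by (simp add: sum_distrib_left mult_ac)
      also have "\<dots> = (\<Sum>i\<in>UNIV. \<Sum>k<r. \<Sum>j\<in>UNIV. g k x * (A k i x * A k j x * M i j x))"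
        by (intro sum.cong refl sum.swap)
      also have "\<dots> = (\<Sum>k<r. \<Sum>i\<in>UNIV. \<Sum>j\<in>UNIV. g k x * (A k i x * A k j x * M i j x))"
        by (rule sum.swap)
      also have "\<dots> = (\<Sum>k<r. g k x * (\<Sum>i\<in>UNIV. \<Sum>j\<in>UNIV. A k i x * A k j x * M i j x))"
        by (simp add: sum_distrib_left)
      also have "0 \<le> \<dots>"
      proof (rule sum_nonneg)
        fix k assume "k \<in> {..<r}"
        then have "0 \<le> g k x" using g by simp
        then show "0 \<le> g k x * (\<Sum>i\<in>UNIV. \<Sum>j\<in>UNIV. A k i x * A k j x * M i j x)"
          using Hn[of "\<lambda>i. A k i x"] by (rule mult_nonneg_nonneg)
      qed
      finally show "0 \<le> (\<Sum>i\<in>UNIV. \<Sum>j\<in>UNIV. M i j x * coeff \<eta> i j x)" .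
    qed
    finally show ?thesis .
  qed
  ultimately show ?thesis by (intro LIMSEQ_le_const) auto
qed

text \<open>
  Test forms with the coefficient matrix \<open>u i * u j * h\<close> are positive.
\<close>

lemma curvature_rank_one:
  assumes \<phi>: "pc (\<lambda>x. \<phi> (torus_proj L x))" and pos: "positive_current L 1 (curvature \<phi>)"
    and h: "smooth h" "periodic L h" "\<And>x. 0 \<le> h x"
  shows "0 \<le> (\<Sum>i\<in>UNIV. \<Sum>j\<in>UNIV. u i * u j *
     (I (\<lambda>x. \<phi> (torus_proj L x) * partial_deriv j (partial_deriv i h) x) + b (axis i 1) (axis j 1) * I h))"
proof -
  define s where "s = (-1::real) ^ ((CARD('n) - 1) * (CARD('n) - 1 - 1) div 2)"
  define \<alpha> :: "'n form" where "\<alpha> I J x = (if J = {} then (\<Sum>k\<in>UNIV. if I = - {k} then sign_compl k * u k else 0) else 0)" for I J x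
  have \<alpha>i: "\<alpha> (- {i}) {} x = sign_compl i * u i" for i x
  proof -
    have "- {i} = - {k} \<longleftrightarrow> k = i" for k by auto
    then show ?thesis by (simp add: \<alpha>_def)
  qed
  have type: "of_type (CARD('n) - 1) 0 \<alpha>"
    unfolding of_type_def
  proof (intro allI impI)
    fix I J assume "\<alpha> I J \<noteq> (\<lambda>x. 0)"
    then have J: "J = {}" and ne: "(\<Sum>k\<in>UNIV. if I = - {k} then sign_compl k * u k else 0) \<noteq> 0"
      by (auto simp: \<alpha>_def split: if_splits)
    obtain k where "(if I = - {k} then sign_compl k * u k else 0) \<noteq> 0"
      using sum.not_neutral_contains_not_neutral[OF ne] by blast
    then have "I = - {k}" by (auto split: if_splits)
    then show "card I = CARD('n) - 1 \<and> card J = 0" using J by (simp add: card_Compl_singleton)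
  qed
  have \<alpha>c: "\<alpha> I J = (\<lambda>x. \<alpha> I J 0)" for I J by (rule ext) (simp add: \<alpha>_def)
  have t\<alpha>: "torus_form L (CARD('n) - 1) 0 \<alpha>"
    unfolding torus_form_def using type
    by (intro conjI allI) (assumption, subst \<alpha>c, rule smooth_const, subst \<alpha>c, simp add: periodic_def)
  define \<eta> where "\<eta> = (\<lambda>I J x. \<Sum>k<(1::nat). s * h x * wedge \<alpha> (form_J \<alpha>) I J x)"
  have \<eta>e: "\<eta> I J = (\<lambda>x. (s * \<alpha> I {} 0 * \<alpha> J {} 0) * h x)" for I J
    unfolding \<eta>_def
  proof (rule ext)
    fix x
    have "\<alpha> I {} x = \<alpha> I {} 0" "\<alpha> J {} x = \<alpha> J {} 0" by (simp_all add: \<alpha>_def)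
    then show "(\<Sum>k<(1::nat). s * h x * wedge \<alpha> (form_J \<alpha>) I J x) = (s * \<alpha> I {} 0 * \<alpha> J {} 0) * h x"
      by (simp only: wedge_alpha_J[OF type]) simp
  qed
  have p\<eta>: "positive_form L (CARD('n) - 1) \<eta>"
    unfolding positive_form_def \<eta>_def s_def
    by (rule exI[of _ 1], rule exI[of _ "\<lambda>_. h"], rule exI[of _ "\<lambda>_. \<alpha>"]) (use h t\<alpha> in simp)
  have t\<eta>: "torus_form L (CARD('n) - 1) (CARD('n) - 1) \<eta>"
    unfolding torus_form_def of_type_def
  proof (intro conjI allI impI)
    fix I J assume "\<eta> I J \<noteq> (\<lambda>x. 0)"
    then have "\<alpha> I {} 0 \<noteq> 0" "\<alpha> J {} 0 \<noteq> 0" by (auto simp: \<eta>e)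
    then have "\<alpha> I {} \<noteq> (\<lambda>x. 0)" "\<alpha> J {} \<noteq> (\<lambda>x. 0)" by auto
    then show "card I = CARD('n) - 1" "card J = CARD('n) - 1" using type by (auto simp: of_type_def)
  next
    fix I J show "smooth (\<eta> I J)" "periodic L (\<eta> I J)"
      unfolding \<eta>e using h by (auto intro: smooth_cmult simp: periodic_def)
  qed
  have co: "coeff \<eta> i j = (\<lambda>x. (u i * u j) * h x)" for i j
  proof
    fix x
    have "coeff \<eta> i j x = (orientation TYPE('n) * (-1) ^ (CARD('n) + 1) * s) * ((sign_compl i * sign_compl i) * (sign_compl j * sign_compl j)) * (u i * u j * h x)"
      unfolding coeff_def \<eta>e \<alpha>i by (simp only: mult_ac)
    also have "orientation TYPE('n) * (-1) ^ (CARD('n) + 1) * s = 1" unfolding s_def by (rule orientation_sign)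
    finally show "coeff \<eta> i j x = (u i * u j) * h x" by simp
  qed
  have "0 \<le> curvature \<phi> \<eta>" using pos t\<eta> p\<eta> by (simp add: positive_current_def)
  also have "curvature \<phi> \<eta> = (\<Sum>i\<in>UNIV. \<Sum>j\<in>UNIV. u i * u j *
     (I (\<lambda>x. \<phi> (torus_proj L x) * partial_deriv j (partial_deriv i h) x) + b (axis i 1) (axis j 1) * I h))"
    unfolding curvature_eq[OF \<phi> t\<eta>] co
  proof (intro sum.cong refl)
    fix i j
    have "partial_deriv j (partial_deriv i (\<lambda>x. (u i * u j) * h x)) = (\<lambda>x. (u i * u j) * partial_deriv j (partial_deriv i h) x)"
      by (simp only: partial_deriv_cmult[OF smooth_differentiable[OF h(1)]]
          partial_deriv_cmult[OF smooth_differentiable[OF smooth_partial[OF h(1)]]])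
    then have "I (\<lambda>x. \<phi> (torus_proj L x) * partial_deriv j (partial_deriv i (\<lambda>x. (u i * u j) * h x)) x)
        = (u i * u j) * I (\<lambda>x. \<phi> (torus_proj L x) * partial_deriv j (partial_deriv i h) x)"
      using I_cmult[of "u i * u j" "\<lambda>x. \<phi> (torus_proj L x) * partial_deriv j (partial_deriv i h) x"]
      by (simp add: mult.left_commute)
    then show "I (\<lambda>x. \<phi> (torus_proj L x) * partial_deriv j (partial_deriv i (\<lambda>x. (u i * u j) * h x)) x)
        + b (axis i 1) (axis j 1) * I (\<lambda>x. (u i * u j) * h x)
      = u i * u j * (I (\<lambda>x. \<phi> (torus_proj L x) * partial_deriv j (partial_deriv i h) x) + b (axis i 1) (axis j 1) * I h)"
      unfolding I_cmult[of "u i * u j" h] by (simp add: algebra_simps)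
  qed
  finally show ?thesis .
qed

text \<open>
  For the converse take for \<open>h\<close> the translated kernels: the inequality then says that the Hessian of the
  mollified function is positive semidefinite, and convexity is preserved by pointwise limits.
\<close>

theorem positive_current_iff_convex:
  assumes \<phi>: "pc (\<lambda>x. \<phi> (torus_proj L x))"
  shows "positive_current L 1 (curvature \<phi>) \<longleftrightarrow> convex_on UNIV (\<lambda>x. \<phi> (torus_proj L x) + q x)"
proof
  assume "convex_on UNIV (\<lambda>x. \<phi> (torus_proj L x) + q x)"
  then show "positive_current L 1 (curvature \<phi>)"
    using curvature_form_J[OF \<phi>] curvature_nonneg[OF \<phi>] by (simp add: positive_current_def)
next
  assume pos: "positive_current L 1 (curvature \<phi>)"
  define f where "f x = \<phi> (torus_proj L x)" for x
  have f: "pc f" using \<phi> by (simp add: f_def[abs_def])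
  have "convex_on UNIV (smoothed N f)" for N
  proof (rule convex_on_if_Hess_nonneg[OF smoothed_C2[OF f]])
    fix x v
    define h where "h w = bump_kernel N (w - x)" for w
    have sk: "smooth (bump_kernel N)" using smooth_sym_bump_kernel by (simp add: smooth_sym_def)
    have h: "smooth h" "periodic L h" "\<And>w. 0 \<le> h w"
      using smooth_translate[OF sk, of "- x"] pc_shift[OF pc_bump_kernel, of N "- x"] bump_kernel_nonneg
      by (auto simp: h_def[abs_def] pc_def)
    have "I h = 1" using I_shift[OF pc_bump_kernel, of N "- x"] I_bump_kernel by (simp add: h_def[abs_def])
    then have "0 \<le> (\<Sum>i\<in>UNIV. \<Sum>j\<in>UNIV. v $ i * v $ j * (I (\<lambda>w. f w * partial_deriv j (partial_deriv i h) w) + b (axis i 1) (axis j 1)))"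
      using curvature_rank_one[OF \<phi> pos h, of "\<lambda>i. v $ i"] by (simp add: f_def)
    also have "\<dots> = (\<Sum>i\<in>UNIV. \<Sum>j\<in>UNIV. v $ j * v $ i * partial_deriv j (partial_deriv i (smoothed N f)) x)"
      unfolding smoothed_second_derivative[OF f] mollify_smooth_sym(3)[OF f]
      by (intro sum.cong refl) (simp add: h_def[abs_def] b_sym mult.commute)
    also have "\<dots> = Hess (smoothed N f) x v \<bullet> v"
      unfolding Hess_inner[OF smoothed_C2[OF f]] by (rule sum.swap)
    finally show "0 \<le> Hess (smoothed N f) x v \<bullet> v" .
  qed
  then have "convex_on UNIV (\<lambda>x. f x + q x)"
    by (rule convex_on_pointwise_limit) (rule tendsto_uniform_limitI[OF smoothed_limit[OF f, of UNIV]], simp)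
  then show "convex_on UNIV (\<lambda>x. \<phi> (torus_proj L x) + q x)" by (simp add: f_def)
qed

end

section \<open>Uniqueness of the potential of an optimal map\<close>

context polarized_torus
begin

lemma smoothed_maximiser:
  assumes \<phi>: "pc \<phi>" and cvx: "convex_on UNIV (\<lambda>x. \<phi> x + q x)"
  shows "optimal (mollify N \<phi>) (\<gamma> (smoothed N \<phi>) x) x"
  unfolding optimal_def
proof
  fix y
  have "smoothed N \<phi> x - b x (\<gamma> (smoothed N \<phi>) x) \<le> smoothed N \<phi> y - b y (\<gamma> (smoothed N \<phi>) x)"
    by (rule critical_point_minimal[OF smoothed_convex[OF \<phi> cvx] smoothed_C2[OF \<phi>] refl])
  then show "- mollify N \<phi> y - q (y - \<gamma> (smoothed N \<phi>) x) \<le> - mollify N \<phi> x - q (x - \<gamma> (smoothed N \<phi>) x)"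
    by (simp add: smoothed_def q_diff)
qed

text \<open>
  Every point is a maximiser for some slope: this is the existence of a subgradient, obtained as a
  limit of gradients of the smooth approximations.
\<close>

lemma maximiser_for_some_slope:
  assumes \<phi>: "pc \<phi>" and cvx: "convex_on UNIV (\<lambda>x. \<phi> x + q x)" shows "\<exists>z. optimal \<phi> z x"
proof -
  define zs where "zs N = \<gamma> (smoothed N \<phi>) x" for N
  have optimal: "optimal (mollify N \<phi>) (zs N) x" for N unfolding zs_def by (rule smoothed_maximiser[OF \<phi> cvx])
  have pcm: "pc (mollify N \<phi>)" for N by (intro pc_smooth mollify_smooth mollify_smooth_sym(2) \<phi>)
  have "norm (zs N) \<le> norm x + R" for N
    using norm_triangle_sub[of "zs N" x] optimal_norm[OF pcm optimal, of N] by (simp add: norm_minus_commute)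
  then have "bounded (range zs)" by (auto simp: bounded_iff)
  then obtain z r where zr: "strict_mono (r :: nat \<Rightarrow> nat)" "(zs \<circ> r) \<longlonglongrightarrow> z"
    using bounded_imp_convergent_subsequence by blast
  have ul: "uniform_limit UNIV (\<lambda>k. mollify (r k) \<phi>) \<phi> sequentially"
    using filterlim_compose[OF mollify_uniform_limit[OF \<phi>] filterlim_subseq[OF zr(1)]] by (simp add: o_def)
  have "optimal \<phi> z x"
    by (rule optimal_limit[OF \<phi> _ zr(2) tendsto_const ul]) (simp add: optimal)
  then show ?thesis ..
qed

lemma ct_ct_eq:
  assumes \<phi>: "pc \<phi>" and cvx: "convex_on UNIV (\<lambda>x. \<phi> x + q x)" shows "ct (ct \<phi>) x = \<phi> x"
proof -
  obtain z where z: "optimal \<phi> z x" using maximiser_for_some_slope[OF \<phi> cvx] by blast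
  have "\<phi> x = - ct \<phi> z - q (z - x)" using ct_eq[OF z] q_minus_commute[of x z] by simp
  also have "\<dots> \<le> ct (ct \<phi>) x" by (rule ct_ge[OF pc_ct[OF \<phi>]])
  finally show ?thesis using ct_ct_le[OF \<phi>, of x] by simp
qed

text \<open>
  The slopes \<open>z\<close> at which \<open>ct \<phi> + q\<close> and \<open>ct \<psi> + q\<close> have a common subgradient.
\<close>

definition common :: "('n NR \<Rightarrow> real) \<Rightarrow> ('n NR \<Rightarrow> real) \<Rightarrow> 'n NR set" where
  "common \<phi> \<psi> = {z. \<exists>x. optimal \<phi> z x \<and> optimal \<psi> z x}"

lemma closed_common: assumes "pc \<phi>" "pc \<psi>" shows "closed (common \<phi> \<psi>)"
  unfolding closed_sequential_limits
proof (intro allI impI, elim conjE)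
  fix zs z assume zs: "\<forall>k. zs k \<in> common \<phi> \<psi>" and z: "zs \<longlonglongrightarrow> z"
  then obtain xs where xs: "\<And>k. optimal \<phi> (zs k) (xs k)" "\<And>k. optimal \<psi> (zs k) (xs k)"
    unfolding common_def by simp metis
  obtain x r where r: "strict_mono r" "(xs \<circ> r) \<longlonglongrightarrow> x" "optimal \<phi> z x"
    using optimal_sequence_subseq[where \<Phi>="\<lambda>_. \<phi>", OF assms(1) xs(1) z assms(1) uniform_limit_const_seq] by blast
  have "optimal \<psi> z x"
    by (rule optimal_limit[where \<Phi>="\<lambda>_. \<psi>", OF assms(2) _ LIMSEQ_subseq_LIMSEQ[OF z r(1)] r(2) uniform_limit_const_seq])
       (simp add: xs)
  then show "z \<in> common \<phi> \<psi>" using r by (auto simp: common_def)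
qed

lemma common_shift: assumes "pc \<phi>" "pc \<psi>" "l \<in> L" shows "z + l \<in> common \<phi> \<psi> \<longleftrightarrow> z \<in> common \<phi> \<psi>"
proof -
  have *: "z + l \<in> common \<phi> \<psi>" if "l \<in> L" "z \<in> common \<phi> \<psi>" for z l
    using that assms optimal_shift[of \<phi> l z] optimal_shift[of \<psi> l z] unfolding common_def pc_def by blast
  show ?thesis using *[OF assms(3), of z] *[OF L_neg[OF assms(3)], of "z + l"] by auto
qed

text \<open>
  If both maps transport Lebesgue measure to the same measure, then the two nonnegative excesses
  \<open>\<phi> x + ct \<phi> z + q (x - z)\<close> along the graph of \<open>T \<psi>\<close>, and with \<open>\<phi>\<close> and \<open>\<psi>\<close> exchanged, have
  opposite integrals.  So both vanish almost everywhere.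
\<close>

lemma common_almost_everywhere:
  assumes \<phi>: "pc \<phi>" and \<psi>: "pc \<psi>"
    and eq: "I (\<lambda>z. \<phi> (T \<phi> z) - \<psi> (T \<phi> z)) = I (\<lambda>z. \<phi> (T \<psi> z) - \<psi> (T \<psi> z))"
  shows "AE z in lborel. z \<in> FD \<longrightarrow> z \<in> common \<phi> \<psi>"
proof -
  define A where "A z = \<phi> (T \<psi> z) - \<psi> (T \<psi> z) + (ct \<phi> z - ct \<psi> z)" for z
  define B where "B z = (ct \<psi> z - ct \<phi> z) - (\<phi> (T \<phi> z) - \<psi> (T \<phi> z))" for z
  have pd: "pc (\<lambda>x. \<phi> x - \<psi> x)" by (intro pc_diff \<phi> \<psi>)
  obtain C where C: "\<And>x. \<bar>\<phi> x - \<psi> x\<bar> \<le> C" using pc_bounded[OF pd] by blast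
  have hT: "(\<lambda>z. \<phi> (T \<chi>' z) - \<psi> (T \<chi>' z)) \<in> borel_measurable borel" if "pc \<chi>'" for \<chi>'
    using measurable_compose[OF measurable_T[OF that] pc_measurable[OF pd]] .
  have iT: "set_integrable lborel FD (\<lambda>z. \<phi> (T \<chi>' z) - \<psi> (T \<chi>' z))" if "pc \<chi>'" for \<chi>'
    by (rule FD_integrable[OF hT[OF that], where C=C]) (rule C)
  have ic: "set_integrable lborel FD (\<lambda>z. ct \<phi> z - ct \<psi> z)" "set_integrable lborel FD (\<lambda>z. ct \<psi> z - ct \<phi> z)"
    by (intro pc_integrable pc_diff pc_ct \<phi> \<psi>)+
  have A0: "0 \<le> A z" if "z \<notin> nonunique \<psi>" for z
  proof -
    have "optimal \<psi> z (T \<psi> z)" using optimal_T[OF \<psi> that] by simp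
    then show ?thesis using ct_eq[of \<psi> z "T \<psi> z"] ct_ge[OF \<phi>, of "T \<psi> z" z] by (simp add: A_def)
  qed
  have B0: "0 \<le> B z" if "z \<notin> nonunique \<phi>" for z
  proof -
    have "optimal \<phi> z (T \<phi> z)" using optimal_T[OF \<phi> that] by simp
    then show ?thesis using ct_eq[of \<phi> z "T \<phi> z"] ct_ge[OF \<psi>, of "T \<phi> z" z] by (simp add: B_def)
  qed
  have iA: "set_integrable lborel FD A" unfolding A_def[abs_def] by (intro set_integral_add iT ic \<psi>)
  have iB: "set_integrable lborel FD B" unfolding B_def[abs_def] by (intro set_integral_diff iT ic \<phi>)
  have IA: "I A = I (\<lambda>z. \<phi> (T \<psi> z) - \<psi> (T \<psi> z)) + I (\<lambda>z. ct \<phi> z - ct \<psi> z)"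
    unfolding I_def A_def[abs_def] by (rule set_integral_add(2)[OF iT[OF \<psi>] ic(1)])
  have IB: "I B = I (\<lambda>z. ct \<psi> z - ct \<phi> z) - I (\<lambda>z. \<phi> (T \<phi> z) - \<psi> (T \<phi> z))"
    unfolding I_def B_def[abs_def] by (rule set_integral_diff(2)[OF ic(2) iT[OF \<phi>]])
  have "I A + I B = 0"
    unfolding IA IB by (simp add: eq I_diff pc_ct \<phi> \<psi>)
  moreover have "AE z in lborel. 0 \<le> indicator FD z *\<^sub>R A z"
    using AE_not_nonunique[OF \<psi>] by eventually_elim (simp add: A0 indicator_def)
  moreover have "AE z in lborel. 0 \<le> indicator FD z *\<^sub>R B z"
    using AE_not_nonunique[OF \<phi>] by eventually_elim (simp add: B0 indicator_def)
  moreover have "0 \<le> I A" "0 \<le> I B"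
    using calculation(2,3) unfolding I_def set_lebesgue_integral_def by (auto intro: integral_nonneg_AE)
  ultimately have "I A = 0" and nn: "AE z in lborel. 0 \<le> indicator FD z *\<^sub>R A z" by linarith+
  then have "AE z in lborel. indicator FD z *\<^sub>R A z = 0"
    using integral_nonneg_eq_0_iff_AE[OF iA[unfolded set_integrable_def] nn]
    by (simp add: I_def set_lebesgue_integral_def)
  then show ?thesis using AE_not_nonunique[OF \<psi>]
  proof eventually_elim
    case (elim z)
    show ?case
    proof
      assume "z \<in> FD"
      then have "A z = 0" using elim(1) by simp
      have M: "optimal \<psi> z (T \<psi> z)" using optimal_T[OF \<psi> elim(2)] by simp
      then have "ct \<phi> z = - \<phi> (T \<psi> z) - q (T \<psi> z - z)"
        using \<open>A z = 0\<close> ct_eq[OF M] by (simp add: A_def)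
      then have "optimal \<phi> z (T \<psi> z)" by (simp add: optimal_iff[OF \<phi>])
      then show "z \<in> common \<phi> \<psi>" using M by (auto simp: common_def)
    qed
  qed
qed

text \<open>
  The complement is an open periodic null set.
\<close>

lemma common_UNIV:
  assumes \<phi>: "pc \<phi>" and \<psi>: "pc \<psi>"
    and eq: "I (\<lambda>z. \<phi> (T \<phi> z) - \<psi> (T \<phi> z)) = I (\<lambda>z. \<phi> (T \<psi> z) - \<psi> (T \<psi> z))"
  shows "common \<phi> \<psi> = UNIV"
proof -
  define U where "U = - common \<phi> \<psi>"
  have oU: "open U" using closed_common[OF \<phi> \<psi>] by (simp add: U_def open_Compl)
  then have Ub [measurable]: "U \<in> sets borel" by simp
  have sh: "x + l \<in> U \<longleftrightarrow> x \<in> U" if "l \<in> L" for x l using common_shift[OF \<phi> \<psi> that] by (simp add: U_def)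
  have "(\<integral>\<^sup>+x. indicator U x \<partial>lborel) = (\<integral>\<^sup>+l. (\<integral>\<^sup>+x\<in>FD. indicator U (x + l) \<partial>lborel) \<partial>count_space L)"
    by (rule nn_integral_unfold[OF countable_L is_fundamental_domain_FD]) measurable
  also have "\<dots> = (\<integral>\<^sup>+l. 0 \<partial>count_space L)"
  proof (rule nn_integral_cong)
    fix l assume "l \<in> space (count_space L)"
    then have l: "l \<in> L" by simp
    have "AE x in lborel. indicator U (x + l) * indicator FD x = (0 :: ennreal)"
      using common_almost_everywhere[OF \<phi> \<psi> eq]
    proof eventually_elim
      case (elim x)
      then have "x \<in> FD \<longrightarrow> x + l \<notin> U" unfolding sh[OF l] by (simp add: U_def)
      then show ?case by (auto simp: indicator_def)
    qed
    then have "(\<integral>\<^sup>+x\<in>FD. indicator U (x + l) \<partial>lborel) = (\<integral>\<^sup>+x. 0 \<partial>(lborel :: 'n NR measure))"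
      by (rule nn_integral_cong_AE)
    then show "(\<integral>\<^sup>+x\<in>FD. indicator U (x + l) \<partial>lborel) = 0" by simp
  qed
  finally have "emeasure lborel U = 0" using Ub by simp
  then have "U = {}" using open_not_negligible[OF oU] oU by (auto simp: negligible_iff_null_sets null_sets_def)
  then show ?thesis by (auto simp: U_def)
qed

text \<open>
  Two convex functions with a common subgradient at every point differ by a constant: along a
  segment cut into \<open>n\<close> pieces the increments differ by at most the total variation of the
  subgradient, divided by \<open>n\<close>.
\<close>

lemma ct_diff_constant:
  assumes \<phi>: "pc \<phi>" and \<psi>: "pc \<psi>" and com: "common \<phi> \<psi> = UNIV"
  shows "ct \<phi> z - ct \<psi> z = ct \<phi> 0 - ct \<psi> 0"
proof -
  have "\<forall>z. \<exists>x. optimal \<phi> z x \<and> optimal \<psi> z x" using com by (auto simp: common_def)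
  then obtain p where p: "\<And>z. optimal \<phi> z (p z)" "\<And>z. optimal \<psi> z (p z)" by metis
  define \<delta> where "\<delta> z = ct \<phi> z - ct \<psi> z" for z
  have sub: "ct \<chi>' w + q w + b (p w) (w' - w) \<le> ct \<chi>' w' + q w'"
    if "pc \<chi>'" "\<And>z. optimal \<chi>' z (p z)" for \<chi>' w w'
    using ct_eq[OF that(2)[of w]] ct_ge[OF that(1), of "p w" w'] by (simp add: q_diff b_simps)
  have step: "\<bar>\<delta> w' - \<delta> w\<bar> \<le> b (p w' - p w) (w' - w)" for w w'
    using sub[OF \<phi> p(1), of w w'] sub[OF \<phi> p(1), of w' w] sub[OF \<psi> p(2), of w w'] sub[OF \<psi> p(2), of w' w]
    by (simp add: \<delta>_def b_simps abs_le_iff)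
  have bound: "\<bar>\<delta> z - \<delta> 0\<bar> \<le> b (p z - p 0) z * inverse (real (Suc m))" for m
  proof -
    define w where "w k = (real k / real (Suc m)) *\<^sub>R z" for k
    have w: "w 0 = 0" "w (Suc m) = z" by (simp_all add: w_def del: of_nat_Suc)
    have dw: "w (Suc k) - w k = inverse (real (Suc m)) *\<^sub>R z" for k
    proof -
      have "real (Suc k) / real (Suc m) - real k / real (Suc m) = inverse (real (Suc m))"
        by (simp add: diff_divide_distrib[symmetric] inverse_eq_divide)
      then show ?thesis by (simp add: w_def scaleR_left_diff_distrib[symmetric] del: of_nat_Suc)
    qed
    have "\<delta> z - \<delta> 0 = (\<Sum>k<Suc m. \<delta> (w (Suc k)) - \<delta> (w k))"
      using sum_lessThan_telescope[of "\<lambda>k. \<delta> (w k)" "Suc m"] w by simp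
    then have "\<bar>\<delta> z - \<delta> 0\<bar> \<le> (\<Sum>k<Suc m. \<bar>\<delta> (w (Suc k)) - \<delta> (w k)\<bar>)"
      by (simp only: sum_abs)
    also have "\<dots> \<le> (\<Sum>k<Suc m. b (p (w (Suc k))) z * inverse (real (Suc m)) - b (p (w k)) z * inverse (real (Suc m)))"
    proof (rule sum_mono)
      fix k
      have "\<bar>\<delta> (w (Suc k)) - \<delta> (w k)\<bar> \<le> b (p (w (Suc k)) - p (w k)) (inverse (real (Suc m)) *\<^sub>R z)"
        using step[of "w (Suc k)" "w k"] unfolding dw .
      then show "\<bar>\<delta> (w (Suc k)) - \<delta> (w k)\<bar> \<le> b (p (w (Suc k))) z * inverse (real (Suc m)) - b (p (w k)) z * inverse (real (Suc m))"
        by (simp add: b_simps algebra_simps del: of_nat_Suc)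
    qed
    also have "\<dots> = b (p z) z * inverse (real (Suc m)) - b (p 0) z * inverse (real (Suc m))"
      using sum_lessThan_telescope[of "\<lambda>k. b (p (w k)) z * inverse (real (Suc m))" "Suc m"] w by simp
    finally show ?thesis by (simp add: b_simps left_diff_distrib del: of_nat_Suc)
  qed
  have "(\<lambda>m. b (p z - p 0) z * inverse (real (Suc m))) \<longlonglongrightarrow> b (p z - p 0) z * 0"
    by (intro tendsto_intros LIMSEQ_inverse_real_of_nat)
  then have "\<bar>\<delta> z - \<delta> 0\<bar> \<le> b (p z - p 0) z * 0"
    by (rule LIMSEQ_le_const) (use bound in auto)
  then show ?thesis by (simp add: \<delta>_def)
qed

theorem potentials_differ_by_constant:
  assumes \<phi>: "pc \<phi>" "convex_on UNIV (\<lambda>x. \<phi> x + q x)" and \<psi>: "pc \<psi>" "convex_on UNIV (\<lambda>x. \<psi> x + q x)"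
    and eq: "\<And>h. pc h \<Longrightarrow> I (\<lambda>z. h (T \<phi> z)) = I (\<lambda>z. h (T \<psi> z))"
  shows "\<exists>c. \<forall>x. \<psi> x = \<phi> x + c"
proof -
  define c where "c = ct \<phi> 0 - ct \<psi> 0"
  have "common \<phi> \<psi> = UNIV" by (intro common_UNIV \<phi>(1) \<psi>(1) eq pc_diff)
  then have "ct \<phi> z = ct \<psi> z + c" for z
    using ct_diff_constant[OF \<phi>(1) \<psi>(1)] by (simp add: c_def algebra_simps)
  then have "ct (ct \<phi>) x = ct (ct \<psi>) x - c" for x
    using ct_add_const[OF pc_ct[OF \<psi>(1)], of c x] by presburger
  then show ?thesis using ct_ct_eq[OF \<phi>] ct_ct_eq[OF \<psi>] by (intro exI[of _ c]) simp
qed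

end

section \<open>Measures determined by continuous functions\<close>

text \<open>
  Continuous functions that increase to the indicator of the open set \<open>U\<close>.
\<close>

definition ramp :: "'a::metric_space set \<Rightarrow> nat \<Rightarrow> 'a \<Rightarrow> real" where
  "ramp U k x = (if U = UNIV then 1 else min 1 (real k * infdist x (- U)))"

lemma ramp_bounds: "0 \<le> ramp U k x" "ramp U k x \<le> 1"
  by (auto simp: ramp_def infdist_nonneg)

lemma continuous_ramp: "continuous_on UNIV (ramp U k)"
proof (cases "U = UNIV")
  case True then show ?thesis by (simp add: ramp_def[abs_def])
next
  case False then show ?thesis by (auto simp: ramp_def[abs_def] intro!: continuous_intros)
qed

lemma ramp_outside: "x \<notin> U \<Longrightarrow> ramp U k x = 0"
  by (auto simp: ramp_def)

lemma ramp_tendsto: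
  assumes "open U" shows "(\<lambda>k. ramp U k x) \<longlonglongrightarrow> indicator U x"
proof (cases "x \<in> U \<and> U \<noteq> UNIV")
  case True
  define d where "d = infdist x (- U)"
  have d: "0 < d" unfolding d_def
    using assms True by (intro infdist_pos_not_in_closed) auto
  obtain n where n: "1 / d < real n" using reals_Archimedean2 by blast
  have "ramp U k x = 1" if "n \<le> k" for k
  proof -
    have "1 / d < real k" using n that by simp
    then have "1 \<le> real k * d" using d by (simp add: field_simps)
    then show ?thesis using True by (simp add: ramp_def d_def)
  qed
  then have "\<forall>\<^sub>F k in sequentially. ramp U k x = 1" unfolding eventually_sequentially by blast
  then show ?thesis using True by (simp add: tendsto_eventually)
next
  case False
  then have "ramp U k x = indicator U x" for k using ramp_outside[of x U k] by (auto simp: ramp_def)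
  then show ?thesis by simp
qed

lemma measure_eqI_compact_support:
  fixes m m' :: "'a::euclidean_space measure"
  assumes sets: "sets m = sets borel" "sets m' = sets borel"
    and fin: "\<And>K. compact K \<Longrightarrow> emeasure m K < \<infinity>" "\<And>K. compact K \<Longrightarrow> emeasure m' K < \<infinity>"
    and eq: "\<And>h :: 'a \<Rightarrow> real. continuous_on UNIV h \<Longrightarrow> compact (closure {x. h x \<noteq> 0}) \<Longrightarrow> (\<integral>x. h x \<partial>m) = (\<integral>x. h x \<partial>m')"
  shows "m = m'"
proof (rule measure_eqI_generator_eq)
  let ?E = "range (\<lambda>(a, b). box a b :: 'a set)"
  show "Int_stable ?E"
    by (auto simp: Int_stable_def Int_interval box_Int_box image_iff split: prod.splits)
  show "sets m = sigma_sets UNIV ?E" "sets m' = sigma_sets UNIV ?E"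
    using sets by (simp_all add: borel_eq_box)
  show "range (\<lambda>n::nat. box (- real n *\<^sub>R One) (real n *\<^sub>R One)) \<subseteq> ?E" by auto
  show "(\<Union>n::nat. box (- real n *\<^sub>R One) (real n *\<^sub>R One)) = (UNIV :: 'a set)"
    using UN_box_eq_UNIV by auto
  have finb: "emeasure \<mu> (box a b) \<noteq> \<infinity>" if "sets \<mu> = sets borel" "\<And>K. compact K \<Longrightarrow> emeasure \<mu> K < \<infinity>" for \<mu> and a b :: 'a
  proof -
    have "emeasure \<mu> (box a b) \<le> emeasure \<mu> (cbox a b)"
      using that(1) box_subset_cbox by (intro emeasure_mono) auto
    then show ?thesis using that(2)[OF compact_cbox, of a b] by (auto simp: top_unique)
  qed
  show "emeasure m (box (- real n *\<^sub>R One) (real n *\<^sub>R One)) \<noteq> \<infinity>" for n :: nat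
    by (rule finb[OF sets(1) fin(1)])
  show "emeasure m X = emeasure m' X" if X0: "X \<in> ?E" for X
  proof -
    obtain a b where X: "X = box a b" using X0 by auto
    have lim: "(\<lambda>k. \<integral>x. ramp X k x \<partial>\<mu>) \<longlonglongrightarrow> measure \<mu> X"
      if s: "sets \<mu> = sets borel" and f: "\<And>K. compact K \<Longrightarrow> emeasure \<mu> K < \<infinity>" for \<mu>
    proof -
      have Xs: "X \<in> sets \<mu>" using s X by simp
      have iX: "integrable \<mu> (indicator X :: 'a \<Rightarrow> real)"
        using finb[OF s f] Xs by (simp add: X less_top)
      have "(\<lambda>k. \<integral>x. ramp X k x \<partial>\<mu>) \<longlonglongrightarrow> (\<integral>x. indicator X x \<partial>\<mu>)"
      proof (rule integral_dominated_convergence[OF _ _ iX])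
        show "indicator X \<in> borel_measurable \<mu>" using Xs by simp
        show "ramp X k \<in> borel_measurable \<mu>" for k
          using borel_measurable_continuous_onI[OF continuous_ramp] s by (simp cong: measurable_cong_sets)
        show "AE x in \<mu>. (\<lambda>k. ramp X k x) \<longlonglongrightarrow> indicator X x"
          by (intro AE_I2 ramp_tendsto) (simp add: X open_box)
        show "AE x in \<mu>. norm (ramp X k x) \<le> indicator X x" for k
          by (intro AE_I2) (auto simp: ramp_bounds ramp_outside indicator_def)
      qed
      then show ?thesis using Xs sets_eq_imp_space_eq[OF s] by simp
    qed
    have "(\<integral>x. ramp X k x \<partial>m) = (\<integral>x. ramp X k x \<partial>m')" for k
    proof (rule eq[OF continuous_ramp])
      have "closure {x. ramp X k x \<noteq> 0} \<subseteq> cbox a b"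
        using ramp_outside[of _ X k] box_subset_cbox[of a b] by (intro closure_minimal) (auto simp: X)
      then show "compact (closure {x. ramp X k x \<noteq> 0})"
        using compact_cbox bounded_cbox bounded_subset compact_eq_bounded_closed closed_closure by metis
    qed
    then have "measure m X = measure m' X"
      using LIMSEQ_unique[OF lim[OF sets(1) fin(1)]] lim[OF sets(2) fin(2)] by simp
    then show ?thesis
      using finb[OF sets(1) fin(1), of a b] finb[OF sets(2) fin(2), of a b]
      by (simp add: emeasure_eq_ennreal_measure X)
  qed
qed auto

section \<open>The topology and the Borel sets of the torus\<close>

context torus_lattice
begin

abbreviation proj :: "'n NR \<Rightarrow> 'n NR set" where "proj \<equiv> torus_proj L"

abbreviation torus :: "'n NR set topology" where "torus \<equiv> torus_topology L"

lemma mem_proj: "y \<in> proj x \<longleftrightarrow> y - x \<in> L"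
proof
  assume "y - x \<in> L"
  then have "x + (y - x) \<in> proj x" unfolding torus_proj_def by (rule imageI)
  then show "y \<in> proj x" by simp
qed (auto simp: torus_proj_def)

lemma proj_eq_iff: "proj x = proj y \<longleftrightarrow> x - y \<in> L"
proof
  assume "proj x = proj y"
  moreover have "x \<in> proj x" by (simp add: mem_proj)
  ultimately show "x - y \<in> L" by (simp add: mem_proj)
next
  assume xy: "x - y \<in> L"
  have "z - x \<in> L \<longleftrightarrow> z - y \<in> L" for z
    using L_add[OF _ xy, of "z - x"] L_diff[OF _ xy, of "z - y"] by auto
  then show "proj x = proj y" by (auto simp: mem_proj)
qed

lemma proj_add: "l \<in> L \<Longrightarrow> proj (x + l) = proj x"
  by (simp add: proj_eq_iff)

lemma proj_red: "proj (red x) = proj x"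
  by (simp add: proj_eq_iff red_L)

lemma inj_on_proj_FD: "inj_on proj FD"
proof (rule inj_onI)
  fix x y assume x: "x \<in> FD" and y: "y \<in> FD" and "proj x = proj y"
  then have "x - y \<in> L" "x - (x - y) \<in> FD" "0 \<in> L" "x - 0 \<in> FD" by (auto simp: proj_eq_iff)
  then have "x - y = 0" using FD_unique[of x] by blast
  then show "x = y" by simp
qed

lemma vimage_image_proj: "proj -` (proj ` A) = (\<Union>l\<in>L. (\<lambda>x. x + l) -` A)"
proof (rule Set.set_eqI)
  fix x
  have "x \<in> proj -` (proj ` A) \<longleftrightarrow> (\<exists>a\<in>A. a - x \<in> L)"
    by (auto simp: proj_eq_iff image_iff) (metis L_neg minus_diff_eq)+
  also have "\<dots> \<longleftrightarrow> (\<exists>l\<in>L. x + l \<in> A)"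
  proof
    assume "\<exists>a\<in>A. a - x \<in> L"
    then obtain a where "a \<in> A" "a - x \<in> L" by blast
    then show "\<exists>l\<in>L. x + l \<in> A" by (intro bexI[of _ "a - x"]) auto
  next
    assume "\<exists>l\<in>L. x + l \<in> A"
    then obtain l where "l \<in> L" "x + l \<in> A" by blast
    then show "\<exists>a\<in>A. a - x \<in> L" by (intro bexI[of _ "x + l"]) auto
  qed
  finally show "x \<in> proj -` (proj ` A) \<longleftrightarrow> x \<in> (\<Union>l\<in>L. (\<lambda>x. x + l) -` A)" by auto
qed

lemma openin_proj_image: assumes "open V" shows "openin torus (proj ` V)"
proof -
  have "open ((\<lambda>x. x + l) -` V)" for l
    by (rule open_vimage[OF assms]) (intro continuous_intros)
  then show ?thesis by (auto simp: openin_torus_topology vimage_image_proj)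
qed

lemma sigma_algebra_torus: "sigma_algebra (range proj) (borel_sets torus)"
  unfolding borel_sets_def topspace_torus_topology
  by (rule sigma_algebra_sigma_sets) (auto simp: openin_torus_topology)

lemma borel_sets_subset: "A \<in> borel_sets torus \<Longrightarrow> A \<subseteq> range proj"
  using sigma_algebra.sigma_sets_subset'[OF sigma_algebra_torus] sigma_algebra_torus[unfolded sigma_algebra_iff2] by blast

lemma vimage_proj_borel: "A \<in> borel_sets torus \<Longrightarrow> proj -` A \<in> sets borel"
  unfolding borel_sets_def topspace_torus_topology
proof (induction rule: sigma_sets.induct)
  case (Basic A) then show ?case by (simp add: openin_torus_topology)
next
  case (Compl A)
  have "proj -` (range proj - A) = - (proj -` A)" by auto
  then show ?case using Compl by auto
next
  case (Union A)
  then show ?case by (auto simp: vimage_UN)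
qed simp

text \<open>
  On an open set where it is injective, the projection commutes with complements and unions.
\<close>

lemma proj_image_borel_small:
  assumes V: "open V" "inj_on proj V" and A: "A \<in> sets borel"
  shows "proj ` (A \<inter> V) \<in> borel_sets torus"
proof -
  interpret sigma_algebra "range proj" "borel_sets torus" by (rule sigma_algebra_torus)
  have basic: "proj ` U \<in> borel_sets torus" if "open U" for U
    using openin_proj_image[OF that] unfolding borel_sets_def by (intro sigma_sets.Basic) simp
  show ?thesis using A unfolding sets_borel
  proof (induction rule: sigma_sets.induct)
    case (Basic U) then show ?case using V by (intro basic open_Int) auto
  next
    case (Compl A)
    have "proj ` ((UNIV - A) \<inter> V) = proj ` V - proj ` (A \<inter> V)"
      using V(2) by (auto simp: inj_on_def)
    then show ?case using Compl basic[OF V(1)] by (simp add: Diff)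
  next
    case (Union A)
    have "proj ` ((\<Union>i. A i) \<inter> V) = (\<Union>i. proj ` (A i \<inter> V))" by auto
    then show ?case using Union by auto
  qed simp
qed

definition sep :: real where "sep = (SOME r. 0 < r \<and> (\<forall>l\<in>L. l \<noteq> 0 \<longrightarrow> r \<le> norm l))"

lemma sep: "0 < sep" "l \<in> L \<Longrightarrow> l \<noteq> 0 \<Longrightarrow> sep \<le> norm l"
proof -
  have "0 < sep \<and> (\<forall>l\<in>L. l \<noteq> 0 \<longrightarrow> sep \<le> norm l)"
    unfolding sep_def using L_separated by (rule someI_ex[of "\<lambda>r. 0 < r \<and> (\<forall>l\<in>L. l \<noteq> 0 \<longrightarrow> r \<le> norm l)"])
  then show "0 < sep" "l \<in> L \<Longrightarrow> l \<noteq> 0 \<Longrightarrow> sep \<le> norm l" by auto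
qed

lemma inj_on_proj_ball: "inj_on proj (ball x (sep / 2))"
proof (rule inj_onI, rule ccontr)
  fix y z assume yz: "y \<in> ball x (sep / 2)" "z \<in> ball x (sep / 2)" and "proj y = proj z" and "y \<noteq> z"
  then have "sep \<le> norm (y - z)" by (intro sep(2)) (auto simp: proj_eq_iff)
  moreover have "norm (y - z) < sep"
    using yz dist_triangle_half_r[of x y sep z] by (simp add: dist_norm)
  ultimately show False by simp
qed

text \<open>Countably many small balls, on each of which the projection is injective, cover the space.\<close>

definition chart :: "nat \<Rightarrow> 'n NR set" where
  "chart = (SOME V. (\<forall>k. open (V k) \<and> inj_on proj (V k)) \<and> (\<Union>k. V k) = UNIV)"

lemma chart: "open (chart k)" "inj_on proj (chart k)" "(\<Union>k. chart k) = UNIV"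
proof -
  obtain D :: "'n NR set" where D: "countable D" "\<And>X. open X \<Longrightarrow> X \<noteq> {} \<Longrightarrow> \<exists>d\<in>D. d \<in> X"
    by (rule countable_dense_setE) blast
  have "D \<noteq> {}" using D(2)[of UNIV] by auto
  define V where "V k = ball (from_nat_into D k) (sep / 2)" for k
  have "\<exists>k. z \<in> V k" for z
  proof -
    obtain d where "d \<in> D" "d \<in> ball z (sep / 2)" using D(2)[of "ball z (sep / 2)"] sep(1) by auto
    then have "z \<in> V (to_nat_on D d)" using D(1) by (simp add: V_def dist_commute)
    then show ?thesis ..
  qed
  then have "(\<forall>k. open (V k) \<and> inj_on proj (V k)) \<and> (\<Union>k. V k) = UNIV"
    using inj_on_proj_ball by (auto simp: V_def)
  then have "\<exists>V::nat \<Rightarrow> 'n NR set. (\<forall>k. open (V k) \<and> inj_on proj (V k)) \<and> (\<Union>k. V k) = UNIV" by (intro exI[of _ V])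
  then have "(\<forall>k. open (chart k) \<and> inj_on proj (chart k)) \<and> (\<Union>k. chart k) = UNIV"
    unfolding chart_def by (rule someI_ex)
  then show "open (chart k)" "inj_on proj (chart k)" "(\<Union>k. chart k) = UNIV" by auto
qed

lemma proj_image_borel: assumes "A \<in> sets borel" shows "proj ` A \<in> borel_sets torus"
proof -
  interpret sigma_algebra "range proj" "borel_sets torus" by (rule sigma_algebra_torus)
  have "A = (\<Union>k. A \<inter> chart k)" using chart(3) by blast
  then have "proj ` A = (\<Union>k. proj ` (A \<inter> chart k))" by (metis image_UN)
  then show ?thesis using proj_image_borel_small[OF chart(1,2) assms] by auto
qed

text \<open>
  A Borel section of the projection, with values in the fundamental domain.
\<close>

definition rep :: "'n NR set \<Rightarrow> 'n NR" where "rep c = red (SOME x. proj x = c)"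

lemma rep_FD: "rep c \<in> FD" by (simp add: rep_def)

lemma proj_rep: "c \<in> range proj \<Longrightarrow> proj (rep c) = c"
proof -
  assume "c \<in> range proj"
  then have "proj (SOME x. proj x = c) = c" by (intro someI_ex[of "\<lambda>x. proj x = c"]) auto
  then show ?thesis by (simp add: rep_def proj_red)
qed

lemma rep_proj: "rep (proj x) - x \<in> L"
  using proj_rep[OF rangeI[of proj x]] by (simp add: proj_eq_iff)

lemma periodic_rep: "periodic L g \<Longrightarrow> g (rep (proj x)) = g x"
  using periodic_add[OF _ rep_proj, of g x x] by simp

lemma continuous_map_torus:
  "continuous_map torus euclideanreal \<phi> \<longleftrightarrow> pc (\<lambda>x. \<phi> (proj x))"
proof -
  have "openin torus {c \<in> topspace torus. \<phi> c \<in> U} \<longleftrightarrow> open ((\<lambda>x. \<phi> (proj x)) -` U)" for U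
  proof -
    have "proj -` {c \<in> range proj. \<phi> c \<in> U} = (\<lambda>x. \<phi> (proj x)) -` U" by auto
    then show ?thesis by (simp add: openin_torus_topology topspace_torus_topology)
  qed
  then have "continuous_map torus euclideanreal \<phi> \<longleftrightarrow> continuous_on UNIV (\<lambda>x. \<phi> (proj x))"
    by (auto simp: continuous_map_def continuous_on_open_vimage)
  moreover have "periodic L (\<lambda>x. \<phi> (proj x))" by (simp add: periodic_def proj_add)
  ultimately show ?thesis by (simp add: pc_def)
qed

text \<open>
  The complement of a null set meets every punctured neighbourhood, so the limit superior is taken
  over a proper filter and equals the value by continuity.
\<close>

lemma continuous_strongly_usc:
  assumes \<phi>: "continuous_map torus euclideanreal \<phi>" shows "strongly_usc L \<phi>"
  unfolding strongly_usc_def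
proof (intro ballI allI impI)
  fix a E assume a: "a \<in> range proj" and E: "torus_null_set L E"
  let ?F = "atin_within torus a (- E)"
  obtain x where x: "a = proj x" using a by auto
  have nt: "?F \<noteq> bot"
  proof
    assume "?F = bot"
    then have "eventually (\<lambda>_. False) ?F" by simp
    then obtain U where U: "openin torus U" "a \<in> U" "\<And>c. c \<in> U \<Longrightarrow> c \<notin> - E \<or> c = a"
      using a by (auto simp: eventually_atin_within topspace_torus_topology)
    have oU: "open (proj -` U)" using U(1) by (simp add: openin_torus_topology)
    have "proj -` U \<subseteq> proj -` E \<union> (\<lambda>l. x + l) ` L"
    proof
      fix y assume "y \<in> proj -` U"
      then have "proj y \<in> E \<or> y - x \<in> L" using U(3)[of "proj y"] by (auto simp: x proj_eq_iff)
      moreover have "y \<in> (\<lambda>l. x + l) ` L" if "y - x \<in> L"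
        using that by (intro image_eqI[of _ _ "y - x"]) auto
      ultimately show "y \<in> proj -` E \<union> (\<lambda>l. x + l) ` L" by auto
    qed
    moreover have "negligible (proj -` E)" using E by (simp add: torus_null_set_def negligible_iff_null_sets)
    moreover have "negligible ((\<lambda>l. x + l) ` L)"
      using null_sets_completionI[OF countable_imp_null_set_lborel[OF countable_image[OF countable_L]]]
      by (simp add: negligible_iff_null_sets)
    ultimately have "negligible (proj -` U)" using negligible_Un negligible_subset by metis
    moreover have "proj -` U \<noteq> {}" using U(2) x by auto
    ultimately show False using open_not_negligible[OF oU] by blast
  qed
  have "(\<phi> \<longlongrightarrow> \<phi> a) ?F"
  proof (rule topological_tendstoI)
    fix S assume S: "open S" "\<phi> a \<in> S"
    have "openin torus {c \<in> topspace torus. \<phi> c \<in> S}"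
      using \<phi> S by (simp add: continuous_map_def)
    then show "\<forall>\<^sub>F c in ?F. \<phi> c \<in> S"
      using S a by (auto simp: eventually_atin_within topspace_torus_topology)
  qed
  then have "((\<lambda>c. ereal (\<phi> c)) \<longlongrightarrow> ereal (\<phi> a)) ?F" by (simp add: tendsto_ereal)
  from lim_imp_Limsup[OF nt this] show "ereal (\<phi> a) = Limsup ?F (\<lambda>x. ereal (\<phi> x))" by simp
qed

section \<open>Measures on the torus\<close>

text \<open>
  A Borel set of the torus is a countable disjoint union of images of Borel sets on which the
  projection is injective.
\<close>

lemma descends_unique:
  assumes \<mu>: "descends_to L m \<mu>" and \<mu>': "descends_to L m \<mu>'" shows "\<mu> = \<mu>'"
proof (rule measure_eqI)
  show "sets \<mu> = sets \<mu>'" using assms by (simp add: descends_to_def)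
  fix A assume A: "A \<in> sets \<mu>"
  then have Ab: "A \<in> borel_sets torus" using \<mu> by (simp add: descends_to_def)
  define W where "W k = disjointed chart k \<inter> (FD \<inter> proj -` A)" for k
  have Wb: "W k \<in> sets borel" for k
  proof -
    have "range (disjointed chart) \<subseteq> sets borel" using chart(1) by (intro sets.range_disjointed_sets) auto
    then show ?thesis using vimage_proj_borel[OF Ab] by (auto simp: W_def)
  qed
  have Wc: "W k \<subseteq> chart k" for k using disjointed_subset[of chart k] by (auto simp: W_def)
  have disj: "disjoint_family (\<lambda>k. proj ` W k)"
  proof -
    have "disjoint_family W" unfolding W_def
      using disjoint_family_disjointed[of chart] by (auto simp: disjoint_family_on_def)
    moreover have "inj_on proj (\<Union>k. W k)" by (rule inj_on_subset[OF inj_on_proj_FD]) (auto simp: W_def)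
    ultimately show ?thesis
      unfolding disjoint_family_on_def
    proof (intro ballI impI)
      fix j k :: nat assume "\<forall>m\<in>UNIV. \<forall>n\<in>UNIV. m \<noteq> n \<longrightarrow> W m \<inter> W n = {}" and inj: "inj_on proj (\<Union>k. W k)" and "j \<noteq> k"
      then have "W j \<inter> W k = {}" by blast
      moreover have "proj ` (W j \<inter> W k) = proj ` W j \<inter> proj ` W k" by (rule inj_on_image_Int[OF inj]) auto
      ultimately show "proj ` W j \<inter> proj ` W k = {}" by simp
    qed
  qed
  have "A = (\<Union>k. proj ` W k)"
  proof
    show "A \<subseteq> (\<Union>k. proj ` W k)"
    proof
      fix c assume c: "c \<in> A"
      then have r: "proj (rep c) = c" using borel_sets_subset[OF Ab] proj_rep by blast
      obtain k where "rep c \<in> disjointed chart k" using chart(3) UN_disjointed_eq[of chart] by blast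
      then have "rep c \<in> W k" using c r rep_FD by (simp add: W_def)
      then show "c \<in> (\<Union>k. proj ` W k)" using r by (metis UN_I UNIV_I imageI)
    qed
  qed (auto simp: W_def)
  moreover have "emeasure \<nu> (\<Union>k. proj ` W k) = (\<Sum>k. emeasure m (W k))" if "descends_to L m \<nu>" for \<nu>
  proof -
    have "range (\<lambda>k. proj ` W k) \<subseteq> sets \<nu>"
      using proj_image_borel[OF Wb] that by (auto simp: descends_to_def)
    then have "emeasure \<nu> (\<Union>k. proj ` W k) = (\<Sum>k. emeasure \<nu> (proj ` W k))"
      by (intro suminf_emeasure[symmetric] disj)
    moreover have "emeasure \<nu> (proj ` W k) = emeasure m (W k)" for k
      using that chart(1,2)[of k] Wb[of k] Wc[of k] unfolding descends_to_def by blast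
    ultimately show ?thesis by simp
  qed
  ultimately show "emeasure \<mu> A = emeasure \<mu>' A" using assms by metis
qed

definition torus_space :: "'n NR set measure" where
  "torus_space = sigma (range proj) (borel_sets torus)"

lemma sets_torus_space [simp]: "sets torus_space = borel_sets torus"
  using sigma_algebra.sets_measure_of_eq[OF sigma_algebra_torus] by (simp add: torus_space_def)

lemma space_torus_space [simp]: "space torus_space = range proj"
  by (simp add: torus_space_def space_measure_of_conv)

lemma measurable_proj: "proj \<in> measurable borel torus_space"
  by (rule measurableI) (auto intro: vimage_proj_borel)

lemma measurable_rep: "sets \<mu> = borel_sets torus \<Longrightarrow> space \<mu> = range proj \<Longrightarrow> rep \<in> measurable \<mu> borel"
proof (rule measurableI)
  fix A :: "'n NR set" assume s: "sets \<mu> = borel_sets torus" "space \<mu> = range proj" and A: "A \<in> sets borel"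
  have "rep -` A \<inter> space \<mu> = proj ` (A \<inter> FD)"
  proof (rule Set.set_eqI)
    fix c
    show "c \<in> rep -` A \<inter> space \<mu> \<longleftrightarrow> c \<in> proj ` (A \<inter> FD)"
    proof
      assume "c \<in> rep -` A \<inter> space \<mu>"
      then have "rep c \<in> A \<inter> FD" "proj (rep c) = c" using s rep_FD proj_rep by auto
      then show "c \<in> proj ` (A \<inter> FD)" by (metis imageI)
    next
      assume "c \<in> proj ` (A \<inter> FD)"
      then obtain x where x: "c = proj x" "x \<in> A" "x \<in> FD" by blast
      have "proj (rep c) = proj x" using proj_rep x by auto
      then have "rep c = x" using inj_onD[OF inj_on_proj_FD _ rep_FD x(3)] by blast
      then show "c \<in> rep -` A \<inter> space \<mu>" using x s by auto
    qed
  qed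
  then show "rep -` A \<inter> space \<mu> \<in> sets \<mu>" using A s by (simp add: proj_image_borel)
qed simp

lemma infdist_translate:
  fixes A :: "'n NR set"
  assumes "\<And>x. x + l \<in> A \<longleftrightarrow> x \<in> A" shows "infdist (x + l) A = infdist x A"
proof -
  have "A = (\<lambda>a. a + l) ` A"
  proof
    show "A \<subseteq> (\<lambda>a. a + l) ` A"
    proof
      fix a assume "a \<in> A"
      then have "a - l \<in> A" using assms[of "a - l"] by simp
      then show "a \<in> (\<lambda>a. a + l) ` A" by (intro image_eqI[of _ _ "a - l"]) auto
    qed
  qed (use assms in auto)
  then have "(\<lambda>a. dist (x + l) a) ` A = (\<lambda>a. dist (x + l) a) ` (\<lambda>a. a + l) ` A" by (rule arg_cong)
  then have "(\<lambda>a. dist (x + l) a) ` A = (\<lambda>a. dist x a) ` A" by (simp add: image_image)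
  then show ?thesis by (simp add: infdist_def)
qed

lemma pc_ramp: assumes "openin torus U" shows "pc (ramp (proj -` U) k)"
proof -
  have sh: "x + l \<in> - (proj -` U) \<longleftrightarrow> x \<in> - (proj -` U)" if "l \<in> L" for x l by (simp add: proj_add[OF that])
  have "ramp (proj -` U) k (x + l) = ramp (proj -` U) k x" if "l \<in> L" for x l
    by (simp add: ramp_def infdist_translate[OF sh[OF that]])
  then show ?thesis by (simp add: pc_def periodic_def continuous_ramp)
qed

end

context polarized_torus
begin

text \<open>The image of \<open>\<kappa>\<close> times Lebesgue measure on the torus under the map induced by \<open>T \<phi>\<close>.\<close>

definition torus_push :: "('n NR \<Rightarrow> real) \<Rightarrow> real \<Rightarrow> 'n NR set measure" where
  "torus_push \<phi> \<kappa> = distr (density lborel (\<lambda>x. ennreal \<kappa> * indicator FD x)) torus_space (proj \<circ> T \<phi>)"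

lemma measurable_proj_T: "pc \<phi> \<Longrightarrow> proj \<circ> T \<phi> \<in> measurable borel torus_space"
  using measurable_comp[OF measurable_T measurable_proj] .

lemma emeasure_torus_push:
  assumes "pc \<phi>" "A \<in> borel_sets torus"
  shows "emeasure (torus_push \<phi> \<kappa>) A = ennreal \<kappa> * emeasure lborel (FD \<inter> T \<phi> -` (proj -` A))"
proof -
  have TA: "T \<phi> -` (proj -` A) \<in> sets borel"
    using measurable_sets[OF measurable_T[OF assms(1)] vimage_proj_borel[OF assms(2)]] by simp
  have "emeasure (torus_push \<phi> \<kappa>) A = emeasure (density lborel (\<lambda>x. ennreal \<kappa> * indicator FD x)) (T \<phi> -` (proj -` A))"
    unfolding torus_push_def using measurable_proj_T[OF assms(1)] assms(2)
    by (subst emeasure_distr) (auto simp: vimage_comp)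
  also have "\<dots> = (\<integral>\<^sup>+x. (ennreal \<kappa> * indicator FD x) * indicator (T \<phi> -` (proj -` A)) x \<partial>lborel)"
    using TA by (subst emeasure_density) auto
  also have "\<dots> = (\<integral>\<^sup>+x. ennreal \<kappa> * indicator (FD \<inter> T \<phi> -` (proj -` A)) x \<partial>lborel)"
    by (intro nn_integral_cong) (auto simp: indicator_def)
  also have "\<dots> = ennreal \<kappa> * emeasure lborel (FD \<inter> T \<phi> -` (proj -` A))"
    using TA by (subst nn_integral_cmult) auto
  finally show ?thesis .
qed

text \<open>
  Unfold the integral over the space along the lattice.  As \<open>T \<phi>\<close> commutes with lattice translations,
  each \<open>x\<close> in the fundamental domain is counted once for every sheet of \<open>B\<close> above the image of \<open>B\<close>, and
  there is exactly one.
\<close>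

lemma descends_push:
  assumes \<phi>: "pc \<phi>" shows "descends_to L (push \<phi> \<kappa>) (torus_push \<phi> \<kappa>)"
  unfolding descends_to_def
proof (intro conjI allI impI)
  show "space (torus_push \<phi> \<kappa>) = range proj" "sets (torus_push \<phi> \<kappa>) = borel_sets torus"
    by (simp_all add: torus_push_def)
  fix V B assume "open V \<and> inj_on proj V \<and> B \<in> sets borel \<and> B \<subseteq> V"
  then have V: "inj_on proj V" and B [measurable]: "B \<in> sets borel" and BV: "B \<subseteq> V" by auto
  note [measurable] = measurable_T[OF \<phi>]
  define h where "h x = (indicator B (T \<phi> x) :: ennreal)" for x
  have [measurable]: "h \<in> borel_measurable borel" unfolding h_def by measurable
  have sheets: "(\<integral>\<^sup>+l. indicator B (y + l) \<partial>count_space L) = (indicator (proj -` (proj ` B)) y :: ennreal)" for y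
  proof (cases "y \<in> proj -` (proj ` B)")
    case True
    then obtain l0 where l0: "l0 \<in> L" "y + l0 \<in> B" unfolding vimage_image_proj by auto
    have "l = l0" if "l \<in> L" "y + l \<in> B" for l
    proof -
      have "proj (y + l) = proj (y + l0)" using that(1) l0(1) by (simp add: proj_add)
      then have "y + l = y + l0" using inj_onD[OF V] that(2) l0(2) BV by blast
      then show ?thesis by simp
    qed
    then have "y + l \<in> B \<longleftrightarrow> l \<in> {l0}" if "l \<in> L" for l using that l0(2) by blast
    then have "(\<integral>\<^sup>+l. indicator B (y + l) \<partial>count_space L) = (\<integral>\<^sup>+l. indicator {l0} l \<partial>count_space L)"
      by (intro nn_integral_cong) (simp add: indicator_def)
    also have "\<dots> = emeasure (count_space L) {l0}" using l0(1) by (intro nn_integral_indicator) simp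
    also have "\<dots> = 1" using l0(1) by (subst emeasure_count_space_finite) auto
    finally show ?thesis by (simp only: indicator_simps(1)[OF True])
  next
    case False
    then have "(\<integral>\<^sup>+l. indicator B (y + l) \<partial>count_space L) = (\<integral>\<^sup>+l. 0 \<partial>count_space L)"
      unfolding vimage_image_proj by (intro nn_integral_cong) (auto simp: indicator_def)
    then show ?thesis using False by simp
  qed
  have "emeasure lborel (T \<phi> -` B) = (\<integral>\<^sup>+x. h x \<partial>lborel)"
  proof -
    have "T \<phi> -` B \<in> sets borel" using measurable_sets[OF measurable_T[OF \<phi>] B] by simp
    then have "emeasure lborel (T \<phi> -` B) = (\<integral>\<^sup>+x. indicator (T \<phi> -` B) x \<partial>lborel)"
      by (intro nn_integral_indicator[symmetric]) simp
    also have "\<dots> = (\<integral>\<^sup>+x. h x \<partial>lborel)"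
      by (intro nn_integral_cong) (simp only: h_def indicator_def vimage_eq)
    finally show ?thesis .
  qed
  also have "\<dots> = (\<integral>\<^sup>+l. (\<integral>\<^sup>+x\<in>FD. h (x + l) \<partial>lborel) \<partial>count_space L)"
    by (rule nn_integral_unfold[OF countable_L is_fundamental_domain_FD]) measurable
  also have "\<dots> = (\<integral>\<^sup>+l. (\<integral>\<^sup>+x. indicator FD x * indicator B (T \<phi> x + l) \<partial>lborel) \<partial>count_space L)"
  proof (rule nn_integral_cong)
    fix l assume "l \<in> space (count_space L)"
    then have l: "l \<in> L" by simp
    show "(\<integral>\<^sup>+x\<in>FD. h (x + l) \<partial>lborel) = (\<integral>\<^sup>+x. indicator FD x * indicator B (T \<phi> x + l) \<partial>lborel)"
    proof (rule nn_integral_cong_AE)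
      show "AE x in lborel. h (x + l) * indicator FD x = indicator FD x * indicator B (T \<phi> x + l)"
        using AE_not_nonunique[OF \<phi>] by eventually_elim (simp add: h_def T_shift[OF \<phi> l] mult.commute)
    qed
  qed
  also have "\<dots> = (\<integral>\<^sup>+x. (\<integral>\<^sup>+l. indicator FD x * indicator B (T \<phi> x + l) \<partial>count_space L) \<partial>lborel)"
    by (rule nn_integral_count_space_nn_integral[OF countable_L, symmetric]) measurable
  also have "\<dots> = (\<integral>\<^sup>+x. indicator (FD \<inter> T \<phi> -` (proj -` (proj ` B))) x \<partial>lborel)"
  proof (rule nn_integral_cong)
    fix x
    show "(\<integral>\<^sup>+l. indicator FD x * indicator B (T \<phi> x + l) \<partial>count_space L)
        = indicator (FD \<inter> T \<phi> -` (proj -` (proj ` B))) x"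
      by (simp add: nn_integral_cmult sheets) (simp add: indicator_def)
  qed
  also have "\<dots> = emeasure lborel (FD \<inter> T \<phi> -` (proj -` (proj ` B)))"
  proof -
    have "T \<phi> -` (proj -` (proj ` B)) \<in> sets borel"
      using measurable_sets[OF measurable_T[OF \<phi>] vimage_proj_borel[OF proj_image_borel[OF B]]] by simp
    then show ?thesis by (intro nn_integral_indicator) auto
  qed
  finally show "emeasure (torus_push \<phi> \<kappa>) (proj ` B) = emeasure (push \<phi> \<kappa>) B"
    by (simp add: emeasure_push[OF \<phi> B] emeasure_torus_push[OF \<phi> proj_image_borel[OF B]])
qed

lemma integral_torus_push:
  assumes \<phi>: "pc \<phi>" and h: "pc h" and \<kappa>: "0 \<le> \<kappa>"
  shows "(\<integral>c. h (rep c) \<partial>torus_push \<phi> \<kappa>) = \<kappa> * I (\<lambda>z. h (T \<phi> z))"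
proof -
  have hp: "periodic L h" using h by (simp add: pc_def)
  have rm: "(\<lambda>c. h (rep c)) \<in> borel_measurable torus_space"
    by (rule measurable_compose[OF measurable_rep pc_measurable[OF h]]) simp_all
  have hT: "(\<lambda>z. h (T \<phi> z)) \<in> borel_measurable borel"
    using measurable_compose[OF measurable_T[OF \<phi>] pc_measurable[OF h]] .
  have "(\<integral>c. h (rep c) \<partial>torus_push \<phi> \<kappa>)
      = (\<integral>z. h (rep ((proj \<circ> T \<phi>) z)) \<partial>density lborel (\<lambda>x. ennreal \<kappa> * indicator FD x))"
    unfolding torus_push_def using measurable_proj_T[OF \<phi>] rm by (intro integral_distr) auto
  also have "\<dots> = (\<integral>z. h (T \<phi> z) \<partial>density lborel (\<lambda>x. ennreal (\<kappa> * indicator FD x)))"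
    using \<kappa> by (simp add: periodic_rep[OF hp] ennreal_mult' ennreal_indicator)
  also have "\<dots> = (\<integral>z. (\<kappa> * indicator FD z) *\<^sub>R h (T \<phi> z) \<partial>lborel)"
    using hT \<kappa> by (intro integral_density) auto
  also have "\<dots> = \<kappa> * I (\<lambda>z. h (T \<phi> z))"
    by (simp add: I_def set_lebesgue_integral_def mult.assoc)
  finally show ?thesis .
qed

text \<open>
  Open sets are increasing limits of continuous periodic functions, and they generate the Borel sets.
\<close>

lemma measure_eq_torus_push:
  assumes \<phi>: "pc \<phi>" and \<kappa>: "0 \<le> \<kappa>"
    and \<mu>: "space \<mu> = range proj" "sets \<mu> = borel_sets torus" "emeasure \<mu> (range proj) < \<infinity>"
    and eq: "\<And>h. pc h \<Longrightarrow> (\<integral>c. h (rep c) \<partial>\<mu>) = \<kappa> * I (\<lambda>z. h (T \<phi> z))"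
  shows "\<mu> = torus_push \<phi> \<kappa>"
proof (rule measure_eqI_generator_eq)
  let ?E = "{U. openin torus U}"
  have sp: "space (torus_push \<phi> \<kappa>) = range proj" and st: "sets (torus_push \<phi> \<kappa>) = borel_sets torus"
    by (simp_all add: torus_push_def)
  have finp: "emeasure (torus_push \<phi> \<kappa>) (range proj) < \<infinity>"
  proof -
    have "range proj \<in> borel_sets torus" using sets.top[of "torus_push \<phi> \<kappa>"] sp st by simp
    then have "emeasure (torus_push \<phi> \<kappa>) (range proj) = ennreal \<kappa> * emeasure lborel (FD \<inter> T \<phi> -` (proj -` range proj))"
      by (rule emeasure_torus_push[OF \<phi>])
    also have "FD \<inter> T \<phi> -` (proj -` range proj) = FD" by auto
    finally show ?thesis using FD_finite by (simp add: ennreal_mult_less_top)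
  qed
  show "Int_stable ?E" by (auto simp: Int_stable_def)
  show "?E \<subseteq> Pow (range proj)" by (auto simp: openin_torus_topology)
  show "sets \<mu> = sigma_sets (range proj) ?E" "sets (torus_push \<phi> \<kappa>) = sigma_sets (range proj) ?E"
    using \<mu> st by (simp_all add: borel_sets_def topspace_torus_topology)
  show "range (\<lambda>_::nat. range proj) \<subseteq> ?E" by (auto simp: openin_torus_topology vimage_def)
  show "(\<Union>i::nat. range proj) = range proj" by simp
  show "emeasure \<mu> (range proj) \<noteq> \<infinity>" for i :: nat using \<mu>(3) by simp
  show "emeasure \<mu> U = emeasure (torus_push \<phi> \<kappa>) U" if "U \<in> ?E" for U
  proof -
    have U: "openin torus U" using that by simp
    have oU: "open (proj -` U)" using U by (simp add: openin_torus_topology)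
    have Us: "U \<in> borel_sets torus" unfolding borel_sets_def using U by (intro sigma_sets.Basic) simp
    have lim: "(\<lambda>k. \<integral>c. ramp (proj -` U) k (rep c) \<partial>\<nu>) \<longlonglongrightarrow> measure \<nu> U"
      if s: "space \<nu> = range proj" "sets \<nu> = borel_sets torus" and f: "emeasure \<nu> (range proj) < \<infinity>" for \<nu>
    proof -
      interpret finite_measure \<nu> by (rule finite_measureI) (use s f in auto)
      have "(\<lambda>k. \<integral>c. ramp (proj -` U) k (rep c) \<partial>\<nu>) \<longlonglongrightarrow> (\<integral>c. indicator U c \<partial>\<nu>)"
      proof (rule integral_dominated_convergence[where w="\<lambda>_. 1"])
        show "indicator U \<in> borel_measurable \<nu>"
          by (rule borel_measurable_indicator) (simp add: Us s)
        show "(\<lambda>c. ramp (proj -` U) k (rep c)) \<in> borel_measurable \<nu>" for k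
          by (rule measurable_compose[OF measurable_rep[OF s(2,1)] pc_measurable[OF pc_ramp[OF U]]])
        show "AE c in \<nu>. (\<lambda>k. ramp (proj -` U) k (rep c)) \<longlonglongrightarrow> indicator U c"
        proof (rule AE_I2)
          fix c assume "c \<in> space \<nu>"
          then have "proj (rep c) = c" using s proj_rep by auto
          then show "(\<lambda>k. ramp (proj -` U) k (rep c)) \<longlonglongrightarrow> indicator U c"
            using ramp_tendsto[OF oU, of "rep c"] by (simp add: indicator_def)
        qed
        show "AE c in \<nu>. norm (ramp (proj -` U) k (rep c)) \<le> 1" for k
          by (simp add: ramp_bounds)
      qed simp
      then show ?thesis using Us s sets.sets_into_space[of U \<nu>] by (simp add: Int_absorb2)
    qed
    have "(\<integral>c. ramp (proj -` U) k (rep c) \<partial>\<mu>) = (\<integral>c. ramp (proj -` U) k (rep c) \<partial>torus_push \<phi> \<kappa>)" for k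
      by (simp add: eq[OF pc_ramp[OF U]] integral_torus_push[OF \<phi> pc_ramp[OF U] \<kappa>])
    then have m: "measure \<mu> U = measure (torus_push \<phi> \<kappa>) U"
      using LIMSEQ_unique[OF lim[OF \<mu>]] lim[OF sp st finp] by simp
    have "emeasure \<nu> U \<noteq> \<infinity>" if s: "space \<nu> = range proj" "sets \<nu> = borel_sets torus" and f: "emeasure \<nu> (range proj) < \<infinity>" for \<nu>
    proof -
      have "emeasure \<nu> U \<le> emeasure \<nu> (space \<nu>)" by (rule emeasure_space)
      then show ?thesis using s f by (auto simp: top_unique)
    qed
    then show ?thesis using m \<mu> sp st finp by (simp add: emeasure_eq_ennreal_measure)
  qed
qed

end

section \<open>Free abelian groups and integer vectors\<close>

locale free_abelian_group = comm_group G for G :: "('a, 'x) monoid_scheme" (structure) +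
  fixes e :: "'n::finite \<Rightarrow> 'a"
  assumes free_basis_G: "free_basis G e"
begin

definition power_product :: "('n \<Rightarrow> int) \<Rightarrow> 'a" where
  "power_product k = finprod G (\<lambda>i. e i [^] k i) UNIV"

definition exponents :: "'a \<Rightarrow> 'n \<Rightarrow> int" where
  "exponents x = (THE k. x = power_product k)"

definition int_vec :: "'a \<Rightarrow> real ^ 'n" where
  "int_vec x = (\<chi> i. of_int (exponents x i))"

lemma e_carrier [simp]: "e i \<in> carrier G"
  using free_basis_G by (auto simp: free_basis_def)

lemma power_product_carrier [simp]: "power_product k \<in> carrier G"
  unfolding power_product_def by (rule finprod_closed) simp

lemma ex1_exponents: "x \<in> carrier G \<Longrightarrow> \<exists>!k. x = power_product k"
  using free_basis_G by (simp add: free_basis_def power_product_def)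

lemma power_product_exponents: "x \<in> carrier G \<Longrightarrow> power_product (exponents x) = x"
  unfolding exponents_def by (rule theI'[OF ex1_exponents, symmetric])

lemma exponents_power_product [simp]: "exponents (power_product k) = k"
  unfolding exponents_def by (rule the1_equality[OF ex1_exponents]) simp_all

lemma power_product_add: "power_product (\<lambda>i. k i + k' i) = power_product k \<otimes> power_product k'"
  unfolding power_product_def by (subst finprod_multf[symmetric]) (auto simp: int_pow_mult)

lemma exponents_mult:
  assumes "x \<in> carrier G" "y \<in> carrier G"
  shows "exponents (x \<otimes> y) = (\<lambda>i. exponents x i + exponents y i)"
proof -
  have "x \<otimes> y = power_product (\<lambda>i. exponents x i + exponents y i)"
    by (simp add: power_product_add power_product_exponents assms)
  then show ?thesis by simp
qed

lemma int_vec_mult: "x \<in> carrier G \<Longrightarrow> y \<in> carrier G \<Longrightarrow> int_vec (x \<otimes> y) = int_vec x + int_vec y"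
  by (simp add: int_vec_def exponents_mult vec_eq_iff)

lemma inj_on_int_vec: "inj_on int_vec (carrier G)"
proof (rule inj_onI)
  fix x y assume xy: "x \<in> carrier G" "y \<in> carrier G" and "int_vec x = int_vec y"
  then have "power_product (exponents x) = power_product (exponents y)"
    by (intro arg_cong[of _ _ power_product]) (simp add: int_vec_def vec_eq_iff fun_eq_iff)
  then show "x = y" by (simp only: power_product_exponents xy)
qed

lemma int_vec_surj: assumes z: "\<And>i. z $ i \<in> \<int>" shows "\<exists>x\<in>carrier G. int_vec x = z"
proof (rule bexI)
  have "real_of_int \<lfloor>z $ i\<rfloor> = z $ i" for i using z[of i] by (rule of_int_floor)
  then show "int_vec (power_product (\<lambda>i. \<lfloor>z $ i\<rfloor>)) = z"
    unfolding int_vec_def exponents_power_product vec_eq_iff vec_lambda_beta by blast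
qed (rule power_product_carrier)

context
  fixes h :: "'a \<Rightarrow> 'b::real_vector"
  assumes additive: "\<And>x y. x \<in> carrier G \<Longrightarrow> y \<in> carrier G \<Longrightarrow> h (x \<otimes> y) = h x + h y"
begin

lemma additive_one: "h \<one> = 0"
  using additive[of \<one> \<one>] by simp

lemma additive_inv: "x \<in> carrier G \<Longrightarrow> h (inv x) = - h x"
  using additive[of x "inv x"] by (simp add: additive_one eq_neg_iff_add_eq_0 add.commute)

lemma additive_nat_pow: "x \<in> carrier G \<Longrightarrow> h (x [^] (k::nat)) = of_nat k *\<^sub>R h x"
  by (induction k) (simp_all add: additive additive_one algebra_simps)

lemma additive_int_pow: assumes "x \<in> carrier G" shows "h (x [^] (k::int)) = of_int k *\<^sub>R h x"
proof (cases k)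
  case (nonneg n) then show ?thesis by (simp add: int_pow_int additive_nat_pow assms)
next
  case (neg n)
  have "h (x [^] k) = - (of_nat (Suc n) *\<^sub>R h x)"
    unfolding neg int_pow_neg_int[OF assms] by (simp only: additive_inv nat_pow_closed assms additive_nat_pow)
  then show ?thesis unfolding neg by (simp add: algebra_simps)
qed

lemma additive_power_product: "h (power_product k) = (\<Sum>i\<in>UNIV. of_int (k i) *\<^sub>R h (e i))"
proof -
  have "h (finprod G (\<lambda>i. e i [^] k i) A) = (\<Sum>i\<in>A. of_int (k i) *\<^sub>R h (e i))" if "finite A" for A
    using that by (induction A rule: finite_induct) (simp_all add: additive additive_one additive_int_pow Pi_def)
  then show ?thesis by (simp add: power_product_def)
qed

lemma additive_expand: "x \<in> carrier G \<Longrightarrow> h x = (\<Sum>i\<in>UNIV. int_vec x $ i *\<^sub>R h (e i))"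
  using additive_power_product[of "exponents x"] by (simp add: power_product_exponents int_vec_def)

end

text \<open>
  The vectors in \<open>V\<close> are the coordinates of one chosen element from each coset of \<open>H\<close>.
\<close>

lemma coset_representatives:
  assumes H: "subgroup H G" and fin: "finite (carrier (G Mod H))"
  obtains V where "finite V" "card V = order (G Mod H)" "\<And>r i. r \<in> V \<Longrightarrow> r $ i \<in> \<int>"
    "\<And>z. (\<And>i. z $ i \<in> \<int>) \<Longrightarrow> \<exists>!r. r \<in> V \<and> z - r \<in> int_vec ` H"
proof -
  define R where "R C = (SOME x. x \<in> C)" for C :: "'a set"
  have cosets: "carrier (G Mod H) = rcosets H" by (simp add: FactGroup_def)
  have R: "R C \<in> carrier G" "H #> R C = C" if "C \<in> rcosets H" for C
  proof -
    obtain x where x: "x \<in> carrier G" "C = H #> x" using \<open>C \<in> rcosets H\<close> by (auto simp: RCOSETS_def)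
    have "x \<in> C" using x H by (simp add: rcos_self)
    then have RC: "R C \<in> C" unfolding R_def by (rule someI)
    then show "R C \<in> carrier G" using x r_coset_subset_G[OF subgroup.subset[OF H] x(1)] by blast
    show "H #> R C = C" using repr_independence[of "R C" H x] RC x H by simp
  qed
  define V where "V = (\<lambda>C. int_vec (R C)) ` (rcosets H)"
  have inj: "inj_on (\<lambda>C. int_vec (R C)) (rcosets H)"
  proof (rule inj_onI)
    fix C D assume CD: "C \<in> rcosets H" "D \<in> rcosets H" "int_vec (R C) = int_vec (R D)"
    then have "R C = R D" using inj_onD[OF inj_on_int_vec] R(1) by blast
    then show "C = D" using R(2) CD by metis
  qed
  show thesis
  proof (rule that[of V])
    show "finite V" using fin by (simp add: V_def cosets)
    show "card V = order (G Mod H)" by (simp add: V_def card_image[OF inj] order_def cosets)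
    show "r $ i \<in> \<int>" if "r \<in> V" for r i using that by (auto simp: V_def int_vec_def)
    show "\<exists>!r. r \<in> V \<and> z - r \<in> int_vec ` H" if z: "\<And>i. z $ i \<in> \<int>" for z
    proof -
      obtain x where x: "x \<in> carrier G" "int_vec x = z" using int_vec_surj[OF z] by blast
      let ?C = "H #> x"
      have C: "?C \<in> rcosets H" using x by (simp add: rcosetsI[OF subgroup.subset[OF H]])
      have key: "z - int_vec (R D) \<in> int_vec ` H \<longleftrightarrow> D = ?C" if D: "D \<in> rcosets H" for D
      proof
        assume "z - int_vec (R D) \<in> int_vec ` H"
        then obtain h where h: "h \<in> H" "z = int_vec h + int_vec (R D)" by (auto simp: algebra_simps)
        have hG: "h \<in> carrier G" using h(1) subgroup.subset[OF H] by blast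
        have "int_vec x = int_vec (h \<otimes> R D)" using int_vec_mult[OF hG R(1)[OF D]] x(2) h(2) by simp
        then have "x = h \<otimes> R D" using inj_onD[OF inj_on_int_vec _ x(1)] hG R(1)[OF D] by simp
        then have "x \<in> H #> R D" using h(1) by (auto simp: r_coset_def)
        then have "H #> R D = ?C" using repr_independence[OF _ R(1)[OF D] H] by simp
        then show "D = ?C" using R(2)[OF D] by simp
      next
        assume "D = ?C"
        then have "x \<in> H #> R D" using R(2)[OF D] rcos_self[OF x(1) H] by simp
        then obtain h where h: "h \<in> H" "x = h \<otimes> R D" by (auto simp: r_coset_def)
        have hG: "h \<in> carrier G" using h(1) subgroup.subset[OF H] by blast
        have "z = int_vec h + int_vec (R D)" using int_vec_mult[OF hG R(1)[OF D]] x(2) h(2) by metis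
        then have "z - int_vec (R D) = int_vec h" by simp
        then show "z - int_vec (R D) \<in> int_vec ` H" using h(1) by blast
      qed
      show ?thesis
      proof (rule ex1I[of _ "int_vec (R ?C)"])
        show "int_vec (R ?C) \<in> V \<and> z - int_vec (R ?C) \<in> int_vec ` H" using key[OF C] C by (auto simp: V_def)
        fix r assume "r \<in> V \<and> z - r \<in> int_vec ` H"
        then obtain D where "D \<in> rcosets H" "r = int_vec (R D)" "z - int_vec (R D) \<in> int_vec ` H"
          by (auto simp: V_def)
        then show "r = int_vec (R ?C)" using key by simp
      qed
    qed
  qed
qed

end

lemma emeasure_half_open_cube:
  "emeasure lborel {x :: real ^ 'n::finite. \<forall>i. 0 \<le> x $ i \<and> x $ i < 1} = 1"
proof -
  let ?Q = "{x :: real ^ 'n. \<forall>i. 0 \<le> x $ i \<and> x $ i < 1}"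
  have Q: "?Q \<in> sets borel" by measurable
  have one: "(One :: real ^ 'n) = 1"
  proof -
    have "(One :: real ^ 'n) $ i = 1" for i
      using inner_sum_left_Basis[of "axis i 1 :: real ^ 'n" "\<lambda>_. 1"] by (simp only: scaleR_one cart_eq_inner_axis axis_in_Basis_iff Basis_real_def insert_iff simp_thms)
    then show ?thesis by (simp only: vec_eq_iff one_index simp_thms)
  qed
  have "emeasure lborel (cbox 0 One :: (real ^ 'n) set) = 1" "emeasure lborel (box 0 One :: (real ^ 'n) set) = 1"
    by (subst emeasure_lborel_cbox emeasure_lborel_box; simp)+
  moreover have "box 0 One \<subseteq> ?Q" unfolding one by (auto simp: mem_box_cart intro: less_imp_le)
  moreover have "?Q \<subseteq> cbox 0 One" unfolding one
  proof
    fix x assume "x \<in> ?Q"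
    then have "0 \<le> x $ i \<and> x $ i \<le> 1" for i by (simp add: less_imp_le)
    then show "x \<in> cbox 0 1" by (simp add: mem_box_cart)
  qed
  ultimately show ?thesis
    using emeasure_mono[of "box 0 One" ?Q lborel] emeasure_mono[of ?Q "cbox 0 One" lborel] Q by (simp add: antisym)
qed

text \<open>
  The index of a sublattice \<open>K\<close> of the integer lattice is its covolume, since the translates of the unit
  cube by representatives of the cosets of \<open>K\<close> form a fundamental domain.
\<close>

lemma index_eq_covolume:
  fixes K V :: "(real ^ 'n::finite) set"
  assumes V: "finite V" "\<And>r i. r \<in> V \<Longrightarrow> r $ i \<in> \<int>" and K: "\<And>k i. k \<in> K \<Longrightarrow> k $ i \<in> \<int>"
    and ex1: "\<And>z. (\<And>i. z $ i \<in> \<int>) \<Longrightarrow> \<exists>!r. r \<in> V \<and> z - r \<in> K"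
  obtains D where "is_fundamental_domain K D" "emeasure lborel D = of_nat (card V)"
proof
  define Q where "Q = {x :: real ^ 'n. \<forall>i. 0 \<le> x $ i \<and> x $ i < 1}"
  have Q: "Q \<in> sets borel" unfolding Q_def by measurable
  define fl where "fl x = (\<chi> i. real_of_int \<lfloor>x $ i\<rfloor>)" for x :: "real ^ 'n"
  have fl: "x - z \<in> Q \<longleftrightarrow> z = fl x" if "\<And>i. z $ i \<in> \<int>" for x z
  proof -
    have "0 \<le> (x - z) $ i \<and> (x - z) $ i < 1 \<longleftrightarrow> z $ i = fl x $ i" for i
    proof -
      obtain k where "z $ i = of_int k" using \<open>\<And>i. z $ i \<in> \<int>\<close>[of i] by (auto elim: Ints_cases)
      then show ?thesis by (simp add: fl_def) linarith
    qed
    then show ?thesis by (simp add: Q_def vec_eq_iff)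
  qed
  have fl_int: "fl x $ i \<in> \<int>" for x i by (simp add: fl_def)
  define S where "S r = (\<lambda>x. x - r) -` Q" for r
  have S: "S r \<in> sets borel" for r
    using measurable_sets[of "\<lambda>x. x - r" borel borel Q] Q by (simp add: S_def)
  have SQ: "emeasure lborel (S r) = 1" for r
  proof -
    have "emeasure lborel Q = emeasure (distr lborel borel ((+) (- r))) Q" by (simp add: lborel_distr_plus)
    also have "\<dots> = emeasure lborel (S r)"
      using Q by (subst emeasure_distr) (auto simp: S_def vimage_def)
    finally show ?thesis using emeasure_half_open_cube[where 'n='n] by (simp add: Q_def)
  qed
  define D where "D = (\<Union>r\<in>V. S r)"
  have "disjoint_family_on S V"
    using V(2) fl by (auto simp: disjoint_family_on_def S_def)
  then have "emeasure lborel D = (\<Sum>r\<in>V. emeasure lborel (S r))"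
    unfolding D_def using V(1) S by (intro sum_emeasure[symmetric]) auto
  then show "emeasure lborel D = of_nat (card V)" by (simp add: SQ)
  show "is_fundamental_domain K D" unfolding is_fundamental_domain_def
  proof (intro conjI allI)
    show "D \<in> sets borel" unfolding D_def using V(1) S by (intro sets.finite_UN) auto
    fix x
    have mem: "k \<in> K \<and> x - k \<in> D \<longleftrightarrow> k \<in> K \<and> (\<exists>r\<in>V. k = fl x - r)" for k
    proof -
      have "x - k - r \<in> Q \<longleftrightarrow> k = fl x - r" if "k \<in> K" "r \<in> V" for r
        using fl[of "k + r" x] K[OF that(1)] V(2)[OF that(2)] by (auto simp: algebra_simps)
      then show ?thesis by (auto simp: D_def S_def)
    qed
    have "\<exists>!r. r \<in> V \<and> fl x - r \<in> K" by (rule ex1) (rule fl_int)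
    then obtain r where r: "r \<in> V \<and> fl x - r \<in> K" and u: "\<forall>r'. r' \<in> V \<and> fl x - r' \<in> K \<longrightarrow> r' = r"
      by (rule ex1E)
    show "\<exists>!k. k \<in> K \<and> x - k \<in> D" unfolding mem
    proof (rule ex1I[of _ "fl x - r"])
      show "fl x - r \<in> K \<and> (\<exists>r'\<in>V. fl x - r = fl x - r')" using r by blast
      show "k = fl x - r" if "k \<in> K \<and> (\<exists>r'\<in>V. k = fl x - r')" for k using that u by blast
    qed
  qed
qed

section \<open>The lattice and the polarization of a polarized tropical abelian variety\<close>

lemma span_independent_full:
  fixes w :: "'n::finite \<Rightarrow> real ^ 'n"
  assumes "inj w" "independent (range w)" shows "span (range w) = UNIV"
proof -
  have "card (range w) = CARD('n)" using assms(1) by (rule card_image)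
  then show ?thesis
    using card_ge_dim_independent[of "range w" UNIV] assms(2) by auto
qed

context polarized_tropical_abelian_variety
begin

sublocale Lam: free_abelian_group \<Lambda> f
  by (simp add: free_abelian_group_def free_abelian_group_axioms_def comm_group_\<Lambda> basis_\<Lambda>)

sublocale M: free_abelian_group M e
  by (simp add: free_abelian_group_def free_abelian_group_axioms_def comm_group_M basis_M)

abbreviation vec_of :: "'l \<Rightarrow> 'n NR" where "vec_of \<equiv> lattice_vector P e"

definition w :: "'n \<Rightarrow> 'n NR" where "w j = vec_of (f j)"

abbreviation lattice :: "'n NR set" where "lattice \<equiv> period_lattice \<Lambda> P e"

abbreviation form :: "'n NR \<Rightarrow> 'n NR \<Rightarrow> real" where "form \<equiv> polarization_form \<Lambda> P lam e"

lemma vec_of_add: "l \<in> carrier \<Lambda> \<Longrightarrow> l' \<in> carrier \<Lambda> \<Longrightarrow> vec_of (l \<otimes>\<^bsub>\<Lambda>\<^esub> l') = vec_of l + vec_of l'"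
  by (simp add: lattice_vector_def pairing_add_left vec_eq_iff)

lemma vec_of_expand: "l \<in> carrier \<Lambda> \<Longrightarrow> vec_of l = (\<Sum>j\<in>UNIV. Lam.int_vec l $ j *\<^sub>R w j)"
  unfolding w_def by (rule Lam.additive_expand[OF vec_of_add])

lemma pairing_eq_inner: assumes l: "l \<in> carrier \<Lambda>" and m: "m \<in> carrier M" shows "P l m = vec_of l \<bullet> M.int_vec m"
proof -
  have "P l m = (\<Sum>i\<in>UNIV. M.int_vec m $ i *\<^sub>R P l (e i))"
    by (rule M.additive_expand[OF pairing_add_right[OF l] m])
  then show ?thesis by (simp add: inner_vec_def lattice_vector_def mult.commute)
qed

text \<open>
  The lattice vectors of a basis are independent because the pairing is nondegenerate.
\<close>

lemma w_combination_zero: assumes "(\<Sum>j\<in>UNIV. s j *\<^sub>R w j) = 0" shows "s j = 0"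
proof -
  have "(\<Sum>j\<in>UNIV. s j * P (f j) (e i)) = (\<Sum>j\<in>UNIV. s j *\<^sub>R w j) $ i" for i
    by (simp add: w_def lattice_vector_def)
  then show ?thesis using nondegenerate_left[of s] assms by simp
qed

lemma inj_w: "inj w"
proof (rule injI, rule ccontr)
  fix i j assume ij: "w i = w j" "i \<noteq> j"
  have "(\<Sum>k\<in>UNIV. (of_bool (k = i) - of_bool (k = j)) *\<^sub>R w k) = w i - w j"
    by (simp add: scaleR_left_diff_distrib sum_subtractf of_bool_def if_distrib[of "\<lambda>c. c *\<^sub>R _"] cong: if_cong)
  then show False using w_combination_zero[of "\<lambda>k. of_bool (k = i) - of_bool (k = j)" i] ij by simp
qed

lemma independent_w: "independent (range w)"
proof -
  have "u y = 0" if "(\<Sum>x\<in>range w. u x *\<^sub>R x) = 0" "y \<in> range w" for u y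
  proof -
    have "(\<Sum>j\<in>UNIV. u (w j) *\<^sub>R w j) = 0" using that(1) by (simp add: sum.reindex[OF inj_w])
    then show ?thesis using w_combination_zero[of "\<lambda>j. u (w j)"] that(2) by auto
  qed
  then show ?thesis by (subst independent_explicit) auto
qed

lemma lattice_basis_w: "lattice_basis lattice w"
proof -
  have "lattice = {\<Sum>i\<in>UNIV. of_int (k i) *\<^sub>R w i |k. True}"
  proof (rule Set.set_eqI)
    fix x
    show "x \<in> lattice \<longleftrightarrow> x \<in> {\<Sum>i\<in>UNIV. of_int (k i) *\<^sub>R w i |k. True}"
    proof
      assume "x \<in> lattice"
      then obtain l where "l \<in> carrier \<Lambda>" "x = vec_of l" by (auto simp: period_lattice_def)
      then have "x = (\<Sum>i\<in>UNIV. of_int (Lam.exponents l i) *\<^sub>R w i)" by (simp add: vec_of_expand Lam.int_vec_def)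
      then show "x \<in> {\<Sum>i\<in>UNIV. of_int (k i) *\<^sub>R w i |k. True}" by blast
    next
      assume "x \<in> {\<Sum>i\<in>UNIV. of_int (k i) *\<^sub>R w i |k. True}"
      then obtain k where "x = (\<Sum>i\<in>UNIV. of_int (k i) *\<^sub>R w i)" by blast
      then have "x = vec_of (Lam.power_product k)" by (simp add: vec_of_expand Lam.int_vec_def)
      then show "x \<in> lattice" by (simp add: period_lattice_def)
    qed
  qed
  then show ?thesis by (simp add: lattice_basis_def inj_w independent_w)
qed

lemma span_w: "span (range w) = UNIV"
  by (rule span_independent_full[OF inj_w independent_w])

sublocale torus_lattice lattice
  by unfold_locales (rule exI, rule lattice_basis_w)

text \<open>The linear extension of \<open>lam\<close> to \<open>N\<^sub>R\<close>, in coordinates.\<close>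

definition lam_R :: "'n NR \<Rightarrow> real ^ 'n" where
  "lam_R = (SOME g. linear g \<and> (\<forall>j. g (w j) = M.int_vec (lam (f j))))"

lemma lam_R: "linear lam_R" "lam_R (w j) = M.int_vec (lam (f j))"
proof -
  obtain g where g: "linear g" "\<forall>x\<in>range w. g x = M.int_vec (lam (f (inv_into UNIV w x)))"
    using linear_independent_extend[OF independent_w, of "\<lambda>x. M.int_vec (lam (f (inv_into UNIV w x)))"] by blast
  then have "\<exists>g. linear g \<and> (\<forall>j. g (w j) = M.int_vec (lam (f j)))"
    by (intro exI[of _ g]) (simp add: inj_w)
  then have "linear lam_R \<and> (\<forall>j. lam_R (w j) = M.int_vec (lam (f j)))"
    unfolding lam_R_def by (rule someI_ex)
  then show "linear lam_R" "lam_R (w j) = M.int_vec (lam (f j))" by auto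
qed

lemma lam_carrier: "l \<in> carrier \<Lambda> \<Longrightarrow> lam l \<in> carrier M"
  using lam_hom by (auto simp: hom_def)

lemma lam_mult: "l \<in> carrier \<Lambda> \<Longrightarrow> l' \<in> carrier \<Lambda> \<Longrightarrow> lam (l \<otimes>\<^bsub>\<Lambda>\<^esub> l') = lam l \<otimes>\<^bsub>M\<^esub> lam l'"
  using lam_hom by (auto simp: hom_def)

lemma lam_R_vec_of: assumes "l \<in> carrier \<Lambda>" shows "lam_R (vec_of l) = M.int_vec (lam l)"
proof -
  have "M.int_vec (lam l) = (\<Sum>j\<in>UNIV. Lam.int_vec l $ j *\<^sub>R M.int_vec (lam (f j)))"
    by (rule Lam.additive_expand[of "\<lambda>l. M.int_vec (lam l)", OF _ assms])
       (simp add: lam_mult lam_carrier M.int_vec_mult)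
  then show ?thesis
    by (simp add: vec_of_expand[OF assms] linear_sum[OF lam_R(1)] linear_scale[OF lam_R(1)] lam_R(2))
qed

text \<open>
  A bilinear form is determined by its values on the basis \<open>w\<close>, so the definite description is met by
  the form written down here.
\<close>

lemma form_eq: "form x y = x \<bullet> lam_R y"
proof -
  let ?b = "\<lambda>x y. x \<bullet> lam_R y"
  have bil: "bilinear ?b"
    by (auto simp: bilinear_def linear_iff inner_add_left inner_add_right linear_add[OF lam_R(1)] linear_scale[OF lam_R(1)])
  have val: "?b (vec_of l) (vec_of l') = P l (lam l')" if "l \<in> carrier \<Lambda>" "l' \<in> carrier \<Lambda>" for l l'
    using that by (simp add: lam_R_vec_of pairing_eq_inner lam_carrier)
  have "form = ?b" unfolding polarization_form_def
  proof (rule the_equality)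
    show "bilinear ?b \<and> (\<forall>l\<in>carrier \<Lambda>. \<forall>l'\<in>carrier \<Lambda>. ?b (vec_of l) (vec_of l') = P l (lam l'))"
      using bil val by blast
    fix b assume b: "bilinear b \<and> (\<forall>l\<in>carrier \<Lambda>. \<forall>l'\<in>carrier \<Lambda>. b (vec_of l) (vec_of l') = P l (lam l'))"
    have "b (w i) (w j) = ?b (w i) (w j)" for i j
      using b val[of "f i" "f j"] by (simp add: w_def)
    then have "b x y = ?b x y" for x y
      using bilinear_eq[of b ?b UNIV "range w" UNIV "range w" x y] b bil span_w by auto
    then show "b = ?b" by (simp add: fun_eq_iff)
  qed
  then show ?thesis by simp
qed

lemma bilinear_form: "bilinear form"
  by (auto simp: form_eq bilinear_def linear_iff inner_add_left inner_add_right linear_add[OF lam_R(1)] linear_scale[OF lam_R(1)])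

lemma form_vec_of: "l \<in> carrier \<Lambda> \<Longrightarrow> l' \<in> carrier \<Lambda> \<Longrightarrow> form (vec_of l) (vec_of l') = P l (lam l')"
  by (simp add: form_eq lam_R_vec_of pairing_eq_inner lam_carrier)

lemma form_sym: "form x y = form y x"
proof -
  have bil: "bilinear (\<lambda>x y. form y x)" using bilinear_form by (simp add: bilinear_def)
  have "form (w i) (w j) = form (w j) (w i)" for i j
    using polarization_symmetric[of "f i" "f j"] by (simp add: w_def form_vec_of)
  then show ?thesis
    using bilinear_eq[of form "\<lambda>x y. form y x" UNIV "range w" UNIV "range w" x y] bilinear_form bil span_w by auto
qed

lemma form_nonneg_lattice: assumes "x \<in> lattice" shows "0 \<le> form x x"
proof -
  obtain l where l: "l \<in> carrier \<Lambda>" "x = vec_of l" using assms by (auto simp: period_lattice_def)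
  show ?thesis
  proof (cases "l = \<one>\<^bsub>\<Lambda>\<^esub>")
    case True
    then have "x = 0" using Lam.additive_one[OF vec_of_add] l(2) by simp
    then show ?thesis by (simp add: bilinear_lzero[OF bilinear_form])
  next
    case False
    then show ?thesis using polarization_pos[of l] l by (simp add: form_vec_of less_imp_le)
  qed
qed

text \<open>
  The form is nonnegative on the lattice, hence on its rational multiples, and these are dense.
\<close>

lemma form_nonneg: "0 \<le> form x x"
proof -
  define l where "l k = of_nat (Suc k) *\<^sub>R x - red (of_nat (Suc k) *\<^sub>R x)" for k
  define y where "y k = (1 / of_nat (Suc k)) *\<^sub>R l k" for k
  have y: "y k = x - (1 / of_nat (Suc k)) *\<^sub>R red (of_nat (Suc k) *\<^sub>R x)" for k
    by (simp add: y_def l_def scaleR_right_diff_distrib del: of_nat_Suc)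
  have "(\<lambda>k. (1 / of_nat (Suc k)) *\<^sub>R red (of_nat (Suc k) *\<^sub>R x)) \<longlonglongrightarrow> 0"
  proof (rule Lim_null_comparison)
    show "\<forall>\<^sub>F k in sequentially. norm ((1 / of_nat (Suc k)) *\<^sub>R red (of_nat (Suc k) *\<^sub>R x)) \<le> (1 / of_nat (Suc k)) * \<rho>"
      using norm_red by (intro always_eventually allI) (simp add: divide_right_mono del: of_nat_Suc)
    show "(\<lambda>k. (1 / of_nat (Suc k)) * \<rho>) \<longlonglongrightarrow> 0"
      using tendsto_mult_left_zero[OF lim_inverse_n'[THEN LIMSEQ_Suc], of \<rho>] by simp
  qed
  from tendsto_diff[OF tendsto_const this, of x] have lim: "y \<longlonglongrightarrow> x" by (simp add: y[abs_def] del: of_nat_Suc)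
  have "bounded_bilinear form" using bilinear_form by (simp add: bilinear_conv_bounded_bilinear)
  from bounded_bilinear.tendsto[OF this lim lim] have "(\<lambda>k. form (y k) (y k)) \<longlonglongrightarrow> form x x" .
  moreover have "0 \<le> form (y k) (y k)" for k
  proof -
    have "l k \<in> lattice" using L_neg[OF red_L[of "of_nat (Suc k) *\<^sub>R x"]] by (simp add: l_def)
    then show ?thesis unfolding y_def
      using form_nonneg_lattice by (simp add: bilinear_lmul[OF bilinear_form] bilinear_rmul[OF bilinear_form])
  qed
  ultimately show ?thesis by (intro LIMSEQ_le_const) auto
qed

definition degree :: nat where "degree = order (M Mod (lam ` carrier \<Lambda>))"

lemma subgroup_lam: "subgroup (lam ` carrier \<Lambda>) M"
proof -
  interpret group_hom \<Lambda> M lam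
    by unfold_locales (rule lam_hom)
  show ?thesis by (rule img_is_subgroup)
qed

lemma int_vec_lam_image: "M.int_vec ` lam ` carrier \<Lambda> = lam_R ` lattice"
  by (auto simp: period_lattice_def image_image lam_R_vec_of)

lemma coset_vectors:
  obtains V where "finite V" "card V = degree" "\<And>r i. r \<in> V \<Longrightarrow> r $ i \<in> \<int>"
    "\<And>z. (\<And>i. z $ i \<in> \<int>) \<Longrightarrow> \<exists>!r. r \<in> V \<and> z - r \<in> lam_R ` lattice"
proof -
  show thesis
  proof (rule M.coset_representatives[OF subgroup_lam finite_coker, unfolded int_vec_lam_image, folded degree_def])
    fix V assume V: "finite V" "card V = degree" "\<And>r i. r \<in> V \<Longrightarrow> r $ i \<in> \<int>"
      and ex1: "\<And>z. (\<And>i. z $ i \<in> \<int>) \<Longrightarrow> \<exists>!r. r \<in> V \<and> z - r \<in> lam_R ` lattice"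
    show thesis
    proof (rule that[OF V])
      show "\<exists>!r. r \<in> V \<and> z - r \<in> lam_R ` lattice" if z: "\<And>i. z $ i \<in> \<int>" for z by (rule ex1) (rule z)
    qed
  qed
qed

text \<open>
  A vector \<open>x\<close> with \<open>form x x = 0\<close> is orthogonal to the image of \<open>lam_R\<close>, by the Cauchy-Schwarz argument
  for semidefinite forms.  As the cokernel is finite, the inner product with \<open>x\<close> then takes only
  finitely many values on the integer lattice, so \<open>x = 0\<close>.
\<close>

lemma form_pos: assumes "x \<noteq> 0" shows "0 < form x x"
proof (rule ccontr)
  assume "\<not> 0 < form x x"
  then have xx: "form x x = 0" using form_nonneg[of x] by simp
  have orth: "x \<bullet> lam_R y = 0" for y
  proof -
    have quad: "0 \<le> form y y + 2 * t * form x y" for t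
    proof -
      have "form (y + t *\<^sub>R x) (y + t *\<^sub>R x) = form y y + 2 * t * form x y"
        using xx form_sym[of y x]
        by (simp add: bilinear_ladd[OF bilinear_form] bilinear_radd[OF bilinear_form]
          bilinear_lmul[OF bilinear_form] bilinear_rmul[OF bilinear_form])
      then show ?thesis using form_nonneg[of "y + t *\<^sub>R x"] by simp
    qed
    have "form x y = 0"
    proof (rule ccontr)
      assume "form x y \<noteq> 0"
      then have "2 * (- (form y y + 1) / (2 * form x y)) * form x y = - (form y y + 1)" by simp
      then show False using quad[of "- (form y y + 1) / (2 * form x y)"] by linarith
    qed
    then show ?thesis by (simp add: form_eq)
  qed
  obtain V where V: "finite V" "\<And>z. (\<And>i. z $ i \<in> \<int>) \<Longrightarrow> \<exists>!r. r \<in> V \<and> z - r \<in> lam_R ` lattice"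
    by (rule coset_vectors) blast
  have "x $ i = 0" for i
  proof (rule ccontr)
    assume xi: "x $ i \<noteq> 0"
    have "of_int k * x $ i \<in> (\<lambda>r. x \<bullet> r) ` V" for k
    proof -
      let ?z = "axis i (of_int k) :: real ^ 'n"
      have "?z $ j \<in> \<int>" for j by (simp add: axis_def)
      then obtain r y where r: "r \<in> V" "?z - r = lam_R y" using V(2)[of ?z] by blast
      have "x \<bullet> ?z = x \<bullet> r + x \<bullet> (?z - r)" by (simp add: inner_diff_right)
      also have "\<dots> = x \<bullet> r" using orth[of y] r(2) by simp
      finally have "of_int k * x $ i = x \<bullet> r" by (simp add: inner_axis mult.commute)
      then show ?thesis using r(1) by blast
    qed
    then have "range (\<lambda>k::int. of_int k * x $ i) \<subseteq> (\<lambda>r. x \<bullet> r) ` V" by blast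
    then have "finite (range (\<lambda>k::int. of_int k * x $ i))" using V(1) finite_subset by blast
    moreover have "inj (\<lambda>k::int. of_int k * x $ i)" using xi by (intro injI) simp
    ultimately show False using finite_imageD infinite_UNIV_int by blast
  qed
  then show False using assms by (simp add: vec_eq_iff)
qed

sublocale polarized_torus lattice form
  by unfold_locales (rule bilinear_form form_sym form_pos; assumption?)+

lemma bvec_eq: "bvec = lam_R"
  by (simp add: fun_eq_iff bvec_def form_eq vec_eq_iff inner_axis')

text \<open>
  The map \<open>lam_R\<close> carries the lattice to a sublattice of index \<open>degree\<close> in the integer lattice.  The
  covolume of this sublattice is computed with two fundamental domains: unit cubes, and the image
  of \<open>FD\<close>.
\<close>

theorem covolume: "det_b * measure lborel FD = degree"
proof -
  let ?K = "bvec ` lattice"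
  obtain V where V: "finite V" "card V = degree" "\<And>r i. r \<in> V \<Longrightarrow> r $ i \<in> \<int>"
      "\<And>z. (\<And>i. z $ i \<in> \<int>) \<Longrightarrow> \<exists>!r. r \<in> V \<and> z - r \<in> ?K"
    unfolding bvec_eq by (rule coset_vectors) blast
  have Kint: "k $ i \<in> \<int>" if "k \<in> ?K" for k i
    using that by (auto simp: bvec_eq int_vec_lam_image[symmetric] M.int_vec_def)
  obtain D where D: "is_fundamental_domain ?K D" "emeasure lborel D = of_nat (card V)"
    by (rule index_eq_covolume[OF V(1,3) Kint V(4)])
  have fdb: "bvec ` FD \<in> sets borel"
  proof -
    have "bvec ` FD = bvec_inv -` FD" by (auto simp: image_iff) (metis bvec_inv(1))
    then show ?thesis
      using measurable_sets[of bvec_inv borel borel FD] linear_continuous_on[of bvec_inv UNIV] linear_bvec_inv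
      by (simp add: borel_measurable_continuous_onI linear_conv_bounded_linear)
  qed
  have E: "is_fundamental_domain ?K (bvec ` FD)" unfolding is_fundamental_domain_def
  proof (intro conjI allI fdb)
    fix x
    have eq: "k \<in> ?K \<and> x - k \<in> bvec ` FD \<longleftrightarrow> bvec_inv k \<in> lattice \<and> bvec_inv x - bvec_inv k \<in> FD" for k
    proof -
      have mem: "y \<in> bvec ` S \<longleftrightarrow> bvec_inv y \<in> S" for y S
        using image_eqI[of y bvec "bvec_inv y" S] by auto
      show ?thesis by (simp add: mem linear_diff[OF linear_bvec_inv])
    qed
    obtain l where l: "l \<in> lattice \<and> bvec_inv x - l \<in> FD"
      and u: "\<forall>l'. l' \<in> lattice \<and> bvec_inv x - l' \<in> FD \<longrightarrow> l' = l"
      using FD_unique[of "bvec_inv x"] by (rule ex1E)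
    show "\<exists>!k. k \<in> ?K \<and> x - k \<in> bvec ` FD" unfolding eq
    proof (rule ex1I[of _ "bvec l"])
      show "bvec_inv (bvec l) \<in> lattice \<and> bvec_inv x - bvec_inv (bvec l) \<in> FD" using l by simp
      fix k assume "bvec_inv k \<in> lattice \<and> bvec_inv x - bvec_inv k \<in> FD"
      then have "bvec_inv k = l" using u by blast
      then show "k = bvec l" by (metis bvec_inv(1))
    qed
  qed
  have "emeasure lborel (bvec ` FD) = emeasure lborel D"
  proof -
    have "D \<in> sets borel" using D(1) by (simp add: is_fundamental_domain_def)
    moreover have "- k \<in> ?K" if "k \<in> ?K" for k
      using that L_neg by (auto simp: linear_neg[OF linear_bvec, symmetric])
    ultimately show ?thesis
      using nn_integral_fundamental_domains_eq[OF countable_image[OF countable_L] _ E D(1), of "\<lambda>_. 1"] fdb by simp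
  qed
  then have "ennreal \<bar>det_b\<bar> * emeasure lborel FD = of_nat degree"
    using emeasure_linear_image_cart[OF _ linear_bvec inj_bvec, of FD] D(2) V(2) by (simp add: det_b_def)
  then have "enn2real (ennreal \<bar>det_b\<bar> * emeasure lborel FD) = real degree" by simp
  then show ?thesis using det_b_pos by (simp add: enn2real_mult measure_def)
qed

end

section \<open>The Monge-Ampere equation on the torus\<close>

context torus_currents
begin

abbreviation mass_factor :: real where "mass_factor \<equiv> fact CARD('n) * det_b"

lemma mass_factor_pos: "0 < mass_factor"
  using det_b_pos by simp

lemma omega_psh_iff_convex:
  assumes \<phi>: "continuous_map torus euclideanreal \<phi>"
  shows "omega_psh L b \<phi> \<longleftrightarrow> convex_on UNIV (\<lambda>x. \<phi> (proj x) + q x)"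
proof -
  have pc: "pc (\<lambda>x. \<phi> (proj x))" using \<phi> by (simp add: continuous_map_torus)
  have "(\<lambda>x. \<phi> (proj x)) absolutely_integrable_on K" if "compact K" for K
  proof -
    have "integrable lborel (\<lambda>x. indicator K x *\<^sub>R \<phi> (proj x))"
      using pc by (intro borel_integrable_compact \<open>compact K\<close>) (auto simp: pc_def intro: continuous_on_subset)
    then show ?thesis
      unfolding set_integrable_def by (subst integrable_completion) (auto dest: borel_measurable_integrable)
  qed
  then show ?thesis
    using continuous_strongly_usc[OF \<phi>] positive_current_iff_convex[OF pc]
    by (simp add: omega_psh_def curvature_def[abs_def])
qed

text \<open>
  Smooth convex approximations exist, so the limit relation determines the Monge-Ampere measure.
\<close>

lemma real_monge_ampere_unique:
  assumes \<phi>: "pc \<phi>" and cvx: "convex_on UNIV (\<lambda>x. \<phi> x + q x)" and m: "real_monge_ampere (\<lambda>x. \<phi> x + q x) m"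
  shows "m = push \<phi> mass_factor"
proof -
  have approx: "(\<forall>k. C_diff 2 (smoothed k \<phi>) \<and> convex_on UNIV (smoothed k \<phi>)) \<and>
      (\<forall>K. compact K \<longrightarrow> uniform_limit K (\<lambda>k. smoothed k \<phi>) (\<lambda>x. \<phi> x + q x) sequentially)"
    using smoothed_C2[OF \<phi>] smoothed_convex[OF \<phi> cvx] smoothed_limit[OF \<phi>] by blast
  have lim: "(\<lambda>k. LINT x|lborel. h x * hessian_density (smoothed k \<phi>) x) \<longlonglongrightarrow> (LINT x|m'. h x)"
    if "real_monge_ampere (\<lambda>x. \<phi> x + q x) m'" "continuous_on UNIV h" "compact (closure {x. h x \<noteq> 0})" for m' h
  proof -
    note all = that(1)[unfolded real_monge_ampere_def, THEN conjunct2, THEN conjunct2]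
    show ?thesis by (rule all[rule_format, OF approx]) (use that(2,3) in blast)
  qed
  note push = real_monge_ampere_push[OF \<phi>]
  show ?thesis
  proof (rule measure_eqI_compact_support)
    fix h :: "'n NR \<Rightarrow> real" assume "continuous_on UNIV h" "compact (closure {x. h x \<noteq> 0})"
    then show "(\<integral>x. h x \<partial>m) = (\<integral>x. h x \<partial>push \<phi> mass_factor)"
      using LIMSEQ_unique[OF lim[OF m] lim[OF push]] by blast
  qed (use m push in \<open>auto simp: real_monge_ampere_def\<close>)
qed

text \<open>
  The measure on \<open>N\<^sub>R\<close> is determined by the potential, and the measure on the torus by its lift.
\<close>

lemma tropical_monge_ampere_iff:
  assumes \<phi>: "continuous_map torus euclideanreal \<phi>" and psh: "omega_psh L b \<phi>"
  shows "tropical_monge_ampere L b \<phi> \<mu> \<longleftrightarrow> \<mu> = torus_push (\<lambda>x. \<phi> (proj x)) mass_factor"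
proof -
  let ?\<phi> = "\<lambda>x. \<phi> (proj x)"
  have pc: "pc ?\<phi>" using \<phi> by (simp add: continuous_map_torus)
  have cvx: "convex_on UNIV (\<lambda>x. ?\<phi> x + q x)" using psh by (simp add: omega_psh_iff_convex[OF \<phi>])
  have q: "1/2 * b x x = q x" for x by (simp add: q_def)
  note push = descends_push[OF pc, of mass_factor]
  show ?thesis
  proof
    assume "tropical_monge_ampere L b \<phi> \<mu>"
    then obtain m where m: "real_monge_ampere (\<lambda>x. ?\<phi> x + q x) m" "descends_to L m \<mu>"
      unfolding tropical_monge_ampere_def q by blast
    have "m = push ?\<phi> mass_factor" by (rule real_monge_ampere_unique[OF pc cvx m(1)])
    then show "\<mu> = torus_push ?\<phi> mass_factor" using descends_unique[OF m(2)] push by simp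
  next
    assume "\<mu> = torus_push ?\<phi> mass_factor"
    then show "tropical_monge_ampere L b \<phi> \<mu>"
      unfolding tropical_monge_ampere_def q using real_monge_ampere_push[OF pc] push by blast
  qed
qed

text \<open>
  Solve the transport problem for the image of \<open>\<mu>\<close> in the fundamental domain.
\<close>

theorem monge_ampere_solution_exists:
  assumes \<mu>: "space \<mu> = range proj" "sets \<mu> = borel_sets torus"
    and total: "emeasure \<mu> (range proj) = ennreal (mass_factor * measure lborel FD)"
  shows "\<exists>\<phi>. continuous_map torus euclideanreal \<phi> \<and> omega_psh L b \<phi> \<and> tropical_monge_ampere L b \<phi> \<mu>"
proof -
  have fin: "emeasure \<mu> (range proj) < \<infinity>" by (simp add: total)
  interpret finite_measure \<mu> by (rule finite_measureI) (use \<mu> fin in auto)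
  define \<nu> where "\<nu> = distr \<mu> borel rep"
  have rep [measurable]: "rep \<in> measurable \<mu> borel" by (rule measurable_rep[OF \<mu>(2,1)])
  interpret torus_ma L b \<nu> mass_factor
  proof (intro torus_ma.intro torus_ma_axioms.intro polarized_torus_axioms)
    show "sets \<nu> = sets borel" by (simp add: \<nu>_def)
    show "finite_measure \<nu>" unfolding \<nu>_def by (rule finite_measure_distr) simp
    show "0 < mass_factor" by (rule mass_factor_pos)
    have "measure \<nu> UNIV = measure \<mu> (range proj)" by (simp add: \<nu>_def measure_distr \<mu>)
    also have "\<dots> = mass_factor * measure lborel FD"
      using total det_b_pos by (simp add: measure_def)
    finally show "measure \<nu> UNIV = mass_factor * measure lborel FD" .
  qed
  obtain u where u: "pc u" "convex_on UNIV (\<lambda>x. u x + q x)"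
      "\<forall>h. pc h \<longrightarrow> (\<integral>x. h x \<partial>\<nu>) = mass_factor * I (\<lambda>z. h (T u z))"
    using exists_pushforward_solution by blast
  define \<phi> where "\<phi> c = u (rep c)" for c
  have lift: "(\<lambda>x. \<phi> (proj x)) = u" using u(1) by (simp add: \<phi>_def pc_def periodic_rep fun_eq_iff)
  have c: "continuous_map torus euclideanreal \<phi>" by (simp add: continuous_map_torus lift u(1))
  have p: "omega_psh L b \<phi>" unfolding omega_psh_iff_convex[OF c] using u(2) fun_cong[OF lift] by simp
  have "\<mu> = torus_push u mass_factor"
  proof (rule measure_eq_torus_push[OF u(1) _ \<mu> fin])
    show "0 \<le> mass_factor" using mass_factor_pos by (rule less_imp_le)
    fix h assume h: "pc h"
    have "(\<integral>c. h (rep c) \<partial>\<mu>) = (\<integral>x. h x \<partial>\<nu>)"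
      unfolding \<nu>_def using pc_measurable[OF h] by (intro integral_distr[symmetric]) simp_all
    then show "(\<integral>c. h (rep c) \<partial>\<mu>) = mass_factor * I (\<lambda>z. h (T u z))" using u(3) h by simp
  qed
  then have "tropical_monge_ampere L b \<phi> \<mu>" unfolding tropical_monge_ampere_iff[OF c p] lift .
  then show ?thesis using c p by blast
qed

theorem monge_ampere_solution_unique:
  assumes \<phi>: "continuous_map torus euclideanreal \<phi>" "omega_psh L b \<phi>" "tropical_monge_ampere L b \<phi> \<mu>"
    and \<psi>: "continuous_map torus euclideanreal \<psi>" "omega_psh L b \<psi>" "tropical_monge_ampere L b \<psi> \<mu>"
  shows "\<exists>c. \<forall>x\<in>range proj. \<psi> x = \<phi> x + c"
proof -
  let ?\<phi> = "\<lambda>x. \<phi> (proj x)" and ?\<psi> = "\<lambda>x. \<psi> (proj x)"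
  have pc: "pc ?\<phi>" "pc ?\<psi>" using \<phi>(1) \<psi>(1) by (simp_all add: continuous_map_torus)
  have eq: "torus_push ?\<phi> mass_factor = torus_push ?\<psi> mass_factor"
    using \<phi>(3) \<psi>(3) by (simp add: tropical_monge_ampere_iff \<phi>(1,2) \<psi>(1,2))
  have "I (\<lambda>z. h (T ?\<phi> z)) = I (\<lambda>z. h (T ?\<psi> z))" if h: "pc h" for h
  proof -
    have "mass_factor * I (\<lambda>z. h (T ?\<phi> z)) = mass_factor * I (\<lambda>z. h (T ?\<psi> z))"
      using integral_torus_push[OF pc(1) h, of mass_factor] integral_torus_push[OF pc(2) h, of mass_factor]
      unfolding eq using mass_factor_pos by (metis less_imp_le)
    then show ?thesis using mass_factor_pos by (simp only: mult_cancel_left less_irrefl simp_thms split: if_splits) auto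
  qed
  then obtain c where "\<forall>x. ?\<psi> x = ?\<phi> x + c"
    using potentials_differ_by_constant[OF pc(1) _ pc(2)] omega_psh_iff_convex \<phi>(1,2) \<psi>(1,2) by blast
  then show ?thesis by blast
qed

end

theorem corollary7p5p5:
  fixes \<Lambda> :: "('l, 'x) monoid_scheme" and M :: "('m, 'y) monoid_scheme"
    and P :: "'l \<Rightarrow> 'm \<Rightarrow> real" and lam :: "'l \<Rightarrow> 'm"
    and f :: "'n::{finite,linorder} \<Rightarrow> 'l" and e :: "'n \<Rightarrow> 'm"
    and L :: "'n NR set" and b :: "'n NR \<Rightarrow> 'n NR \<Rightarrow> real"
    and \<mu> :: "'n NR set measure"
  defines "L \<equiv> period_lattice \<Lambda> P e"
    and "b \<equiv> polarization_form \<Lambda> P lam e"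
  assumes "polarized_tropical_abelian_variety \<Lambda> M P lam f e"
    and "radon_measure (torus_topology L) \<mu>"
    and "emeasure \<mu> (space \<mu>) =
      ennreal (fact CARD('n) * sqrt (real (polarization_degree \<Lambda> M lam)))"
  shows "(\<exists>\<phi>. continuous_map (torus_topology L) euclideanreal \<phi> \<and> omega_psh L b \<phi> \<and>
            tropical_monge_ampere L b \<phi> \<mu>) \<and>
         (\<forall>\<phi> \<psi>.
            continuous_map (torus_topology L) euclideanreal \<phi> \<and> omega_psh L b \<phi> \<and>
            tropical_monge_ampere L b \<phi> \<mu> \<and>
            continuous_map (torus_topology L) euclideanreal \<psi> \<and> omega_psh L b \<psi> \<and>
            tropical_monge_ampere L b \<psi> \<mu> \<longrightarrow>
            (\<exists>c. \<forall>x \<in> topspace (torus_topology L). \<psi> x = \<phi> x + c))"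
proof -
  interpret A: polarized_tropical_abelian_variety \<Lambda> M P lam f e by fact
  interpret torus_currents L b
    unfolding L_def b_def by (rule torus_currents.intro[OF A.polarized_torus_axioms])
  have covol: "det_b * measure lborel FD = A.degree"
    using A.covolume unfolding L_def b_def .
  have \<mu>: "space \<mu> = range proj" "sets \<mu> = borel_sets torus"
    using \<open>radon_measure (torus_topology L) \<mu>\<close> by (simp_all add: radon_measure_def topspace_torus_topology)
  have "sqrt (real (polarization_degree \<Lambda> M lam)) = A.degree"
    by (simp add: polarization_degree_def A.degree_def)
  then have total: "emeasure \<mu> (range proj) = ennreal (mass_factor * measure lborel FD)"
    using assms(5) covol by (simp add: \<mu>(1) mult.assoc)
  show ?thesis
    unfolding topspace_torus_topology
    using monge_ampere_solution_exists[OF \<mu> total] monge_ampere_solution_unique by blast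
qed

end
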